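(* Let $N\ge1$, $s\in(0,1)$, and let $\mu_0$ be a (signed) locally finite Radon measure on $\mathbb{R}^N$ with $\int_{\mathbb{R}^N}(1+|x|)^{-(N+2s)}\,\mathrm{d}|\mu_0|(x)<\infty$. Then there exists a unique (not necessarily nonnegative) very weak solution $u$ of $\partial_t u+(-\Delta)^s u=0$ taking $\mu_0$ as initial data in the sense $\lim_{t\to0^+}\int_{\mathbb{R}^N}u(t,x)\psi(x)\,\mathrm{d}x=\int\psi\,\mathrm{d}\mu_0$ for all $\psi\in C_0(\mathbb{R}^N)$, and it is given by $u(t,x)=\int_{\mathbb{R}^N}P^t(x-y)\,\mathrm{d}\mu_0(y)$.
   Context: $(-\Delta)^s$ denotes the fractional Laplacian on $\mathbb{R}^N$ (Fourier multiplier $|\xi|^{2s}$). $P^t$ ($t>0$) is the fractional heat kernel, the function on $\mathbb{R}^N$ whose Fourier transform is $e^{-t|\xi|^{2s}}$. The weight $\Phi$ is defined by $\Phi(x)=1$ for $|x|\le1$ and $\Phi(x)=(1+(|x|^2-1)^4)^{-(N+2s)/8}$ for $|x|\ge1$; $\mathrm{L}^1_\Phi(\mathbb{R}^N)$ is the space of $f\in \mathrm{L}^1_{loc}(\mathbb{R}^N)$ with $\int|f|\Phi\,\mathrm{d}x<\infty$. A very weak solution in $(0,T)\times\mathbb{R}^N$ (here of any sign) is a function $u\in \mathrm{L}^1_{loc}((0,T);\mathrm{L}^1_\Phi(\mathbb{R}^N))$ such that $\int_0^T\int_{\mathbb{R}^N}u\,\partial_t\psi\,\mathrm{d}x\,\mathrm{d}t=\int_0^T\int_{\mathbb{R}^N}u\,(-\Delta)^s\psi\,\mathrm{d}x\,\mathrm{d}t$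 for all nonnegative $\psi\in C_c^\infty((0,T)\times\mathbb{R}^N)$; taking initial data $\mu_0$ additionally requires $u\in \mathrm{L}^1((0,T);\mathrm{L}^1_\Phi(\mathbb{R}^N))$ and the stated limit (over a.e. $t$). *)

theory Defs
  imports "HOL-Analysis.Analysis"
begin

text \<open>Space dimension N is DIM('a) for 'a :: euclidean_space.
  Fourier transform convention: hat f(xi) = integral of f(y) e^{-i y.xi} dy,
  inverse with factor (2 pi)^{-N}; so (-Delta)^s has multiplier |xi|^{2s}.\<close>

definition fourier_tr :: "('a::euclidean_space \<Rightarrow> real) \<Rightarrow> 'a \<Rightarrow> complex" where
  "fourier_tr f \<xi> = (LINT y|lborel. complex_of_real (f y) * cis (- (y \<bullet> \<xi>)))"

definition frac_lap :: "real \<Rightarrow> ('a::euclidean_space \<Rightarrow> real) \<Rightarrow> 'a \<Rightarrow> real" where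
  "frac_lap s f x = Re (complex_of_real ((2 * pi) powr (- real DIM('a))) *
      (LINT \<xi>|lborel. complex_of_real (norm \<xi> powr (2 * s)) * fourier_tr f \<xi> * cis (x \<bullet> \<xi>)))"

definition frac_heat_kernel :: "real \<Rightarrow> real \<Rightarrow> 'a::euclidean_space \<Rightarrow> real" where
  "frac_heat_kernel s t x = Re (complex_of_real ((2 * pi) powr (- real DIM('a))) *
      (LINT \<xi>|lborel. complex_of_real (exp (- t * norm \<xi> powr (2 * s))) * cis (x \<bullet> \<xi>)))"

definition Phi_weight :: "real \<Rightarrow> 'a::euclidean_space \<Rightarrow> real" where
  "Phi_weight s x = (if norm x \<le> 1 then 1
     else (1 + ((norm x)\<^sup>2 - 1) ^ 4) powr (- (real DIM('a) + 2 * s) / 8))"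

fun C_k :: "nat \<Rightarrow> ('a::real_normed_vector \<Rightarrow> real) \<Rightarrow> bool" where
  "C_k 0 f = continuous_on UNIV f"
| "C_k (Suc n) f = (f differentiable_on UNIV \<and>
      (\<forall>v. C_k n (\<lambda>x. frechet_derivative f (at x) v)))"

definition smooth_fun :: "('a::real_normed_vector \<Rightarrow> real) \<Rightarrow> bool" where
  "smooth_fun f \<longleftrightarrow> (\<forall>n. C_k n f)"

definition test_fun :: "real \<Rightarrow> (real \<times> 'a::euclidean_space \<Rightarrow> real) \<Rightarrow> bool" where
  "test_fun T \<psi> \<longleftrightarrow> smooth_fun \<psi> \<and> compact (closure {p. \<psi> p \<noteq> 0})
      \<and> closure {p. \<psi> p \<noteq> 0} \<subseteq> {0<..<T} \<times> UNIV \<and> (\<forall>p. \<psi> p \<ge> 0)"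

definition very_weak_sol :: "real \<Rightarrow> real \<Rightarrow> (real \<Rightarrow> 'a::euclidean_space \<Rightarrow> real) \<Rightarrow> bool" where
  "very_weak_sol s T u \<longleftrightarrow>
     (\<forall>a b. 0 < a \<longrightarrow> b < T \<longrightarrow>
        set_integrable lebesgue ({a..b} \<times> UNIV) (\<lambda>p. u (fst p) (snd p) * Phi_weight s (snd p)))
   \<and> (\<forall>\<psi>. test_fun T \<psi> \<longrightarrow>
        (LINT p|lebesgue. u (fst p) (snd p) * deriv (\<lambda>t. \<psi> (t, snd p)) (fst p))
      = (LINT p|lebesgue. u (fst p) (snd p) * frac_lap s (\<lambda>y. \<psi> (fst p, y)) (snd p)))"

text \<open>Signed locally finite Radon measure mu0 given by its Jordan decomposition
  mu0 = mu_p - mu_m (mutually singular, locally finite Borel measures), so |mu0| = mu_p + mu_m.\<close>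
definition loc_finite_borel :: "'a::euclidean_space measure \<Rightarrow> bool" where
  "loc_finite_borel \<mu> \<longleftrightarrow> sets \<mu> = sets borel \<and> (\<forall>K. compact K \<longrightarrow> emeasure \<mu> K < \<infinity>)"

definition jordan_pair :: "'a::euclidean_space measure \<Rightarrow> 'a measure \<Rightarrow> bool" where
  "jordan_pair \<mu>p \<mu>m \<longleftrightarrow> loc_finite_borel \<mu>p \<and> loc_finite_borel \<mu>m \<and>
     (\<exists>A\<in>sets borel. emeasure \<mu>p A = 0 \<and> emeasure \<mu>m (UNIV - A) = 0)"

definition initial_trace :: "real \<Rightarrow> real \<Rightarrow> (real \<Rightarrow> 'a::euclidean_space \<Rightarrow> real)
     \<Rightarrow> 'a measure \<Rightarrow> 'a measure \<Rightarrow> bool" where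
  "initial_trace s T u \<mu>p \<mu>m \<longleftrightarrow>
     set_integrable lebesgue ({0<..<T} \<times> UNIV) (\<lambda>p. u (fst p) (snd p) * Phi_weight s (snd p))
   \<and> (\<forall>\<psi>::'a \<Rightarrow> real. continuous_on UNIV \<psi> \<longrightarrow> compact (closure {x. \<psi> x \<noteq> 0}) \<longrightarrow>
       (\<exists>E. E \<in> null_sets lborel \<and>
          ((\<lambda>t. LINT x|lebesgue. u t x * \<psi> x) \<longlongrightarrow>
             (integral\<^sup>L \<mu>p \<psi> - integral\<^sup>L \<mu>m \<psi>)) (at 0 within ({0<..<T} - E))))"

end

theory Submission
  imports Defs "HOL-Probability.Probability"
begin

text \<open>
  Everything is reduced to Gaussians. The weight \<open>wt s x\<close>, the integral of \<open>\<tau> powr (- 1 - s)\<close> times the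
  heat kernel at time \<open>\<tau>\<close> over \<open>\<tau> \<ge> 1\<close>, is comparable to \<open>Phi_weight\<close>, and convolving it with a Gaussian
  is an explicit one-dimensional operation on \<open>\<tau>\<close>. Writing \<open>\<lambda> powr s\<close> as a superposition of exponentials
  exhibits the fractional heat semigroup as a limit of powers of positive operators for which \<open>wt s\<close> is an
  approximate supersolution. Hence the kernel is nonnegative and its convolution with \<open>wt s\<close> is at most
  \<open>exp (t K) * wt s\<close>; no pointwise kernel bound is needed. The same representation shows that the fractional
  Laplacian of a test function is bounded by a multiple of \<open>wt s\<close>, so existence is Fubini's theorem.

  For uniqueness, let \<open>w\<close> be the difference of two solutions. Testing with translates of one bump function
  and averaging them against the kernel at time \<open>a\<close> shows that the pairing of \<open>w(t)\<close> with the smoothing of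
  the bump at scale \<open>a\<close> solves the transport equation in \<open>(t, a)\<close> with zero data, so it vanishes; let \<open>a\<close>
  tend to \<open>0\<close>.
\<close>

section \<open>Preliminaries on Lebesgue measure\<close>

text \<open>Two obstacles shape the argument. Neither the fractional Laplacian nor the heat
  evolution of a test function has compact support, so neither is admissible in the weak
  formulation. All estimates therefore live in the class of functions bounded by a multiple of
  \<open>wt s\<close>, which is stable under Gaussian averages and under the heat semigroup and
  contains both of these functions. The growth constant must not see the truncation of small jumps:
  averaging over a Gaussian of time \<tau> costs \<open>wt s\<close> only a factor 1 + O(\<tau>)
  near 0, so the diverging mass of the truncated jump measure cancels exactly and the remainder is
  controlled by the integral of \<open>\<tau> powr (- s)\<close> near 0. In the uniqueness part
  nothing is known about the regularity of a solution in time, and its trace is a limit off a null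
  set only. Hence the time profile is the twice integrated step
  \<open>(max 0 (t - \<tau>))\<^sup>2 / 2\<close>: pairings with it are differentiable in t. Once
  they vanish, differentiating twice in t recovers the step itself, hence the integrals of
  \<open>w\<close> over boxes.\<close>

lemma nn_integral_lborel_affine:
  fixes f :: "'a::euclidean_space \<Rightarrow> ennreal"
  assumes [measurable]: "f \<in> borel_measurable borel" and c: "c \<noteq> 0"
  shows "(\<integral>\<^sup>+x. f x \<partial>lborel) = ennreal (\<bar>c\<bar> ^ DIM('a)) * (\<integral>\<^sup>+x. f (t + c *\<^sub>R x) \<partial>lborel)"
  by (subst lborel_affine[OF c, of t])
     (simp add: nn_integral_density nn_integral_distr nn_integral_cmult)

lemma integrable_lborel_affine:
  fixes f :: "'a::euclidean_space \<Rightarrow> 'b::{banach, second_countable_topology}"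
  assumes c: "c \<noteq> 0" and f: "integrable lborel f"
  shows "integrable lborel (\<lambda>x. f (t + c *\<^sub>R x))"
proof -
  have [measurable]: "f \<in> borel_measurable borel"
    using f by (simp add: integrable_iff_bounded)
  have *: "(\<integral>\<^sup>+x. norm (f x) \<partial>lborel) < \<infinity>"
    using f by (simp add: integrable_iff_bounded)
  show ?thesis unfolding integrable_iff_bounded
  proof
    show "(\<integral>\<^sup>+x. norm (f (t + c *\<^sub>R x)) \<partial>lborel) < \<infinity>"
      using * c by (subst (asm) nn_integral_lborel_affine[of _ c t])
        (auto simp: ennreal_mult_less_top)
  qed measurable
qed

lemma integral_lborel_affine:
  fixes f :: "'a::euclidean_space \<Rightarrow> 'b::{banach, second_countable_topology}"
  assumes c: "c \<noteq> 0" and [measurable]: "f \<in> borel_measurable borel"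
  shows "(LINT x|lborel. f x) = (\<bar>c\<bar> ^ DIM('a)) *\<^sub>R (LINT x|lborel. f (t + c *\<^sub>R x))"
  by (subst lborel_affine[OF c, of t]) (simp add: integral_density integral_distr)

lemma lborel_reflect:
  fixes f :: "'a::euclidean_space \<Rightarrow> 'b::{banach, second_countable_topology}"
  assumes "integrable lborel f"
  shows "integrable lborel (\<lambda>y. f (x - y))" "(LINT y|lborel. f (x - y)) = (LINT y|lborel. f y)"
    "integrable lborel (\<lambda>y. f (y - x))" "(LINT y|lborel. f (y - x)) = (LINT y|lborel. f y)"
proof -
  have [measurable]: "f \<in> borel_measurable borel"
    using assms by (simp add: integrable_iff_bounded)
  show "integrable lborel (\<lambda>y. f (x - y))"
    using integrable_lborel_affine[OF _ assms, of "-1" x] by simp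
  show "(LINT y|lborel. f (x - y)) = (LINT y|lborel. f y)"
    using integral_lborel_affine[of "-1" f x] by simp
  show "integrable lborel (\<lambda>y. f (y - x))"
    using integrable_lborel_affine[OF _ assms, of "1" "-x"] by simp
  show "(LINT y|lborel. f (y - x)) = (LINT y|lborel. f y)"
    using integral_lborel_affine[of "1" f "-x"] by simp
qed

text \<open>Domination by a product of one-variable functions justifies most interchanges below: one
  factor controls the physical variable, the other the frequency or the mixing parameter.\<close>

lemma (in pair_sigma_finite) integrable_product_bound:
  fixes F :: "'a \<times> 'b \<Rightarrow> 'c::{banach, second_countable_topology}" and f :: "'a \<Rightarrow> real" and g :: "'b \<Rightarrow> real"
  assumes f: "integrable M1 f" and g: "integrable M2 g"
    and F: "F \<in> borel_measurable (M1 \<Otimes>\<^sub>M M2)"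
    and le: "\<And>x y. norm (F (x, y)) \<le> f x * g y"
  shows "integrable (M1 \<Otimes>\<^sub>M M2) F"
proof -
  have [measurable]: "f \<in> borel_measurable M1" "g \<in> borel_measurable M2"
    using f g by auto
  have "integrable (M1 \<Otimes>\<^sub>M M2) (\<lambda>p. f (fst p) * g (snd p))"
  proof (rule Fubini_integrable)
    have "(\<lambda>x. LINT y|M2. norm (f (fst (x, y)) * g (snd (x, y)))) = (\<lambda>x. norm (f x) * (LINT y|M2. norm (g y)))"
      by (simp add: abs_mult)
    then show "integrable M1 (\<lambda>x. LINT y|M2. norm (f (fst (x, y)) * g (snd (x, y))))"
      using f by (simp only:) (intro integrable_mult_left integrable_norm)
    show "AE x in M1. integrable M2 (\<lambda>y. f (fst (x, y)) * g (snd (x, y)))"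
      using g by simp
  qed measurable
  then show ?thesis
    by (rule Bochner_Integration.integrable_bound[OF _ F])
       (auto intro!: AE_I2 order_trans[OF le] abs_ge_self)
qed

section \<open>Gaussians and the Fourier transform\<close>

lemma measurable_cis [measurable]: "cis \<in> borel_measurable borel"
  by (intro borel_measurable_continuous_onI continuous_intros)

text \<open>This is the characteristic function of the standard normal law after a change of
  scale.\<close>

lemma gaussian_ft_1d:
  fixes \<alpha> \<xi> :: real assumes "\<alpha> > 0"
  shows "has_bochner_integral lborel (\<lambda>y. complex_of_real (exp (- \<alpha> * y\<^sup>2)) * cis (y * \<xi>))
           (complex_of_real (sqrt (pi / \<alpha>) * exp (- \<xi>\<^sup>2 / (4 * \<alpha>))))"
proof -
  \<comment> \<open>Chosen so that \<open>std_normal_density (c * y)\<close> is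
    \<open>exp (- \<alpha> * y\<^sup>2)\<close> divided by \<open>sqrt (2 * pi)\<close>.\<close>
  define c where "c = sqrt (2 * \<alpha>)"
  have c: "c > 0" "c \<noteq> 0" "c\<^sup>2 = 2 * \<alpha>" using assms by (auto simp: c_def)
  let ?f = "\<lambda>y. complex_of_real (std_normal_density y) * cis (\<xi> / c * y)"
  have 1: "integrable lborel ?f"
  proof (rule Bochner_Integration.integrable_bound)
    show "integrable lborel std_normal_density" by simp
  qed (auto simp: norm_mult)
  have "char std_normal_distribution (\<xi> / c) = integral\<^sup>L lborel ?f"
    unfolding char_def
    by (subst integral_density) (auto simp: scaleR_conv_of_real cis_conv_exp)
  then have 2: "has_bochner_integral lborel ?f (complex_of_real (exp (- ((\<xi> / c)\<^sup>2) / 2)))"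
    using 1 by (simp add: has_bochner_integral_iff char_std_normal_distribution)
  have "has_bochner_integral lborel (\<lambda>y. ?f (0 + c * y)) (complex_of_real (exp (- ((\<xi> / c)\<^sup>2) / 2)) /\<^sub>R \<bar>c\<bar>)"
    using 2 c by (subst (asm) lborel_has_bochner_integral_real_affine_iff[where c=c and t=0]) auto
  then have "has_bochner_integral lborel (\<lambda>y. complex_of_real (sqrt (2 * pi)) * ?f (0 + c * y))
      (complex_of_real (sqrt (2 * pi)) * (complex_of_real (exp (- ((\<xi> / c)\<^sup>2) / 2)) /\<^sub>R \<bar>c\<bar>))"
    by (rule has_bochner_integral_mult_right)
  moreover have "complex_of_real (sqrt (2 * pi)) * ?f (0 + c * y) = complex_of_real (exp (- \<alpha> * y\<^sup>2)) * cis (y * \<xi>)" for y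
    using c by (simp add: std_normal_density_def power_mult_distrib field_simps)
  moreover have "complex_of_real (sqrt (2 * pi)) * (complex_of_real (exp (- ((\<xi> / c)\<^sup>2) / 2)) /\<^sub>R \<bar>c\<bar>)
     = complex_of_real (sqrt (pi / \<alpha>) * exp (- \<xi>\<^sup>2 / (4 * \<alpha>)))"
  proof -
    have "sqrt (2 * pi) / c = sqrt (pi / \<alpha>)" using assms unfolding c_def
      by (simp add: real_sqrt_divide real_sqrt_mult)
    then show ?thesis using c
      by (simp add: scaleR_conv_of_real power_divide field_simps flip: of_real_mult of_real_divide of_real_inverse)
  qed
  ultimately show ?thesis by simp
qed

text \<open>Both factors split over the coordinates, and Lebesgue measure is the image of the
  product measure over \<open>Basis\<close>, so the integral is a product of one-dimensional
  ones.\<close>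

lemma gaussian_ft:
  fixes \<xi> :: "'a::euclidean_space" assumes "\<alpha> > 0"
  shows "has_bochner_integral lborel (\<lambda>y. complex_of_real (exp (- \<alpha> * (norm y)\<^sup>2)) * cis (y \<bullet> \<xi>))
           (complex_of_real ((pi / \<alpha>) powr (real DIM('a) / 2) * exp (- (norm \<xi>)\<^sup>2 / (4 * \<alpha>))))"
proof -
  interpret product_sigma_finite "\<lambda>_::'a. lborel :: real measure" by standard
  let ?g = "\<lambda>b y. complex_of_real (exp (- \<alpha> * y\<^sup>2)) * cis (y * (\<xi> \<bullet> b))"
  have g: "integrable lborel (?g b)" "integral\<^sup>L lborel (?g b) = complex_of_real (sqrt (pi / \<alpha>) * exp (- (\<xi> \<bullet> b)\<^sup>2 / (4 * \<alpha>)))" for b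
    using gaussian_ft_1d[OF assms, of "\<xi> \<bullet> b"] by (auto simp: has_bochner_integral_iff)
  have n2: "(norm z)\<^sup>2 = (\<Sum>b\<in>Basis. (z \<bullet> b)\<^sup>2)" for z :: 'a
    unfolding power2_norm_eq_inner by (subst euclidean_inner) (simp add: power2_eq_square)
  have eq: "complex_of_real (exp (- \<alpha> * (norm y)\<^sup>2)) * cis (y \<bullet> \<xi>) = (\<Prod>b\<in>Basis. ?g b (y \<bullet> b))" for y :: 'a
  proof -
    have "y \<bullet> \<xi> = (\<Sum>b\<in>Basis. (y \<bullet> b) * (\<xi> \<bullet> b))" by (rule euclidean_inner)
    then show ?thesis
      by (simp add: prod.distrib n2 sum_distrib_left cis_conv_exp exp_sum sum_negf flip: exp_of_real)
        (simp add: exp_sum flip: sum_negf)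
  qed
  have P: "(\<Prod>b\<in>Basis. complex_of_real (sqrt (pi / \<alpha>) * exp (- (\<xi> \<bullet> b)\<^sup>2 / (4 * \<alpha>))))
     = complex_of_real ((pi / \<alpha>) powr (real DIM('a) / 2) * exp (- (norm \<xi>)\<^sup>2 / (4 * \<alpha>)))"
  proof -
    have "(pi / \<alpha>) powr (real DIM('a) / 2) = sqrt (pi / \<alpha>) ^ DIM('a)"
      using assms by (simp add: powr_half_sqrt[symmetric] powr_powr flip: powr_realpow)
    then show ?thesis
      by (simp add: prod.distrib n2 exp_sum sum_divide_distrib sum_negf flip: of_real_prod)
        (simp add: sum_divide_distrib exp_sum flip: sum_negf)
  qed
  have m: "(\<lambda>f. \<Sum>b\<in>Basis. f b *\<^sub>R b) \<in> measurable (\<Pi>\<^sub>M b\<in>(Basis::'a set). (lborel::real measure)) borel" by measurable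
  have red: "(\<Sum>b\<in>Basis. x b *\<^sub>R b) \<bullet> c = x c" if "c \<in> Basis" for c :: 'a and x
    using that by simp
  have m2: "(\<lambda>y::'a. \<Prod>b\<in>Basis. ?g b (y \<bullet> b)) \<in> borel_measurable borel" by measurable
  have cong: "(\<lambda>x. \<Prod>b\<in>Basis. ?g b ((\<Sum>c\<in>Basis. x c *\<^sub>R c) \<bullet> b)) = (\<lambda>x. \<Prod>b\<in>(Basis::'a set). ?g b (x b))"
    by (intro ext prod.cong) (simp_all del: inner_sum_left add: red)
  have "integrable lborel (\<lambda>y::'a. \<Prod>b\<in>Basis. ?g b (y \<bullet> b))"
    by (subst lborel_eq, subst integrable_distr_eq[OF m])
      (use m2 product_integrable_prod[of Basis ?g] g(1) in \<open>simp_all only: cong finite_Basis\<close>)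
  moreover have "(LINT y|lborel. (\<Prod>b\<in>Basis. ?g b (y \<bullet> b))) = (\<Prod>b\<in>Basis. complex_of_real (sqrt (pi / \<alpha>) * exp (- (\<xi> \<bullet> b)\<^sup>2 / (4 * \<alpha>))))"
    by (subst lborel_eq, subst integral_distr[OF m])
      (use m2 product_integral_prod[of Basis ?g] g in \<open>simp_all only: cong finite_Basis\<close>)
  ultimately show ?thesis
    unfolding has_bochner_integral_iff eq P by blast
qed

text \<open>The classical heat kernel at time \<tau>: unit mass, Fourier symbol
  \<open>exp (- \<tau> * (norm \<xi>)\<^sup>2)\<close>.\<close>

definition gauss :: "real \<Rightarrow> 'a::euclidean_space \<Rightarrow> real" where
  "gauss \<tau> x = (4 * pi * \<tau>) powr (- (real DIM('a) / 2)) * exp (- ((norm x)\<^sup>2 / (4 * \<tau>)))"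

definition inv_ftc :: "('a::euclidean_space \<Rightarrow> complex) \<Rightarrow> 'a \<Rightarrow> complex" where
  "inv_ftc m x = complex_of_real ((2 * pi) powr (- real DIM('a))) * (LINT \<xi>|lborel. m \<xi> * cis (x \<bullet> \<xi>))"

text \<open>Taking the real part matches \<open>frac_lap\<close> and
  \<open>frac_heat_kernel\<close>, which become instances. The complex version stays available for
  the place where an inverse transform is itself transformed again.\<close>

definition inv_ft :: "('a::euclidean_space \<Rightarrow> complex) \<Rightarrow> 'a \<Rightarrow> real" where
  "inv_ft m x = Re (inv_ftc m x)"

section \<open>Calculus of inverse Fourier transforms\<close>

lemma frac_lap_eq_inv_ft:
  "frac_lap s f = inv_ft (\<lambda>\<xi>. complex_of_real (norm \<xi> powr (2 * s)) * fourier_tr f \<xi>)"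
  by (simp add: fun_eq_iff frac_lap_def inv_ft_def inv_ftc_def)

lemma frac_heat_kernel_eq_inv_ft:
  "frac_heat_kernel s t = inv_ft (\<lambda>\<xi>. complex_of_real (exp (- t * norm \<xi> powr (2 * s))))"
  by (simp add: fun_eq_iff frac_heat_kernel_def inv_ft_def inv_ftc_def)

lemma integrable_mult_cis:
  assumes "integrable lborel (m :: 'a::euclidean_space \<Rightarrow> complex)"
  shows "integrable lborel (\<lambda>\<xi>. m \<xi> * cis (x \<bullet> \<xi>))" "integrable lborel (\<lambda>\<xi>. m \<xi> * cis (- (\<xi> \<bullet> x)))"
  using assms by (auto intro!: Bochner_Integration.integrable_bound[OF assms] simp: norm_mult)

lemma inv_ftc_add:
  assumes "integrable lborel m" "integrable lborel n"
  shows "inv_ftc (\<lambda>\<xi>. m \<xi> + n \<xi>) x = inv_ftc m x + inv_ftc n x"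
  using assms by (simp add: inv_ftc_def algebra_simps integrable_mult_cis)

lemma inv_ftc_cmult: "inv_ftc (\<lambda>\<xi>. c * m \<xi>) x = c * inv_ftc m x"
  by (simp add: inv_ftc_def algebra_simps)

lemma inv_ft_add:
  assumes "integrable lborel m" "integrable lborel n"
  shows "inv_ft (\<lambda>\<xi>. m \<xi> + n \<xi>) x = inv_ft m x + inv_ft n x"
  by (simp add: inv_ft_def inv_ftc_add assms)

lemma inv_ft_cmult: "inv_ft (\<lambda>\<xi>. complex_of_real c * m \<xi>) x = c * inv_ft m x"
  by (simp add: inv_ft_def inv_ftc_cmult)

lemma borel_measurable_inv_ft [measurable]:
  assumes [measurable]: "m \<in> borel_measurable borel"
  shows "inv_ft m \<in> borel_measurable borel"
proof -
  have "(\<lambda>x. LINT \<xi>|lborel. m \<xi> * cis (x \<bullet> \<xi>)) \<in> borel_measurable borel" by measurable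
  then show ?thesis unfolding inv_ft_def[abs_def] inv_ftc_def by measurable
qed

lemma inv_ft_dominated_convergence:
  fixes m :: "'a::euclidean_space \<Rightarrow> complex"
  assumes "integrable lborel w" "\<And>n. M n \<in> borel_measurable borel"
    "\<And>n \<xi>. norm (M n \<xi>) \<le> w \<xi>" "AE \<xi> in lborel. (\<lambda>n. M n \<xi>) \<longlonglongrightarrow> m \<xi>" "m \<in> borel_measurable borel" "X \<longlonglongrightarrow> x"
  shows "(\<lambda>n. inv_ft (M n) (X n)) \<longlonglongrightarrow> inv_ft m x"
proof -
  note [measurable] = assms(2,5)
  have "(\<lambda>n. LINT \<xi>|lborel. M n \<xi> * cis (X n \<bullet> \<xi>)) \<longlonglongrightarrow> (LINT \<xi>|lborel. m \<xi> * cis (x \<bullet> \<xi>))"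
  proof (rule integral_dominated_convergence[OF _ _ assms(1)])
    show "AE \<xi> in lborel. (\<lambda>i. M i \<xi> * cis (X i \<bullet> \<xi>)) \<longlonglongrightarrow> m \<xi> * cis (x \<bullet> \<xi>)"
      using assms(4) by eventually_elim (auto intro!: tendsto_intros assms(6))
    show "AE \<xi> in lborel. norm (M i \<xi> * cis (X i \<bullet> \<xi>)) \<le> w \<xi>" for i
      using assms(3) by (auto simp: norm_mult)
  qed auto
  then show ?thesis
    unfolding inv_ft_def inv_ftc_def by (intro tendsto_intros)
qed

lemma norm_inv_ft_le:
  fixes m :: "'a::euclidean_space \<Rightarrow> complex"
  shows "\<bar>inv_ft m x\<bar> \<le> (2 * pi) powr (- real DIM('a)) * (LINT \<xi>|lborel. norm (m \<xi>))"
proof -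
  have "norm (LINT \<xi>|lborel. m \<xi> * cis (x \<bullet> \<xi>)) \<le> (LINT \<xi>|lborel. norm (m \<xi> * cis (x \<bullet> \<xi>)))"
    by (rule integral_norm_bound)
  then have "norm (inv_ftc m x) \<le> (2 * pi) powr (- real DIM('a)) * (LINT \<xi>|lborel. norm (m \<xi>))"
    unfolding inv_ftc_def norm_mult by (intro mult_mono) (auto simp: norm_mult)
  then show ?thesis unfolding inv_ft_def using abs_Re_le_cmod order_trans by blast
qed

lemma fourier_tr_measurable [measurable]:
  assumes [measurable]: "f \<in> borel_measurable borel"
  shows "fourier_tr f \<in> borel_measurable borel"
  unfolding fourier_tr_def[abs_def] by measurable

lemma norm_fourier_tr_le: "norm (fourier_tr f \<xi>) \<le> (LINT y|lborel. \<bar>f y\<bar>)"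
proof -
  have "norm (fourier_tr f \<xi>) \<le> (LINT y|lborel. norm (complex_of_real (f y) * cis (- (y \<bullet> \<xi>))))"
    unfolding fourier_tr_def by (rule integral_norm_bound)
  then show ?thesis by (simp add: norm_mult)
qed

text \<open>Convolution theorem for a function known only through an integrable symbol
  \<open>m\<close>. The integrals are exchanged before any transform of \<open>inv_ft m\<close> is
  formed, so the integrability of \<open>k\<close> and \<open>m\<close> is enough. It serves both
  for Gaussians and for the fractional heat kernel.\<close>

lemma conv_inv_ft:
  fixes m :: "'a::euclidean_space \<Rightarrow> complex"
  assumes k: "integrable lborel k" and m: "integrable lborel m"
    and ft: "\<And>\<xi>. fourier_tr k \<xi> = complex_of_real (\<kappa> \<xi>)"
  shows "(LINT y|lborel. k (x - y) * inv_ft m y) = inv_ft (\<lambda>\<xi>. complex_of_real (\<kappa> \<xi>) * m \<xi>) x"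
    and "integrable lborel (\<lambda>y. k (x - y) * inv_ft m y)"
proof -
  have [measurable]: "m \<in> borel_measurable borel" "k \<in> borel_measurable borel"
    using k m by (simp_all add: integrable_iff_bounded)
  let ?c = "complex_of_real ((2 * pi) powr (- real DIM('a)))"
  let ?F = "\<lambda>y \<xi>. ?c * complex_of_real (k (x - y)) * (m \<xi> * cis (y \<bullet> \<xi>))"
  have F: "integrable (lborel \<Otimes>\<^sub>M lborel) (case_prod ?F)"
    by (rule lborel_pair.integrable_product_bound[where f="\<lambda>y. norm ?c * \<bar>k (x - y)\<bar>" and g="\<lambda>\<xi>. norm (m \<xi>)"])
       (use k m in \<open>auto simp: norm_mult intro!: lborel_reflect(1)[where f="\<lambda>y. \<bar>k y\<bar>"]\<close>)
  have kx: "(LINT y|lborel. complex_of_real (k (x - y)) * cis (y \<bullet> \<xi>)) = cis (x \<bullet> \<xi>) * fourier_tr k \<xi>" for \<xi>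
  proof -
    have "(LINT y|lborel. complex_of_real (k (x - y)) * cis (y \<bullet> \<xi>))
       = (LINT y|lborel. (\<lambda>z. cis (x \<bullet> \<xi>) * (complex_of_real (k z) * cis (- (z \<bullet> \<xi>)))) (x - y))"
      by (intro Bochner_Integration.integral_cong refl)
        (simp add: cis_mult inner_diff_left mult.left_commute)
    also have "\<dots> = (LINT z|lborel. cis (x \<bullet> \<xi>) * (complex_of_real (k z) * cis (- (z \<bullet> \<xi>))))"
      by (rule lborel_reflect(2)) (use k in \<open>auto intro!: integrable_mult_right integrable_mult_cis(2)\<close>)
    finally show ?thesis by (simp add: fourier_tr_def)
  qed
  have 1: "k (x - y) * inv_ft m y = Re (LINT \<xi>|lborel. ?F y \<xi>)" for y
    by (simp add: inv_ft_def inv_ftc_def)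
  have 2: "integrable lborel (\<lambda>y. LINT \<xi>|lborel. ?F y \<xi>)"
    using lborel_pair.integrable_fst[OF F] by simp
  then show "integrable lborel (\<lambda>y. k (x - y) * inv_ft m y)"
    unfolding 1 by (rule integrable_Re)
  have "(LINT y|lborel. k (x - y) * inv_ft m y) = Re (LINT y|lborel. LINT \<xi>|lborel. ?F y \<xi>)"
    unfolding 1 using 2 by (rule integral_Re)
  also have "(LINT y|lborel. LINT \<xi>|lborel. ?F y \<xi>) = (LINT \<xi>|lborel. LINT y|lborel. ?F y \<xi>)"
    using lborel_pair.Fubini_integral[OF F] by simp
  also have "(\<lambda>\<xi>. LINT y|lborel. ?F y \<xi>) = (\<lambda>\<xi>. ?c * (complex_of_real (\<kappa> \<xi>) * m \<xi> * cis (x \<bullet> \<xi>)))"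
  proof
    fix \<xi>
    have "(LINT y|lborel. ?F y \<xi>) = (LINT y|lborel. (?c * m \<xi>) * (complex_of_real (k (x - y)) * cis (y \<bullet> \<xi>)))"
      by (simp add: mult_ac)
    also have "\<dots> = (?c * m \<xi>) * (cis (x \<bullet> \<xi>) * fourier_tr k \<xi>)" by (simp only: integral_mult_right_zero kx)
    finally show "(LINT y|lborel. ?F y \<xi>) = ?c * (complex_of_real (\<kappa> \<xi>) * m \<xi> * cis (x \<bullet> \<xi>))"
      by (simp add: ft mult_ac)
  qed
  finally show "(LINT y|lborel. k (x - y) * inv_ft m y) = inv_ft (\<lambda>\<xi>. complex_of_real (\<kappa> \<xi>) * m \<xi>) x"
    by (simp add: inv_ft_def inv_ftc_def mult.assoc)
qed

text \<open>Here the kernel is given by its symbol and the function by its values, the reverse of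
  the preceding rule. Gaussian regularisation and the pairing of the heat kernel with a test
  function have this form.\<close>

lemma conv_inv_ft':
  fixes m :: "'a::euclidean_space \<Rightarrow> complex"
  assumes f: "integrable lborel f" and m: "integrable lborel m"
  shows "(LINT y|lborel. f y * inv_ft m (x - y)) = inv_ft (\<lambda>\<xi>. m \<xi> * fourier_tr f \<xi>) x"
proof -
  have [measurable]: "m \<in> borel_measurable borel" "f \<in> borel_measurable borel"
    using f m by (simp_all add: integrable_iff_bounded)
  let ?c = "complex_of_real ((2 * pi) powr (- real DIM('a)))"
  let ?F = "\<lambda>y \<xi>. ?c * complex_of_real (f y) * (m \<xi> * cis ((x - y) \<bullet> \<xi>))"
  have F: "integrable (lborel \<Otimes>\<^sub>M lborel) (case_prod ?F)"
    by (rule lborel_pair.integrable_product_bound[where f="\<lambda>y. norm ?c * \<bar>f y\<bar>" and g="\<lambda>\<xi>. norm (m \<xi>)"])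
       (use f m in \<open>auto simp: norm_mult\<close>)
  have 1: "f y * inv_ft m (x - y) = Re (LINT \<xi>|lborel. ?F y \<xi>)" for y
    by (simp add: inv_ft_def inv_ftc_def)
  have 2: "integrable lborel (\<lambda>y. LINT \<xi>|lborel. ?F y \<xi>)"
    using lborel_pair.integrable_fst[OF F] by simp
  have "(LINT y|lborel. f y * inv_ft m (x - y)) = Re (LINT y|lborel. LINT \<xi>|lborel. ?F y \<xi>)"
    unfolding 1 using 2 by (rule integral_Re)
  also have "(LINT y|lborel. LINT \<xi>|lborel. ?F y \<xi>) = (LINT \<xi>|lborel. LINT y|lborel. ?F y \<xi>)"
    using lborel_pair.Fubini_integral[OF F] by simp
  also have "(\<lambda>\<xi>. LINT y|lborel. ?F y \<xi>) = (\<lambda>\<xi>. ?c * (m \<xi> * fourier_tr f \<xi> * cis (x \<bullet> \<xi>)))"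
  proof
    fix \<xi>
    have "?F y \<xi> = (?c * m \<xi> * cis (x \<bullet> \<xi>)) * (complex_of_real (f y) * cis (- (y \<bullet> \<xi>)))" for y
    proof -
      have "cis ((x - y) \<bullet> \<xi>) = cis (x \<bullet> \<xi>) * cis (- (y \<bullet> \<xi>))" by (simp add: cis_mult inner_diff_left)
      then show ?thesis by (simp add: mult_ac)
    qed
    then have "(LINT y|lborel. ?F y \<xi>) = (?c * m \<xi> * cis (x \<bullet> \<xi>)) * fourier_tr f \<xi>"
      unfolding fourier_tr_def by (simp only: integral_mult_right_zero)
    then show "(LINT y|lborel. ?F y \<xi>) = ?c * (m \<xi> * fourier_tr f \<xi> * cis (x \<bullet> \<xi>))"
      by (simp add: mult_ac)
  qed
  finally show ?thesis
    by (simp add: inv_ft_def inv_ftc_def mult.assoc)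
qed

section \<open>Gaussian kernels: semigroup law, approximate identity, Fourier inversion\<close>

lemma gauss_nonneg: "gauss \<tau> x \<ge> 0"
  by (simp add: gauss_def)

lemma gauss_measurable [measurable (raw)]:
  assumes [measurable]: "f \<in> borel_measurable M" "g \<in> borel_measurable M"
  shows "(\<lambda>x. gauss (f x) (g x)) \<in> borel_measurable M"
  unfolding gauss_def by measurable

lemma integrable_gaussian:
  assumes "\<alpha> > 0" shows "integrable lborel (\<lambda>y::'a::euclidean_space. exp (- \<alpha> * (norm y)\<^sup>2))"
  using integrable_norm[OF integrable.intros[OF gaussian_ft[OF assms, of 0]]] by simp

lemma gauss_exp: "gauss \<tau> = (\<lambda>x::'a::euclidean_space. (4 * pi * \<tau>) powr (- (real DIM('a) / 2)) * exp (- (1 / (4*\<tau>)) * (norm x)\<^sup>2))"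
  by (simp add: gauss_def fun_eq_iff)

lemma integrable_gauss: "\<tau> > 0 \<Longrightarrow> integrable lborel (gauss \<tau>)"
  unfolding gauss_exp by (intro integrable_mult_right integrable_gaussian) simp

lemma fourier_tr_gauss:
  fixes \<xi> :: "'a::euclidean_space" assumes "\<tau> > 0"
  shows "fourier_tr (gauss \<tau>) \<xi> = complex_of_real (exp (- \<tau> * (norm \<xi>)\<^sup>2))"
proof -
  let ?c = "(4 * pi * \<tau>) powr (- (real DIM('a) / 2))"
  have "fourier_tr (gauss \<tau>) \<xi> = (LINT y|lborel. complex_of_real ?c * (complex_of_real (exp (- (1 / (4*\<tau>)) * (norm y)\<^sup>2)) * cis (y \<bullet> (-\<xi>))))"
    unfolding fourier_tr_def gauss_exp by (simp add: mult.assoc)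
  also have "\<dots> = complex_of_real ?c * (complex_of_real ((pi / (1 / (4*\<tau>))) powr (real DIM('a) / 2) * exp (- (norm (-\<xi>))\<^sup>2 / (4 * (1 / (4*\<tau>))))))"
    using has_bochner_integral_integral_eq[OF gaussian_ft[of "1/(4*\<tau>)" "-\<xi>"]] assms
    by (simp only: integral_mult_right_zero) simp
  also have "\<dots> = complex_of_real (exp (- \<tau> * (norm \<xi>)\<^sup>2))"
    using assms by (simp add: powr_minus field_simps flip: of_real_mult)
  finally show ?thesis .
qed

lemma gauss_const:
  assumes "\<tau> > 0"
  shows "(2 * pi) powr (- real DIM('a::euclidean_space)) * (pi / \<tau>) powr (real DIM('a) / 2) = (4 * pi * \<tau>) powr (- (real DIM('a) / 2))"
proof -
  have "4 * pi * pi = (2 * pi) powr 2" by (simp add: power2_eq_square)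
  then have 1: "(2 * pi) powr (- real DIM('a)) = (4 * pi * pi) powr (- (real DIM('a) / 2))"
    by (simp only: powr_powr) simp
  have 2: "(pi / \<tau>) powr (real DIM('a) / 2) = (\<tau> / pi) powr (- (real DIM('a) / 2))"
    using assms by (simp add: powr_minus powr_divide)
  have 3: "4 * pi * pi * (\<tau> / pi) = 4 * pi * \<tau>" by simp
  show ?thesis
    by (simp only: 1 2 powr_mult[symmetric] 3)
qed

lemma gauss_eq_inv_ft:
  assumes "\<tau> > 0"
  shows "gauss \<tau> = inv_ft (\<lambda>\<xi>::'a::euclidean_space. complex_of_real (exp (- \<tau> * (norm \<xi>)\<^sup>2)))"
proof
  fix x :: 'a
  have "(LINT \<xi>|lborel. complex_of_real (exp (- \<tau> * (norm \<xi>)\<^sup>2)) * cis (x \<bullet> \<xi>))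
    = complex_of_real ((pi / \<tau>) powr (real DIM('a) / 2) * exp (- (norm x)\<^sup>2 / (4 * \<tau>)))"
    using has_bochner_integral_integral_eq[OF gaussian_ft[OF assms, of x]] by (simp add: inner_commute)
  then show "gauss \<tau> x = inv_ft (\<lambda>\<xi>. complex_of_real (exp (- \<tau> * (norm \<xi>)\<^sup>2))) x"
    unfolding inv_ft_def inv_ftc_def gauss_def by (simp add: gauss_const[OF assms, symmetric])
qed

lemma integral_gauss: "\<tau> > 0 \<Longrightarrow> (LINT x|lborel. gauss \<tau> (x::'a::euclidean_space)) = 1"
proof -
  assume "\<tau> > 0"
  then have "complex_of_real (LINT x|lborel. gauss \<tau> (x::'a)) = 1"
    using fourier_tr_gauss[of \<tau> "0::'a"] unfolding fourier_tr_def by simp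
  then show ?thesis by simp
qed

lemma gauss_conv_inv_ft:
  assumes "\<tau> > 0" "integrable lborel m"
  shows "(LINT y|lborel. gauss \<tau> (x - y) * inv_ft m y) = inv_ft (\<lambda>\<xi>. complex_of_real (exp (- \<tau> * (norm \<xi>)\<^sup>2)) * m \<xi>) x"
    "integrable lborel (\<lambda>y. gauss \<tau> (x - y) * inv_ft m y)"
  using conv_inv_ft[OF integrable_gauss[OF assms(1)] assms(2) fourier_tr_gauss[OF assms(1)]] by blast+

lemma gauss_semigroup:
  fixes x :: "'a::euclidean_space"
  assumes "\<tau> > 0" "\<sigma> > 0"
  shows "(LINT y|lborel. gauss \<tau> (x - y) * gauss \<sigma> y) = gauss (\<tau> + \<sigma>) x"
    "integrable lborel (\<lambda>y. gauss \<tau> (x - y) * gauss \<sigma> y)"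
proof -
  have i: "integrable lborel (\<lambda>\<xi>::'a. complex_of_real (exp (- \<sigma> * (norm \<xi>)\<^sup>2)))"
    using integrable_gaussian[OF assms(2)] by (rule integrable_of_real)
  have "(\<lambda>\<xi>::'a. complex_of_real (exp (- \<tau> * (norm \<xi>)\<^sup>2)) * complex_of_real (exp (- \<sigma> * (norm \<xi>)\<^sup>2)))
    = (\<lambda>\<xi>. complex_of_real (exp (- (\<tau> + \<sigma>) * (norm \<xi>)\<^sup>2)))"
    by (auto simp: algebra_simps exp_add[symmetric] simp flip: of_real_mult exp_minus)
  then show "(LINT y|lborel. gauss \<tau> (x - y) * gauss \<sigma> y) = gauss (\<tau> + \<sigma>) x" "integrable lborel (\<lambda>y. gauss \<tau> (x - y) * gauss \<sigma> y)"
    using gauss_conv_inv_ft[OF assms(1) i, of x] assms by (simp_all add: gauss_eq_inv_ft)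
qed

lemma gauss_scale:
  fixes z :: "'a::euclidean_space" assumes "\<tau> > 0"
  shows "(sqrt \<tau>) ^ DIM('a) * gauss \<tau> (sqrt \<tau> *\<^sub>R z) = gauss 1 z"
proof -
  have "(sqrt \<tau>) ^ DIM('a) = \<tau> powr (real DIM('a) / 2)"
    using assms by (simp add: powr_half_sqrt[symmetric] powr_powr flip: powr_realpow)
  then show ?thesis using assms
    by (simp add: gauss_def powr_mult powr_minus power_mult_distrib field_simps)
qed

lemma gauss_conv_scale:
  fixes x :: "'a::euclidean_space"
  assumes "\<tau> > 0" "g \<in> borel_measurable borel"
  shows "(LINT y|lborel. gauss \<tau> (x - y) * g y) = (LINT z|lborel. gauss 1 z * g (x + sqrt \<tau> *\<^sub>R z))"
proof -
  note [measurable] = assms(2)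
  have "(LINT y|lborel. gauss \<tau> (x - y) * g y) = (sqrt \<tau>) ^ DIM('a) * (LINT z|lborel. gauss \<tau> (sqrt \<tau> *\<^sub>R z) * g (x + sqrt \<tau> *\<^sub>R z))"
    using assms by (subst integral_lborel_affine[of "sqrt \<tau>" _ x]) (auto simp: gauss_def)
  also have "\<dots> = (LINT z|lborel. gauss 1 z * g (x + sqrt \<tau> *\<^sub>R z))"
    by (simp add: gauss_scale[OF assms(1), symmetric] mult.assoc)
  finally show ?thesis .
qed

text \<open>Rescaling by \<open>sqrt (T n)\<close> replaces the shrinking kernel by the fixed weight
  \<open>gauss 1\<close>, so dominated convergence applies with boundedness of \<open>g\<close> and
  continuity at the single point \<open>x\<close>.\<close>

lemma gauss_approx_identity:
  fixes g :: "'a::euclidean_space \<Rightarrow> real"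
  assumes [measurable]: "g \<in> borel_measurable borel" and b: "\<And>y. \<bar>g y\<bar> \<le> B" and c: "isCont g x"
    and T: "\<And>n. T n > 0" "T \<longlonglongrightarrow> 0"
  shows "(\<lambda>n. LINT y|lborel. gauss (T n) (x - y) * g y) \<longlonglongrightarrow> g x"
proof -
  have "(\<lambda>n. LINT z|lborel. gauss 1 z * g (x + sqrt (T n) *\<^sub>R z)) \<longlonglongrightarrow> (LINT z|lborel. gauss 1 (z::'a) * g x)"
  proof (rule integral_dominated_convergence)
    show "integrable lborel (\<lambda>z::'a. gauss 1 z * B)" by (intro integrable_mult_left integrable_gauss) simp
    show "AE z in lborel. norm (gauss 1 z * g (x + sqrt (T n) *\<^sub>R z)) \<le> gauss 1 z * B" for n
      by (auto simp: abs_mult gauss_nonneg intro!: mult_left_mono b)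
    show "AE z in lborel. (\<lambda>n. gauss 1 z * g (x + sqrt (T n) *\<^sub>R z)) \<longlonglongrightarrow> gauss 1 z * g x"
    proof (intro AE_I2 tendsto_intros isCont_tendsto_compose[OF c])
      fix z :: 'a
      have "(\<lambda>n. x + sqrt (T n) *\<^sub>R z) \<longlonglongrightarrow> x + sqrt 0 *\<^sub>R z" by (intro tendsto_intros T)
      then show "(\<lambda>n. x + sqrt (T n) *\<^sub>R z) \<longlonglongrightarrow> x" by simp
    qed
  qed measurable
  then show ?thesis by (simp add: gauss_conv_scale T integral_gauss)
qed

text \<open>Gaussian regularisation: the mean of \<open>f\<close> against a narrow Gaussian equals
  the inverse transform of the damped symbol. One side tends to \<open>f x\<close>, the other to the
  undamped inverse transform.\<close>

lemma fourier_inversion: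
  fixes f :: "'a::euclidean_space \<Rightarrow> real"
  assumes f: "integrable lborel f" and b: "\<And>y. \<bar>f y\<bar> \<le> B" and c: "isCont f x"
    and i: "integrable lborel (fourier_tr f)"
  shows "inv_ft (fourier_tr f) x = f x"
proof -
  have [measurable]: "f \<in> borel_measurable borel" using f by (simp add: integrable_iff_bounded)
  let ?T = "\<lambda>n. inverse (real (Suc n))"
  have T: "\<And>n. ?T n > 0" "?T \<longlonglongrightarrow> 0" using LIMSEQ_inverse_real_of_nat by auto
  have "(LINT y|lborel. gauss (?T n) (x - y) * f y) = inv_ft (\<lambda>\<xi>. complex_of_real (exp (- ?T n * (norm \<xi>)\<^sup>2)) * fourier_tr f \<xi>) x" for n
  proof -
    have "integrable lborel (\<lambda>\<xi>::'a. complex_of_real (exp (- ?T n * (norm \<xi>)\<^sup>2)))"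
      using integrable_gaussian[OF T(1)] by (rule integrable_of_real)
    from conv_inv_ft'[OF f this] show ?thesis
      unfolding gauss_eq_inv_ft[OF T(1)] by (simp add: mult.commute)
  qed
  then have "(\<lambda>n. inv_ft (\<lambda>\<xi>. complex_of_real (exp (- ?T n * (norm \<xi>)\<^sup>2)) * fourier_tr f \<xi>) x) \<longlonglongrightarrow> f x"
    using gauss_approx_identity[OF _ b c T] by simp
  moreover have "(\<lambda>n. inv_ft (\<lambda>\<xi>. complex_of_real (exp (- ?T n * (norm \<xi>)\<^sup>2)) * fourier_tr f \<xi>) x) \<longlonglongrightarrow> inv_ft (fourier_tr f) x"
  proof (rule inv_ft_dominated_convergence)
    show "integrable lborel (\<lambda>\<xi>. norm (fourier_tr f \<xi>))" using i by simp
    show "norm (complex_of_real (exp (- ?T n * (norm \<xi>)\<^sup>2)) * fourier_tr f \<xi>) \<le> norm (fourier_tr f \<xi>)" for n \<xi>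
      by (auto simp: norm_mult intro!: mult_left_le_one_le)
    show "AE \<xi> in lborel. (\<lambda>n. complex_of_real (exp (- ?T n * (norm \<xi>)\<^sup>2)) * fourier_tr f \<xi>) \<longlonglongrightarrow> fourier_tr f \<xi>"
    proof (rule AE_I2)
      fix \<xi> :: 'a
      have "(\<lambda>n. complex_of_real (exp (- ?T n * (norm \<xi>)\<^sup>2)) * fourier_tr f \<xi>) \<longlonglongrightarrow> complex_of_real (exp (- 0 * (norm \<xi>)\<^sup>2)) * fourier_tr f \<xi>"
        by (intro tendsto_intros T)
      then show "(\<lambda>n. complex_of_real (exp (- ?T n * (norm \<xi>)\<^sup>2)) * fourier_tr f \<xi>) \<longlonglongrightarrow> fourier_tr f \<xi>" by simp
    qed
  qed auto
  ultimately show ?thesis using LIMSEQ_unique by blast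
qed

text \<open>Lets a mixture of Gaussians over \<tau> be read as one function with one symbol.\<close>

lemma inv_ft_superposition:
  fixes M :: "'b::euclidean_space \<Rightarrow> 'a::euclidean_space \<Rightarrow> complex"
  assumes M: "integrable (lborel \<Otimes>\<^sub>M lborel) (case_prod M)"
  shows "(LINT \<tau>|lborel. inv_ft (M \<tau>) x) = inv_ft (\<lambda>\<xi>. LINT \<tau>|lborel. M \<tau> \<xi>) x"
    and "integrable lborel (\<lambda>\<tau>. inv_ft (M \<tau>) x)"
proof -
  have [measurable]: "case_prod M \<in> borel_measurable (borel \<Otimes>\<^sub>M borel)"
    using M by (auto simp: integrable_iff_bounded)
  let ?c = "complex_of_real ((2 * pi) powr (- real DIM('a)))"
  let ?F = "\<lambda>\<tau> \<xi>. ?c * (M \<tau> \<xi> * cis (x \<bullet> \<xi>))"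
  have F: "integrable (lborel \<Otimes>\<^sub>M lborel) (case_prod ?F)"
    by (rule Bochner_Integration.integrable_bound[OF integrable_mult_right[OF M, of ?c]]) (auto simp: norm_mult)
  have 1: "inv_ft (M \<tau>) x = Re (LINT \<xi>|lborel. ?F \<tau> \<xi>)" for \<tau>
    by (simp add: inv_ft_def inv_ftc_def)
  have 2: "integrable lborel (\<lambda>\<tau>. LINT \<xi>|lborel. ?F \<tau> \<xi>)"
    using lborel_pair.integrable_fst[OF F] by simp
  then show "integrable lborel (\<lambda>\<tau>. inv_ft (M \<tau>) x)"
    unfolding 1 by (rule integrable_Re)
  have "(LINT \<tau>|lborel. inv_ft (M \<tau>) x) = Re (LINT \<tau>|lborel. LINT \<xi>|lborel. ?F \<tau> \<xi>)"
    unfolding 1 using 2 by (rule integral_Re)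
  also have "(LINT \<tau>|lborel. LINT \<xi>|lborel. ?F \<tau> \<xi>) = (LINT \<xi>|lborel. LINT \<tau>|lborel. ?F \<tau> \<xi>)"
    using lborel_pair.Fubini_integral[OF F] by simp
  finally show "(LINT \<tau>|lborel. inv_ft (M \<tau>) x) = inv_ft (\<lambda>\<xi>. LINT \<tau>|lborel. M \<tau> \<xi>) x"
    by (simp add: inv_ft_def inv_ftc_def)
qed

section \<open>A weight built from Gaussians\<close>

text \<open>Up to the factor \<open>s / Gamma (1 - s)\<close> this is the jump density of the
  s-stable subordinator, restricted to jumps of size at least \<open>a\<close>. The restriction
  makes the total mass finite, namely \<open>a powr (- s) / s\<close>.\<close>

definition sker :: "real \<Rightarrow> real \<Rightarrow> real \<Rightarrow> real" where
  "sker a s \<tau> = indicator {a..} \<tau> * \<tau> powr (- 1 - s)"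

text \<open>Without the cutoff at 1 the mixture would be a multiple of |x| to the power -(N + 2s),
  the jump kernel of the fractional Laplacian. The cutoff removes the singularity at the origin and
  keeps the tail.\<close>

definition wt :: "real \<Rightarrow> 'a::euclidean_space \<Rightarrow> real" where
  "wt s x = (LINT \<tau>|lborel. sker 1 s \<tau> * gauss \<tau> x)"

lemma sker_nonneg: "sker a s \<tau> \<ge> 0"
  by (simp add: sker_def)

lemma sker_measurable [measurable]: "sker a s \<in> borel_measurable borel"
  unfolding sker_def[abs_def] by measurable

lemma nn_integral_sker:
  assumes "a > 0" "s > 0"
  shows "(\<integral>\<^sup>+\<tau>. ennreal (sker a s \<tau>) \<partial>lborel) = ennreal (a powr (- s) / s)"
proof -
  have "(\<integral>\<^sup>+\<tau>. ennreal (sker a s \<tau>) \<partial>lborel) = (\<integral>\<^sup>+\<tau>. ennreal (\<tau> powr (- 1 - s)) * indicator {a..} \<tau> \<partial>lborel)"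
    by (intro nn_integral_cong) (auto simp: sker_def indicator_def)
  also have "\<dots> = ennreal (0 - (- (a powr (- s) / s)))"
  proof (rule nn_integral_FTC_atLeast)
    fix x assume "a \<le> x"
    then show "((\<lambda>x. - (x powr (- s) / s)) has_real_derivative x powr (- 1 - s)) (at x)"
      using assms by (auto intro!: derivative_eq_intros simp: field_simps powr_diff powr_minus)
    show "0 \<le> x powr (- 1 - s)" by simp
  next
    have "((\<lambda>x. x powr (- s)) \<longlongrightarrow> 0) at_top"
      using assms by (intro tendsto_neg_powr filterlim_ident) auto
    from tendsto_minus[OF tendsto_divide[OF this tendsto_const[of s]]]
    show "((\<lambda>x. - (x powr (- s) / s)) \<longlongrightarrow> 0) at_top" using assms by simp
  qed measurable
  finally show ?thesis by simp
qed

lemma sker_integral: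
  assumes "a > 0" "s > 0"
  shows "integrable lborel (sker a s)" "(LINT \<tau>|lborel. sker a s \<tau>) = a powr (- s) / s"
proof -
  show 1: "integrable lborel (sker a s)"
    using nn_integral_sker[OF assms] by (intro integrableI_nonneg) (auto simp: sker_nonneg)
  show "(LINT \<tau>|lborel. sker a s \<tau>) = a powr (- s) / s"
    using nn_integral_sker[OF assms] assms nn_integral_eq_integral[OF 1] by (simp add: sker_nonneg Bochner_Integration.integral_nonneg)
qed

lemma gauss_le_1:
  assumes "\<tau> \<ge> 1" shows "gauss \<tau> x \<le> 1"
proof -
  have "(4 * pi * \<tau>) \<ge> 1"
    using mult_mono[of 1 "4 * pi" 1 \<tau>] assms pi_ge_two by simp
  then have "(4 * pi * \<tau>) powr (- (real DIM('a) / 2)) \<le> 1"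
    by (subst powr_minus) (auto intro!: inverse_le_1_iff[THEN iffD2] ge_one_powr_ge_zero)
  then show ?thesis unfolding gauss_def using assms by (intro mult_le_one) auto
qed

lemma sker_gauss_le: "sker 1 s \<tau> * gauss \<tau> x \<le> sker 1 s \<tau>"
  by (cases "\<tau> \<ge> 1") (auto intro: mult_left_le simp: gauss_le_1 sker_nonneg, simp add: sker_def)

lemma integrable_wt: "s > 0 \<Longrightarrow> integrable lborel (\<lambda>\<tau>. sker 1 s \<tau> * gauss \<tau> x)"
  by (rule Bochner_Integration.integrable_bound[OF sker_integral(1)[of 1 s]])
     (auto simp: sker_nonneg gauss_nonneg sker_gauss_le)

lemma nn_integral_wt: "s > 0 \<Longrightarrow> (\<integral>\<^sup>+\<tau>. ennreal (sker 1 s \<tau> * gauss \<tau> x) \<partial>lborel) = ennreal (wt s x)"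
  unfolding wt_def by (intro nn_integral_eq_integral integrable_wt) (auto simp: sker_nonneg gauss_nonneg)

lemma wt_measurable [measurable]: "wt s \<in> borel_measurable borel"
  unfolding wt_def[abs_def] by measurable

lemma wt_nonneg: "wt s x \<ge> 0"
  unfolding wt_def by (intro Bochner_Integration.integral_nonneg) (auto simp: sker_nonneg gauss_nonneg)

lemma wt_le:
  assumes "s > 0" shows "wt s x \<le> 1 / s"
proof -
  have "wt s x \<le> (LINT \<tau>|lborel. sker 1 s \<tau>)"
    unfolding wt_def by (rule Bochner_Integration.integral_mono)
      (auto intro: integrable_wt sker_integral sker_gauss_le assms)
  then show ?thesis using assms by (simp add: sker_integral)
qed

lemma nn_integral_wt_space:
  assumes "s > 0" shows "(\<integral>\<^sup>+x. ennreal (wt s (x::'a::euclidean_space)) \<partial>lborel) = ennreal (1 / s)"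
proof -
  have "(\<integral>\<^sup>+x. ennreal (wt s (x::'a)) \<partial>lborel) = (\<integral>\<^sup>+x. \<integral>\<^sup>+\<tau>. ennreal (sker 1 s \<tau> * gauss \<tau> x) \<partial>lborel \<partial>(lborel :: 'a measure))"
    by (simp add: nn_integral_wt[OF assms])
  also have "\<dots> = (\<integral>\<^sup>+\<tau>. \<integral>\<^sup>+x. ennreal (sker 1 s \<tau> * gauss \<tau> (x::'a)) \<partial>lborel \<partial>lborel)"
    by (rule lborel_pair.Fubini') measurable
  also have "\<dots> = (\<integral>\<^sup>+\<tau>. ennreal (sker 1 s \<tau>) \<partial>lborel)"
  proof (rule nn_integral_cong)
    fix \<tau>
    show "(\<integral>\<^sup>+x. ennreal (sker 1 s \<tau> * gauss \<tau> (x::'a)) \<partial>lborel) = ennreal (sker 1 s \<tau>)"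
    proof (cases "\<tau> \<ge> 1")
      case True
      then have "(\<integral>\<^sup>+x. ennreal (gauss \<tau> (x::'a)) \<partial>lborel) = 1"
        using nn_integral_eq_integral[OF integrable_gauss[of \<tau>, where 'a='a]] integral_gauss[of \<tau>, where 'a='a]
        by (simp add: gauss_nonneg)
      then show ?thesis by (simp add: ennreal_mult sker_nonneg gauss_nonneg nn_integral_cmult)
    qed (simp add: sker_def)
  qed
  finally show ?thesis using nn_integral_sker[of 1 s] assms by simp
qed

lemma integrable_wt_space: "s > 0 \<Longrightarrow> integrable lborel (wt s)"
  by (rule integrableI_nonneg) (auto simp: wt_nonneg nn_integral_wt_space)

text \<open>With r = 1 + |x|, only the window from \<open>r\<^sup>2\<close> to
  \<open>2 * r\<^sup>2\<close> is kept. It lies above 1 because r is at least 1, has length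
  \<open>r\<^sup>2\<close>, and the integrand there is at least of order r to the power -2 - 2s - N,
  since the Gaussian exponent is at most 1/4.\<close>

lemma wt_ge:
  assumes "0 < s"
  obtains c where "c > 0" "\<And>x::'a::euclidean_space. c * (1 + norm x) powr (- (real DIM('a) + 2 * s)) \<le> wt s x"
proof
  let ?N = "real DIM('a)"
  let ?c = "2 powr (- 1 - s) * ((8 * pi) powr (- (?N / 2)) * exp (- (1/4)))"
  show "?c > 0" by simp
  fix x :: 'a
  let ?r = "1 + norm x"
  have r: "?r \<ge> 1" "?r > 0" by (auto simp: add_pos_nonneg)
  have r1: "?r\<^sup>2 \<ge> 1" using r by simp
  let ?I = "{?r\<^sup>2..2*?r\<^sup>2}"
  let ?d = "(2 * ?r\<^sup>2) powr (- 1 - s) * ((8 * pi * ?r\<^sup>2) powr (- (?N / 2)) * exp (- (1/4)))"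
  have "(LINT \<tau>|lborel. indicator ?I \<tau> * ?d) \<le> wt s x"
    unfolding wt_def
  proof (rule Bochner_Integration.integral_mono[OF _ integrable_wt[OF assms]])
    show "integrable lborel (\<lambda>\<tau>. indicator ?I \<tau> * ?d)" by simp
    fix \<tau>
    show "indicator ?I \<tau> * ?d \<le> sker 1 s \<tau> * gauss \<tau> x"
    proof (cases "\<tau> \<in> ?I")
      case True
      then have t: "\<tau> \<ge> ?r\<^sup>2" "\<tau> \<le> 2 * ?r\<^sup>2" by auto
      then have t1: "\<tau> \<ge> 1" using order_trans[OF r1] by blast
      have a: "(2 * ?r\<^sup>2) powr (- 1 - s) \<le> sker 1 s \<tau>"
        using t t1 r assms by (auto simp: sker_def intro!: powr_mono2')
      have "(8 * pi * ?r\<^sup>2) powr (- (?N / 2)) \<le> (4 * pi * \<tau>) powr (- (?N / 2))"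
        using t t1 r by (intro powr_mono2') auto
      moreover have "(norm x)\<^sup>2 \<le> ?r\<^sup>2" by (intro power_mono) auto
      then have "(norm x)\<^sup>2 \<le> \<tau>" using t by linarith
      then have "(norm x)\<^sup>2 / (4 * \<tau>) \<le> 1/4" using t1 by (simp add: field_simps)
      then have "exp (- (1/4)) \<le> exp (- ((norm x)\<^sup>2 / (4 * \<tau>)))" by simp
      ultimately have b: "(8 * pi * ?r\<^sup>2) powr (- (?N / 2)) * exp (- (1/4)) \<le> gauss \<tau> x"
        unfolding gauss_def by (intro mult_mono) auto
      show ?thesis using True mult_mono[OF a b] by (simp add: sker_nonneg)
    qed (simp add: sker_nonneg gauss_nonneg)
  qed
  moreover have "(LINT \<tau>|lborel. indicator ?I \<tau> * ?d) = ?r\<^sup>2 * ?d"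
    using r by simp
  moreover have "?r\<^sup>2 * ?d = ?c * ?r powr (- (?N + 2 * s))"
  proof -
    have p: "(?r\<^sup>2) powr a = ?r powr (2 * a)" for a using r by (simp add: powr_powr powr_realpow[symmetric] flip: powr_numeral)
    have "?r\<^sup>2 * ?d = ?c * (?r powr 2 * ?r powr (2 * (- 1 - s)) * ?r powr (2 * (- (?N / 2))))"
      using r by (simp add: powr_mult p)
    also have "?r powr 2 * ?r powr (2 * (- 1 - s)) * ?r powr (2 * (- (?N / 2))) = ?r powr (- (?N + 2 * s))"
      by (simp only: powr_add[symmetric]) (simp add: algebra_simps)
    finally show ?thesis .
  qed
  ultimately show "?c * ?r powr (- (?N + 2 * s)) \<le> wt s x" by simp
qed

lemma powr_divide_neg:
  fixes x c p :: real assumes "c > 0"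
  shows "(x / c) powr (- p) = c powr p * x powr (- p)"
  using assms by (simp add: powr_divide powr_minus field_simps)

lemma exp_neg_le_powr:
  fixes q k :: real assumes "q > 0" "k > 0"
  shows "exp (- q) \<le> (k / q) powr k"
proof -
  have "q / k \<le> exp (q / k)" using exp_ge_add_one_self[of "q/k"] by linarith
  then have "(q / k) powr k \<le> exp (q / k) powr k" using assms by (intro powr_mono2) auto
  also have "\<dots> = exp q" using assms by (simp add: powr_def)
  finally have "inverse (exp q) \<le> inverse ((q / k) powr k)" using assms by (intro le_imp_inverse_le) auto
  also have "inverse ((q / k) powr k) = (k / q) powr k" using assms by (simp add: powr_divide)
  finally show ?thesis by (simp add: exp_minus)
qed

text \<open>For |x| at least 1 the integral is split at \<tau> = |x|^2. Below, the exponential beats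
  the powers of \<tau>; above, the exponential is dropped and the tail integrated. For |x| below 1
  the bound \<open>1 / s\<close> suffices.\<close>

lemma wt_upper:
  assumes "0 < s"
  obtains C where "C > 0" "\<And>x::'a::euclidean_space. wt s x \<le> C * (1 + norm x) powr (- (real DIM('a) + 2 * s))"
proof -
  let ?N = "real DIM('a)"
  \<comment> \<open>The total negative power of \<tau> in the integrand: applying
    \<open>exp_neg_le_powr\<close> with this exponent cancels it exactly and leaves a constant on
    \<open>{0..?r\<^sup>2}\<close>.\<close>
  define k where "k = ?N / 2 + 1 + s"
  have k: "k > 0" using assms by (simp add: k_def add_nonneg_pos)
  define A where "A = (4 * k) powr k + 1 / (?N / 2 + s)"
  have A: "A > 0" using assms k by (simp add: A_def add_pos_pos)
  have Ns: "?N / 2 + s > 0" using assms by (simp add: add_nonneg_pos)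
  have far: "wt s x \<le> A * norm x powr (- (?N + 2 * s))" if x: "norm x \<ge> 1" for x :: 'a
  proof -
    let ?r = "norm x"
    have r0: "?r > 0" using x by linarith
    let ?g = "\<lambda>\<tau>. indicator {0..?r\<^sup>2} \<tau> * ((4 * k) powr k * ?r powr (- 2 * k)) + sker (?r\<^sup>2) (?N / 2 + s) \<tau>"
    have p: "(?r\<^sup>2) powr a = ?r powr (2 * a)" for a using r0 by (simp add: powr_powr powr_realpow[symmetric] flip: powr_numeral)
    have ig: "integrable lborel ?g"
      using sker_integral(1)[of "?r\<^sup>2" "?N/2+s"] Ns r0 by (intro Bochner_Integration.integrable_add) auto
    have "wt s x \<le> (LINT \<tau>|lborel. ?g \<tau>)"
      unfolding wt_def
    proof (rule Bochner_Integration.integral_mono[OF integrable_wt[OF assms] ig])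
      fix \<tau> :: real
      show "sker 1 s \<tau> * gauss \<tau> x \<le> ?g \<tau>"
      proof (cases "\<tau> \<ge> 1")
        case True
        have "(4 * pi * \<tau>) powr (- (?N / 2)) \<le> \<tau> powr (- (?N / 2))"
          using True pi_ge_two by (intro powr_mono2') (auto intro: mult_le_cancel_right1[THEN iffD2])
        then have "sker 1 s \<tau> * gauss \<tau> x \<le> \<tau> powr (- 1 - s) * (\<tau> powr (- (?N / 2)) * exp (- (?r\<^sup>2 / (4 * \<tau>))))"
          unfolding gauss_def sker_def using True by (intro mult_mono) auto
        also have "\<dots> = \<tau> powr (- k) * exp (- (?r\<^sup>2 / (4 * \<tau>)))"
        proof -
          have "\<tau> powr (- 1 - s) * \<tau> powr (- (?N / 2)) = \<tau> powr (- k)"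
            by (simp only: powr_add[symmetric] k_def) (simp add: algebra_simps)
          then show ?thesis by (simp add: mult.assoc[symmetric])
        qed
        also have "\<dots> \<le> ?g \<tau>"
        proof (cases "\<tau> \<le> ?r\<^sup>2")
          case t: True
          have "exp (- (?r\<^sup>2 / (4 * \<tau>))) \<le> (k / (?r\<^sup>2 / (4 * \<tau>))) powr k"
            using True r0 k by (intro exp_neg_le_powr) auto
          also have "\<dots> = (4 * k) powr k * ?r powr (- 2 * k) * \<tau> powr k"
            using True r0 k by (simp add: powr_divide powr_mult p powr_minus field_simps)
          finally have "\<tau> powr (- k) * exp (- (?r\<^sup>2 / (4 * \<tau>))) \<le> \<tau> powr (- k) * ((4 * k) powr k * ?r powr (- 2 * k) * \<tau> powr k)"
            by (intro mult_left_mono) auto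
          also have "\<dots> = (4 * k) powr k * ?r powr (- 2 * k)"
            using True by (simp add: powr_minus field_simps)
          finally show ?thesis using t True sker_nonneg[of "?r\<^sup>2" "?N / 2 + s" \<tau>] by simp
        next
          case False
          then show ?thesis using True k
            by (simp add: sker_def k_def algebra_simps mult_left_le)
        qed
        finally show ?thesis .
      qed (simp add: sker_def)
    qed
    also have "\<dots> = ?r\<^sup>2 * ((4 * k) powr k * ?r powr (- 2 * k)) + (?r\<^sup>2) powr (- (?N / 2 + s)) / (?N / 2 + s)"
      using sker_integral[of "?r\<^sup>2" "?N/2+s"] Ns r0 by simp
    also have "\<dots> = A * ?r powr (- (?N + 2 * s))"
    proof -
      have "?r\<^sup>2 * ?r powr (- 2 * k) = ?r powr (2 + (- 2 * k))"
        by (subst powr_add) (use r0 in simp)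
      also have "2 + (- 2 * k) = - (?N + 2 * s)" by (simp add: k_def algebra_simps)
      finally have e: "?r\<^sup>2 * ?r powr (- 2 * k) = ?r powr (- (?N + 2 * s))" .
      have e2: "(?r\<^sup>2) powr (- (?N / 2 + s)) = ?r powr (- (?N + 2 * s))" unfolding p by (rule arg_cong2[where f="(powr)"]) (auto simp: algebra_simps)
      have "?r\<^sup>2 * ((4 * k) powr k * ?r powr (- 2 * k)) = (4 * k) powr k * ?r powr (- (?N + 2 * s))"
        unfolding e[symmetric] by simp
      then show ?thesis unfolding e2 A_def by (simp add: algebra_simps)
    qed
    finally show ?thesis .
  qed
  let ?p = "?N + 2 * s"
  have pp: "?p > 0" using assms by (simp add: add_nonneg_pos)
  show ?thesis
  proof
    show "(A + 1 / s) * 2 powr ?p > 0" using A assms by (simp add: add_pos_pos)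
    fix x :: 'a
    show "wt s x \<le> ((A + 1 / s) * 2 powr ?p) * (1 + norm x) powr (- ?p)"
    proof (cases "norm x \<ge> 1")
      case True
      have "norm x powr (- ?p) \<le> ((1 + norm x) / 2) powr (- ?p)"
        using True pp by (intro powr_mono2') auto
      also have "\<dots> = 2 powr ?p * (1 + norm x) powr (- ?p)"
        by (rule powr_divide_neg) simp
      finally have "A * norm x powr (- ?p) \<le> (A + 1 / s) * (2 powr ?p * (1 + norm x) powr (- ?p))"
        using A assms by (intro mult_mono) auto
      then show ?thesis using far[OF True] by (simp add: mult.assoc)
    next
      case False
      have "2 powr (- ?p) \<le> (1 + norm x) powr (- ?p)"
        using False pp by (intro powr_mono2') (auto simp: add_pos_nonneg)
      from mult_left_mono[OF this, of "2 powr ?p"]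
      have "1 \<le> 2 powr ?p * (1 + norm x) powr (- ?p)"
        by (simp only: powr_add[symmetric]) simp
      then have "(1/s) * 1 \<le> (A + 1 / s) * (2 powr ?p * (1 + norm x) powr (- ?p))"
        using A assms by (intro mult_mono) auto
      then show ?thesis using wt_le[OF assms, of x] by (simp add: mult.assoc)
    qed
  qed
qed

lemma wt_pos: "s > 0 \<Longrightarrow> wt s (x::'a::euclidean_space) > 0"
proof -
  assume "s > 0"
  from wt_ge[OF this, where 'a='a] obtain c where "c > 0" "c * (1 + norm x) powr (- (real DIM('a) + 2 * s)) \<le> wt s x" by metis
  moreover have "c * (1 + norm x) powr (- (real DIM('a) + 2 * s)) > 0"
    using \<open>c > 0\<close> norm_ge_zero[of x] by (simp add: add_nonneg_eq_0_iff)
  ultimately show ?thesis by linarith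
qed

text \<open>Both inequalities compare the base of the power with the eighth power of 1 + |x|. The
  constant is 2048 = 256 * 8: the factor 2^8 comes from 1 + |x| \<le> 2|x|, the factor 8 from (1 +
  q)^4 \<le> 8 (1 + q^4) with q = |x|^2 - 1.\<close>

lemma Phi_weight_bounds:
  fixes x :: "'a::euclidean_space"
  assumes "0 < s"
  shows "(1 + norm x) powr (- (real DIM('a) + 2 * s)) \<le> Phi_weight s x"
    "Phi_weight s x \<le> 2048 powr ((real DIM('a) + 2 * s) / 8) * (1 + norm x) powr (- (real DIM('a) + 2 * s))"
proof -
  let ?r = "norm x" let ?p = "real DIM('a) + 2 * s"
  have pp: "?p > 0" using assms by (simp add: add_nonneg_pos)
  define b where "b = (if ?r \<le> 1 then 1 else 1 + (?r\<^sup>2 - 1) ^ 4)"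
  have P: "Phi_weight s x = b powr (- (?p / 8))"
    unfolding Phi_weight_def b_def minus_divide_left by simp
  have e8: "(1 + ?r) powr (- ?p) = ((1 + ?r) ^ 8) powr (- (?p / 8))"
  proof -
    have "(1 + ?r) ^ 8 = (1 + ?r) powr 8" by (simp add: add_pos_nonneg)
    moreover have "8 * (- (q / 8)) = - q" for q :: real by simp
    ultimately show ?thesis by (simp only: powr_powr)
  qed
  have u: "b \<le> (1 + ?r) ^ 8"
  proof (cases "?r \<le> 1")
    case False
    define q where "q = ?r\<^sup>2 - 1"
    have q: "q \<ge> 0" using False by (simp add: q_def)
    have "1 + q ^ 4 \<le> (1 + q) ^ 4" using q by (simp add: power4_eq_xxxx algebra_simps)
    also have "\<dots> = ?r ^ 8" by (simp add: q_def flip: power_mult)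
    also have "\<dots> \<le> (1 + ?r) ^ 8" by (intro power_mono) auto
    finally show ?thesis using False by (simp add: b_def q_def)
  qed (simp add: b_def)
  have l: "(1 + ?r) ^ 8 \<le> 2048 * b"
  proof (cases "?r \<le> 1")
    case True
    then have "(1 + ?r) ^ 8 \<le> 2 ^ 8" by (intro power_mono) auto
    then show ?thesis using True by (simp add: b_def)
  next
    case False
    define q where "q = ?r\<^sup>2 - 1"
    have q: "q \<ge> 0" using False by (simp add: q_def)
    have "(1 + ?r) ^ 8 \<le> (2 * ?r) ^ 8" using False by (intro power_mono) auto
    also have "\<dots> = 256 * (1 + q) ^ 4" by (simp add: power_mult_distrib q_def flip: power_mult)
    also have "(1 + q) ^ 4 \<le> 8 * (1 + q ^ 4)"
    proof -
      have "(1 + q)\<^sup>2 \<le> 2 * (1 + q\<^sup>2)" using sum_squares_ge_zero[of "1 - q" 0] by (simp add: power2_eq_square algebra_simps)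
      then have "((1 + q)\<^sup>2)\<^sup>2 \<le> (2 * (1 + q\<^sup>2))\<^sup>2" by (intro power_mono) auto
      also have "\<dots> = 4 * (1 + q\<^sup>2)\<^sup>2" by (simp add: power2_eq_square algebra_simps)
      also have "(1 + q\<^sup>2)\<^sup>2 \<le> 2 * (1 + (q\<^sup>2)\<^sup>2)" using sum_squares_ge_zero[of "1 - q\<^sup>2" 0] by (simp add: power2_eq_square algebra_simps)
      finally show ?thesis by (simp flip: power_mult)
    qed
    finally show ?thesis using False by (simp add: b_def q_def)
  qed
  have b1: "b \<ge> 1" by (simp add: b_def)
  show "(1 + ?r) powr (- ?p) \<le> Phi_weight s x"
    unfolding e8 P using u b1 pp by (intro powr_mono2') auto
  have "b powr (- (?p / 8)) \<le> ((1 + ?r) ^ 8 / 2048) powr (- (?p / 8))"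
    using l pp norm_ge_zero[of x] by (intro powr_mono2') (auto simp del: norm_ge_zero)
  also have "\<dots> = 2048 powr (?p / 8) * ((1 + ?r) ^ 8) powr (- (?p / 8))"
    by (rule powr_divide_neg) simp
  finally show "Phi_weight s x \<le> 2048 powr (?p / 8) * (1 + ?r) powr (- ?p)"
    unfolding e8 P .
qed

text \<open>By the semigroup law a Gaussian of time \<open>t\<close> merely shifts the mixing
  parameter of the weight. The identity is stated with nonnegative integrals, so that Tonelli
  applies before integrability is known.\<close>

lemma nn_gauss_conv_wt:
  fixes x :: "'a::euclidean_space"
  assumes "t > 0" "s > 0"
  shows "(\<integral>\<^sup>+y. ennreal (gauss t (x - y) * wt s y) \<partial>lborel) = (\<integral>\<^sup>+\<tau>. ennreal (sker 1 s \<tau> * gauss (t + \<tau>) x) \<partial>lborel)"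
proof -
  have "(\<integral>\<^sup>+y. ennreal (gauss t (x - y) * wt s y) \<partial>lborel)
      = (\<integral>\<^sup>+y. \<integral>\<^sup>+\<tau>. ennreal (sker 1 s \<tau> * (gauss t (x - y) * gauss \<tau> y)) \<partial>lborel \<partial>lborel)"
  proof (rule nn_integral_cong)
    fix y
    have "ennreal (gauss t (x - y) * wt s y) = ennreal (gauss t (x - y)) * (\<integral>\<^sup>+\<tau>. ennreal (sker 1 s \<tau> * gauss \<tau> y) \<partial>lborel)"
      by (simp add: nn_integral_wt assms ennreal_mult wt_nonneg gauss_nonneg)
    also have "\<dots> = (\<integral>\<^sup>+\<tau>. ennreal (sker 1 s \<tau> * (gauss t (x - y) * gauss \<tau> y)) \<partial>lborel)"
      by (subst nn_integral_cmult[symmetric]) (auto simp: ennreal_mult[symmetric] sker_nonneg gauss_nonneg mult_ac)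
    finally show "ennreal (gauss t (x - y) * wt s y) = (\<integral>\<^sup>+\<tau>. ennreal (sker 1 s \<tau> * (gauss t (x - y) * gauss \<tau> y)) \<partial>lborel)" .
  qed
  also have "\<dots> = (\<integral>\<^sup>+\<tau>. \<integral>\<^sup>+y. ennreal (sker 1 s \<tau> * (gauss t (x - y) * gauss \<tau> y)) \<partial>lborel \<partial>lborel)"
    by (rule lborel_pair.Fubini') measurable
  also have "\<dots> = (\<integral>\<^sup>+\<tau>. ennreal (sker 1 s \<tau> * gauss (t + \<tau>) x) \<partial>lborel)"
  proof (rule nn_integral_cong)
    fix \<tau> :: real
    show "(\<integral>\<^sup>+y. ennreal (sker 1 s \<tau> * (gauss t (x - y) * gauss \<tau> y)) \<partial>lborel) = ennreal (sker 1 s \<tau> * gauss (t + \<tau>) x)"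
    proof (cases "\<tau> \<ge> 1")
      case True
      then have "(\<integral>\<^sup>+y. ennreal (gauss t (x - y) * gauss \<tau> y) \<partial>lborel) = ennreal (gauss (t + \<tau>) x)"
        using gauss_semigroup[of t \<tau> x] assms by (subst nn_integral_eq_integral) (auto simp: gauss_nonneg)
      then show ?thesis
        by (simp add: ennreal_mult sker_nonneg gauss_nonneg nn_integral_cmult)
    qed (simp add: sker_def)
  qed
  finally show ?thesis .
qed

lemma nn_integral_shift:
  fixes f :: "real \<Rightarrow> ennreal"
  assumes "f \<in> borel_measurable borel"
  shows "(\<integral>\<^sup>+\<tau>. f (t + \<tau>) \<partial>lborel) = (\<integral>\<^sup>+\<tau>. f \<tau> \<partial>lborel)"
  using nn_integral_lborel_affine[OF assms, of 1 t] by simp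

text \<open>Where the left side is nonzero, \<sigma> \<le> (1 + t)(\<sigma> - t). It matters that
  the factor is 1 + O(t) for small t: that linear excess is what stays integrable against the jump
  density near 0.\<close>

lemma sker_shift_le:
  assumes "t \<ge> 0" "0 < s" "s < 1"
  shows "sker 1 s (\<sigma> - t) \<le> (1 + t)\<^sup>2 * sker 1 s \<sigma>"
proof (cases "\<sigma> - t \<ge> 1")
  case True
  then have "\<sigma> \<le> (1 + t) * (\<sigma> - t)"
    using mult_left_mono[of 1 "\<sigma> - t" t] assms by (simp add: algebra_simps)
  then have "((1 + t) * (\<sigma> - t)) powr (- 1 - s) \<le> \<sigma> powr (- 1 - s)"
    using True assms by (intro powr_mono2') auto
  then have "(1 + t) powr (- 1 - s) * (\<sigma> - t) powr (- 1 - s) \<le> \<sigma> powr (- 1 - s)"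
    using True assms by (simp add: powr_mult)
  then have "(1 + t) powr (1 + s) * ((1 + t) powr (- 1 - s) * (\<sigma> - t) powr (- 1 - s)) \<le> (1 + t) powr (1 + s) * \<sigma> powr (- 1 - s)"
    by (intro mult_left_mono) auto
  moreover have "(1 + t) powr (1 + s) * (1 + t) powr (- 1 - s) = 1"
    using assms by (simp only: powr_add[symmetric]) simp
  ultimately have "(\<sigma> - t) powr (- 1 - s) \<le> (1 + t) powr (1 + s) * \<sigma> powr (- 1 - s)"
    by (simp add: mult.assoc[symmetric])
  also have "\<dots> \<le> (1 + t) powr 2 * \<sigma> powr (- 1 - s)"
    using assms by (intro mult_right_mono powr_mono) auto
  finally show ?thesis using True assms by (simp add: sker_def)
qed (simp add: sker_def)

lemma gauss_conv_wt:
  fixes x :: "'a::euclidean_space"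
  assumes "t > 0" "0 < s" "s < 1"
  shows "integrable lborel (\<lambda>y. gauss t (x - y) * wt s y)"
    "(LINT y|lborel. gauss t (x - y) * wt s y) \<le> (1 + t)\<^sup>2 * wt s x"
proof -
  have "(\<integral>\<^sup>+y. ennreal (gauss t (x - y) * wt s y) \<partial>lborel) = (\<integral>\<^sup>+\<tau>. (\<lambda>\<sigma>. ennreal (sker 1 s (\<sigma> - t) * gauss \<sigma> x)) (t + \<tau>) \<partial>lborel)"
    using nn_gauss_conv_wt[of t s x] assms by simp
  also have "\<dots> = (\<integral>\<^sup>+\<sigma>. ennreal (sker 1 s (\<sigma> - t) * gauss \<sigma> x) \<partial>lborel)"
    by (rule nn_integral_shift) measurable
  also have "\<dots> \<le> (\<integral>\<^sup>+\<sigma>. ennreal ((1 + t)\<^sup>2) * ennreal (sker 1 s \<sigma> * gauss \<sigma> x) \<partial>lborel)"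
    using assms sker_shift_le[of t s]
    by (intro nn_integral_mono) (auto simp: ennreal_mult[symmetric] sker_nonneg gauss_nonneg mult.assoc[symmetric] intro!: ennreal_leI mult_right_mono)
  also have "\<dots> = ennreal ((1 + t)\<^sup>2 * wt s x)"
    by (simp add: nn_integral_cmult nn_integral_wt assms ennreal_mult wt_nonneg)
  finally have *: "(\<integral>\<^sup>+y. ennreal (gauss t (x - y) * wt s y) \<partial>lborel) \<le> ennreal ((1 + t)\<^sup>2 * wt s x)" .
  then show 1: "integrable lborel (\<lambda>y. gauss t (x - y) * wt s y)"
    by (intro integrableI_nonneg) (auto simp: gauss_nonneg wt_nonneg intro: le_less_trans)
  show "(LINT y|lborel. gauss t (x - y) * wt s y) \<le> (1 + t)\<^sup>2 * wt s x"
    using * by (subst (asm) nn_integral_eq_integral[OF 1]) (auto simp: gauss_nonneg wt_nonneg)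
qed

text \<open>The larger of the two parameters is at least half of the sum, so its kernel is at most
  \<open>2 powr (1 + s)\<close> times the kernel at the sum. This is the one-big-jump property of
  power tails.\<close>

lemma sker_mult_le:
  assumes "0 < s"
  shows "sker 1 s \<tau> * sker 1 s \<sigma> \<le> 2 powr (1 + s) * (sker 1 s \<tau> * sker 1 s (\<tau> + \<sigma>) + sker 1 s \<sigma> * sker 1 s (\<tau> + \<sigma>))"
proof -
  have *: "sker 1 s \<tau> * sker 1 s \<sigma> \<le> 2 powr (1 + s) * (sker 1 s \<sigma> * sker 1 s (\<tau> + \<sigma>))" if "\<sigma> \<le> \<tau>" for \<sigma> \<tau>
  proof (cases "\<sigma> \<ge> 1")
    case True
    then have "\<tau> powr (- 1 - s) \<le> ((\<tau> + \<sigma>) / 2) powr (- 1 - s)"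
      using that assms by (intro powr_mono2') auto
    also have "\<dots> = 2 powr (1 + s) * (\<tau> + \<sigma>) powr (- 1 - s)"
      using powr_divide_neg[of 2 "\<tau> + \<sigma>" "1 + s"] by simp
    finally have "\<sigma> powr (- 1 - s) * \<tau> powr (- 1 - s) \<le> \<sigma> powr (- 1 - s) * (2 powr (1 + s) * (\<tau> + \<sigma>) powr (- 1 - s))"
      by (intro mult_left_mono) auto
    then show ?thesis using True that by (simp add: sker_def mult_ac)
  qed (simp add: sker_def)
  show ?thesis
  proof (cases "\<sigma> \<le> \<tau>")
    case True
    then show ?thesis using *[OF True] by (simp add: sker_nonneg algebra_simps add_increasing2)
  next
    case False
    then show ?thesis using *[of \<tau> \<sigma>] by (simp add: sker_nonneg algebra_simps add_increasing)
  qed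
qed

text \<open>For large \<tau> the factor (1 + \<tau>)^2 of \<open>gauss_conv_wt\<close> is not
  integrable against \<open>sker 1 s\<close>. Instead both mixtures are merged into a double
  integral and \<open>sker_mult_le\<close> is used; in each of the two resulting terms one parameter
  shifts away, which leaves \<open>wt s x\<close> times the mass 1/s.\<close>

lemma sker_gauss_conv_wt:
  fixes x :: "'a::euclidean_space"
  assumes "0 < s"
  shows "(\<integral>\<^sup>+\<tau>. ennreal (sker 1 s \<tau>) * (\<integral>\<^sup>+y. ennreal (gauss \<tau> (x - y) * wt s y) \<partial>lborel) \<partial>lborel) \<le> ennreal (2 powr (2 + s) / s * wt s x)"
proof -
  let ?D = "2 powr (1 + s)"
  let ?A = "\<lambda>\<tau> \<sigma>. ennreal (sker 1 s \<tau> * (sker 1 s (\<tau> + \<sigma>) * gauss (\<tau> + \<sigma>) x))"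
  have inner: "(\<integral>\<^sup>+\<sigma>. ?A \<tau> \<sigma> \<partial>lborel) = ennreal (sker 1 s \<tau>) * ennreal (wt s x)" for \<tau>
  proof -
    have "(\<integral>\<^sup>+\<sigma>. ?A \<tau> \<sigma> \<partial>lborel) = ennreal (sker 1 s \<tau>) * (\<integral>\<^sup>+\<sigma>. (\<lambda>\<rho>. ennreal (sker 1 s \<rho> * gauss \<rho> x)) (\<tau> + \<sigma>) \<partial>lborel)"
      by (subst nn_integral_cmult[symmetric]) (auto simp: ennreal_mult[symmetric] sker_nonneg gauss_nonneg)
    also have "(\<integral>\<^sup>+\<sigma>. (\<lambda>\<rho>. ennreal (sker 1 s \<rho> * gauss \<rho> x)) (\<tau> + \<sigma>) \<partial>lborel) = (\<integral>\<^sup>+\<rho>. ennreal (sker 1 s \<rho> * gauss \<rho> x) \<partial>lborel)"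
      by (rule nn_integral_shift) measurable
    finally show ?thesis by (simp add: nn_integral_wt assms)
  qed
  have AA: "(\<integral>\<^sup>+\<tau>. \<integral>\<^sup>+\<sigma>. ?A \<tau> \<sigma> \<partial>lborel \<partial>lborel) = ennreal (1 / s * wt s x)"
    using nn_integral_sker[of 1 s] assms
    by (simp add: inner nn_integral_multc ennreal_mult[symmetric] wt_nonneg)
  have AA2: "(\<integral>\<^sup>+\<tau>. \<integral>\<^sup>+\<sigma>. ?A \<sigma> \<tau> \<partial>lborel \<partial>lborel) = ennreal (1 / s * wt s x)"
    unfolding AA[symmetric] by (rule lborel_pair.Fubini') measurable
  have "(\<integral>\<^sup>+\<tau>. ennreal (sker 1 s \<tau>) * (\<integral>\<^sup>+y. ennreal (gauss \<tau> (x - y) * wt s y) \<partial>lborel) \<partial>lborel)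
     = (\<integral>\<^sup>+\<tau>. \<integral>\<^sup>+\<sigma>. ennreal (sker 1 s \<tau> * (sker 1 s \<sigma> * gauss (\<tau> + \<sigma>) x)) \<partial>lborel \<partial>lborel)"
  proof (rule nn_integral_cong)
    fix \<tau> :: real
    show "ennreal (sker 1 s \<tau>) * (\<integral>\<^sup>+y. ennreal (gauss \<tau> (x - y) * wt s y) \<partial>lborel)
       = (\<integral>\<^sup>+\<sigma>. ennreal (sker 1 s \<tau> * (sker 1 s \<sigma> * gauss (\<tau> + \<sigma>) x)) \<partial>lborel)"
    proof (cases "\<tau> \<ge> 1")
      case True
      then show ?thesis
        by (simp add: nn_gauss_conv_wt assms) (subst nn_integral_cmult[symmetric], auto simp: ennreal_mult[symmetric] sker_nonneg gauss_nonneg)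
    qed (simp add: sker_def)
  qed
  also have "\<dots> \<le> (\<integral>\<^sup>+\<tau>. \<integral>\<^sup>+\<sigma>. ennreal ?D * (?A \<tau> \<sigma> + ?A \<sigma> \<tau>) \<partial>lborel \<partial>lborel)"
  proof (intro nn_integral_mono)
    fix \<tau> \<sigma> :: real
    have "sker 1 s \<tau> * sker 1 s \<sigma> * gauss (\<tau> + \<sigma>) x \<le> ?D * (sker 1 s \<tau> * sker 1 s (\<tau> + \<sigma>) + sker 1 s \<sigma> * sker 1 s (\<tau> + \<sigma>)) * gauss (\<tau> + \<sigma>) x"
      by (intro mult_right_mono sker_mult_le assms gauss_nonneg)
    then have "ennreal (sker 1 s \<tau> * (sker 1 s \<sigma> * gauss (\<tau> + \<sigma>) x)) \<le> ennreal (?D * (sker 1 s \<tau> * (sker 1 s (\<tau> + \<sigma>) * gauss (\<tau> + \<sigma>) x) + sker 1 s \<sigma> * (sker 1 s (\<sigma> + \<tau>) * gauss (\<sigma> + \<tau>) x)))"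
      by (intro ennreal_leI) (simp add: algebra_simps)
    also have "\<dots> = ennreal ?D * (?A \<tau> \<sigma> + ?A \<sigma> \<tau>)"
      by (simp add: ennreal_mult ennreal_plus sker_nonneg gauss_nonneg)
    finally show "ennreal (sker 1 s \<tau> * (sker 1 s \<sigma> * gauss (\<tau> + \<sigma>) x)) \<le> ennreal ?D * (?A \<tau> \<sigma> + ?A \<sigma> \<tau>)" .
  qed
  also have "\<dots> = ennreal ?D * ((\<integral>\<^sup>+\<tau>. \<integral>\<^sup>+\<sigma>. ?A \<tau> \<sigma> \<partial>lborel \<partial>lborel) + (\<integral>\<^sup>+\<tau>. \<integral>\<^sup>+\<sigma>. ?A \<sigma> \<tau> \<partial>lborel \<partial>lborel))"
    by (simp add: nn_integral_cmult nn_integral_add)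
  also have "\<dots> = ennreal (?D * (1 / s * wt s x + 1 / s * wt s x))"
    unfolding AA AA2 using assms by (simp add: ennreal_mult[symmetric] ennreal_plus[symmetric] wt_nonneg del: ennreal_plus)
  also have "?D * (1 / s * wt s x + 1 / s * wt s x) = 2 powr (2 + s) / s * wt s x"
    by (simp add: powr_add field_simps)
  finally show ?thesis .
qed

lemma gauss_conv_wt_nn:
  fixes x :: "'a::euclidean_space"
  assumes "\<tau> > 0" "0 < s" "s < 1"
  shows "(\<integral>\<^sup>+y. ennreal (gauss \<tau> (x - y) * wt s y) \<partial>lborel) = ennreal (LINT y|lborel. gauss \<tau> (x - y) * wt s y)"
  by (rule nn_integral_eq_integral[OF gauss_conv_wt(1)[OF assms]]) (auto simp: gauss_nonneg wt_nonneg)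

lemma gauss_conv_wt_nonneg: "0 \<le> (LINT y|lborel. gauss \<tau> (x - y) * wt s y)"
  by (rule Bochner_Integration.integral_nonneg) (auto simp: gauss_nonneg wt_nonneg)

lemma sker1_gauss_conv_wt:
  fixes x :: "'a::euclidean_space"
  assumes "0 < s" "s < 1"
  shows "integrable lborel (\<lambda>\<tau>. sker 1 s \<tau> * (LINT y|lborel. gauss \<tau> (x - y) * wt s y))"
    "(LINT \<tau>|lborel. sker 1 s \<tau> * (LINT y|lborel. gauss \<tau> (x - y) * wt s y)) \<le> 2 powr (2 + s) / s * wt s x"
proof -
  let ?f = "\<lambda>\<tau>. sker 1 s \<tau> * (LINT y|lborel. gauss \<tau> (x - y) * wt s y)"
  have "(\<integral>\<^sup>+\<tau>. ennreal (?f \<tau>) \<partial>lborel) = (\<integral>\<^sup>+\<tau>. ennreal (sker 1 s \<tau>) * (\<integral>\<^sup>+y. ennreal (gauss \<tau> (x - y) * wt s y) \<partial>lborel) \<partial>lborel)"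
  proof (rule nn_integral_cong)
    fix \<tau> :: real
    show "ennreal (?f \<tau>) = ennreal (sker 1 s \<tau>) * (\<integral>\<^sup>+y. ennreal (gauss \<tau> (x - y) * wt s y) \<partial>lborel)"
      by (cases "\<tau> \<ge> 1") (simp_all add: gauss_conv_wt_nn assms ennreal_mult sker_nonneg gauss_conv_wt_nonneg, simp add: sker_def)
  qed
  then have *: "(\<integral>\<^sup>+\<tau>. ennreal (?f \<tau>) \<partial>lborel) \<le> ennreal (2 powr (2 + s) / s * wt s x)"
    using sker_gauss_conv_wt[OF assms(1), of x] by simp
  then show 1: "integrable lborel ?f"
    by (intro integrableI_nonneg) (auto simp: sker_nonneg gauss_conv_wt_nonneg intro: le_less_trans)
  show "(LINT \<tau>|lborel. ?f \<tau>) \<le> 2 powr (2 + s) / s * wt s x"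
    using * assms by (subst (asm) nn_integral_eq_integral[OF 1]) (auto simp: sker_nonneg gauss_conv_wt_nonneg wt_nonneg)
qed

lemma unit_powr_integral:
  fixes s a :: real
  assumes "0 < s" "s < 1" "a \<ge> 0"
  shows "integrable lborel (\<lambda>\<tau>. indicator {0..a} \<tau> * \<tau> powr (- s))"
    "(LINT \<tau>|lborel. indicator {0..a} \<tau> * \<tau> powr (- s)) = a powr (1 - s) / (1 - s)"
proof -
  have "((\<lambda>\<tau>. \<tau> powr (- s)) has_integral (a powr (- s + 1) / (- s + 1))) {0..a}"
    using assms has_integral_powr_from_0[of "- s" a] by simp
  then have *: "(\<integral>\<^sup>+\<tau>. ennreal (indicator {0..a} \<tau> * \<tau> powr (- s)) \<partial>lborel) = ennreal (a powr (- s + 1) / (- s + 1))"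
    by (intro nn_integral_has_integral_lebesgue) auto
  then show 1: "integrable lborel (\<lambda>\<tau>. indicator {0..a} \<tau> * \<tau> powr (- s))"
    by (intro integrableI_nonneg) auto
  show "(LINT \<tau>|lborel. indicator {0..a} \<tau> * \<tau> powr (- s)) = a powr (1 - s) / (1 - s)"
    using * assms by (subst (asm) nn_integral_eq_integral[OF 1])
      (auto simp: add.commute[of "-s" 1] Bochner_Integration.integral_nonneg)
qed

text \<open>The first term is three times the integral of \<open>\<tau> powr (- s)\<close> over the
  unit interval, from jumps below 1; the second comes from the jumps above 1.\<close>

definition wtK :: "real \<Rightarrow> real" where
  "wtK s = 3 / (1 - s) + 2 powr (2 + s) / s"

text \<open>The part that diverges as \<open>e\<close> tends to 0 is exactly the total mass of
  \<open>sker e s\<close>, with coefficient one; the rest is bounded independently of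
  \<open>e\<close>. The generator subtracts that mass again, so \<open>wt s\<close> is a
  supersolution up to the constant \<open>wtK s\<close>.\<close>

lemma sker_gauss_conv_wt_le:
  fixes x :: "'a::euclidean_space"
  assumes "0 < s" "s < 1" "0 < e" "e < 1"
  shows "integrable lborel (\<lambda>\<tau>. sker e s \<tau> * (LINT y|lborel. gauss \<tau> (x - y) * wt s y))"
    "(LINT \<tau>|lborel. sker e s \<tau> * (LINT y|lborel. gauss \<tau> (x - y) * wt s y)) \<le> (e powr (- s) / s + wtK s) * wt s x"
proof -
  let ?c = "\<lambda>\<tau>. LINT y|lborel. gauss \<tau> (x - y) * wt s y"
  let ?u = "\<lambda>\<tau>. indicator {0..1} \<tau> * \<tau> powr (- s)"
  \<comment> \<open>One majorant for all \<tau>: its first term handles \<tau> \<ge> 1, its second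
    the range between \<open>e\<close> and 1. Every term is nonnegative, so counting the mass of
    large jumps twice does no harm.\<close>
  let ?g = "\<lambda>\<tau>. sker 1 s \<tau> * ?c \<tau> + (sker e s \<tau> + 3 * ?u \<tau>) * wt s x"
  have ig: "integrable lborel ?g"
    using assms by (intro Bochner_Integration.integrable_add integrable_mult_left integrable_mult_right sker1_gauss_conv_wt sker_integral unit_powr_integral) auto
  have le: "sker e s \<tau> * ?c \<tau> \<le> ?g \<tau>" for \<tau>
  proof (cases "\<tau> \<ge> 1")
    case True
    then have "sker e s \<tau> = sker 1 s \<tau>" using assms by (simp add: sker_def)
    then show ?thesis using assms by (simp add: sker_nonneg wt_nonneg)
  next
    case F: False
    show ?thesis
    proof (cases "\<tau> \<ge> e")
      case True
      then have t: "\<tau> > 0" "\<tau> \<le> 1" using F assms by auto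
      \<comment> \<open>The linear excess turns \<open>\<tau> powr (- 1 - s)\<close> into the
        integrable \<open>\<tau> powr (- s)\<close>; the 1 reproduces the mass.\<close>
      have "(1 + \<tau>)\<^sup>2 \<le> 1 + 3 * \<tau>"
        using mult_left_mono[of \<tau> 1 \<tau>] t by (simp add: power2_eq_square algebra_simps)
      then have "?c \<tau> \<le> (1 + 3 * \<tau>) * wt s x"
        using gauss_conv_wt(2)[of \<tau> s x] assms t mult_right_mono[of "(1+\<tau>)\<^sup>2" "1 + 3 * \<tau>" "wt s x"] wt_nonneg[of s x] by auto
      then have "sker e s \<tau> * ?c \<tau> \<le> sker e s \<tau> * ((1 + 3 * \<tau>) * wt s x)"
        by (intro mult_left_mono sker_nonneg)
      also have "\<dots> = (sker e s \<tau> + 3 * ?u \<tau>) * wt s x"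
      proof -
        have "\<tau> * \<tau> powr (- 1 - s) = \<tau> powr (- s)"
          using t powr_add[of \<tau> 1 "- 1 - s"] by simp
        then show ?thesis using t True by (simp add: sker_def algebra_simps)
      qed
      also have "\<dots> \<le> ?g \<tau>" by (simp add: sker_nonneg gauss_conv_wt_nonneg)
      finally show ?thesis .
    next
      case False
      then have "sker e s \<tau> * ?c \<tau> = 0" by (simp add: sker_def)
      moreover have "0 \<le> ?g \<tau>" by (simp add: sker_nonneg gauss_conv_wt_nonneg wt_nonneg)
      ultimately show ?thesis by linarith
    qed
  qed
  show 1: "integrable lborel (\<lambda>\<tau>. sker e s \<tau> * ?c \<tau>)"
    using le by (intro Bochner_Integration.integrable_bound[OF ig])
      (auto simp: sker_nonneg gauss_conv_wt_nonneg intro!: AE_I2 order_trans[OF _ abs_ge_self])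
  have "(LINT \<tau>|lborel. sker e s \<tau> * ?c \<tau>) \<le> (LINT \<tau>|lborel. ?g \<tau>)"
    by (rule Bochner_Integration.integral_mono[OF 1 ig le])
  also have "\<dots> = (LINT \<tau>|lborel. sker 1 s \<tau> * ?c \<tau>) + (e powr (- s) / s + 3 * (1 / (1 - s))) * wt s x"
    using assms sker1_gauss_conv_wt(1)[of s x] sker_integral[of e s] unit_powr_integral[of s 1] by simp
  also have "\<dots> \<le> 2 powr (2 + s) / s * wt s x + (e powr (- s) / s + 3 * (1 / (1 - s))) * wt s x"
    using sker1_gauss_conv_wt(2)[of s x] assms by simp
  also have "\<dots> = (e powr (- s) / s + wtK s) * wt s x"
    by (simp add: wtK_def algebra_simps)
  finally show "(LINT \<tau>|lborel. sker e s \<tau> * ?c \<tau>) \<le> (e powr (- s) / s + wtK s) * wt s x" .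
qed

section \<open>Fractional powers as superpositions of exponentials\<close>

lemma Gamma_integral_scaled:
  fixes s l :: real assumes "0 < s" "s < 1" "l > 0"
  shows "integrable lborel (\<lambda>\<tau>. indicator {0..} \<tau> * (\<tau> powr (- s) * exp (- l * \<tau>)))"
    "(LINT \<tau>|lborel. indicator {0..} \<tau> * (\<tau> powr (- s) * exp (- l * \<tau>))) = Gamma (1 - s) * l powr (s - 1)"
proof -
  let ?f = "\<lambda>\<tau>. indicator {0..} \<tau> * (\<tau> powr (- s) / exp \<tau>)"
  have "((\<lambda>\<tau>. \<tau> powr (- s) / exp \<tau>) has_integral Gamma (1 - s)) {0..}"
    using Gamma_integral_real[of "1 - s"] assms by simp
  then have *: "(\<integral>\<^sup>+\<tau>. ennreal (?f \<tau>) \<partial>lborel) = ennreal (Gamma (1 - s))"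
    by (intro nn_integral_has_integral_lebesgue) auto
  then have 1: "integrable lborel ?f" by (intro integrableI_nonneg) auto
  have 2: "(LINT \<tau>|lborel. ?f \<tau>) = Gamma (1 - s)"
    using * assms by (subst (asm) nn_integral_eq_integral[OF 1])
      (auto simp: Bochner_Integration.integral_nonneg Gamma_real_nonneg)
  have "has_bochner_integral lborel (\<lambda>\<tau>. ?f (0 + l * \<tau>)) (Gamma (1 - s) /\<^sub>R \<bar>l\<bar>)"
    using 1 2 assms by (subst lborel_has_bochner_integral_real_affine_iff[symmetric]) (auto simp: has_bochner_integral_iff)
  then have "has_bochner_integral lborel (\<lambda>\<tau>. l powr s * ?f (0 + l * \<tau>)) (l powr s * (Gamma (1 - s) /\<^sub>R \<bar>l\<bar>))"
    by (rule has_bochner_integral_mult_right)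
  moreover have "l powr s * ?f (0 + l * \<tau>) = indicator {0..} \<tau> * (\<tau> powr (- s) * exp (- l * \<tau>))" for \<tau>
    using assms by (auto simp: indicator_def powr_mult powr_minus exp_minus field_simps zero_le_mult_iff)
  moreover have "l powr s * (Gamma (1 - s) /\<^sub>R \<bar>l\<bar>) = Gamma (1 - s) * l powr (s - 1)"
    using assms by (simp add: powr_diff field_simps)
  ultimately have "has_bochner_integral lborel (\<lambda>\<tau>. indicator {0..} \<tau> * (\<tau> powr (- s) * exp (- l * \<tau>))) (Gamma (1 - s) * l powr (s - 1))"
    by (simp only:)
  then show "integrable lborel (\<lambda>\<tau>. indicator {0..} \<tau> * (\<tau> powr (- s) * exp (- l * \<tau>)))"
    "(LINT \<tau>|lborel. indicator {0..} \<tau> * (\<tau> powr (- s) * exp (- l * \<tau>))) = Gamma (1 - s) * l powr (s - 1)"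
    by (auto simp: has_bochner_integral_iff)
qed

lemma integrable_sker_exp:
  assumes "a > 0" "s > 0" "l \<ge> 0"
  shows "integrable lborel (\<lambda>\<tau>. sker a s \<tau> * exp (- l * \<tau>))"
proof (rule Bochner_Integration.integrable_bound[OF sker_integral(1)[OF assms(1,2)]])
  show "AE \<tau> in lborel. norm (sker a s \<tau> * exp (- l * \<tau>)) \<le> norm (sker a s \<tau>)"
    using assms by (auto simp: sker_def indicator_def intro!: AE_I2 mult_left_le)
qed measurable

text \<open>Multiply the Gamma integral for \<open>l powr (s - 1)\<close> by \<open>l\<close>, split
  it at \<open>a\<close> and integrate by parts on the tail. Every integral then converges
  absolutely: near 0 the factor \<open>l\<close> (a Laplacian) is kept, near infinity the decay of
  \<open>sker\<close> is used.\<close>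

lemma fractional_power_identity:
  fixes s l a :: real assumes "0 < s" "s < 1" "l \<ge> 0" "a > 0"
  shows "Gamma (1 - s) * l powr s = l * (LINT \<tau>|lborel. indicator {0..a} \<tau> * \<tau> powr (- s) * exp (- l * \<tau>))
     + a powr (- s) * exp (- l * a) - s * (LINT \<tau>|lborel. sker a s \<tau> * exp (- l * \<tau>))"
proof (cases "l = 0")
  case True
  then show ?thesis using sker_integral[of a s] assms by simp
next
  case False
  then have l: "l > 0" using assms by simp
  let ?g = "\<lambda>\<tau>. \<tau> powr (- s) * exp (- l * \<tau>)"
  have iA: "integrable lborel (\<lambda>\<tau>. indicator {a..} \<tau> * ?g \<tau>)" and i0: "integrable lborel (\<lambda>\<tau>. indicator {0..a} \<tau> * ?g \<tau>)"
    using assms by (auto intro!: Bochner_Integration.integrable_bound[OF Gamma_integral_scaled(1)[OF assms(1,2) l]] simp: indicator_def)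
  have "(LINT \<tau>|lborel. indicator {0..} \<tau> * ?g \<tau>) = (LINT \<tau>|lborel. indicator {0..a} \<tau> * ?g \<tau> + indicator {a..} \<tau> * ?g \<tau>)"
  proof (rule integral_cong_AE)
    show "AE \<tau> in lborel. indicator {0..} \<tau> * ?g \<tau> = indicator {0..a} \<tau> * ?g \<tau> + indicator {a..} \<tau> * ?g \<tau>"
      using AE_lborel_singleton[of a] by eventually_elim (use assms in \<open>auto simp: indicator_def\<close>)
  qed measurable
  then have split: "Gamma (1 - s) * l powr (s - 1) = (LINT \<tau>|lborel. indicator {0..a} \<tau> * ?g \<tau>) + (LINT \<tau>|lborel. indicator {a..} \<tau> * ?g \<tau>)"
    using iA i0 Gamma_integral_scaled(2)[OF assms(1,2) l] by simp
  \<comment> \<open>Integration by parts on the tail: this integrand is the derivative of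
    \<open>- ?g\<close>, and it is nonnegative, so the fundamental theorem on a half line applies at
    once.\<close>
  have "(\<integral>\<^sup>+\<tau>. ennreal (s * (sker a s \<tau> * exp (- l * \<tau>)) + l * (indicator {a..} \<tau> * ?g \<tau>)) \<partial>lborel)
    = (\<integral>\<^sup>+\<tau>. ennreal (s * (\<tau> powr (- 1 - s) * exp (- l * \<tau>)) + l * ?g \<tau>) * indicator {a..} \<tau> \<partial>lborel)"
    by (intro nn_integral_cong) (auto simp: sker_def indicator_def)
  also have "\<dots> = ennreal (0 - (- ?g a))"
  proof (rule nn_integral_FTC_atLeast)
    fix x assume x: "a \<le> x"
    have "x powr (- 1 - s) = x powr (- s) / x" using x assms by (simp add: powr_diff powr_minus field_simps)
    then show "((\<lambda>x. - ?g x) has_real_derivative s * (x powr (- 1 - s) * exp (- l * x)) + l * ?g x) (at x)"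
      using x assms by (auto intro!: derivative_eq_intros simp: field_simps powr_diff)
    show "0 \<le> s * (x powr (- 1 - s) * exp (- l * x)) + l * ?g x" using assms by simp
  next
    have "((\<lambda>x. x powr (- s)) \<longlongrightarrow> 0) at_top"
      using assms by (intro tendsto_neg_powr filterlim_ident) auto
    moreover have "((\<lambda>x. exp (- l * x)) \<longlongrightarrow> 0) at_top" using l
      by (intro filterlim_compose[OF exp_at_bot] filterlim_tendsto_neg_mult_at_bot[OF tendsto_const] filterlim_ident) simp
    ultimately have "((\<lambda>x. - ?g x) \<longlongrightarrow> - (0 * 0)) at_top" by (intro tendsto_intros)
    then show "((\<lambda>x. - ?g x) \<longlongrightarrow> 0) at_top" by simp
  qed measurable
  finally have nn: "(\<integral>\<^sup>+\<tau>. ennreal (s * (sker a s \<tau> * exp (- l * \<tau>)) + l * (indicator {a..} \<tau> * ?g \<tau>)) \<partial>lborel) = ennreal (?g a)" by simp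
  have iS: "integrable lborel (\<lambda>\<tau>. sker a s \<tau> * exp (- l * \<tau>))" by (rule integrable_sker_exp) (use assms in auto)
  have iT: "integrable lborel (\<lambda>\<tau>. s * (sker a s \<tau> * exp (- l * \<tau>)) + l * (indicator {a..} \<tau> * ?g \<tau>))"
    by (intro Bochner_Integration.integrable_add integrable_mult_right iA iS)
  have nneg: "0 \<le> s * (sker a s \<tau> * exp (- l * \<tau>)) + l * (indicator {a..} \<tau> * ?g \<tau>)" for \<tau>
    using assms by (simp add: sker_nonneg)
  have "(LINT \<tau>|lborel. s * (sker a s \<tau> * exp (- l * \<tau>)) + l * (indicator {a..} \<tau> * ?g \<tau>)) = ?g a"
    using nn nneg by (subst (asm) nn_integral_eq_integral[OF iT]) (auto simp: Bochner_Integration.integral_nonneg)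
  then have "s * (LINT \<tau>|lborel. sker a s \<tau> * exp (- l * \<tau>)) + l * (LINT \<tau>|lborel. indicator {a..} \<tau> * ?g \<tau>) = ?g a"
    using iA iS by simp
  moreover have "Gamma (1 - s) * l powr s = l * (Gamma (1 - s) * l powr (s - 1))"
    using l by (simp add: powr_diff)
  ultimately show ?thesis unfolding split by (simp add: algebra_simps)
qed

lemma norm_powr_2s: "norm \<xi> powr (2 * s) = ((norm \<xi>)\<^sup>2) powr s"
  by (cases "\<xi> = 0") (simp_all add: powr_powr flip: powr_numeral)

lemma gauss_conv_abs_le:
  fixes g :: "'a::euclidean_space \<Rightarrow> real"
  assumes "\<tau> > 0" "0 < s" "s < 1" "\<And>y. \<bar>g y\<bar> \<le> A * wt s y" "g \<in> borel_measurable borel"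
  shows "\<bar>LINT y|lborel. gauss \<tau> (x - y) * g y\<bar> \<le> A * (LINT y|lborel. gauss \<tau> (x - y) * wt s y)"
proof -
  note [measurable] = assms(5)
  have i: "integrable lborel (\<lambda>y. A * (gauss \<tau> (x - y) * wt s y))"
    by (intro integrable_mult_right gauss_conv_wt assms)
  have le: "norm (gauss \<tau> (x - y) * g y) \<le> A * (gauss \<tau> (x - y) * wt s y)" for y
    using mult_left_mono[OF assms(4)[of y] gauss_nonneg[of \<tau> "x - y"]] by (simp add: abs_mult gauss_nonneg mult_ac)
  have "norm (LINT y|lborel. gauss \<tau> (x - y) * g y) \<le> (LINT y|lborel. A * (gauss \<tau> (x - y) * wt s y))"
  proof (rule Bochner_Integration.integral_norm_bound_integral[OF _ i])
    show "integrable lborel (\<lambda>y. gauss \<tau> (x - y) * g y)"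
      by (rule Bochner_Integration.integrable_bound[OF i]) (auto intro!: AE_I2 order_trans[OF le[unfolded real_norm_def]])
  qed (rule le)
  then show ?thesis by simp
qed

text \<open>A signed mixture of Gaussian averages acts as a multiplier. The kernel must vanish for
  \<tau> \<le> 0, where the exponential is not bounded by 1 and \<open>gauss\<close> is no heat
  kernel.\<close>

lemma gauss_superposition:
  fixes m :: "'a::euclidean_space \<Rightarrow> complex"
  assumes k: "integrable lborel k" and k0: "\<And>\<tau>. \<tau> \<le> 0 \<Longrightarrow> k \<tau> = 0" and m: "integrable lborel m"
  shows "(LINT \<tau>|lborel. k \<tau> * (LINT y|lborel. gauss \<tau> (x - y) * inv_ft m y))
       = inv_ft (\<lambda>\<xi>. complex_of_real (LINT \<tau>|lborel. k \<tau> * exp (- (norm \<xi>)\<^sup>2 * \<tau>)) * m \<xi>) x"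
    "integrable lborel (\<lambda>\<tau>. k \<tau> * (LINT y|lborel. gauss \<tau> (x - y) * inv_ft m y))"
    "integrable lborel (\<lambda>\<xi>. complex_of_real (LINT \<tau>|lborel. k \<tau> * exp (- (norm \<xi>)\<^sup>2 * \<tau>)) * m \<xi>)"
proof -
  have [measurable]: "m \<in> borel_measurable borel" "k \<in> borel_measurable borel"
    using k m by (simp_all add: integrable_iff_bounded)
  let ?M = "\<lambda>\<tau> \<xi>. complex_of_real (k \<tau> * exp (- (norm \<xi>)\<^sup>2 * \<tau>)) * m \<xi>"
  have M: "integrable (lborel \<Otimes>\<^sub>M lborel) (case_prod ?M)"
  proof (rule lborel_pair.integrable_product_bound[where f="\<lambda>\<tau>. \<bar>k \<tau>\<bar>" and g="\<lambda>\<xi>. norm (m \<xi>)"])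
    fix \<tau> :: real and \<xi> :: 'a
    have "\<bar>k \<tau> * exp (- (norm \<xi>)\<^sup>2 * \<tau>)\<bar> \<le> \<bar>k \<tau>\<bar>"
      by (cases "\<tau> \<le> 0") (auto simp: k0 abs_mult intro!: mult_left_le)
    then show "norm (case (\<tau>, \<xi>) of (\<tau>, \<xi>) \<Rightarrow> ?M \<tau> \<xi>) \<le> \<bar>k \<tau>\<bar> * norm (m \<xi>)"
      unfolding prod.case norm_mult norm_of_real by (rule mult_right_mono) simp
  qed (use k m in auto)
  have eq: "inv_ft (?M \<tau>) x = k \<tau> * (LINT y|lborel. gauss \<tau> (x - y) * inv_ft m y)" for \<tau>
  proof (cases "\<tau> \<le> 0")
    case True then show ?thesis by (simp add: k0 inv_ft_def inv_ftc_def)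
  next
    case False
    have "?M \<tau> = (\<lambda>\<xi>. complex_of_real (k \<tau>) * (complex_of_real (exp (- \<tau> * (norm \<xi>)\<^sup>2)) * m \<xi>))"
      by (simp add: fun_eq_iff mult_ac)
    then show ?thesis using False m by (simp only: inv_ft_cmult gauss_conv_inv_ft(1) not_le)
  qed
  have int: "(LINT \<tau>|lborel. ?M \<tau> \<xi>) = complex_of_real (LINT \<tau>|lborel. k \<tau> * exp (- (norm \<xi>)\<^sup>2 * \<tau>)) * m \<xi>" for \<xi>
    by (simp only: integral_mult_left_zero integral_complex_of_real)
  show "(LINT \<tau>|lborel. k \<tau> * (LINT y|lborel. gauss \<tau> (x - y) * inv_ft m y))
       = inv_ft (\<lambda>\<xi>. complex_of_real (LINT \<tau>|lborel. k \<tau> * exp (- (norm \<xi>)\<^sup>2 * \<tau>)) * m \<xi>) x"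
    using inv_ft_superposition(1)[OF M, of x] unfolding eq int .
  show "integrable lborel (\<lambda>\<tau>. k \<tau> * (LINT y|lborel. gauss \<tau> (x - y) * inv_ft m y))"
    using inv_ft_superposition(2)[OF M, of x] unfolding eq .
  show "integrable lborel (\<lambda>\<xi>. complex_of_real (LINT \<tau>|lborel. k \<tau> * exp (- (norm \<xi>)\<^sup>2 * \<tau>)) * m \<xi>)"
    using lborel_pair.integrable_snd[OF M] unfolding int .
qed

text \<open>The three summands belong to the three terms of \<open>fractional_power_identity\<close>
  at \<open>a = 1\<close>: averages of the Laplacian over times up to 1 (4 bounds (1 + \<tau>)^2),
  the Gaussian average at time 1, and the tail, whose factor s cancels the 1/s.\<close>

definition fracC :: "real \<Rightarrow> real" where
  "fracC s = (4 / (1 - s) + 4 + 2 powr (2 + s)) / Gamma (1 - s)"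

lemma fracC_pos: "0 < s \<Longrightarrow> s < 1 \<Longrightarrow> fracC s > 0"
  unfolding fracC_def by (intro divide_pos_pos add_pos_pos) (auto simp: Gamma_real_pos)

text \<open>With the split at 1 the fractional Laplacian is a sum of Gaussian averages: of the
  Laplacian of f over short times, and of f itself at time 1 and over long times. Each average
  preserves a bound by \<open>wt s\<close>, so the decay of order -(N + 2s) comes without any
  estimate of singular integrals.\<close>

lemma frac_symbol_bound:
  fixes m :: "'a::euclidean_space \<Rightarrow> complex"
  assumes s: "0 < s" "s < 1" and m: "integrable lborel m"
    and m2: "integrable lborel (\<lambda>\<xi>. complex_of_real ((norm \<xi>)\<^sup>2) * m \<xi>)"
    and f: "\<And>y. \<bar>inv_ft m y\<bar> \<le> A * wt s y"
    and u: "\<And>y. \<bar>inv_ft (\<lambda>\<xi>. complex_of_real ((norm \<xi>)\<^sup>2) * m \<xi>) y\<bar> \<le> A * wt s y"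
  shows "\<bar>inv_ft (\<lambda>\<xi>. complex_of_real (norm \<xi> powr (2 * s)) * m \<xi>) x\<bar> \<le> fracC s * A * wt s x"
proof -
  have [measurable]: "m \<in> borel_measurable borel" using m by (simp add: integrable_iff_bounded)
  let ?m2 = "\<lambda>\<xi>. complex_of_real ((norm \<xi>)\<^sup>2) * m \<xi>"
  let ?k = "\<lambda>\<tau>::real. indicator {0..1} \<tau> * \<tau> powr (- s)"
  let ?L1 = "\<lambda>\<xi>::'a. LINT \<tau>|lborel. ?k \<tau> * exp (- (norm \<xi>)\<^sup>2 * \<tau>)"
  let ?L3 = "\<lambda>\<xi>::'a. LINT \<tau>|lborel. sker 1 s \<tau> * exp (- (norm \<xi>)\<^sup>2 * \<tau>)"
  have A: "A \<ge> 0" using order_trans[OF abs_ge_zero f[of 0]] wt_pos[OF s(1), of "0::'a"] by (simp add: zero_le_mult_iff)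
  have k0: "?k \<tau> = 0" if "\<tau> \<le> 0" for \<tau> using that by (auto simp: indicator_def)
  have sk0: "sker 1 s \<tau> = 0" if "\<tau> \<le> 0" for \<tau> using that by (auto simp: sker_def indicator_def)
  have k: "integrable lborel ?k" "(LINT \<tau>|lborel. ?k \<tau>) = 1 / (1 - s)" using unit_powr_integral[OF s, of 1] by auto
  have sk: "integrable lborel (sker 1 s)" using sker_integral[of 1 s] s by auto
  have i2: "integrable lborel (\<lambda>\<xi>. complex_of_real (exp (- 1 * (norm \<xi>)\<^sup>2)) * m \<xi>)"
    by (rule Bochner_Integration.integrable_bound[OF m]) (auto simp: norm_mult intro!: AE_I2 mult_left_le_one_le)
  have id: "complex_of_real (Gamma (1 - s)) * (complex_of_real (norm \<xi> powr (2 * s)) * m \<xi>)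
     = complex_of_real (?L1 \<xi>) * ?m2 \<xi> + (complex_of_real (exp (- 1 * (norm \<xi>)\<^sup>2)) * m \<xi> + complex_of_real (- s) * (complex_of_real (?L3 \<xi>) * m \<xi>))" for \<xi>
  proof -
    have "Gamma (1 - s) * norm \<xi> powr (2 * s) = (norm \<xi>)\<^sup>2 * ?L1 \<xi> + exp (- 1 * (norm \<xi>)\<^sup>2) - s * ?L3 \<xi>"
      using fractional_power_identity[OF s, of "(norm \<xi>)\<^sup>2" 1] by (simp add: norm_powr_2s)
    then have "complex_of_real (Gamma (1 - s) * norm \<xi> powr (2 * s)) = complex_of_real ((norm \<xi>)\<^sup>2 * ?L1 \<xi> + exp (- 1 * (norm \<xi>)\<^sup>2) - s * ?L3 \<xi>)"
      by simp
    then show ?thesis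
      by (simp only: of_real_mult of_real_add of_real_diff of_real_minus mult.assoc[symmetric]) (simp add: algebra_simps)
  qed
  let ?I1 = "LINT \<tau>|lborel. ?k \<tau> * (LINT y|lborel. gauss \<tau> (x - y) * inv_ft ?m2 y)"
  let ?I2 = "LINT y|lborel. gauss 1 (x - y) * inv_ft m y"
  let ?I3 = "LINT \<tau>|lborel. sker 1 s \<tau> * (LINT y|lborel. gauss \<tau> (x - y) * inv_ft m y)"
  note S1 = gauss_superposition(1,2)[OF k(1) k0 m2, of x] gauss_superposition(3)[OF k(1) k0 m2]
  note S3 = gauss_superposition(1,2)[OF sk sk0 m, of x] gauss_superposition(3)[OF sk sk0 m]
  have i3: "integrable lborel (\<lambda>\<xi>. complex_of_real (- s) * (complex_of_real (?L3 \<xi>) * m \<xi>))"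
    using S3(3) by (rule integrable_mult_right)
  note i23 = Bochner_Integration.integrable_add[OF i2 i3]
  have main: "Gamma (1 - s) * inv_ft (\<lambda>\<xi>. complex_of_real (norm \<xi> powr (2 * s)) * m \<xi>) x = ?I1 + (?I2 + (- s) * ?I3)"
  proof -
    have "Gamma (1 - s) * inv_ft (\<lambda>\<xi>. complex_of_real (norm \<xi> powr (2 * s)) * m \<xi>) x
      = inv_ft (\<lambda>\<xi>. complex_of_real (?L1 \<xi>) * ?m2 \<xi> + (complex_of_real (exp (- 1 * (norm \<xi>)\<^sup>2)) * m \<xi> + complex_of_real (- s) * (complex_of_real (?L3 \<xi>) * m \<xi>))) x"
      unfolding id[symmetric] inv_ft_cmult ..
    also have "\<dots> = inv_ft (\<lambda>\<xi>. complex_of_real (?L1 \<xi>) * ?m2 \<xi>) x + (inv_ft (\<lambda>\<xi>. complex_of_real (exp (- 1 * (norm \<xi>)\<^sup>2)) * m \<xi>) x + (- s) * inv_ft (\<lambda>\<xi>. complex_of_real (?L3 \<xi>) * m \<xi>) x)"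
      using inv_ft_add[OF S1(3) i23, of x] inv_ft_add[OF i2 i3, of x] inv_ft_cmult[of "- s" "\<lambda>\<xi>. complex_of_real (?L3 \<xi>) * m \<xi>" x]
      by (simp only:)
    finally show ?thesis using S1(1) S3(1) gauss_conv_inv_ft(1)[OF zero_less_one m, of x] by simp
  qed
  have b1: "\<bar>?I1\<bar> \<le> 4 / (1 - s) * (A * wt s x)"
  proof -
    have "norm ?I1 \<le> (LINT \<tau>|lborel. ?k \<tau> * (4 * (A * wt s x)))"
    proof (rule Bochner_Integration.integral_norm_bound_integral[OF S1(2)])
      show "integrable lborel (\<lambda>\<tau>. ?k \<tau> * (4 * (A * wt s x)))" using k by (intro integrable_mult_left)
      fix \<tau> :: real
      show "norm (?k \<tau> * (LINT y|lborel. gauss \<tau> (x - y) * inv_ft ?m2 y)) \<le> ?k \<tau> * (4 * (A * wt s x))"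
      proof (cases "0 < \<tau> \<and> \<tau> \<le> 1")
        case True
        have "\<bar>LINT y|lborel. gauss \<tau> (x - y) * inv_ft ?m2 y\<bar> \<le> A * (LINT y|lborel. gauss \<tau> (x - y) * wt s y)"
          using True s u by (intro gauss_conv_abs_le) auto
        also have "\<dots> \<le> A * ((1 + \<tau>)\<^sup>2 * wt s x)" using True s A by (intro mult_left_mono gauss_conv_wt) auto
        also have "\<dots> \<le> A * (4 * wt s x)"
        proof (intro mult_left_mono mult_right_mono A wt_nonneg)
          have "(1 + \<tau>)\<^sup>2 \<le> 2\<^sup>2" using True by (intro power_mono) auto
          then show "(1 + \<tau>)\<^sup>2 \<le> 4" by simp
        qed
        finally have le: "\<bar>LINT y|lborel. gauss \<tau> (x - y) * inv_ft ?m2 y\<bar> \<le> A * (4 * wt s x)" .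
        have "0 \<le> ?k \<tau>" by simp
        from mult_left_mono[OF le this] show ?thesis by (simp add: abs_mult mult_ac)
      next
        case False
        then have "?k \<tau> = 0" by (cases "\<tau> = 0") auto
        then show ?thesis by (simp only: mult_zero_left norm_zero order_refl)
      qed
    qed
    then show ?thesis using k(2) by simp
  qed
  have b2: "\<bar>?I2\<bar> \<le> 4 * (A * wt s x)"
  proof -
    have "\<bar>?I2\<bar> \<le> A * (LINT y|lborel. gauss 1 (x - y) * wt s y)"
      using s f by (intro gauss_conv_abs_le) auto
    also have "\<dots> \<le> A * ((1 + 1)\<^sup>2 * wt s x)" using s A by (intro mult_left_mono gauss_conv_wt) auto
    finally show ?thesis by simp
  qed
  have b3: "\<bar>?I3\<bar> \<le> 2 powr (2 + s) / s * (A * wt s x)"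
  proof -
    have "norm ?I3 \<le> (LINT \<tau>|lborel. A * (sker 1 s \<tau> * (LINT y|lborel. gauss \<tau> (x - y) * wt s y)))"
    proof (rule Bochner_Integration.integral_norm_bound_integral[OF S3(2)])
      show "integrable lborel (\<lambda>\<tau>. A * (sker 1 s \<tau> * (LINT y|lborel. gauss \<tau> (x - y) * wt s y)))"
        by (intro integrable_mult_right sker1_gauss_conv_wt s)
      fix \<tau> :: real
      show "norm (sker 1 s \<tau> * (LINT y|lborel. gauss \<tau> (x - y) * inv_ft m y)) \<le> A * (sker 1 s \<tau> * (LINT y|lborel. gauss \<tau> (x - y) * wt s y))"
      proof (cases "\<tau> \<ge> 1")
        case True
        have "\<bar>LINT y|lborel. gauss \<tau> (x - y) * inv_ft m y\<bar> \<le> A * (LINT y|lborel. gauss \<tau> (x - y) * wt s y)"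
          using True s f by (intro gauss_conv_abs_le) auto
        from mult_left_mono[OF this sker_nonneg[of 1 s \<tau>]] show ?thesis by (simp add: abs_mult sker_nonneg mult_ac)
      qed (simp add: sker_def)
    qed
    also have "\<dots> \<le> A * (2 powr (2 + s) / s * wt s x)"
      using mult_left_mono[OF sker1_gauss_conv_wt(2)[OF s, of x] A] by simp
    finally show ?thesis by (simp add: mult_ac)
  qed
  have G: "Gamma (1 - s) > 0" using s by (simp add: Gamma_real_pos)
  have "\<bar>?I1 + (?I2 + (- s) * ?I3)\<bar> \<le> \<bar>?I1\<bar> + \<bar>?I2\<bar> + s * \<bar>?I3\<bar>"
    using s abs_mult[of s ?I3] by (simp add: abs_triangle_ineq)
  also have "\<dots> \<le> 4 / (1 - s) * (A * wt s x) + 4 * (A * wt s x) + s * (2 powr (2 + s) / s * (A * wt s x))"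
    using b1 b2 b3 s by (intro add_mono mult_left_mono) auto
  also have "\<dots> = (4 / (1 - s) + 4 + 2 powr (2 + s)) * (A * wt s x)" using s by (simp add: algebra_simps)
  finally have le: "\<bar>?I1 + (?I2 + (- s) * ?I3)\<bar> \<le> (4 / (1 - s) + 4 + 2 powr (2 + s)) * (A * wt s x)" .
  let ?X = "inv_ft (\<lambda>\<xi>. complex_of_real (norm \<xi> powr (2 * s)) * m \<xi>) x"
  have "\<bar>?X\<bar> = \<bar>Gamma (1 - s) * ?X\<bar> / Gamma (1 - s)" unfolding abs_mult using G by simp
  also have "\<dots> \<le> ((4 / (1 - s) + 4 + 2 powr (2 + s)) * (A * wt s x)) / Gamma (1 - s)"
    unfolding main using le G by (intro divide_right_mono) auto
  also have "\<dots> = fracC s * A * wt s x" by (simp only: fracC_def times_divide_eq_left times_divide_eq_right mult.assoc)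
  finally show ?thesis .
qed

section \<open>The fractional heat semigroup\<close>

text \<open>The integral of \<open>sker e s \<tau>\<close> against 1 minus the Gaussian symbol, i.e.
  the symbol of a compound Poisson generator: Brownian jumps of duration at least \<open>e\<close>,
  with total rate \<open>e powr (- s) / s\<close>.\<close>

definition jump_symbol :: "real \<Rightarrow> real \<Rightarrow> 'a::euclidean_space \<Rightarrow> real" where
  "jump_symbol e s \<xi> = e powr (- s) / s - (LINT \<tau>|lborel. sker e s \<tau> * exp (- (norm \<xi>)\<^sup>2 * \<tau>))"

lemma jump_symbol_bounds:
  assumes "0 < e" "0 < s"
  shows "0 \<le> jump_symbol e s \<xi>" "jump_symbol e s \<xi> \<le> e powr (- s) / s"
proof -
  have i: "integrable lborel (\<lambda>\<tau>. sker e s \<tau> * exp (- (norm \<xi>)\<^sup>2 * \<tau>))"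
    using assms by (intro integrable_sker_exp) auto
  have "(LINT \<tau>|lborel. sker e s \<tau> * exp (- (norm \<xi>)\<^sup>2 * \<tau>)) \<le> (LINT \<tau>|lborel. sker e s \<tau>)"
  proof (rule Bochner_Integration.integral_mono[OF i])
    show "sker e s \<tau> * exp (- (norm \<xi>)\<^sup>2 * \<tau>) \<le> sker e s \<tau>" for \<tau>
      using assms by (auto simp: sker_def indicator_def intro!: mult_left_le)
  qed (use sker_integral assms in auto)
  then show "0 \<le> jump_symbol e s \<xi>" using sker_integral[OF assms] by (simp add: jump_symbol_def)
  show "jump_symbol e s \<xi> \<le> e powr (- s) / s"
    by (simp add: jump_symbol_def Bochner_Integration.integral_nonneg sker_nonneg)
qed

lemma jump_symbol_measurable [measurable]: "jump_symbol e s \<in> borel_measurable borel"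
  unfolding jump_symbol_def[abs_def] by measurable

text \<open>Subtracting \<open>fractional_power_identity\<close> at \<open>a = e\<close> leaves a
  boundary term and a short-time integral; both are of order \<open>e powr (1 - s)\<close> times the
  square of |\<xi>|.\<close>

lemma jump_symbol_approx:
  assumes "0 < e" "0 < s" "s < 1"
  shows "\<bar>s / Gamma (1 - s) * jump_symbol e s \<xi> - norm \<xi> powr (2 * s)\<bar>
     \<le> e powr (1 - s) * ((norm \<xi>)\<^sup>2 * (1 / (1 - s) + 1) / Gamma (1 - s))"
proof -
  let ?l = "(norm \<xi>)\<^sup>2"
  let ?L = "LINT \<tau>|lborel. indicator {0..e} \<tau> * \<tau> powr (- s) * exp (- ?l * \<tau>)"
  have G: "Gamma (1 - s) > 0" using assms by (simp add: Gamma_real_pos)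
  have "s * jump_symbol e s \<xi> = e powr (- s) - s * (LINT \<tau>|lborel. sker e s \<tau> * exp (- ?l * \<tau>))"
    using assms by (simp add: jump_symbol_def algebra_simps)
  then have "s * jump_symbol e s \<xi> - Gamma (1 - s) * norm \<xi> powr (2 * s) = e powr (- s) * (1 - exp (- ?l * e)) - ?l * ?L"
    unfolding norm_powr_2s using fractional_power_identity[OF assms(2,3) _ assms(1), of ?l] by (simp add: algebra_simps)
  moreover have "0 \<le> e powr (- s) * (1 - exp (- ?l * e))" using assms by simp
  moreover have "e powr (- s) * (1 - exp (- ?l * e)) \<le> e powr (1 - s) * ?l"
  proof -
    have "e powr (- s) * (1 - exp (- ?l * e)) \<le> e powr (- s) * (?l * e)"
      using exp_ge_add_one_self[of "- ?l * e"] by (intro mult_left_mono) auto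
    also have "\<dots> = e powr (1 - s) * ?l" using assms powr_add[of e 1 "-s"] by simp
    finally show ?thesis .
  qed
  moreover have "0 \<le> ?L" by (intro Bochner_Integration.integral_nonneg) simp
  moreover have "?L \<le> e powr (1 - s) / (1 - s)"
  proof -
    have u: "integrable lborel (\<lambda>\<tau>. indicator {0..e} \<tau> * \<tau> powr (- s))" using unit_powr_integral[of s e] assms by simp
    have le: "indicator {0..e} \<tau> * \<tau> powr (- s) * exp (- ?l * \<tau>) \<le> indicator {0..e} \<tau> * \<tau> powr (- s)" for \<tau>
      by (auto simp: indicator_def intro!: mult_left_le)
    have "?L \<le> (LINT \<tau>|lborel. indicator {0..e} \<tau> * \<tau> powr (- s))"
      by (rule Bochner_Integration.integral_mono[OF _ u le])
        (rule Bochner_Integration.integrable_bound[OF u], measurable, rule AE_I2, use le in simp)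
    then show ?thesis using unit_powr_integral[of s e] assms by simp
  qed
  ultimately have "\<bar>s * jump_symbol e s \<xi> - Gamma (1 - s) * norm \<xi> powr (2 * s)\<bar> \<le> e powr (1 - s) * ?l + ?l * (e powr (1 - s) / (1 - s))"
    using mult_left_mono[of ?L "e powr (1 - s) / (1 - s)" ?l] mult_nonneg_nonneg[of ?l ?L] by (smt (verit) zero_le_power2)
  then have "\<bar>s * jump_symbol e s \<xi> - Gamma (1 - s) * norm \<xi> powr (2 * s)\<bar> / Gamma (1 - s) \<le> (e powr (1 - s) * ?l + ?l * (e powr (1 - s) / (1 - s))) / Gamma (1 - s)"
    using G by (intro divide_right_mono) auto
  moreover have "\<bar>s * jump_symbol e s \<xi> - Gamma (1 - s) * norm \<xi> powr (2 * s)\<bar> / Gamma (1 - s)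
     = \<bar>s / Gamma (1 - s) * jump_symbol e s \<xi> - norm \<xi> powr (2 * s)\<bar>"
    using G by (subst abs_of_pos[OF G, symmetric], subst abs_divide[symmetric]) (simp add: diff_divide_distrib)
  moreover have "(e powr (1 - s) * ?l + ?l * (e powr (1 - s) / (1 - s))) / Gamma (1 - s) = e powr (1 - s) * (?l * (1 / (1 - s) + 1) / Gamma (1 - s))"
    by (simp add: algebra_simps)
  ultimately show ?thesis by (simp only:)
qed

text \<open>One explicit Euler step. If the step \<open>d\<close> times the jump rate is at most 1,
  the operator is a combination with nonnegative coefficients of the identity and of Gaussian
  averages, hence positive. In the bound by \<open>wt s\<close> the rate cancels and only
  \<open>1 + d * wtK s\<close> remains.\<close>

lemma jump_step:
  fixes m :: "'a::euclidean_space \<Rightarrow> complex"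
  assumes s: "0 < s" "s < 1" and e: "0 < e" "e < 1" and d: "0 \<le> d" "d * (e powr (- s) / s) \<le> 1"
    and m: "integrable lborel m" and f: "\<And>y. 0 \<le> inv_ft m y"
  shows "integrable lborel (\<lambda>\<xi>. complex_of_real (1 - d * jump_symbol e s \<xi>) * m \<xi>)" (is ?A)
    and "0 \<le> inv_ft (\<lambda>\<xi>. complex_of_real (1 - d * jump_symbol e s \<xi>) * m \<xi>) x" (is ?B)
    and "(\<And>y. inv_ft m y \<le> B * wt s y) \<Longrightarrow> inv_ft (\<lambda>\<xi>. complex_of_real (1 - d * jump_symbol e s \<xi>) * m \<xi>) x \<le> (1 + d * wtK s) * B * wt s x"
proof -
  have [measurable]: "m \<in> borel_measurable borel" using m by (simp add: integrable_iff_bounded)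
  let ?E = "e powr (- s) / s"
  let ?L = "\<lambda>\<xi>::'a. LINT \<tau>|lborel. sker e s \<tau> * exp (- (norm \<xi>)\<^sup>2 * \<tau>)"
  have sk: "integrable lborel (sker e s)" using sker_integral[of e s] s e by auto
  have sk0: "sker e s \<tau> = 0" if "\<tau> \<le> 0" for \<tau> using that e by (auto simp: sker_def indicator_def)
  note S = gauss_superposition(1,2)[OF sk sk0 m, of x] gauss_superposition(3)[OF sk sk0 m]
  let ?c = "\<lambda>\<tau>. LINT y|lborel. gauss \<tau> (x - y) * inv_ft m y"
  have q: "complex_of_real (1 - d * jump_symbol e s \<xi>) * m \<xi> = complex_of_real (1 - d * ?E) * m \<xi> + complex_of_real d * (complex_of_real (?L \<xi>) * m \<xi>)" for \<xi>
  proof -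
    have "1 - d * jump_symbol e s \<xi> = (1 - d * ?E) + d * ?L \<xi>" by (simp add: jump_symbol_def algebra_simps)
    then show ?thesis by (simp only: of_real_add of_real_mult distrib_right mult.assoc)
  qed
  have i1: "integrable lborel (\<lambda>\<xi>. complex_of_real (1 - d * ?E) * m \<xi>)" using m by (rule integrable_mult_right)
  have i2: "integrable lborel (\<lambda>\<xi>. complex_of_real d * (complex_of_real (?L \<xi>) * m \<xi>))" using S(3) by (rule integrable_mult_right)
  show ?A unfolding q by (rule Bochner_Integration.integrable_add[OF i1 i2])
  have eq: "inv_ft (\<lambda>\<xi>. complex_of_real (1 - d * jump_symbol e s \<xi>) * m \<xi>) x = (1 - d * ?E) * inv_ft m x + d * (LINT \<tau>|lborel. sker e s \<tau> * ?c \<tau>)"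
    unfolding q inv_ft_add[OF i1 i2] inv_ft_cmult by (rule arg_cong[OF S(1)[symmetric]])
  have c0: "0 \<le> ?c \<tau>" for \<tau> by (intro Bochner_Integration.integral_nonneg) (simp add: gauss_nonneg f)
  show ?B unfolding eq using d f c0
    by (intro add_nonneg_nonneg mult_nonneg_nonneg Bochner_Integration.integral_nonneg) (auto simp: sker_nonneg gauss_nonneg)
  assume B: "\<And>y. inv_ft m y \<le> B * wt s y"
  have B0: "B \<ge> 0" using order_trans[OF f B, of 0] wt_pos[OF s(1), of "0::'a"] by (simp add: zero_le_mult_iff)
  have "(LINT \<tau>|lborel. sker e s \<tau> * ?c \<tau>) \<le> (LINT \<tau>|lborel. B * (sker e s \<tau> * (LINT y|lborel. gauss \<tau> (x - y) * wt s y)))"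
  proof (rule Bochner_Integration.integral_mono[OF S(2)])
    show "integrable lborel (\<lambda>\<tau>. B * (sker e s \<tau> * (LINT y|lborel. gauss \<tau> (x - y) * wt s y)))"
      by (intro integrable_mult_right sker_gauss_conv_wt_le s e)
    fix \<tau> :: real
    show "sker e s \<tau> * ?c \<tau> \<le> B * (sker e s \<tau> * (LINT y|lborel. gauss \<tau> (x - y) * wt s y))"
    proof (cases "\<tau> \<le> 0")
      case False
      have "\<bar>?c \<tau>\<bar> \<le> B * (LINT y|lborel. gauss \<tau> (x - y) * wt s y)"
        using False s B f by (intro gauss_conv_abs_le) auto
      from mult_left_mono[OF order_trans[OF abs_ge_self this] sker_nonneg[of e s \<tau>]]
      show ?thesis by (simp add: mult_ac)
    qed (simp add: sk0)
  qed
  also have "\<dots> \<le> B * ((?E + wtK s) * wt s x)"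
    using mult_left_mono[OF sker_gauss_conv_wt_le(2)[OF s e, of x] B0] by simp
  finally have "inv_ft (\<lambda>\<xi>. complex_of_real (1 - d * jump_symbol e s \<xi>) * m \<xi>) x \<le> (1 - d * ?E) * (B * wt s x) + d * (B * ((?E + wtK s) * wt s x))"
    unfolding eq using d B by (intro add_mono mult_left_mono) auto
  also have "\<dots> = (1 + d * wtK s) * B * wt s x" by (simp add: algebra_simps)
  finally show "inv_ft (\<lambda>\<xi>. complex_of_real (1 - d * jump_symbol e s \<xi>) * m \<xi>) x \<le> (1 + d * wtK s) * B * wt s x" .
qed

text \<open>The conclusions form one conjunction because each step of the induction uses
  integrability and positivity of the previous iterate along with its bound.\<close>

lemma jump_power:
  fixes m :: "'a::euclidean_space \<Rightarrow> complex"
  assumes s: "0 < s" "s < 1" and e: "0 < e" "e < 1" and d: "0 \<le> d" "d * (e powr (- s) / s) \<le> 1"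
    and m: "integrable lborel m" and f: "\<And>y. 0 \<le> inv_ft m y"
  shows "integrable lborel (\<lambda>\<xi>. complex_of_real ((1 - d * jump_symbol e s \<xi>) ^ n) * m \<xi>) \<and>
    (\<forall>x. 0 \<le> inv_ft (\<lambda>\<xi>. complex_of_real ((1 - d * jump_symbol e s \<xi>) ^ n) * m \<xi>) x) \<and>
    ((\<forall>y. inv_ft m y \<le> B * wt s y) \<longrightarrow> (\<forall>x. inv_ft (\<lambda>\<xi>. complex_of_real ((1 - d * jump_symbol e s \<xi>) ^ n) * m \<xi>) x \<le> (1 + d * wtK s) ^ n * B * wt s x))"
proof (induction n)
  case 0
  then show ?case using m f by simp
next
  case (Suc n)
  let ?m = "\<lambda>\<xi>. complex_of_real ((1 - d * jump_symbol e s \<xi>) ^ n) * m \<xi>"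
  have eq: "(\<lambda>\<xi>. complex_of_real ((1 - d * jump_symbol e s \<xi>) ^ Suc n) * m \<xi>) = (\<lambda>\<xi>. complex_of_real (1 - d * jump_symbol e s \<xi>) * ?m \<xi>)"
    by (simp add: fun_eq_iff mult.assoc)
  have m': "integrable lborel ?m" and f': "\<And>y. 0 \<le> inv_ft ?m y" using Suc by auto
  show ?case unfolding eq
    using jump_step(1,2)[OF s e d m' f'] jump_step(3)[OF s e d m' f', of "(1 + d * wtK s) ^ n * B"] Suc
    by (simp add: mult.assoc)
qed

text \<open>The factor \<open>s / Gamma (1 - s)\<close> normalises \<open>jump_symbol\<close> so
  that it tends to \<open>norm \<xi> powr (2 * s)\<close>.\<close>

definition heatK :: "real \<Rightarrow> real" where
  "heatK s = s / Gamma (1 - s) * wtK s"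

lemma wtK_pos: "0 < s \<Longrightarrow> s < 1 \<Longrightarrow> wtK s > 0"
  unfolding wtK_def by (intro add_pos_pos) auto

lemma heatK_pos: "0 < s \<Longrightarrow> s < 1 \<Longrightarrow> heatK s > 0"
  unfolding heatK_def by (intro mult_pos_pos divide_pos_pos wtK_pos) (auto simp: Gamma_real_pos)

text \<open>The jump operator with symbol \<open>jump_symbol\<close> is bounded, so its semigroup is a limit of powers
  of positive operators; letting the truncation parameter tend to zero yields the fractional heat semigroup.\<close>

lemma jump_semigroup:
  fixes m :: "'a::euclidean_space \<Rightarrow> complex"
  assumes s: "0 < s" "s < 1" and e: "0 < e" "e < 1" and t: "t \<ge> 0"
    and m: "integrable lborel m" and f: "\<And>y. 0 \<le> inv_ft m y"
  shows "0 \<le> inv_ft (\<lambda>\<xi>. complex_of_real (exp (- t * (s / Gamma (1 - s) * jump_symbol e s \<xi>))) * m \<xi>) x"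
    and "(\<And>y. inv_ft m y \<le> B * wt s y) \<Longrightarrow>
      inv_ft (\<lambda>\<xi>. complex_of_real (exp (- t * (s / Gamma (1 - s) * jump_symbol e s \<xi>))) * m \<xi>) x \<le> exp (t * heatK s) * B * wt s x"
proof -
  have [measurable]: "m \<in> borel_measurable borel" using m by (simp add: integrable_iff_bounded)
  let ?E = "e powr (- s) / s"
  define c where "c = s / Gamma (1 - s)"
  have c: "c > 0" unfolding c_def using s by (simp add: Gamma_real_pos)
  \<comment> \<open>The number of Euler steps starts at \<open>n0\<close>, so that every step size
    already satisfies the condition of \<open>jump_step\<close>.\<close>
  obtain n0 :: nat where n0: "t * c * ?E < real n0" using reals_Archimedean2 by blast
  define k where "k n = n + n0" for n
  have k0: "real (k n) > 0" for n
  proof -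
    have "0 \<le> t * c * ?E" using t c s by simp
    then show ?thesis using n0 unfolding k_def by linarith
  qed
  define d where "d n = t * c / real (k n)" for n
  have d: "0 \<le> d n" "d n * ?E \<le> 1" for n
  proof -
    show "0 \<le> d n" using t c by (simp add: d_def)
    have "t * c * ?E \<le> real (k n)" using n0 by (simp add: k_def)
    moreover have "d n * ?E = (t * c * ?E) / real (k n)" by (simp add: d_def)
    ultimately show "d n * ?E \<le> 1" using k0[of n] by (simp only: pos_divide_le_eq mult_1)
  qed
  have b: "0 \<le> 1 - d n * jump_symbol e s \<xi>" "1 - d n * jump_symbol e s \<xi> \<le> 1" for n and \<xi> :: 'a
  proof -
    have "d n * jump_symbol e s \<xi> \<le> d n * ?E" using d jump_symbol_bounds[of e s \<xi>] e s by (intro mult_left_mono) auto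
    then show "0 \<le> 1 - d n * jump_symbol e s \<xi>" using d(2)[of n] by linarith
    show "1 - d n * jump_symbol e s \<xi> \<le> 1" using d(1)[of n] jump_symbol_bounds(1)[of e s \<xi>] e s by simp
  qed
  let ?M = "\<lambda>n \<xi>. complex_of_real ((1 - d n * jump_symbol e s \<xi>) ^ k n) * m \<xi>"
  have lim: "(\<lambda>n. inv_ft (?M n) x) \<longlonglongrightarrow> inv_ft (\<lambda>\<xi>. complex_of_real (exp (- t * (c * jump_symbol e s \<xi>))) * m \<xi>) x"
  proof (rule inv_ft_dominated_convergence)
    show "integrable lborel (\<lambda>\<xi>. norm (m \<xi>))" using m by simp
    show "norm (?M n \<xi>) \<le> norm (m \<xi>)" for n \<xi>
      unfolding norm_mult norm_of_real using b[of n \<xi>] by (intro mult_left_le_one_le) (auto simp: power_le_one power_abs)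
    show "AE \<xi> in lborel. (\<lambda>n. ?M n \<xi>) \<longlonglongrightarrow> complex_of_real (exp (- t * (c * jump_symbol e s \<xi>))) * m \<xi>"
    proof (intro AE_I2 tendsto_intros)
      fix \<xi> :: 'a
      have "(\<lambda>n. (1 + (- t * (c * jump_symbol e s \<xi>)) / real n) ^ n) \<longlonglongrightarrow> exp (- t * (c * jump_symbol e s \<xi>))"
        by (rule tendsto_exp_limit_sequentially)
      from LIMSEQ_ignore_initial_segment[OF this, of n0]
      show "(\<lambda>n. (1 - d n * jump_symbol e s \<xi>) ^ k n) \<longlonglongrightarrow> exp (- t * (c * jump_symbol e s \<xi>))"
        by (simp add: d_def k_def mult_ac)
    qed
  qed auto
  show "0 \<le> inv_ft (\<lambda>\<xi>. complex_of_real (exp (- t * (s / Gamma (1 - s) * jump_symbol e s \<xi>))) * m \<xi>) x"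
    using lim jump_power[OF s e d m f, of _ _ undefined] unfolding c_def by (intro LIMSEQ_le_const[OF lim[unfolded c_def]]) auto
  assume B: "\<And>y. inv_ft m y \<le> B * wt s y"
  have B0: "B \<ge> 0" using order_trans[OF f B, of 0] wt_pos[OF s(1), of "0::'a"] by (simp add: zero_le_mult_iff)
  have "inv_ft (?M n) x \<le> exp (t * heatK s) * B * wt s x" for n
  proof -
    have "inv_ft (?M n) x \<le> (1 + d n * wtK s) ^ k n * B * wt s x"
      using jump_power[OF s e d m f, of n "k n" B] B by auto
    also have "\<dots> \<le> exp (t * heatK s) * B * wt s x"
    proof (intro mult_right_mono B0 wt_nonneg)
      have "(1 + d n * wtK s) ^ k n \<le> exp (d n * wtK s) ^ k n"
        using d(1)[of n] wtK_pos[OF s] by (intro power_mono) (auto simp: add_nonneg_nonneg)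
      also have "\<dots> = exp (t * heatK s)"
        using k0[of n] by (simp add: exp_of_nat_mult[symmetric] d_def heatK_def c_def)
      finally show "(1 + d n * wtK s) ^ k n \<le> exp (t * heatK s)" .
    qed
    finally show ?thesis .
  qed
  then show "inv_ft (\<lambda>\<xi>. complex_of_real (exp (- t * (s / Gamma (1 - s) * jump_symbol e s \<xi>))) * m \<xi>) x \<le> exp (t * heatK s) * B * wt s x"
    by (intro LIMSEQ_le_const2[OF lim[unfolded c_def]]) auto
qed

lemma heat_semigroup_bounds:
  fixes m :: "'a::euclidean_space \<Rightarrow> complex"
  assumes s: "0 < s" "s < 1" and t: "t \<ge> 0"
    and m: "integrable lborel m" and f: "\<And>y. 0 \<le> inv_ft m y"
  shows "0 \<le> inv_ft (\<lambda>\<xi>. complex_of_real (exp (- t * norm \<xi> powr (2 * s))) * m \<xi>) x"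
    and "(\<And>y. inv_ft m y \<le> B * wt s y) \<Longrightarrow>
      inv_ft (\<lambda>\<xi>. complex_of_real (exp (- t * norm \<xi> powr (2 * s))) * m \<xi>) x \<le> exp (t * heatK s) * B * wt s x"
proof -
  have [measurable]: "m \<in> borel_measurable borel" using m by (simp add: integrable_iff_bounded)
  \<comment> \<open>Two successors, because the estimates of the truncated operator require
    \<open>e < 1\<close>.\<close>
  define e where "e n = inverse (real (Suc (Suc n)))" for n
  have e: "0 < e n" "e n < 1" for n by (auto simp: e_def field_simps)
  have e0: "e \<longlonglongrightarrow> 0" unfolding e_def using LIMSEQ_Suc[OF LIMSEQ_inverse_real_of_nat] by simp
  let ?j = "\<lambda>n \<xi>. s / Gamma (1 - s) * jump_symbol (e n) s \<xi>"
  have G: "Gamma (1 - s) > 0" using s by (simp add: Gamma_real_pos)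
  let ?M = "\<lambda>n \<xi>. complex_of_real (exp (- t * ?j n \<xi>)) * m \<xi>"
  have lim: "(\<lambda>n. inv_ft (?M n) x) \<longlonglongrightarrow> inv_ft (\<lambda>\<xi>. complex_of_real (exp (- t * norm \<xi> powr (2 * s))) * m \<xi>) x"
  proof (rule inv_ft_dominated_convergence)
    show "integrable lborel (\<lambda>\<xi>. norm (m \<xi>))" using m by simp
    show "norm (?M n \<xi>) \<le> norm (m \<xi>)" for n \<xi>
      unfolding norm_mult norm_of_real using jump_symbol_bounds(1)[OF e(1) s(1), of n \<xi>] t s G
      by (intro mult_left_le_one_le) (auto intro!: mult_nonneg_nonneg divide_nonneg_nonneg)
    show "AE \<xi> in lborel. (\<lambda>n. ?M n \<xi>) \<longlonglongrightarrow> complex_of_real (exp (- t * norm \<xi> powr (2 * s))) * m \<xi>"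
    proof (intro AE_I2 tendsto_intros)
      fix \<xi> :: 'a
      let ?c = "(norm \<xi>)\<^sup>2 * (1 / (1 - s) + 1) / Gamma (1 - s)"
      have "(\<lambda>n. e n powr (1 - s)) \<longlonglongrightarrow> 0 powr (1 - s)"
        using s e by (intro tendsto_powr2 e0 tendsto_const) (auto intro!: always_eventually less_imp_le)
      then have "(\<lambda>n. e n powr (1 - s) * ?c) \<longlonglongrightarrow> 0"
        using tendsto_mult_left_zero by fastforce
      then have "(\<lambda>n. ?j n \<xi> - norm \<xi> powr (2 * s)) \<longlonglongrightarrow> 0"
        by (rule Lim_null_comparison[rotated]) (use jump_symbol_approx[OF e(1) s, of _ \<xi>] in auto)
      then show "(\<lambda>n. ?j n \<xi>) \<longlonglongrightarrow> norm \<xi> powr (2 * s)" by (rule LIM_zero_cancel)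
    qed
  qed auto
  show "0 \<le> inv_ft (\<lambda>\<xi>. complex_of_real (exp (- t * norm \<xi> powr (2 * s))) * m \<xi>) x"
    by (rule LIMSEQ_le_const[OF lim]) (use jump_semigroup(1)[OF s e t m f] in auto)
  assume B: "\<And>y. inv_ft m y \<le> B * wt s y"
  show "inv_ft (\<lambda>\<xi>. complex_of_real (exp (- t * norm \<xi> powr (2 * s))) * m \<xi>) x \<le> exp (t * heatK s) * B * wt s x"
    by (rule LIMSEQ_le_const2[OF lim]) (use jump_semigroup(2)[OF s e t m f B] in auto)
qed

text \<open>Read off from the finite mass of \<open>wt \<sigma>\<close> and its lower bound, in
  place of polar coordinates.\<close>

lemma integrable_one_plus_norm_powr:
  assumes "\<sigma> > 0"
  shows "integrable lborel (\<lambda>x::'a::euclidean_space. (1 + norm x) powr (- (real DIM('a) + 2 * \<sigma>)))"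
proof -
  obtain c where c: "c > 0" "\<And>x::'a. c * (1 + norm x) powr (- (real DIM('a) + 2 * \<sigma>)) \<le> wt \<sigma> x"
    using wt_ge[OF assms, where 'a='a] by blast
  have "integrable lborel (\<lambda>x::'a. c * (1 + norm x) powr (- (real DIM('a) + 2 * \<sigma>)))"
    by (rule Bochner_Integration.integrable_bound[OF integrable_wt_space[OF assms]])
       (use c in \<open>auto simp: wt_nonneg\<close>)
  then show ?thesis using c by simp
qed

lemma integrable_one_plus_norm_powr_1:
  "integrable lborel (\<lambda>x::'a::euclidean_space. (1 + norm x) powr (- (real DIM('a) + 1)))"
  using integrable_one_plus_norm_powr[of "1/2", where 'a='a] by simp

lemma integrable_heat_symbol:
  assumes s: "0 < s" and t: "0 < t"
  shows "integrable lborel (\<lambda>\<xi>::'a::euclidean_space. exp (- t * norm \<xi> powr (2 * s)))"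
proof -
  define p where "p = real DIM('a) + 1"
  \<comment> \<open>Turns \<open>norm \<xi> powr (2 * s)\<close> to the power -k into decay of order
    \<open>p\<close>, one more than the dimension.\<close>
  define k where "k = p / (2 * s)"
  have p: "p > 0" and k: "k > 0" "2 * s * k = p" using s by (auto simp: p_def k_def add_nonneg_pos)
  let ?C = "((k / t) powr k + 1) * 2 powr p"
  have le: "exp (- t * norm \<xi> powr (2 * s)) \<le> ?C * (1 + norm \<xi>) powr (- p)" for \<xi> :: 'a
  proof (cases "norm \<xi> \<ge> 1")
    case True
    then have n0: "norm \<xi> > 0" by linarith
    have "exp (- (t * norm \<xi> powr (2 * s))) \<le> (k / (t * norm \<xi> powr (2 * s))) powr k"
      using n0 t k by (intro exp_neg_le_powr) auto
    also have "\<dots> = (k / t) powr k * norm \<xi> powr (- p)"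
      using n0 t k by (simp add: powr_divide powr_mult powr_powr powr_minus field_simps)
    also have "\<dots> \<le> ((k / t) powr k + 1) * ((1 + norm \<xi>) / 2) powr (- p)"
      using True p n0 by (intro mult_mono powr_mono2') auto
    also have "\<dots> = ?C * (1 + norm \<xi>) powr (- p)"
      by (subst powr_divide_neg) auto
    finally show ?thesis by simp
  next
    case False
    have "exp (- t * norm \<xi> powr (2 * s)) \<le> 1 * 1" using t by simp
    also have "\<dots> \<le> ((k / t) powr k + 1) * ((1 + norm \<xi>) / 2) powr (- p)"
    proof (intro mult_mono)
      have "1 powr (- p) \<le> ((1 + norm \<xi>) / 2) powr (- p)"
        using False p norm_ge_zero[of \<xi>] by (intro powr_mono2') (auto simp del: norm_ge_zero)
      then show "1 \<le> ((1 + norm \<xi>) / 2) powr (- p)" by simp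
    qed auto
    also have "\<dots> = ?C * (1 + norm \<xi>) powr (- p)"
      by (subst powr_divide_neg) auto
    finally show ?thesis .
  qed
  have i: "integrable lborel (\<lambda>\<xi>::'a. ?C * (1 + norm \<xi>) powr (- p))"
    unfolding p_def by (intro integrable_mult_right integrable_one_plus_norm_powr_1)
  show ?thesis
    by (rule Bochner_Integration.integrable_bound[OF i]) (use le in \<open>auto intro!: AE_I2 order_trans[OF _ abs_ge_self]\<close>)
qed

section \<open>The fractional heat kernel: positivity, unit mass, scaling, action on the
  weight\<close>

lemma frac_heat_kernel_measurable [measurable (raw)]:
  assumes [measurable]: "f \<in> borel_measurable M" "g \<in> borel_measurable M"
  shows "(\<lambda>x. frac_heat_kernel s (f x) (g x :: 'a::euclidean_space)) \<in> borel_measurable M"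
proof -
  have "(\<lambda>x. LINT \<xi>|lborel. complex_of_real (exp (- f x * norm \<xi> powr (2 * s))) * cis (g x \<bullet> \<xi>)) \<in> borel_measurable M"
    by measurable
  then show ?thesis unfolding frac_heat_kernel_def by measurable
qed

text \<open>For a real even symbol the integral equals its own conjugate, so passing to the real
  part loses nothing.\<close>

lemma inv_ftc_even:
  fixes g :: "'a::euclidean_space \<Rightarrow> real"
  assumes g: "integrable lborel g" and even: "\<And>\<xi>. g (- \<xi>) = g \<xi>"
  shows "inv_ftc (\<lambda>\<xi>. complex_of_real (g \<xi>)) x = complex_of_real (inv_ft (\<lambda>\<xi>. complex_of_real (g \<xi>)) x)"
    "inv_ft (\<lambda>\<xi>. complex_of_real (g \<xi>)) (- x) = inv_ft (\<lambda>\<xi>. complex_of_real (g \<xi>)) x"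
proof -
  let ?J = "\<lambda>x. LINT \<xi>|lborel. complex_of_real (g \<xi>) * cis (x \<bullet> \<xi>)"
  have i: "integrable lborel (\<lambda>\<xi>. complex_of_real (g \<xi>) * cis (x \<bullet> \<xi>))" for x
    using g by (intro integrable_mult_cis integrable_of_real)
  have 1: "?J (- x) = ?J x" for x
    using lborel_reflect(2)[OF i[of x], of 0] even by simp
  have 2: "cnj (?J x) = ?J (- x)" for x
    using integral_bounded_linear[OF bounded_linear_cnj i[of x]] by (simp add: cis_cnj)
  have "Im (?J x) = 0" using 1[of x] 2[of x] by (metis complex_cnj_cancel_iff Reals_cnj_iff complex_is_Real_iff)
  then show "inv_ftc (\<lambda>\<xi>. complex_of_real (g \<xi>)) x = complex_of_real (inv_ft (\<lambda>\<xi>. complex_of_real (g \<xi>)) x)"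
    by (simp add: inv_ft_def inv_ftc_def complex_eq_iff)
  show "inv_ft (\<lambda>\<xi>. complex_of_real (g \<xi>)) (- x) = inv_ft (\<lambda>\<xi>. complex_of_real (g \<xi>)) x"
    by (simp only: inv_ft_def inv_ftc_def 1)
qed

text \<open>Sign replaces decay. The integral of the inverse transform against a wide Gaussian
  equals a narrow Gaussian mean of \<open>g\<close> at 0, which tends to \<open>g 0\<close>; by
  nonnegativity, monotone convergence yields integrability. The same computation at frequency \<xi>,
  now with dominated convergence, identifies the transform.\<close>

lemma inv_ft_integrable_nonneg:
  fixes g :: "'a::euclidean_space \<Rightarrow> real"
  assumes g: "integrable lborel g" and even: "\<And>\<xi>. g (- \<xi>) = g \<xi>" and b: "\<And>\<xi>. \<bar>g \<xi>\<bar> \<le> B"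
    and c: "\<And>\<xi>. isCont g \<xi>" and nn: "\<And>x. 0 \<le> inv_ft (\<lambda>\<xi>. complex_of_real (g \<xi>)) x"
  shows "integrable lborel (inv_ft (\<lambda>\<xi>. complex_of_real (g \<xi>)))"
    "fourier_tr (inv_ft (\<lambda>\<xi>. complex_of_real (g \<xi>))) \<xi> = complex_of_real (g \<xi>)"
proof -
  have [measurable]: "g \<in> borel_measurable borel" using g by (simp add: integrable_iff_bounded)
  let ?P = "inv_ft (\<lambda>\<xi>. complex_of_real (g \<xi>))"
  let ?c = "complex_of_real ((2 * pi) powr (- real DIM('a)))"
  define T where "T n = inverse (real (Suc n))" for n
  have T: "T n > 0" "T \<longlonglongrightarrow> 0" for n unfolding T_def using LIMSEQ_inverse_real_of_nat by auto
  let ?e = "\<lambda>n y::'a. exp (- T n * (norm y)\<^sup>2)"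
  have key: "(LINT y|lborel. complex_of_real (?e n y * ?P y) * cis (- (y \<bullet> \<xi>))) = complex_of_real (LINT \<eta>|lborel. gauss (T n) (\<xi> - \<eta>) * g \<eta>)" for n \<xi>
  proof -
    let ?F = "\<lambda>y \<eta>. ?c * complex_of_real (?e n y) * cis (- (y \<bullet> \<xi>)) * (complex_of_real (g \<eta>) * cis (y \<bullet> \<eta>))"
    have F: "integrable (lborel \<Otimes>\<^sub>M lborel) (case_prod ?F)"
      by (rule lborel_pair.integrable_product_bound[where f="\<lambda>y. norm ?c * ?e n y" and g="\<lambda>\<eta>. \<bar>g \<eta>\<bar>"])
        (use g integrable_gaussian[OF T(1)] in \<open>auto simp: norm_mult\<close>)
    have "(LINT y|lborel. complex_of_real (?e n y * ?P y) * cis (- (y \<bullet> \<xi>))) = (LINT y|lborel. LINT \<eta>|lborel. ?F y \<eta>)"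
    proof (rule Bochner_Integration.integral_cong)
      fix y :: 'a
      have "complex_of_real (?P y) = ?c * (LINT \<eta>|lborel. complex_of_real (g \<eta>) * cis (y \<bullet> \<eta>))"
        using inv_ftc_even(1)[OF g even, of y] by (simp add: inv_ftc_def)
      then show "complex_of_real (?e n y * ?P y) * cis (- (y \<bullet> \<xi>)) = (LINT \<eta>|lborel. ?F y \<eta>)"
        unfolding integral_mult_right_zero of_real_mult by (simp only: mult_ac)
    qed simp
    also have "\<dots> = (LINT \<eta>|lborel. LINT y|lborel. ?F y \<eta>)"
      using lborel_pair.Fubini_integral[OF F] by simp
    also have "\<dots> = (LINT \<eta>|lborel. complex_of_real (gauss (T n) (\<xi> - \<eta>) * g \<eta>))"
    proof (rule Bochner_Integration.integral_cong)
      fix \<eta> :: 'a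
      have "?F y \<eta> = (?c * complex_of_real (g \<eta>)) * (complex_of_real (?e n y) * cis (y \<bullet> (\<eta> - \<xi>)))" for y
      proof -
        have "cis (y \<bullet> (\<eta> - \<xi>)) = cis (- (y \<bullet> \<xi>)) * cis (y \<bullet> \<eta>)" by (simp add: cis_mult inner_diff_right)
        then show ?thesis by (simp add: mult_ac)
      qed
      then have "(LINT y|lborel. ?F y \<eta>) = (?c * complex_of_real (g \<eta>)) * complex_of_real ((pi / T n) powr (real DIM('a) / 2) * exp (- (norm (\<eta> - \<xi>))\<^sup>2 / (4 * T n)))"
        using has_bochner_integral_integral_eq[OF gaussian_ft[OF T(1), of n "\<eta> - \<xi>"]] by (simp only: integral_mult_right_zero)
      also have "\<dots> = complex_of_real (((2 * pi) powr (- real DIM('a)) * (pi / T n) powr (real DIM('a) / 2)) * exp (- (norm (\<eta> - \<xi>))\<^sup>2 / (4 * T n)) * g \<eta>)"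
        by (simp add: mult_ac)
      also have "\<dots> = complex_of_real (gauss (T n) (\<xi> - \<eta>) * g \<eta>)"
        unfolding gauss_const[OF T(1)] by (simp add: gauss_def norm_minus_commute)
      finally show "(LINT y|lborel. ?F y \<eta>) = complex_of_real (gauss (T n) (\<xi> - \<eta>) * g \<eta>)" .
    qed simp
    finally show ?thesis by (simp only: integral_complex_of_real)
  qed
  have lim: "(\<lambda>n. LINT \<eta>|lborel. gauss (T n) (\<xi> - \<eta>) * g \<eta>) \<longlonglongrightarrow> g \<xi>" for \<xi>
    by (rule gauss_approx_identity[OF _ b c T]) measurable
  have e_lim: "(\<lambda>n. ?e n y * ?P y) \<longlonglongrightarrow> ?P y" for y
  proof -
    have "(\<lambda>n. ?e n y * ?P y) \<longlonglongrightarrow> exp (- 0 * (norm y)\<^sup>2) * ?P y" by (intro tendsto_intros T)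
    then show ?thesis by simp
  qed
  have int0: "(LINT y|lborel. ?e n y * ?P y) = (LINT \<eta>|lborel. gauss (T n) (0 - \<eta>) * g \<eta>)" for n
  proof -
    have "complex_of_real (LINT y|lborel. ?e n y * ?P y) = complex_of_real (LINT \<eta>|lborel. gauss (T n) (0 - \<eta>) * g \<eta>)"
      using key[of n 0] by (simp only: integral_complex_of_real[symmetric]) simp
    then show ?thesis by (simp only: of_real_eq_iff)
  qed
  have bP: "\<bar>?P y\<bar> \<le> (2 * pi) powr (- real DIM('a)) * (LINT \<xi>|lborel. \<bar>g \<xi>\<bar>)" for y
    using norm_inv_ft_le[of "\<lambda>\<xi>. complex_of_real (g \<xi>)" y] by simp
  have ie: "integrable lborel (\<lambda>y. ?e n y * ?P y)" for n
    by (rule Bochner_Integration.integrable_bound[OF integrable_mult_left[OF integrable_gaussian[OF T(1)[of n], where 'a='a], of "(2 * pi) powr (- real DIM('a)) * (LINT \<xi>|lborel. \<bar>g \<xi>\<bar>)"]])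
       (auto simp: abs_mult intro!: AE_I2 mult_left_mono order_trans[OF bP abs_ge_self[THEN order_trans[OF _ order_refl]]] bP[THEN order_trans] )
  show i: "integrable lborel ?P"
  proof (rule integral_monotone_convergence_nonneg(1)[OF ie, where x="g 0"])
    show "AE y in lborel. mono (\<lambda>n. ?e n y * ?P y)"
    proof (intro AE_I2 monoI mult_right_mono nn)
      fix y :: 'a and m n :: nat assume "m \<le> n"
      then have "T n \<le> T m" by (simp add: T_def field_simps)
      then show "?e m y \<le> ?e n y" by (simp add: mult_right_mono)
    qed
    show "(\<lambda>n. LINT y|lborel. ?e n y * ?P y) \<longlonglongrightarrow> g 0" unfolding int0 by (rule lim)
  qed (use nn e_lim in auto)
  have "(\<lambda>n. LINT y|lborel. complex_of_real (?e n y * ?P y) * cis (- (y \<bullet> \<xi>))) \<longlonglongrightarrow> (LINT y|lborel. complex_of_real (?P y) * cis (- (y \<bullet> \<xi>)))"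
  proof (rule integral_dominated_convergence[OF _ _ i])
    show "AE y in lborel. (\<lambda>n. complex_of_real (?e n y * ?P y) * cis (- (y \<bullet> \<xi>))) \<longlonglongrightarrow> complex_of_real (?P y) * cis (- (y \<bullet> \<xi>))"
      by (intro AE_I2 tendsto_intros e_lim)
    show "AE y in lborel. norm (complex_of_real (?e n y * ?P y) * cis (- (y \<bullet> \<xi>))) \<le> ?P y" for n
      unfolding norm_mult norm_of_real norm_cis abs_mult using nn T(1)[of n] by (auto intro!: AE_I2 mult_left_le_one_le)
  qed measurable
  then have "(\<lambda>n. complex_of_real (LINT \<eta>|lborel. gauss (T n) (\<xi> - \<eta>) * g \<eta>)) \<longlonglongrightarrow> fourier_tr ?P \<xi>"
    unfolding key fourier_tr_def .
  moreover have "(\<lambda>n. complex_of_real (LINT \<eta>|lborel. gauss (T n) (\<xi> - \<eta>) * g \<eta>)) \<longlonglongrightarrow> complex_of_real (g \<xi>)"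
    by (intro tendsto_of_real lim)
  ultimately show "fourier_tr ?P \<xi> = complex_of_real (g \<xi>)" by (rule LIMSEQ_unique)
qed

context
  fixes s :: real assumes s: "0 < s" "s < 1"
begin

text \<open>The kernel is the limit of the positive semigroup applied to ever narrower Gaussians,
  which have integrable symbols and approximate the point mass.\<close>

lemma heat_kernel_nonneg:
  assumes t: "t > 0" shows "0 \<le> frac_heat_kernel s t (x::'a::euclidean_space)"
proof -
  define T where "T n = inverse (real (Suc n))" for n
  have T: "T n > 0" "T \<longlonglongrightarrow> 0" for n unfolding T_def using LIMSEQ_inverse_real_of_nat by auto
  let ?m = "\<lambda>n \<xi>::'a. complex_of_real (exp (- T n * (norm \<xi>)\<^sup>2))"
  let ?S = "\<lambda>\<xi>::'a. complex_of_real (exp (- t * norm \<xi> powr (2 * s)))"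
  have "0 \<le> inv_ft (\<lambda>\<xi>. ?S \<xi> * ?m n \<xi>) x" for n
  proof (rule heat_semigroup_bounds(1)[OF s])
    show "integrable lborel (?m n)" using integrable_gaussian[OF T(1)] by (rule integrable_of_real)
    show "0 \<le> inv_ft (?m n) y" for y unfolding gauss_eq_inv_ft[OF T(1), symmetric] by (rule gauss_nonneg)
  qed (use t in simp)
  moreover have "(\<lambda>n. inv_ft (\<lambda>\<xi>. ?S \<xi> * ?m n \<xi>) x) \<longlonglongrightarrow> inv_ft ?S x"
  proof (rule inv_ft_dominated_convergence)
    show "integrable lborel (\<lambda>\<xi>::'a. exp (- t * norm \<xi> powr (2 * s)))" by (rule integrable_heat_symbol[OF s(1) t])
    show "norm (?S \<xi> * ?m n \<xi>) \<le> exp (- t * norm \<xi> powr (2 * s))" for n \<xi>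
      unfolding norm_mult norm_of_real using T(1)[of n] by (auto intro!: mult_left_le)
    show "AE \<xi> in lborel. (\<lambda>n. ?S \<xi> * ?m n \<xi>) \<longlonglongrightarrow> ?S \<xi>"
    proof (rule AE_I2)
      fix \<xi> :: 'a
      have "(\<lambda>n. ?S \<xi> * ?m n \<xi>) \<longlonglongrightarrow> ?S \<xi> * complex_of_real (exp (- 0 * (norm \<xi>)\<^sup>2))" by (intro tendsto_intros T)
      then show "(\<lambda>n. ?S \<xi> * ?m n \<xi>) \<longlonglongrightarrow> ?S \<xi>" by simp
    qed
  qed auto
  ultimately show ?thesis unfolding frac_heat_kernel_eq_inv_ft by (intro LIMSEQ_le_const) auto
qed

lemma heat_kernel_ft:
  assumes t: "t > 0"
  shows "integrable lborel (frac_heat_kernel s t :: 'a::euclidean_space \<Rightarrow> real)"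
    "fourier_tr (frac_heat_kernel s t) (\<xi>::'a) = complex_of_real (exp (- t * norm \<xi> powr (2 * s)))"
proof -
  let ?g = "\<lambda>\<xi>::'a. exp (- t * norm \<xi> powr (2 * s))"
  have b: "\<bar>?g \<xi>\<bar> \<le> 1" for \<xi> using t by simp
  have c: "isCont ?g \<xi>" for \<xi> using s by (intro continuous_intros) auto
  note * = inv_ft_integrable_nonneg[OF integrable_heat_symbol[OF s(1) t] _ b c, folded frac_heat_kernel_eq_inv_ft]
  show "integrable lborel (frac_heat_kernel s t :: 'a \<Rightarrow> real)"
    by (rule *(1)) (auto simp: heat_kernel_nonneg t)
  show "fourier_tr (frac_heat_kernel s t) \<xi> = complex_of_real (?g \<xi>)"
    by (rule *(2)) (auto simp: heat_kernel_nonneg t)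
qed

lemma heat_kernel_even:
  assumes "t > 0" shows "frac_heat_kernel s t (y - x) = frac_heat_kernel s t (x - y :: 'a::euclidean_space)"
  using inv_ftc_even(2)[OF integrable_heat_symbol[OF s(1) assms], of "x - y"]
  by (simp add: frac_heat_kernel_eq_inv_ft)

lemma heat_conv_inv_ft:
  fixes m :: "'a::euclidean_space \<Rightarrow> complex"
  assumes t: "t > 0" and m: "integrable lborel m"
  shows "(LINT y|lborel. frac_heat_kernel s t (x - y) * inv_ft m y) = inv_ft (\<lambda>\<xi>. complex_of_real (exp (- t * norm \<xi> powr (2 * s))) * m \<xi>) x"
    "integrable lborel (\<lambda>y. frac_heat_kernel s t (x - y) * inv_ft m y)"
  using conv_inv_ft[OF heat_kernel_ft(1)[OF t] m heat_kernel_ft(2)[OF t]] by blast+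

text \<open>The semigroup bounds act on functions given by an integrable symbol. The cutoff at 1
  provides it: for \<tau> \<ge> 1 every Gaussian symbol is dominated by the one at time 1.\<close>

lemma wt_eq_inv_ft:
  obtains m where "integrable lborel m" "wt s = inv_ft (m :: 'a::euclidean_space \<Rightarrow> complex)"
proof -
  let ?M = "\<lambda>\<tau> (\<xi>::'a). complex_of_real (sker 1 s \<tau>) * complex_of_real (exp (- \<tau> * (norm \<xi>)\<^sup>2))"
  have M: "integrable (lborel \<Otimes>\<^sub>M lborel) (case_prod ?M)"
  proof (rule lborel_pair.integrable_product_bound[where f="sker 1 s" and g="\<lambda>\<xi>. exp (- 1 * (norm \<xi>)\<^sup>2)"])
    show "integrable lborel (sker 1 s)" using s by (intro sker_integral) auto
    show "integrable lborel (\<lambda>\<xi>::'a. exp (- 1 * (norm \<xi>)\<^sup>2))" by (rule integrable_gaussian) simp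
    fix \<tau> :: real and \<xi> :: 'a
    have "sker 1 s \<tau> * exp (- \<tau> * (norm \<xi>)\<^sup>2) \<le> sker 1 s \<tau> * exp (- 1 * (norm \<xi>)\<^sup>2)"
      using mult_right_mono[of 1 \<tau> "(norm \<xi>)\<^sup>2"] by (auto simp: sker_def indicator_def intro!: mult_left_mono)
    then show "norm (case (\<tau>, \<xi>) of (\<tau>, \<xi>) \<Rightarrow> ?M \<tau> \<xi>) \<le> sker 1 s \<tau> * exp (- 1 * (norm \<xi>)\<^sup>2)"
      by (simp add: norm_mult sker_nonneg)
  qed measurable
  show ?thesis
  proof
    show "integrable lborel (\<lambda>\<xi>. LINT \<tau>|lborel. ?M \<tau> \<xi>)" using lborel_pair.integrable_snd[OF M] .
    show "wt s = inv_ft (\<lambda>\<xi>. LINT \<tau>|lborel. ?M \<tau> \<xi>)"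
    proof
      fix x :: 'a
      have "inv_ft (?M \<tau>) x = sker 1 s \<tau> * gauss \<tau> x" for \<tau>
        unfolding inv_ft_cmult by (cases "\<tau> \<ge> 1") (auto simp: gauss_eq_inv_ft sker_def)
      then show "wt s x = inv_ft (\<lambda>\<xi>. LINT \<tau>|lborel. ?M \<tau> \<xi>) x"
        using inv_ft_superposition(1)[OF M, of x] by (simp add: wt_def)
    qed
  qed
qed

lemma heat_conv_wt:
  fixes x :: "'a::euclidean_space"
  assumes t: "t > 0"
  shows "integrable lborel (\<lambda>y. frac_heat_kernel s t (x - y) * wt s y)"
    "(LINT y|lborel. frac_heat_kernel s t (x - y) * wt s y) \<le> exp (t * heatK s) * wt s x"
proof -
  obtain m :: "'a \<Rightarrow> complex" where m: "integrable lborel m" "wt s = inv_ft m" using wt_eq_inv_ft by blast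
  show "integrable lborel (\<lambda>y. frac_heat_kernel s t (x - y) * wt s y)"
    unfolding m by (rule heat_conv_inv_ft[OF t m(1)])
  have "inv_ft (\<lambda>\<xi>. complex_of_real (exp (- t * norm \<xi> powr (2 * s))) * m \<xi>) x \<le> exp (t * heatK s) * 1 * wt s x"
  proof (rule heat_semigroup_bounds(2)[OF s _ m(1)])
    show "0 \<le> inv_ft m y" for y unfolding m(2)[symmetric] by (rule wt_nonneg)
  qed (use t m(2) in auto)
  then show "(LINT y|lborel. frac_heat_kernel s t (x - y) * wt s y) \<le> exp (t * heatK s) * wt s x"
    using heat_conv_inv_ft(1)[OF t m(1), of x] m(2) by simp
qed

lemma heat_conv_bound:
  fixes g :: "'a::euclidean_space \<Rightarrow> real"
  assumes t: "t > 0" and g: "g \<in> borel_measurable borel" "\<And>y. \<bar>g y\<bar> \<le> A * wt s y"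
  shows "integrable lborel (\<lambda>y. frac_heat_kernel s t (x - y) * g y)"
    "(LINT y|lborel. frac_heat_kernel s t (x - y) * \<bar>g y\<bar>) \<le> A * exp (t * heatK s) * wt s x"
    "\<bar>LINT y|lborel. frac_heat_kernel s t (x - y) * g y\<bar> \<le> A * exp (t * heatK s) * wt s x"
proof -
  note [measurable] = g(1)
  have A: "A \<ge> 0" using order_trans[OF abs_ge_zero g(2)[of 0]] wt_pos[OF s(1), of "0::'a"] by (simp add: zero_le_mult_iff)
  have i: "integrable lborel (\<lambda>y. A * (frac_heat_kernel s t (x - y) * wt s y))"
    by (intro integrable_mult_right heat_conv_wt t)
  have le: "frac_heat_kernel s t (x - y) * \<bar>g y\<bar> \<le> A * (frac_heat_kernel s t (x - y) * wt s y)" for y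
    using mult_left_mono[OF g(2) heat_kernel_nonneg[OF t]] by (simp add: mult_ac)
  have le': "norm (frac_heat_kernel s t (x - y) * \<bar>g y\<bar>) \<le> norm (A * (frac_heat_kernel s t (x - y) * wt s y))" for y
    using order_trans[OF le[of y] abs_ge_self] heat_kernel_nonneg[OF t, of "x - y"] by (simp add: abs_mult)
  show ig: "integrable lborel (\<lambda>y. frac_heat_kernel s t (x - y) * g y)"
    by (rule Bochner_Integration.integrable_bound[OF i]) (use le' in \<open>auto simp: abs_mult\<close>)
  have ia: "integrable lborel (\<lambda>y. frac_heat_kernel s t (x - y) * \<bar>g y\<bar>)"
    by (rule Bochner_Integration.integrable_bound[OF i]) (use le' in auto)
  have "(LINT y|lborel. frac_heat_kernel s t (x - y) * \<bar>g y\<bar>) \<le> (LINT y|lborel. A * (frac_heat_kernel s t (x - y) * wt s y))"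
    by (rule Bochner_Integration.integral_mono[OF ia i le])
  also have "\<dots> \<le> A * (exp (t * heatK s) * wt s x)"
    using mult_left_mono[OF heat_conv_wt(2)[OF t] A] by simp
  finally show 1: "(LINT y|lborel. frac_heat_kernel s t (x - y) * \<bar>g y\<bar>) \<le> A * exp (t * heatK s) * wt s x" by (simp add: mult_ac)
  have "norm (LINT y|lborel. frac_heat_kernel s t (x - y) * g y) \<le> (LINT y|lborel. norm (frac_heat_kernel s t (x - y) * g y))"
    by (rule integral_norm_bound)
  also have "(\<lambda>y. norm (frac_heat_kernel s t (x - y) * g y)) = (\<lambda>y. frac_heat_kernel s t (x - y) * \<bar>g y\<bar>)"
    by (simp add: abs_mult heat_kernel_nonneg t)
  finally show "\<bar>LINT y|lborel. frac_heat_kernel s t (x - y) * g y\<bar> \<le> A * exp (t * heatK s) * wt s x" using 1 by simp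
qed

text \<open>The substitution by \<open>c\<close> normalises the symbol, since
  \<open>t * c powr (2 * s) = 1\<close>.\<close>

lemma heat_kernel_scaling:
  fixes x :: "'a::euclidean_space" assumes t: "t > 0"
  defines "c \<equiv> t powr (- (1 / (2 * s)))"
  shows "frac_heat_kernel s t x = c ^ DIM('a) * frac_heat_kernel s 1 (c *\<^sub>R x)"
proof -
  have c: "c > 0" using t by (simp add: c_def)
  have tc: "t * (c * r) powr (2 * s) = r powr (2 * s)" if "r \<ge> 0" for r
  proof -
    have "t * (c * r) powr (2 * s) = (t * c powr (2 * s)) * r powr (2 * s)" using c that by (simp add: powr_mult)
    also have "t * c powr (2 * s) = 1" unfolding c_def powr_powr using s t by (simp add: powr_minus)
    finally show ?thesis by simp
  qed
  have "(LINT \<xi>|lborel. complex_of_real (exp (- t * norm \<xi> powr (2 * s))) * cis (x \<bullet> \<xi>))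
     = (\<bar>c\<bar> ^ DIM('a)) *\<^sub>R (LINT \<xi>|lborel. complex_of_real (exp (- t * norm (0 + c *\<^sub>R \<xi>) powr (2 * s))) * cis (x \<bullet> (0 + c *\<^sub>R \<xi>)))"
    by (rule integral_lborel_affine) (use c in auto)
  also have "\<dots> = complex_of_real (c ^ DIM('a)) * (LINT \<xi>|lborel. complex_of_real (exp (- 1 * norm \<xi> powr (2 * s))) * cis ((c *\<^sub>R x) \<bullet> \<xi>))"
    using c by (simp add: scaleR_conv_of_real tc)
  finally show ?thesis unfolding frac_heat_kernel_def by simp
qed

lemma integral_heat_kernel: "t > 0 \<Longrightarrow> (LINT y|lborel. frac_heat_kernel s t (y::'a::euclidean_space)) = 1"
proof -
  assume t: "t > 0"
  have "complex_of_real (LINT y|lborel. frac_heat_kernel s t (y::'a)) = 1"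
    using heat_kernel_ft(2)[OF t, of "0::'a"] s by (simp add: fourier_tr_def)
  then show ?thesis by simp
qed

text \<open>Self-similarity reduces the moving kernel to the fixed integrable kernel at time 1,
  after which dominated convergence works as for Gaussians.\<close>

lemma heat_approx_identity:
  fixes g :: "'a::euclidean_space \<Rightarrow> real"
  assumes [measurable]: "g \<in> borel_measurable borel" and b: "\<And>y. \<bar>g y\<bar> \<le> B" and c: "isCont g x"
    and T: "\<And>n. T n > 0" "T \<longlonglongrightarrow> 0"
  shows "(\<lambda>n. LINT y|lborel. frac_heat_kernel s (T n) (x - y) * g y) \<longlonglongrightarrow> g x"
proof -
  let ?P = "frac_heat_kernel s 1 :: 'a \<Rightarrow> real"
  let ?r = "\<lambda>n. T n powr (1 / (2 * s))"
  have eq: "(LINT y|lborel. frac_heat_kernel s (T n) (x - y) * g y) = (LINT z|lborel. ?P z * g (x + (- ?r n) *\<^sub>R z))" for n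
  proof -
    let ?c = "T n powr (- (1 / (2 * s)))"
    have rc: "?r n * ?c = 1" using T(1)[of n] by (simp add: powr_minus)
    have r: "?r n > 0" using T(1)[of n] by simp
    have "(LINT y|lborel. frac_heat_kernel s (T n) (x - y) * g y)
      = (\<bar>- ?r n\<bar> ^ DIM('a)) *\<^sub>R (LINT z|lborel. frac_heat_kernel s (T n) (x - (x + (- ?r n) *\<^sub>R z)) * g (x + (- ?r n) *\<^sub>R z))"
      by (rule integral_lborel_affine) (use r in auto)
    also have "\<dots> = ?r n ^ DIM('a) * (LINT z|lborel. ?c ^ DIM('a) * (?P z * g (x + (- ?r n) *\<^sub>R z)))"
      using rc T(1)[of n] by (simp add: heat_kernel_scaling[OF T(1)] mult.commute[of ?c] mult.assoc)
    also have "\<dots> = (?r n * ?c) ^ DIM('a) * (LINT z|lborel. ?P z * g (x + (- ?r n) *\<^sub>R z))"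
      by (simp add: power_mult_distrib)
    finally show ?thesis unfolding rc by simp
  qed
  have r0: "?r \<longlonglongrightarrow> 0"
  proof -
    have "?r \<longlonglongrightarrow> 0 powr (1 / (2 * s))"
      using s T by (intro tendsto_powr2 tendsto_const) (auto intro!: always_eventually less_imp_le)
    then show ?thesis by simp
  qed
  have "(\<lambda>n. LINT z|lborel. ?P z * g (x + (- ?r n) *\<^sub>R z)) \<longlonglongrightarrow> (LINT z|lborel. ?P z * g x)"
  proof (rule integral_dominated_convergence)
    show "integrable lborel (\<lambda>z::'a. ?P z * B)" by (intro integrable_mult_left heat_kernel_ft) simp
    show "AE z in lborel. norm (?P z * g (x + (- ?r n) *\<^sub>R z)) \<le> ?P z * B" for n
      by (auto simp: abs_mult heat_kernel_nonneg intro!: mult_left_mono b)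
    show "AE z in lborel. (\<lambda>n. ?P z * g (x + (- ?r n) *\<^sub>R z)) \<longlonglongrightarrow> ?P z * g x"
    proof (intro AE_I2 tendsto_intros isCont_tendsto_compose[OF c])
      fix z :: 'a
      have "(\<lambda>n. x + (- ?r n) *\<^sub>R z) \<longlonglongrightarrow> x + (- 0) *\<^sub>R z" by (intro tendsto_intros r0)
      then show "(\<lambda>n. x + (- ?r n) *\<^sub>R z) \<longlonglongrightarrow> x" by simp
    qed
  qed measurable
  then show ?thesis unfolding eq by (simp add: integral_heat_kernel)
qed

end

section \<open>Test functions\<close>

definition ddir :: "'e::real_normed_vector \<Rightarrow> ('e \<Rightarrow> real) \<Rightarrow> 'e \<Rightarrow> real" where
  "ddir v f x = frechet_derivative f (at x) v"

text \<open>Unlike \<open>test_fun\<close>, this class carries no sign condition and no position of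
  the support, so it is closed under directional derivatives.\<close>

definition csmooth :: "('e::real_normed_vector \<Rightarrow> real) \<Rightarrow> bool" where
  "csmooth f \<longleftrightarrow> smooth_fun f \<and> compact (closure {p. f p \<noteq> 0})"

section \<open>Directional derivatives, compact support and integration by parts\<close>

lemma smooth_fun_ddir: "smooth_fun f \<Longrightarrow> smooth_fun (ddir v f)"
  unfolding smooth_fun_def ddir_def[abs_def] by (metis C_k.simps(2))

lemma smooth_fun_has_derivative:
  "smooth_fun f \<Longrightarrow> (f has_derivative frechet_derivative f (at x)) (at x)"
  unfolding smooth_fun_def by (metis C_k.simps(2) differentiable_on_def UNIV_I frechet_derivative_works)

lemma smooth_fun_continuous: "smooth_fun f \<Longrightarrow> continuous_on S f"
  unfolding smooth_fun_def by (metis C_k.simps(1) continuous_on_subset subset_UNIV)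

lemma ddir_line:
  assumes "smooth_fun f"
  shows "((\<lambda>h. f (x + h *\<^sub>R v)) has_vector_derivative ddir v f (x + h *\<^sub>R v)) (at h)"
proof -
  have "((\<lambda>h. x + h *\<^sub>R v) has_vector_derivative v) (at h)"
    by (auto intro!: derivative_eq_intros simp: has_vector_derivative_def)
  from vector_derivative_diff_chain_within[OF this has_derivative_at_withinI[OF smooth_fun_has_derivative[OF assms]]]
  show ?thesis by (simp add: o_def ddir_def)
qed

lemma ddir_outside_support:
  assumes "x \<notin> closure {p. f p \<noteq> 0}" shows "ddir v f x = 0"
proof -
  have "open (- closure {p. f p \<noteq> 0})" "x \<in> - closure {p. f p \<noteq> 0}" using assms by auto
  then have "eventually (\<lambda>y. f y = 0) (nhds x)"
    unfolding eventually_nhds using closure_subset[of "{p. f p \<noteq> 0}"] by blast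
  then have "(f has_derivative (\<lambda>h. 0)) (at x)"
    by (intro has_derivative_transform_eventually[OF has_derivative_const[of 0]])
      (auto simp: eventually_at_filter elim: eventually_mono dest: eventually_nhds_x_imp_x)
  then have "frechet_derivative f (at x) = (\<lambda>h. 0)" by (rule frechet_derivative_at[symmetric])
  then show ?thesis by (simp add: ddir_def)
qed

lemma csmooth_ddir:
  assumes "csmooth f" shows "csmooth (ddir v f)"
proof -
  have "{p. ddir v f p \<noteq> 0} \<subseteq> closure {p. f p \<noteq> 0}" using ddir_outside_support by blast
  then have "closure {p. ddir v f p \<noteq> 0} \<subseteq> closure {p. f p \<noteq> 0}" by (rule closure_minimal) simp
  then show ?thesis using assms unfolding csmooth_def
    by (metis closed_closure inf.absorb_iff2 compact_Int_closed smooth_fun_ddir)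
qed

lemma compact_support_bounds:
  fixes f :: "'e::euclidean_space \<Rightarrow> real"
  assumes "continuous_on UNIV f" "compact (closure {p. f p \<noteq> 0})"
  obtains R B where "R > 0" "B \<ge> 0" "\<And>x. \<bar>f x\<bar> \<le> B" "\<And>x. norm x > R \<Longrightarrow> f x = 0"
proof -
  have "bounded (closure {p. f p \<noteq> 0})" using assms(2) by (rule compact_imp_bounded)
  then obtain R where R: "R > 0" "\<And>x. x \<in> closure {p. f p \<noteq> 0} \<Longrightarrow> norm x \<le> R" by (auto simp: bounded_pos)
  have z: "f x = 0" if "norm x > R" for x
    using R(2)[of x] that closure_subset[of "{p. f p \<noteq> 0}"] by force
  have "compact (f ` closure {p. f p \<noteq> 0})"
    using assms by (intro compact_continuous_image) (auto intro: continuous_on_subset)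
  then obtain B where B: "B > 0" "\<And>y. y \<in> f ` closure {p. f p \<noteq> 0} \<Longrightarrow> norm y \<le> B"
    using compact_imp_bounded[of "f ` closure {p. f p \<noteq> 0}"] unfolding bounded_pos by auto
  have "\<bar>f x\<bar> \<le> B" for x
  proof (cases "f x = 0")
    case False
    then have "x \<in> closure {p. f p \<noteq> 0}" using closure_subset[of "{p. f p \<noteq> 0}"] by blast
    then show ?thesis using B(2)[of "f x"] by auto
  qed (use B in auto)
  then show ?thesis using that[of R B] R B z by simp
qed

lemma csmooth_bounds:
  fixes f :: "'e::euclidean_space \<Rightarrow> real"
  assumes "csmooth f"
  obtains R B where "R > 0" "B \<ge> 0" "\<And>x. \<bar>f x\<bar> \<le> B" "\<And>x. norm x > R \<Longrightarrow> f x = 0"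
  using assms compact_support_bounds[of f thesis] smooth_fun_continuous unfolding csmooth_def by blast

lemma integrable_bounded_support:
  fixes f :: "'e::euclidean_space \<Rightarrow> 'b::{banach, second_countable_topology}"
  assumes "f \<in> borel_measurable borel" "\<And>x. norm (f x) \<le> B" "\<And>x. norm x > R \<Longrightarrow> f x = 0"
  shows "integrable lborel f"
proof (rule Bochner_Integration.integrable_bound)
  show "integrable lborel (\<lambda>x::'e. B * indicator (cball 0 R) x)"
    using emeasure_lborel_cball_finite[of "0::'e" R] by (intro integrable_mult_right integrable_real_indicator) auto
  show "AE x in lborel. norm (f x) \<le> norm (B * indicator (cball 0 R) x)"
  proof (rule AE_I2)
    fix x :: 'e
    show "norm (f x) \<le> norm (B * indicator (cball 0 R) x)"
      using assms(2)[of x] assms(3)[of x] by (cases "norm x \<le> R") (auto simp: indicator_def)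
  qed
qed (use assms in simp)

text \<open>Integrating the derivative along \<open>v\<close> over unit time gives g(x + v) - g(x),
  whose integral vanishes by translation invariance; exchanging the integrals leaves the integral of
  \<open>g'\<close>. Applied to products, this is the integration by parts used in space and in
  time.\<close>

lemma integral_directional_derivative:
  fixes g g' :: "'e::euclidean_space \<Rightarrow> 'b::euclidean_space"
  assumes d: "\<And>x h. ((\<lambda>h. g (x + h *\<^sub>R v)) has_vector_derivative g' (x + h *\<^sub>R v)) (at h)"
    and c: "continuous_on UNIV g" "continuous_on UNIV g'"
    and b: "\<And>x. norm (g x) \<le> B" "\<And>x. norm (g' x) \<le> B"
    and z: "\<And>x. norm x > R \<Longrightarrow> g x = 0" "\<And>x. norm x > R \<Longrightarrow> g' x = 0"
  shows "(LINT x|lborel. g' x) = 0"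
proof -
  have [measurable]: "g \<in> borel_measurable borel" "g' \<in> borel_measurable borel"
    using c by (auto intro: borel_measurable_continuous_onI)
  have ig: "integrable lborel g" "integrable lborel g'"
    by (rule integrable_bounded_support[OF _ b(1) z(1)], measurable) (rule integrable_bounded_support[OF _ b(2) z(2)], measurable)
  have B: "B \<ge> 0" using b(1)[of 0] norm_ge_zero order_trans by blast
  let ?F = "\<lambda>x h. indicator {0..1} h *\<^sub>R g' (x + h *\<^sub>R v)"
  have F: "integrable (lborel \<Otimes>\<^sub>M lborel) (case_prod ?F)"
  proof (rule lborel_pair.integrable_product_bound[where f="\<lambda>x. B * indicator (cball 0 (R + norm v)) x" and g="indicator {0..1::real}"])
    show "integrable lborel (\<lambda>x::'e. B * indicator (cball 0 (R + norm v)) x)"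
      using emeasure_lborel_cball_finite[of "0::'e" "R + norm v"] by (intro integrable_mult_right integrable_real_indicator) auto
    fix x :: 'e and h :: real
    show "norm (case (x, h) of (x, h) \<Rightarrow> ?F x h) \<le> B * indicator (cball 0 (R + norm v)) x * indicator {0..1} h"
    proof (cases "h \<in> {0..1} \<and> norm x > R + norm v")
      case True
      have "norm x \<le> norm (x + h *\<^sub>R v) + norm (h *\<^sub>R v)" by (metis add_diff_cancel_right' norm_triangle_sub add.commute norm_triangle_ineq4)
      also have "norm (h *\<^sub>R v) \<le> norm v" using True by (auto intro!: mult_left_le_one_le)
      finally have "norm (x + h *\<^sub>R v) > R" using True by linarith
      then show ?thesis using z(2) True by simp
    next
      case False
      then show ?thesis using b(2)[of "x + h *\<^sub>R v"] by (auto simp: indicator_def not_less)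
    qed
  qed auto
  have ftc: "(LINT h|lborel. ?F x h) = g (x + v) - g x" for x
  proof -
    have "(LINT h|lborel. indicator {0..1} h *\<^sub>R g' (x + h *\<^sub>R v)) = g (x + 1 *\<^sub>R v) - g (x + 0 *\<^sub>R v)"
    proof (rule integral_FTC_Icc)
      show "continuous_on {0..1} (\<lambda>h. g' (x + h *\<^sub>R v))"
        by (intro continuous_on_compose2[OF c(2)] continuous_intros) auto
    qed (auto intro: has_vector_derivative_at_within[OF d])
    then show ?thesis by simp
  qed
  have sh: "(LINT x|lborel. g' (x + h *\<^sub>R v)) = (LINT x|lborel. g' x)" for h
    using lborel_reflect(4)[OF ig(2), of "- h *\<^sub>R v"] by simp
  have shg: "integrable lborel (\<lambda>x. g (x + v))" "(LINT x|lborel. g (x + v)) = (LINT x|lborel. g x)"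
    using lborel_reflect(3,4)[OF ig(1), of "- v"] by simp_all
  have "0 = (LINT x|lborel. g (x + v) - g x)" using shg ig by simp
  also have "\<dots> = (LINT x|lborel. LINT h|lborel. ?F x h)" by (simp add: ftc)
  also have "\<dots> = (LINT h|lborel. LINT x|lborel. ?F x h)" using lborel_pair.Fubini_integral[OF F] by simp
  also have "\<dots> = (LINT x|lborel. g' x)" by (simp add: sh)
  finally show ?thesis by simp
qed

lemma csmooth_measurable: "csmooth (f :: 'e::euclidean_space \<Rightarrow> real) \<Longrightarrow> f \<in> borel_measurable borel"
  by (intro borel_measurable_continuous_onI smooth_fun_continuous) (simp add: csmooth_def)

lemma csmooth_slice_bounds:
  fixes \<psi> :: "real \<times> 'a::euclidean_space \<Rightarrow> real"
  assumes "csmooth \<psi>"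
  obtains R B where "R > 0" "B \<ge> 0" "\<And>t x. \<bar>\<psi> (t, x)\<bar> \<le> B" "\<And>t x. norm x > R \<Longrightarrow> \<psi> (t, x) = 0" "\<And>t x. \<bar>t\<bar> > R \<Longrightarrow> \<psi> (t, x) = 0"
proof -
  obtain R B where *: "R > 0" "B \<ge> 0" "\<And>p. \<bar>\<psi> p\<bar> \<le> B" "\<And>p. norm p > R \<Longrightarrow> \<psi> p = 0"
    using csmooth_bounds[OF assms] by blast
  have "norm x \<le> norm (t, x)" "\<bar>t\<bar> \<le> norm (t, x)" for t and x :: 'a
    by (auto simp: norm_Pair real_le_rsqrt)
  then show ?thesis using that[of R B] * by (meson less_le_trans)
qed

lemma continuous_slice:
  fixes \<psi> :: "real \<times> 'a::euclidean_space \<Rightarrow> real"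
  assumes "csmooth \<psi>" shows "continuous_on S (\<lambda>x. \<psi> (t, x))"
  using assms smooth_fun_continuous[of \<psi> UNIV] unfolding csmooth_def
  by (auto intro!: continuous_on_compose2[of UNIV \<psi>] continuous_intros)

lemma integrable_slice:
  fixes \<psi> :: "real \<times> 'a::euclidean_space \<Rightarrow> real"
  assumes "csmooth \<psi>" shows "integrable lborel (\<lambda>x. \<psi> (t, x))"
proof -
  obtain R B where "\<And>t x. \<bar>\<psi> (t, x)\<bar> \<le> B" "\<And>t x. norm x > R \<Longrightarrow> \<psi> (t, x) = 0" using csmooth_slice_bounds[OF assms] by metis
  then show ?thesis using continuous_slice[OF assms]
    by (intro integrable_bounded_support[of _ B R] borel_measurable_continuous_onI) auto
qed

section \<open>Fourier decay and inversion for time slices\<close>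

lemma cis_has_vector_derivative: "(cis has_vector_derivative \<i> * cis a) (at a)"
proof -
  have "((\<lambda>z. exp (\<i> * z)) has_field_derivative \<i> * exp (\<i> * complex_of_real a)) (at (complex_of_real a))"
    by (auto intro!: derivative_eq_intros)
  from has_vector_derivative_real_field[OF this] show ?thesis by (simp add: cis_conv_exp[abs_def])
qed

text \<open>The product of the slice with the character has a directional derivative of integral
  zero; its two terms are the two sides.\<close>

lemma fourier_tr_ddir:
  fixes \<psi> :: "real \<times> 'a::euclidean_space \<Rightarrow> real"
  assumes "csmooth \<psi>"
  shows "fourier_tr (\<lambda>y. ddir (0, b) \<psi> (t, y)) \<xi> = \<i> * complex_of_real (b \<bullet> \<xi>) * fourier_tr (\<lambda>y. \<psi> (t, y)) \<xi>"
proof -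
  note c' = csmooth_ddir[OF assms, of "(0, b)"]
  have sm: "smooth_fun \<psi>" using assms by (simp add: csmooth_def)
  let ?g = "\<lambda>y. complex_of_real (\<psi> (t, y)) * cis (- (y \<bullet> \<xi>))"
  let ?g1 = "\<lambda>y. complex_of_real (ddir (0, b) \<psi> (t, y)) * cis (- (y \<bullet> \<xi>))"
  let ?g2 = "\<lambda>y. complex_of_real (\<psi> (t, y)) * (cis (- (y \<bullet> \<xi>)) * (- \<i> * complex_of_real (b \<bullet> \<xi>)))"
  obtain R B where 1: "\<And>t x. \<bar>\<psi> (t, x)\<bar> \<le> B" "\<And>t x. norm x > R \<Longrightarrow> \<psi> (t, x) = 0" "B \<ge> 0" using csmooth_slice_bounds[OF assms] by metis
  obtain R' B' where 2: "\<And>t x. \<bar>ddir (0, b) \<psi> (t, x)\<bar> \<le> B'" "\<And>t x. norm x > R' \<Longrightarrow> ddir (0, b) \<psi> (t, x) = 0" "B' \<ge> 0"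
    using csmooth_slice_bounds[OF c'] by metis
  have "(LINT y|lborel. ?g1 y + ?g2 y) = 0"
  proof (rule integral_directional_derivative[where g="?g" and v=b and R="max R R'" and B="B + B' + B * \<bar>b \<bullet> \<xi>\<bar>"])
    show "((\<lambda>h. ?g (x + h *\<^sub>R b)) has_vector_derivative (?g1 (x + h *\<^sub>R b) + ?g2 (x + h *\<^sub>R b))) (at h)" for x h
    proof -
      have 1: "((\<lambda>h. \<psi> (t, x + h *\<^sub>R b)) has_vector_derivative ddir (0, b) \<psi> (t, x + h *\<^sub>R b)) (at h)"
        using ddir_line[OF sm, of "(t, x)" "(0, b)" h] by simp
      then have a: "((\<lambda>h. complex_of_real (\<psi> (t, x + h *\<^sub>R b))) has_vector_derivative complex_of_real (ddir (0, b) \<psi> (t, x + h *\<^sub>R b))) (at h)"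
        by (rule bounded_linear.has_vector_derivative[OF bounded_linear_of_real])
      have "((\<lambda>h. - (x \<bullet> \<xi>) - h * (b \<bullet> \<xi>)) has_real_derivative - (b \<bullet> \<xi>)) (at h)"
        by (auto intro!: derivative_eq_intros)
      then have "((\<lambda>h. - ((x + h *\<^sub>R b) \<bullet> \<xi>)) has_real_derivative - (b \<bullet> \<xi>)) (at h)"
        by (simp add: inner_add_left)
      then have bb: "((\<lambda>h. cis (- ((x + h *\<^sub>R b) \<bullet> \<xi>))) has_vector_derivative (- (b \<bullet> \<xi>)) *\<^sub>R (\<i> * cis (- ((x + h *\<^sub>R b) \<bullet> \<xi>)))) (at h)"
        by (intro vector_diff_chain_at[where g=cis, unfolded o_def] cis_has_vector_derivative)
           (simp add: has_real_derivative_iff_has_vector_derivative)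
      show ?thesis
        using has_vector_derivative_mult[OF a bb] by (simp add: scaleR_conv_of_real algebra_simps)
    qed
    show "continuous_on UNIV ?g"
      by (intro continuous_intros continuous_slice[OF assms])
    show "continuous_on UNIV (\<lambda>y. ?g1 y + ?g2 y)"
      by (intro continuous_intros continuous_slice[OF assms] continuous_slice[OF c'])
    show "norm (?g x) \<le> B + B' + B * \<bar>b \<bullet> \<xi>\<bar>" for x
    proof -
      have "0 \<le> B * \<bar>b \<bullet> \<xi>\<bar>" using 1(3) by simp
      moreover have "norm (?g x) = \<bar>\<psi> (t, x)\<bar>" by (simp add: norm_mult)
      ultimately show ?thesis using 1(1)[of t x] 2(3) by linarith
    qed
    show "norm (?g1 x + ?g2 x) \<le> B + B' + B * \<bar>b \<bullet> \<xi>\<bar>" for x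
    proof -
      have "norm (?g1 x + ?g2 x) \<le> norm (?g1 x) + norm (?g2 x)" by (rule norm_triangle_ineq)
      also have "\<dots> \<le> B' + B * \<bar>b \<bullet> \<xi>\<bar>"
        using 1(1)[of t x] 2(1)[of t x] by (intro add_mono) (auto simp: norm_mult intro!: mult_right_mono)
      finally show ?thesis using 1(3) by simp
    qed
  qed (use 1 2 in auto)
  moreover have "integrable lborel ?g1" using integrable_slice[OF c'] by (intro integrable_mult_cis(2) integrable_of_real)
  moreover have "integrable lborel ?g" using integrable_slice[OF assms] by (intro integrable_mult_cis(2) integrable_of_real)
  then have "integrable lborel (\<lambda>y. ?g y * (- \<i> * complex_of_real (b \<bullet> \<xi>)))" by (rule integrable_mult_left)
  then have "integrable lborel ?g2" by (simp add: mult.assoc)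
  moreover have "(LINT y|lborel. ?g2 y) = (LINT y|lborel. ?g y * (- \<i> * complex_of_real (b \<bullet> \<xi>)))" by (simp add: mult.assoc)
  moreover have "\<dots> = (LINT y|lborel. ?g y) * (- \<i> * complex_of_real (b \<bullet> \<xi>))" by (rule integral_mult_left_zero)
  ultimately show ?thesis unfolding fourier_tr_def by (simp add: algebra_simps)
qed

lemma csmooth_ddir_funpow: "csmooth \<psi> \<Longrightarrow> csmooth ((ddir v ^^ n) \<psi>)"
  by (induction n) (auto simp: csmooth_ddir)

lemma fourier_tr_ddir_funpow:
  fixes \<psi> :: "real \<times> 'a::euclidean_space \<Rightarrow> real"
  assumes "csmooth \<psi>"
  shows "fourier_tr (\<lambda>y. (ddir (0, b) ^^ n) \<psi> (t, y)) \<xi> = (\<i> * complex_of_real (b \<bullet> \<xi>)) ^ n * fourier_tr (\<lambda>y. \<psi> (t, y)) \<xi>"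
  by (induction n) (simp_all add: fourier_tr_ddir csmooth_ddir_funpow assms mult_ac)

lemma fourier_tr_slice_bounded:
  fixes \<psi> :: "real \<times> 'a::euclidean_space \<Rightarrow> real"
  assumes "csmooth \<psi>"
  obtains C where "C \<ge> 0" "\<And>t \<xi>. norm (fourier_tr (\<lambda>y. \<psi> (t, y)) \<xi>) \<le> C"
proof -
  obtain R B where 1: "\<And>t x. \<bar>\<psi> (t, x)\<bar> \<le> B" "\<And>t x. norm x > R \<Longrightarrow> \<psi> (t, x) = 0" "B \<ge> 0" using csmooth_slice_bounds[OF assms] by metis
  have i: "integrable lborel (\<lambda>x::'a. B * indicator (cball 0 R) x)"
    using emeasure_lborel_cball_finite[of "0::'a" R] by (intro integrable_mult_right integrable_real_indicator) auto
  let ?C = "LINT x|lborel. B * indicator (cball 0 R) (x::'a)"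
  have "norm (fourier_tr (\<lambda>y. \<psi> (t, y)) \<xi>) \<le> ?C" for t \<xi>
  proof -
    have "norm (fourier_tr (\<lambda>y. \<psi> (t, y)) \<xi>) \<le> (LINT y|lborel. \<bar>\<psi> (t, y)\<bar>)" by (rule norm_fourier_tr_le)
    also have "\<dots> \<le> ?C"
    proof (rule Bochner_Integration.integral_mono[OF _ i])
      show "integrable lborel (\<lambda>y. \<bar>\<psi> (t, y)\<bar>)" using integrable_slice[OF assms] by simp
      show "\<bar>\<psi> (t, y)\<bar> \<le> B * indicator (cball 0 R) y" for y
        using 1(1)[of t y] 1(2)[of y t] by (cases "norm y \<le> R") (auto simp: indicator_def)
    qed
    finally show ?thesis .
  qed
  moreover have "?C \<ge> 0" using 1(3) by (intro Bochner_Integration.integral_nonneg) auto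
  ultimately show ?thesis using that by blast
qed

text \<open>The largest coordinate controls the norm, so it is enough to differentiate repeatedly
  along coordinate directions.\<close>

lemma norm_power_le_sum_Basis:
  fixes \<xi> :: "'a::euclidean_space"
  shows "norm \<xi> ^ k \<le> real DIM('a) ^ k * (\<Sum>b\<in>Basis. \<bar>b \<bullet> \<xi>\<bar> ^ k)"
proof -
  have "Max ((\<lambda>b. \<bar>b \<bullet> \<xi>\<bar>) ` Basis) \<in> (\<lambda>b. \<bar>b \<bullet> \<xi>\<bar>) ` (Basis::'a set)" by (intro Max_in) auto
  then obtain b0 :: 'a where "Max ((\<lambda>b. \<bar>b \<bullet> \<xi>\<bar>) ` Basis) = \<bar>b0 \<bullet> \<xi>\<bar>" "b0 \<in> Basis" by (rule imageE)
  then have b0: "b0 \<in> Basis" "\<bar>b0 \<bullet> \<xi>\<bar> = Max ((\<lambda>b. \<bar>b \<bullet> \<xi>\<bar>) ` Basis)" by simp_all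
  have le: "\<bar>b \<bullet> \<xi>\<bar> \<le> \<bar>b0 \<bullet> \<xi>\<bar>" if "b \<in> Basis" for b
    unfolding b0(2) using that by (intro Max_ge) auto
  have "norm \<xi> \<le> (\<Sum>b\<in>Basis. \<bar>\<xi> \<bullet> b\<bar>)" by (rule norm_le_l1)
  also have "\<dots> \<le> (\<Sum>b\<in>(Basis::'a set). \<bar>b0 \<bullet> \<xi>\<bar>)" by (intro sum_mono) (simp add: le inner_commute[of \<xi>])
  finally have "norm \<xi> \<le> real DIM('a) * \<bar>b0 \<bullet> \<xi>\<bar>" by simp
  then have "norm \<xi> ^ k \<le> (real DIM('a) * \<bar>b0 \<bullet> \<xi>\<bar>) ^ k" by (intro power_mono) auto
  also have "\<dots> = real DIM('a) ^ k * \<bar>b0 \<bullet> \<xi>\<bar> ^ k" by (rule power_mult_distrib)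
  also have "\<dots> \<le> real DIM('a) ^ k * (\<Sum>b\<in>Basis. \<bar>b \<bullet> \<xi>\<bar> ^ k)"
    using b0(1) by (intro mult_left_mono member_le_sum) auto
  finally show ?thesis .
qed

text \<open>Differentiates N + 3 times in every coordinate direction: a multiplier of quadratic
  growth then still leaves decay of order N + 1, which is integrable. The constant is uniform in t
  because the bounds on derivatives are bounds in space-time.\<close>

lemma fourier_tr_slice_decay:
  fixes \<psi> :: "real \<times> 'a::euclidean_space \<Rightarrow> real"
  assumes "csmooth \<psi>"
  obtains C where "C \<ge> 0" "\<And>t \<xi>. norm (fourier_tr (\<lambda>y. \<psi> (t, y)) \<xi>) \<le> C * (1 + norm \<xi>) powr (- (real DIM('a) + 3))"
proof -
  define k where "k = DIM('a) + 3"
  obtain C0 where C0: "C0 \<ge> 0" "\<And>t \<xi>. norm (fourier_tr (\<lambda>y. \<psi> (t, y)) \<xi>) \<le> C0"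
    using fourier_tr_slice_bounded[OF assms] by metis
  have "\<exists>C. \<forall>t \<xi>. norm (fourier_tr (\<lambda>y. (ddir (0, b) ^^ k) \<psi> (t, y)) \<xi>) \<le> C" for b :: 'a
    using fourier_tr_slice_bounded[OF csmooth_ddir_funpow[OF assms, of k "(0, b)"]] by metis
  then obtain C1 where "\<And>b t \<xi>. norm (fourier_tr (\<lambda>y. (ddir (0, b :: 'a) ^^ k) \<psi> (t, y)) \<xi>) \<le> C1 b" by metis
  then have C1: "\<bar>b \<bullet> \<xi>\<bar> ^ k * norm (fourier_tr (\<lambda>y. \<psi> (t, y)) \<xi>) \<le> C1 b" for b t \<xi>
    by (simp add: fourier_tr_ddir_funpow[OF assms] norm_mult norm_power)
  define C where "C = 2 ^ k * (C0 + real DIM('a) ^ k * (\<Sum>b\<in>Basis. C1 b))"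
  have main: "(1 + norm \<xi>) ^ k * norm (fourier_tr (\<lambda>y. \<psi> (t, y)) \<xi>) \<le> C" for t \<xi>
  proof -
    let ?F = "norm (fourier_tr (\<lambda>y. \<psi> (t, y)) \<xi>)"
    have "(1 + norm \<xi>) ^ k \<le> 2 ^ k * (1 + norm \<xi> ^ k)"
    proof (cases "norm \<xi> \<le> 1")
      case True
      then have "(1 + norm \<xi>) ^ k \<le> 2 ^ k" by (intro power_mono) auto
      also have "\<dots> \<le> 2 ^ k * (1 + norm \<xi> ^ k)" by simp
      finally show ?thesis .
    next
      case False
      then have "(1 + norm \<xi>) ^ k \<le> (2 * norm \<xi>) ^ k" by (intro power_mono) auto
      also have "\<dots> \<le> 2 ^ k * (1 + norm \<xi> ^ k)" by (simp add: power_mult_distrib)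
      finally show ?thesis .
    qed
    also have "\<dots> \<le> 2 ^ k * (1 + real DIM('a) ^ k * (\<Sum>b\<in>Basis. \<bar>b \<bullet> \<xi>\<bar> ^ k))"
      by (intro mult_left_mono add_left_mono norm_power_le_sum_Basis) auto
    finally have "(1 + norm \<xi>) ^ k * ?F \<le> 2 ^ k * (1 + real DIM('a) ^ k * (\<Sum>b\<in>Basis. \<bar>b \<bullet> \<xi>\<bar> ^ k)) * ?F"
      by (rule mult_right_mono) simp
    also have "\<dots> = 2 ^ k * (?F + real DIM('a) ^ k * (\<Sum>b\<in>Basis. \<bar>b \<bullet> \<xi>\<bar> ^ k * ?F))"
      by (simp add: algebra_simps sum_distrib_left)
    also have "\<dots> \<le> C" unfolding C_def by (intro mult_left_mono add_mono C0 sum_mono C1) auto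
    finally show ?thesis .
  qed
  show ?thesis
  proof
    have "0 \<le> (1 + norm (0::'a)) ^ k * norm (fourier_tr (\<lambda>y. \<psi> (0, y)) (0::'a))" by simp
    also have "\<dots> \<le> C" by (rule main)
    finally show "C \<ge> 0" .
    fix t and \<xi> :: 'a
    have p: "1 + norm \<xi> > 0" by (simp add: add_pos_nonneg)
    have "(1 + norm \<xi>) powr (- (real DIM('a) + 3)) = inverse ((1 + norm \<xi>) ^ k)"
      using p by (simp only: powr_minus) (simp add: k_def powr_realpow[symmetric] add.commute)
    note e = this
    show "norm (fourier_tr (\<lambda>y. \<psi> (t, y)) \<xi>) \<le> C * (1 + norm \<xi>) powr (- (real DIM('a) + 3))"
      unfolding e using main[of \<xi> t] p by (simp add: field_simps)
  qed
qed

lemma fourier_tr_slice_measurable: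
  fixes \<psi> :: "real \<times> 'a::euclidean_space \<Rightarrow> real"
  assumes "csmooth \<psi>" and [measurable]: "f \<in> borel_measurable M" "g \<in> borel_measurable M"
  shows "(\<lambda>z. fourier_tr (\<lambda>y. \<psi> (f z, y)) (g z)) \<in> borel_measurable M"
proof -
  have "\<psi> \<in> borel_measurable (borel \<Otimes>\<^sub>M borel)"
    using csmooth_measurable[OF assms(1)] by (simp add: borel_prod)
  note [measurable] = this
  show ?thesis unfolding fourier_tr_def by measurable
qed

text \<open>Quadratic growth of \<open>w\<close> covers the constant 1, the Laplacian symbol and,
  since s is below 1, \<open>norm \<xi> powr (2 * s)\<close>.\<close>

lemma integrable_fourier_tr_slice:
  fixes \<psi> :: "real \<times> 'a::euclidean_space \<Rightarrow> real"
  assumes "csmooth \<psi>" and [measurable]: "w \<in> borel_measurable borel" and w: "\<And>\<xi>. \<bar>w \<xi>\<bar> \<le> (1 + norm \<xi>)\<^sup>2"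
  shows "integrable lborel (\<lambda>\<xi>. complex_of_real (w \<xi>) * fourier_tr (\<lambda>y. \<psi> (t, y)) \<xi>)"
proof -
  obtain C where C: "C \<ge> 0" "\<And>t \<xi>. norm (fourier_tr (\<lambda>y. \<psi> (t, y)) \<xi>) \<le> C * (1 + norm \<xi>) powr (- (real DIM('a) + 3))"
    using fourier_tr_slice_decay[OF assms(1)] by metis
  have [measurable]: "(\<lambda>\<xi>. fourier_tr (\<lambda>y. \<psi> (t, y)) \<xi>) \<in> borel_measurable borel"
    by (rule fourier_tr_slice_measurable[OF assms(1)]) auto
  have i: "integrable lborel (\<lambda>\<xi>::'a. C * (1 + norm \<xi>) powr (- (real DIM('a) + 1)))"
    by (intro integrable_mult_right integrable_one_plus_norm_powr_1)
  show ?thesis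
  proof (rule Bochner_Integration.integrable_bound[OF i])
    show "AE \<xi> in lborel. norm (complex_of_real (w \<xi>) * fourier_tr (\<lambda>y. \<psi> (t, y)) \<xi>) \<le> norm (C * (1 + norm \<xi>) powr (- (real DIM('a) + 1)))"
    proof (rule AE_I2)
      fix \<xi> :: 'a
      have p: "1 + norm \<xi> > 0" by (simp add: add_pos_nonneg)
      have "norm (complex_of_real (w \<xi>) * fourier_tr (\<lambda>y. \<psi> (t, y)) \<xi>) \<le> (1 + norm \<xi>)\<^sup>2 * (C * (1 + norm \<xi>) powr (- (real DIM('a) + 3)))"
        unfolding norm_mult norm_of_real by (intro mult_mono w C) auto
      also have "\<dots> = C * ((1 + norm \<xi>) powr 2 * (1 + norm \<xi>) powr (- (real DIM('a) + 3)))" using p by simp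
      also have "(1 + norm \<xi>) powr 2 * (1 + norm \<xi>) powr (- (real DIM('a) + 3)) = (1 + norm \<xi>) powr (- (real DIM('a) + 1))"
        by (simp only: powr_add[symmetric]) (simp add: algebra_simps)
      finally show "norm (complex_of_real (w \<xi>) * fourier_tr (\<lambda>y. \<psi> (t, y)) \<xi>) \<le> norm (C * (1 + norm \<xi>) powr (- (real DIM('a) + 1)))"
        using C(1) by simp
    qed
  qed measurable
qed

lemma fourier_inversion_slice:
  fixes \<psi> :: "real \<times> 'a::euclidean_space \<Rightarrow> real"
  assumes "csmooth \<psi>"
  shows "integrable lborel (fourier_tr (\<lambda>y. \<psi> (t, y)))" "inv_ft (fourier_tr (\<lambda>y. \<psi> (t, y))) x = \<psi> (t, x)"
proof -
  show i: "integrable lborel (fourier_tr (\<lambda>y. \<psi> (t, y)))"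
    using integrable_fourier_tr_slice[OF assms, of "\<lambda>_. 1" t] by (simp add: one_le_power)
  obtain R B where 1: "\<And>t x. \<bar>\<psi> (t, x)\<bar> \<le> B" using csmooth_slice_bounds[OF assms] by metis
  have "isCont (\<lambda>y. \<psi> (t, y)) x" using continuous_slice[OF assms, of UNIV t] by (simp add: continuous_on_eq_continuous_at)
  from fourier_inversion[OF integrable_slice[OF assms] 1 this i]
  show "inv_ft (fourier_tr (\<lambda>y. \<psi> (t, y))) x = \<psi> (t, x)" .
qed

definition lapl :: "(real \<times> 'a::euclidean_space \<Rightarrow> real) \<Rightarrow> real \<times> 'a \<Rightarrow> real" where
  "lapl \<psi> p = (\<Sum>b\<in>Basis. ddir (0, b) (ddir (0, b) \<psi>) p)"

lemma lapl_slice: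
  fixes \<psi> :: "real \<times> 'a::euclidean_space \<Rightarrow> real"
  assumes c: "csmooth \<psi>"
  shows "integrable lborel (\<lambda>\<xi>. complex_of_real ((norm \<xi>)\<^sup>2) * fourier_tr (\<lambda>y. \<psi> (t, y)) \<xi>)"
    "inv_ft (\<lambda>\<xi>. complex_of_real ((norm \<xi>)\<^sup>2) * fourier_tr (\<lambda>y. \<psi> (t, y)) \<xi>) x = - lapl \<psi> (t, x)"
proof -
  let ?m = "fourier_tr (\<lambda>y. \<psi> (t, y))"
  have c2: "csmooth (ddir (0, b) (ddir (0, b) \<psi>))" for b by (intro csmooth_ddir c)
  show i: "integrable lborel (\<lambda>\<xi>. complex_of_real ((norm \<xi>)\<^sup>2) * ?m \<xi>)"
    by (rule integrable_fourier_tr_slice[OF c]) (auto intro!: power_mono)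
  have ft: "fourier_tr (\<lambda>y. lapl \<psi> (t, y)) \<xi> = - (complex_of_real ((norm \<xi>)\<^sup>2) * ?m \<xi>)" for \<xi>
  proof -
    have "fourier_tr (\<lambda>y. lapl \<psi> (t, y)) \<xi> = (\<Sum>b\<in>Basis. fourier_tr (\<lambda>y. ddir (0, b) (ddir (0, b) \<psi>) (t, y)) \<xi>)"
      unfolding fourier_tr_def lapl_def of_real_sum sum_distrib_right
      by (rule Bochner_Integration.integral_sum) (use integrable_slice[OF c2] in \<open>auto intro!: integrable_mult_cis(2)\<close>)
    also have "\<dots> = (\<Sum>b\<in>Basis. - (complex_of_real ((b \<bullet> \<xi>)\<^sup>2)) * ?m \<xi>)"
    proof (intro sum.cong refl)
      fix b :: 'a
      have "\<i> * z * (\<i> * z * w) = (\<i> * \<i>) * (z * z) * w" for z w :: complex by (simp only: mult_ac)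
      then show "fourier_tr (\<lambda>y. ddir (0, b) (ddir (0, b) \<psi>) (t, y)) \<xi> = - (complex_of_real ((b \<bullet> \<xi>)\<^sup>2)) * ?m \<xi>"
        by (simp add: fourier_tr_ddir c csmooth_ddir power2_eq_square)
    qed
    also have "\<dots> = - complex_of_real (\<Sum>b\<in>Basis. (b \<bullet> \<xi>)\<^sup>2) * ?m \<xi>"
      by (simp add: sum_distrib_right sum_negf)
    also have "(\<Sum>b\<in>Basis. (b \<bullet> \<xi>)\<^sup>2) = (norm \<xi>)\<^sup>2"
      unfolding power2_norm_eq_inner by (subst euclidean_inner[of \<xi> \<xi>]) (simp add: power2_eq_square inner_commute)
    finally show ?thesis by simp
  qed
  have il: "integrable lborel (\<lambda>y. lapl \<psi> (t, y))"
    unfolding lapl_def by (intro Bochner_Integration.integrable_sum integrable_slice c2)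
  have cl: "isCont (\<lambda>y. lapl \<psi> (t, y)) x"
    unfolding lapl_def by (intro continuous_sum) (use continuous_slice[OF c2, where S=UNIV and t=t] in \<open>simp add: continuous_on_eq_continuous_at\<close>)
  have "\<exists>B. \<forall>y. \<bar>ddir (0, b) (ddir (0, b) \<psi>) (t, y)\<bar> \<le> B" for b using csmooth_slice_bounds[OF c2[of b]] by metis
  then obtain Bf where Bf: "\<And>b y. \<bar>ddir (0, b) (ddir (0, b) \<psi>) (t, y)\<bar> \<le> Bf b" by metis
  have bl: "\<bar>lapl \<psi> (t, y)\<bar> \<le> (\<Sum>b\<in>Basis. Bf b)" for y
    unfolding lapl_def by (rule order_trans[OF sum_abs sum_mono[OF Bf]])
  have ii: "integrable lborel (fourier_tr (\<lambda>y. lapl \<psi> (t, y)))"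
    using integrable_minus[OF i] by (simp add: ft[abs_def])
  have "lapl \<psi> (t, x) = inv_ft (fourier_tr (\<lambda>y. lapl \<psi> (t, y))) x"
    using fourier_inversion[OF il bl cl ii] by simp
  also have "fourier_tr (\<lambda>y. lapl \<psi> (t, y)) = (\<lambda>\<xi>. complex_of_real (- 1) * (complex_of_real ((norm \<xi>)\<^sup>2) * ?m \<xi>))"
    by (auto simp: ft)
  also have "inv_ft \<dots> x = - inv_ft (\<lambda>\<xi>. complex_of_real ((norm \<xi>)\<^sup>2) * ?m \<xi>) x"
    unfolding inv_ft_cmult by simp
  finally show "inv_ft (\<lambda>\<xi>. complex_of_real ((norm \<xi>)\<^sup>2) * ?m \<xi>) x = - lapl \<psi> (t, x)" by simp
qed

text \<open>The constant depends on the bound and the radius alone and is fixed before the function,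
  so one constant serves all time slices.\<close>

lemma bounded_support_le_wt:
  assumes s: "0 < s" and B: "B \<ge> 0"
  obtains A where "A \<ge> 0" "\<And>(f :: 'a::euclidean_space \<Rightarrow> real) x. (\<And>x. \<bar>f x\<bar> \<le> B) \<Longrightarrow> (\<And>x. norm x > R \<Longrightarrow> f x = 0) \<Longrightarrow> \<bar>f x\<bar> \<le> A * wt s x"
proof -
  let ?p = "real DIM('a) + 2 * s"
  have p: "?p > 0" using s by (simp add: add_nonneg_pos)
  obtain c where c: "c > 0" "\<And>x::'a. c * (1 + norm x) powr (- ?p) \<le> wt s x" using wt_ge[OF s, where 'a='a] by blast
  define d where "d = c * (1 + \<bar>R\<bar>) powr (- ?p)"
  have d: "d > 0" using c by (auto simp: d_def add_nonneg_eq_0_iff)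
  show ?thesis
  proof
    show "B / d \<ge> 0" using B d by simp
    fix f :: "'a \<Rightarrow> real" and x assume f: "\<And>x. \<bar>f x\<bar> \<le> B" "\<And>x. norm x > R \<Longrightarrow> f x = 0"
    show "\<bar>f x\<bar> \<le> B / d * wt s x"
    proof (cases "norm x > R")
      case True
      then show ?thesis using f(2) B d wt_nonneg[of s x] by simp
    next
      case False
      have "(1 + \<bar>R\<bar>) powr (- ?p) \<le> (1 + norm x) powr (- ?p)"
        using False p norm_ge_zero[of x] by (intro powr_mono2') (auto simp del: norm_ge_zero)
      then have "d \<le> wt s x" using c(2)[of x] mult_left_mono[of _ _ c] c(1) unfolding d_def by (meson less_imp_le order_trans)
      then have "B / d * d \<le> B / d * wt s x" using B d by (intro mult_left_mono) auto
      then show ?thesis using f(1)[of x] d by simp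
    qed
  qed
qed

lemma csmooth_le_wt:
  fixes \<psi> :: "real \<times> 'a::euclidean_space \<Rightarrow> real"
  assumes s: "0 < s" and c: "csmooth \<psi>"
  obtains A where "A \<ge> 0" "\<And>t x. \<bar>\<psi> (t, x)\<bar> \<le> A * wt s x"
proof -
  obtain R B where 1: "\<And>t x. \<bar>\<psi> (t, x)\<bar> \<le> B" "\<And>t x. norm x > R \<Longrightarrow> \<psi> (t, x) = 0" "B \<ge> 0" using csmooth_slice_bounds[OF c] by metis
  obtain A where A: "A \<ge> 0" "\<And>(f :: 'a \<Rightarrow> real) x. (\<And>x. \<bar>f x\<bar> \<le> B) \<Longrightarrow> (\<And>x. norm x > R \<Longrightarrow> f x = 0) \<Longrightarrow> \<bar>f x\<bar> \<le> A * wt s x"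
    using bounded_support_le_wt[OF s 1(3), where R=R and 'a='a] by metis
  show ?thesis using that[OF A(1)] A(2)[of "\<lambda>x. \<psi> (t, x)" for t] 1 by blast
qed

lemma powr_2s_le: "0 < s \<Longrightarrow> s < 1 \<Longrightarrow> \<bar>norm \<xi> powr (2 * s)\<bar> \<le> (1 + norm \<xi>)\<^sup>2"
proof -
  assume s: "0 < s" "s < 1"
  have "norm \<xi> powr (2 * s) \<le> (1 + norm \<xi>) powr (2 * s)" using s by (intro powr_mono2) auto
  also have "\<dots> \<le> (1 + norm \<xi>) powr 2" using s by (intro powr_mono) auto
  finally show ?thesis by (simp add: add_pos_nonneg)
qed

lemma frac_lap_slice_integrable:
  fixes \<psi> :: "real \<times> 'a::euclidean_space \<Rightarrow> real"
  assumes "0 < s" "s < 1" "csmooth \<psi>"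
  shows "integrable lborel (\<lambda>\<xi>. complex_of_real (norm \<xi> powr (2 * s)) * fourier_tr (\<lambda>y. \<psi> (t, y)) \<xi>)"
  by (rule integrable_fourier_tr_slice[OF assms(3)]) (use powr_2s_le assms in auto)

text \<open>The slice and its Laplacian are bounded with compact support, hence bounded by
  \<open>wt s\<close>; \<open>frac_symbol_bound\<close> transfers this to the nonlocal operator,
  uniformly in t.\<close>

lemma frac_lap_slice_bound:
  fixes \<psi> :: "real \<times> 'a::euclidean_space \<Rightarrow> real"
  assumes s: "0 < s" "s < 1" and c: "csmooth \<psi>"
  obtains A where "A \<ge> 0" "\<And>t x. \<bar>frac_lap s (\<lambda>y. \<psi> (t, y)) x\<bar> \<le> A * wt s x"
proof -
  obtain A1 where A1: "A1 \<ge> 0" "\<And>t x. \<bar>\<psi> (t, x)\<bar> \<le> A1 * wt s x" using csmooth_le_wt[OF s(1) c] by metis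
  have "\<exists>A. A \<ge> 0 \<and> (\<forall>t x. \<bar>ddir (0, b) (ddir (0, b) \<psi>) (t, x)\<bar> \<le> A * wt s x)" for b
    using csmooth_le_wt[OF s(1) csmooth_ddir[OF csmooth_ddir[OF c]], of "(0, b)" "(0, b)"] by metis
  then obtain Af where Af: "\<And>b. Af b \<ge> 0" "\<And>b t x. \<bar>ddir (0, b) (ddir (0, b) \<psi>) (t, x)\<bar> \<le> Af b * wt s x" by metis
  define A where "A = A1 + (\<Sum>b\<in>Basis. Af b)"
  have A: "A \<ge> 0" "A1 \<le> A" "(\<Sum>b\<in>Basis. Af b) \<le> A" using A1 Af by (auto simp: A_def intro!: add_nonneg_nonneg sum_nonneg)
  have l: "\<bar>lapl \<psi> (t, x)\<bar> \<le> A * wt s x" for t x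
  proof -
    have "\<bar>lapl \<psi> (t, x)\<bar> \<le> (\<Sum>b\<in>Basis. Af b * wt s x)"
      unfolding lapl_def by (rule order_trans[OF sum_abs sum_mono[OF Af(2)]])
    also have "\<dots> = (\<Sum>b\<in>Basis. Af b) * wt s x" by (simp add: sum_distrib_right)
    also have "\<dots> \<le> A * wt s x" by (intro mult_right_mono A wt_nonneg)
    finally show ?thesis .
  qed
  have p: "\<bar>\<psi> (t, x)\<bar> \<le> A * wt s x" for t x
    using order_trans[OF A1(2) mult_right_mono[OF A(2) wt_nonneg]] .
  have "\<bar>frac_lap s (\<lambda>y. \<psi> (t, y)) x\<bar> \<le> fracC s * A * wt s x" for t x
    unfolding frac_lap_eq_inv_ft
    by (rule frac_symbol_bound[OF s fourier_inversion_slice(1)[OF c] lapl_slice(1)[OF c]])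
      (simp_all add: fourier_inversion_slice(2)[OF c] p lapl_slice(2)[OF c, simplified] l)
  moreover have "fracC s * A \<ge> 0" using fracC_pos[OF s] A by simp
  ultimately show ?thesis using that by blast
qed

lemma frac_lap_slice_measurable:
  fixes \<psi> :: "real \<times> 'a::euclidean_space \<Rightarrow> real"
  assumes c: "csmooth \<psi>" and [measurable]: "f \<in> borel_measurable M" "g \<in> borel_measurable M"
  shows "(\<lambda>z. frac_lap s (\<lambda>y. \<psi> (f z, y)) (g z)) \<in> borel_measurable M"
proof -
  have [measurable]: "(\<lambda>z. fourier_tr (\<lambda>y. \<psi> (f (fst z), y)) (snd z :: 'a)) \<in> borel_measurable (M \<Otimes>\<^sub>M lborel)"
    by (rule fourier_tr_slice_measurable[OF c]) auto
  have "(\<lambda>z. LINT \<xi>|lborel. complex_of_real (norm \<xi> powr (2 * s)) * fourier_tr (\<lambda>y. \<psi> (f z, y)) \<xi> * cis (g z \<bullet> \<xi>)) \<in> borel_measurable M"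
    by measurable
  then show ?thesis unfolding frac_lap_def by measurable
qed

section \<open>Existence\<close>

lemma integrable_powr_heat_symbol:
  assumes s: "0 < s" and a: "0 < a"
  shows "integrable lborel (\<lambda>\<xi>::'a::euclidean_space. norm \<xi> powr (2 * s) * exp (- a * norm \<xi> powr (2 * s)))"
proof -
  have i: "integrable lborel (\<lambda>\<xi>::'a. (2 / a) * exp (- (a / 2) * norm \<xi> powr (2 * s)))"
    using a by (intro integrable_mult_right integrable_heat_symbol[OF s]) auto
  have le: "l * exp (- a * l) \<le> (2 / a) * exp (- (a / 2) * l)" if "l \<ge> 0" for l :: real
  proof -
    have "a / 2 * l \<le> exp (a / 2 * l)" using exp_ge_add_one_self[of "a / 2 * l"] by linarith
    then have "l \<le> (2 / a) * exp (a / 2 * l)" using a by (simp add: field_simps)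
    then have "l * exp (- a * l) \<le> (2 / a) * exp (a / 2 * l) * exp (- a * l)" by (intro mult_right_mono) auto
    also have "\<dots> = (2 / a) * exp (- (a / 2) * l)" by (simp add: mult.assoc exp_add[symmetric])
    finally show ?thesis .
  qed
  show ?thesis
    by (rule Bochner_Integration.integrable_bound[OF i]) (use le a in \<open>auto intro!: AE_I2 order_trans[OF _ abs_ge_self]\<close>)
qed

text \<open>Moves a space-time pairing with a kernel of time-dependent symbol to the Fourier side
  with \<xi> as outer variable. A time derivative on \<open>F\<close> can then be shifted for each
  fixed frequency separately.\<close>

lemma kernel_pairing:
  fixes F :: "real \<times> 'a::euclidean_space \<Rightarrow> real" and h :: "real \<Rightarrow> 'a \<Rightarrow> real"
  assumes F [measurable]: "F \<in> borel_measurable borel" and h: "case_prod h \<in> borel_measurable (borel \<Otimes>\<^sub>M borel)"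
    and B: "integrable lborel B" and w: "integrable lborel w"
    and le: "\<And>t x \<xi>. \<bar>F (t, x) * h t \<xi>\<bar> \<le> B (t, x) * w \<xi>"
  shows "integrable lborel (\<lambda>p. F p * inv_ft (\<lambda>\<xi>. complex_of_real (h (fst p) \<xi>)) (y - snd p))"
    and "(LINT p|lborel. F p * inv_ft (\<lambda>\<xi>. complex_of_real (h (fst p) \<xi>)) (y - snd p))
      = Re (complex_of_real ((2 * pi) powr (- real DIM('a))) * (LINT \<xi>|lborel. cis (y \<bullet> \<xi>) *
           (LINT p|lborel. complex_of_real (F p * h (fst p) \<xi>) * cis (- (snd p \<bullet> \<xi>)))))"
proof -
  let ?c = "complex_of_real ((2 * pi) powr (- real DIM('a)))"
  let ?G = "\<lambda>p \<xi>. ?c * (complex_of_real (F p * h (fst p) \<xi>) * cis ((y - snd p) \<bullet> \<xi>))"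
  note [measurable] = h
  have [measurable]: "F \<in> borel_measurable (borel \<Otimes>\<^sub>M borel)" using F by (simp add: borel_prod)
  have Gm: "case_prod ?G \<in> borel_measurable (lborel \<Otimes>\<^sub>M lborel)"
    unfolding lborel_prod[symmetric, where 'a=real and 'b='a] by measurable
  have G: "integrable (lborel \<Otimes>\<^sub>M lborel) (case_prod ?G)"
  proof (rule lborel_pair.integrable_product_bound[OF _ w Gm])
    show "integrable lborel (\<lambda>p. norm ?c * B p)" using B by (rule integrable_mult_right)
    fix p :: "real \<times> 'a" and \<xi> :: 'a
    have "norm (case (p, \<xi>) of (p, \<xi>) \<Rightarrow> ?G p \<xi>) = norm ?c * \<bar>F p * h (fst p) \<xi>\<bar>"
      unfolding prod.case norm_mult norm_cis norm_of_real by simp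
    also have "\<dots> \<le> norm ?c * (B p * w \<xi>)"
      using le[of "fst p" "snd p" \<xi>] by (intro mult_left_mono) auto
    finally show "norm (case (p, \<xi>) of (p, \<xi>) \<Rightarrow> ?G p \<xi>) \<le> norm ?c * B p * w \<xi>" by (simp add: mult.assoc)
  qed
  have 1: "F p * inv_ft (\<lambda>\<xi>. complex_of_real (h (fst p) \<xi>)) (y - snd p) = Re (LINT \<xi>|lborel. ?G p \<xi>)" for p
  proof -
    have "(LINT \<xi>|lborel. ?G p \<xi>) = ?c * (LINT \<xi>|lborel. complex_of_real (F p) * (complex_of_real (h (fst p) \<xi>) * cis ((y - snd p) \<bullet> \<xi>)))"
      unfolding integral_mult_right_zero by (simp add: mult.assoc)
    also have "\<dots> = complex_of_real (F p) * (?c * (LINT \<xi>|lborel. complex_of_real (h (fst p) \<xi>) * cis ((y - snd p) \<bullet> \<xi>)))"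
      unfolding integral_mult_right_zero by (simp add: mult_ac)
    finally show ?thesis by (simp add: inv_ft_def inv_ftc_def)
  qed
  have 2: "integrable lborel (\<lambda>p. LINT \<xi>|lborel. ?G p \<xi>)"
    using lborel_pair.integrable_fst[OF G] by simp
  then show "integrable lborel (\<lambda>p. F p * inv_ft (\<lambda>\<xi>. complex_of_real (h (fst p) \<xi>)) (y - snd p))"
    unfolding 1 by (rule integrable_Re)
  have "(LINT p|lborel. F p * inv_ft (\<lambda>\<xi>. complex_of_real (h (fst p) \<xi>)) (y - snd p)) = Re (LINT p|lborel. LINT \<xi>|lborel. ?G p \<xi>)"
    unfolding 1 using 2 by (rule integral_Re)
  also have "(LINT p|lborel. LINT \<xi>|lborel. ?G p \<xi>) = (LINT \<xi>|lborel. LINT p|lborel. ?G p \<xi>)"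
    using lborel_pair.Fubini_integral[OF G] by simp
  also have "(\<lambda>\<xi>. LINT p|lborel. ?G p \<xi>) = (\<lambda>\<xi>. ?c * (cis (y \<bullet> \<xi>) * (LINT p|lborel. complex_of_real (F p * h (fst p) \<xi>) * cis (- (snd p \<bullet> \<xi>)))))"
  proof
    fix \<xi>
    have "?G p \<xi> = ?c * (cis (y \<bullet> \<xi>) * (complex_of_real (F p * h (fst p) \<xi>) * cis (- (snd p \<bullet> \<xi>))))" for p
    proof -
      have "cis ((y - snd p) \<bullet> \<xi>) = cis (y \<bullet> \<xi>) * cis (- (snd p \<bullet> \<xi>))" by (simp add: cis_mult inner_diff_left)
      then show ?thesis by (simp only: mult_ac)
    qed
    then show "(LINT p|lborel. ?G p \<xi>) = ?c * (cis (y \<bullet> \<xi>) * (LINT p|lborel. complex_of_real (F p * h (fst p) \<xi>) * cis (- (snd p \<bullet> \<xi>))))"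
      by (simp only: integral_mult_right_zero)
  qed
  finally show "(LINT p|lborel. F p * inv_ft (\<lambda>\<xi>. complex_of_real (h (fst p) \<xi>)) (y - snd p))
      = Re (?c * (LINT \<xi>|lborel. cis (y \<bullet> \<xi>) * (LINT p|lborel. complex_of_real (F p * h (fst p) \<xi>) * cis (- (snd p \<bullet> \<xi>)))))"
    by (simp only: integral_mult_right_zero)
qed

text \<open>At a fixed frequency, with \<open>l\<close> in the role of |\<xi>|^(2s), this is
  integration by parts in time against \<open>exp (- t * l)\<close>; compact support removes the
  boundary terms.\<close>

lemma time_derivative_pairing:
  fixes \<psi> :: "real \<times> 'a::euclidean_space \<Rightarrow> real"
  assumes c: "csmooth \<psi>"
  shows "(LINT p|lborel. complex_of_real (ddir (1, 0) \<psi> p * exp (- fst p * l)) * cis (- (snd p \<bullet> \<xi>)))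
       = (LINT p|lborel. complex_of_real (\<psi> p * (l * exp (- fst p * l))) * cis (- (snd p \<bullet> \<xi>)))"
proof -
  note c' = csmooth_ddir[OF c, of "(1, 0)"]
  have sm: "smooth_fun \<psi>" "smooth_fun (ddir (1, 0) \<psi>)" using c c' by (simp_all add: csmooth_def)
  let ?g = "\<lambda>p. complex_of_real (\<psi> p * exp (- fst p * l)) * cis (- (snd p \<bullet> \<xi>))"
  let ?g1 = "\<lambda>p. complex_of_real (ddir (1, 0) \<psi> p * exp (- fst p * l)) * cis (- (snd p \<bullet> \<xi>))"
  let ?g2 = "\<lambda>p. complex_of_real (\<psi> p * (l * exp (- fst p * l))) * cis (- (snd p \<bullet> \<xi>))"
  obtain R B where 1: "\<And>x. \<bar>\<psi> x\<bar> \<le> B" "\<And>x. norm x > R \<Longrightarrow> \<psi> x = 0" "B \<ge> 0" "R > 0" using csmooth_bounds[OF c] by metis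
  obtain R' B' where 2: "\<And>x. \<bar>ddir (1, 0) \<psi> x\<bar> \<le> B'" "\<And>x. norm x > R' \<Longrightarrow> ddir (1, 0) \<psi> x = 0" "B' \<ge> 0"
    using csmooth_bounds[OF c'] by metis
  \<comment> \<open>The exponential is unbounded on all of space-time; on the supports, where |t| is
    at most \<open>max R R'\<close>, this bounds it.\<close>
  define M where "M = exp (max R R' * \<bar>l\<bar>)"
  have M: "exp (- fst p * l) \<le> M" if "norm p \<le> max R R'" for p :: "real \<times> 'a"
  proof -
    have "\<bar>fst p\<bar> \<le> norm p" using norm_fst_le[of "fst p" "snd p"] by simp
    then have "\<bar>fst p * l\<bar> \<le> max R R' * \<bar>l\<bar>" unfolding abs_mult using that by (intro mult_right_mono) auto
    then have "- (fst p * l) \<le> max R R' * \<bar>l\<bar>" by linarith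
    then show ?thesis by (simp add: M_def)
  qed
  have n1: "norm (?g p) \<le> B * M" for p
  proof (cases "norm p \<le> max R R'")
    case True
    then show ?thesis using M[OF True] 1(1)[of p] 1(3) by (auto simp: norm_mult intro!: mult_mono)
  next
    case False then show ?thesis using 1 by (simp add: M_def)
  qed
  have n2: "norm (?g1 p) \<le> B' * M" for p
  proof (cases "norm p \<le> max R R'")
    case True
    then show ?thesis using M[OF True] 2(1)[of p] 2(3) by (auto simp: norm_mult intro!: mult_mono)
  next
    case False then show ?thesis using 2 by (simp add: M_def)
  qed
  have n3: "norm (?g2 p) \<le> \<bar>l\<bar> * (B * M)" for p
  proof -
    have "norm (?g2 p) = \<bar>l\<bar> * norm (?g p)" by (simp add: norm_mult abs_mult)
    then show ?thesis using n1[of p] by (simp add: mult_left_mono)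
  qed
  have cont: "continuous_on UNIV ?g" "continuous_on UNIV ?g1" "continuous_on UNIV ?g2"
    by (intro continuous_intros smooth_fun_continuous sm)+
  have "(LINT p|lborel. ?g1 p - ?g2 p) = 0"
  proof (rule integral_directional_derivative[where g="?g" and v="(1, 0)" and R="max R R'" and B="B * M + B' * M + \<bar>l\<bar> * (B * M)"])
    fix p :: "real \<times> 'a" and h :: real
    let ?q = "p + h *\<^sub>R (1, 0)"
    have a: "((\<lambda>h. \<psi> (p + h *\<^sub>R (1, 0))) has_real_derivative ddir (1, 0) \<psi> ?q) (at h)"
      unfolding has_real_derivative_iff_has_vector_derivative by (rule ddir_line[OF sm(1)])
    have "((\<lambda>h. exp (- (fst p + h) * l)) has_real_derivative - l * exp (- (fst p + h) * l)) (at h)"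
      by (auto intro!: derivative_eq_intros)
    from DERIV_mult[OF a this]
    have "((\<lambda>h. \<psi> (p + h *\<^sub>R (1, 0)) * exp (- (fst p + h) * l)) has_vector_derivative ddir (1, 0) \<psi> ?q * exp (- (fst p + h) * l) - \<psi> ?q * (l * exp (- (fst p + h) * l))) (at h)"
      by (simp add: has_real_derivative_iff_has_vector_derivative algebra_simps)
    from bounded_linear.has_vector_derivative[OF bounded_linear_of_real this]
    have "((\<lambda>h. complex_of_real (\<psi> (p + h *\<^sub>R (1, 0)) * exp (- (fst p + h) * l))) has_vector_derivative complex_of_real (ddir (1, 0) \<psi> ?q * exp (- (fst p + h) * l) - \<psi> ?q * (l * exp (- (fst p + h) * l)))) (at h)" .
    from has_vector_derivative_mult[OF this has_vector_derivative_const[of "cis (- (snd p \<bullet> \<xi>))"]]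
    show "((\<lambda>h. ?g (p + h *\<^sub>R (1, 0))) has_vector_derivative (?g1 ?q - ?g2 ?q)) (at h)"
      by (simp add: algebra_simps)
  next
    show "norm (?g p) \<le> B * M + B' * M + \<bar>l\<bar> * (B * M)" for p
    proof -
      have "0 \<le> B' * M" "0 \<le> \<bar>l\<bar> * (B * M)" using 1 2 by (simp_all add: M_def)
      then show ?thesis using n1[of p] by linarith
    qed
    show "norm (?g1 p - ?g2 p) \<le> B * M + B' * M + \<bar>l\<bar> * (B * M)" for p
    proof -
      have "0 \<le> B * M" using 1 by (simp add: M_def)
      then show ?thesis using norm_triangle_ineq4[of "?g1 p" "?g2 p"] n2[of p] n3[of p] by linarith
    qed
  qed (use 1 2 cont in \<open>auto intro: continuous_on_diff\<close>)
  moreover have "integrable lborel ?g1"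
    by (rule integrable_bounded_support[OF borel_measurable_continuous_onI[OF cont(2)] n2, of R']) (use 2 in auto)
  moreover have "integrable lborel ?g2"
    by (rule integrable_bounded_support[OF borel_measurable_continuous_onI[OF cont(3)] n3, of R]) (use 1 in auto)
  ultimately show ?thesis by simp
qed

lemma test_fun_csmooth: "test_fun T \<psi> \<Longrightarrow> csmooth \<psi>"
  by (simp add: test_fun_def csmooth_def)

text \<open>The positive distance \<open>a\<close> to the initial time comes from compactness. It
  lets \<open>exp (- a * norm \<xi> powr (2 * s))\<close> dominate the heat symbol on the whole
  support, while at time 0 itself the symbol is not integrable.\<close>

lemma test_fun_time_support:
  fixes \<psi> :: "real \<times> 'a::euclidean_space \<Rightarrow> real"
  assumes "test_fun T \<psi>"
  obtains a where "a > 0" "\<And>t x. t < a \<Longrightarrow> \<psi> (t, x) = 0" "\<And>v t x. t < a \<Longrightarrow> ddir v \<psi> (t, x) = 0"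
    "\<And>t x. t \<ge> T \<Longrightarrow> \<psi> (t, x) = 0" "\<And>v t x. t \<ge> T \<Longrightarrow> ddir v \<psi> (t, x) = 0"
proof -
  let ?K = "closure {p. \<psi> p \<noteq> 0}"
  have K: "compact ?K" "?K \<subseteq> {0<..<T} \<times> UNIV" using assms by (auto simp: test_fun_def)
  have z: "\<psi> p = 0" if "p \<notin> ?K" for p using that closure_subset[of "{p. \<psi> p \<noteq> 0}"] by blast
  have "\<exists>a>0. \<forall>p\<in>?K. a \<le> fst p"
  proof (cases "?K = {}")
    case True then show ?thesis unfolding True by (intro exI[of _ 1]) auto
  next
    case False
    have "continuous_on ?K fst" by (intro continuous_intros)
    from continuous_attains_inf[OF K(1) False this] obtain q where q: "q \<in> ?K" "\<forall>p\<in>?K. fst q \<le> fst p" by blast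
    then show ?thesis using K(2) by (intro exI[of _ "fst q"]) auto
  qed
  then obtain a where a: "a > 0" "\<And>p. p \<in> ?K \<Longrightarrow> a \<le> fst p" by blast
  show ?thesis
  proof (rule that[of a])
    fix t x v
    have 1: "(t, x) \<notin> ?K" if "t < a" using a(2)[of "(t, x)"] that by auto
    have 2: "(t, x) \<notin> ?K" if "t \<ge> T" using K(2) that by auto
    show "\<psi> (t, x) = 0" "ddir v \<psi> (t, x) = 0" if "t < a" using z ddir_outside_support 1[OF that] by blast+
    show "\<psi> (t, x) = 0" "ddir v \<psi> (t, x) = 0" if "t \<ge> T" using z ddir_outside_support 2[OF that] by blast+
  qed (rule a)
qed

lemma deriv_eq_ddir:
  assumes "csmooth \<psi>" shows "deriv (\<lambda>t. \<psi> (t, x)) t = ddir (1, 0) \<psi> (t, x)"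
proof -
  have "((\<lambda>h. \<psi> ((0, x) + h *\<^sub>R (1, 0))) has_vector_derivative ddir (1, 0) \<psi> ((0, x) + t *\<^sub>R (1, 0))) (at t)"
    by (rule ddir_line) (use assms in \<open>simp add: csmooth_def\<close>)
  then have "((\<lambda>t. \<psi> (t, x)) has_real_derivative ddir (1, 0) \<psi> (t, x)) (at t)"
    by (simp add: has_real_derivative_iff_has_vector_derivative)
  then show ?thesis by (rule DERIV_imp_deriv)
qed

text \<open>The kernel with pole at y solves the equation weakly for every y, so integrating over y
  gives the potential of any measure. The symbol is even, so the pairing may be written as a
  convolution evaluated at y.\<close>

lemma heat_pairing_identity:
  fixes \<psi> :: "real \<times> 'a::euclidean_space \<Rightarrow> real"
  assumes s: "0 < s" "s < 1" and \<psi>: "test_fun T \<psi>"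
    and i: "integrable lborel (\<lambda>p. frac_heat_kernel s (fst p) (snd p - y) * frac_lap s (\<lambda>z. \<psi> (fst p, z)) (snd p))"
  shows "(LINT p|lborel. frac_heat_kernel s (fst p) (snd p - y) * ddir (1, 0) \<psi> p)
       = (LINT p|lborel. frac_heat_kernel s (fst p) (snd p - y) * frac_lap s (\<lambda>z. \<psi> (fst p, z)) (snd p))"
proof -
  note c = test_fun_csmooth[OF \<psi>]
  note c' = csmooth_ddir[OF c, of "(1, 0)"]
  obtain a where a: "a > 0" "\<And>t x. t < a \<Longrightarrow> \<psi> (t, x) = 0" "\<And>t x. t < a \<Longrightarrow> ddir (1, 0) \<psi> (t, x) = 0"
    using test_fun_time_support[OF \<psi>] by metis
  obtain R B where 1: "\<And>x. \<bar>\<psi> x\<bar> \<le> B" "\<And>x. norm x > R \<Longrightarrow> \<psi> x = 0" using csmooth_bounds[OF c] by metis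
  obtain R' B' where 2: "\<And>x. \<bar>ddir (1, 0) \<psi> x\<bar> \<le> B'" "\<And>x. norm x > R' \<Longrightarrow> ddir (1, 0) \<psi> x = 0" using csmooth_bounds[OF c'] by metis
  have i1: "integrable lborel \<psi>" by (rule integrable_bounded_support[OF csmooth_measurable[OF c], of B R]) (use 1 in auto)
  have i2: "integrable lborel (ddir (1, 0) \<psi>)" by (rule integrable_bounded_support[OF csmooth_measurable[OF c'], of B' R']) (use 2 in auto)
  let ?l = "\<lambda>\<xi>::'a. norm \<xi> powr (2 * s)"
  let ?E = "\<lambda>t \<xi>. exp (- t * ?l \<xi>)"
  let ?Q = "\<lambda>t \<xi>. ?l \<xi> * exp (- t * ?l \<xi>)"
  have E_le: "?E t \<xi> \<le> ?E a \<xi>" if "t \<ge> a" for t \<xi> using that by (simp add: mult_right_mono)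
  have P1: "\<And>t x \<xi>. \<bar>ddir (1, 0) \<psi> (t, x) * ?E t \<xi>\<bar> \<le> \<bar>ddir (1, 0) \<psi> (t, x)\<bar> * ?E a \<xi>"
    subgoal for t x \<xi> using E_le[of t \<xi>] a(3)[of t x] by (cases "t < a") (auto simp: abs_mult intro!: mult_left_mono) done
  have P2: "\<And>t x \<xi>. \<bar>\<psi> (t, x) * ?Q t \<xi>\<bar> \<le> \<bar>\<psi> (t, x)\<bar> * ?Q a \<xi>"
    subgoal for t x \<xi> using E_le[of t \<xi>] a(2)[of t x] by (cases "t < a") (auto simp: abs_mult intro!: mult_left_mono) done
  have m1: "case_prod ?E \<in> borel_measurable (borel \<Otimes>\<^sub>M borel)" by measurable
  have m2: "case_prod ?Q \<in> borel_measurable (borel \<Otimes>\<^sub>M borel)" by measurable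
  note K1 = kernel_pairing[OF csmooth_measurable[OF c'] m1 integrable_abs[OF i2] integrable_heat_symbol[OF s(1) a(1)] P1, of y]
  note K2 = kernel_pairing[OF csmooth_measurable[OF c] m2 integrable_abs[OF i1] integrable_powr_heat_symbol[OF s(1) a(1)] P2, of y]
  have "(LINT p|lborel. frac_heat_kernel s (fst p) (snd p - y) * ddir (1, 0) \<psi> p)
      = (LINT p|lborel. ddir (1, 0) \<psi> p * inv_ft (\<lambda>\<xi>. complex_of_real (?E (fst p) \<xi>)) (y - snd p))"
  proof (rule Bochner_Integration.integral_cong)
    fix p :: "real \<times> 'a"
    show "frac_heat_kernel s (fst p) (snd p - y) * ddir (1, 0) \<psi> p = ddir (1, 0) \<psi> p * inv_ft (\<lambda>\<xi>. complex_of_real (?E (fst p) \<xi>)) (y - snd p)"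
    proof (cases "fst p < a")
      case True then show ?thesis using a(3)[of "fst p" "snd p"] by simp
    next
      case False
      then have "frac_heat_kernel s (fst p) (snd p - y) = frac_heat_kernel s (fst p) (y - snd p)"
        using a(1) by (intro heat_kernel_even s) auto
      then show ?thesis by (simp add: frac_heat_kernel_eq_inv_ft)
    qed
  qed simp
  also have "\<dots> = (LINT p|lborel. \<psi> p * inv_ft (\<lambda>\<xi>. complex_of_real (?Q (fst p) \<xi>)) (y - snd p))"
    unfolding K1(2) K2(2) time_derivative_pairing[OF c] ..
  \<comment> \<open>After the time derivative has become the multiplier \<open>?l\<close>, one
    returns to slices. There the convolution theorem regroups the symbols and moves
    \<open>?l\<close> from the kernel to the test function.\<close>
  also have "\<dots> = (LINT t|lborel. LINT x|lborel. \<psi> (t, x) * inv_ft (\<lambda>\<xi>. complex_of_real (?Q t \<xi>)) (y - x))"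
    using lborel_pair.integral_fst'[of "\<lambda>p. \<psi> p * inv_ft (\<lambda>\<xi>. complex_of_real (?Q (fst p) \<xi>)) (y - snd p)"] K2(1)
    by (simp add: lborel_prod)
  also have "\<dots> = (LINT t|lborel. LINT x|lborel. frac_heat_kernel s t (x - y) * frac_lap s (\<lambda>z. \<psi> (t, z)) x)"
  proof (rule Bochner_Integration.integral_cong)
    fix t :: real
    show "(LINT x|lborel. \<psi> (t, x) * inv_ft (\<lambda>\<xi>. complex_of_real (?Q t \<xi>)) (y - x)) = (LINT x|lborel. frac_heat_kernel s t (x - y) * frac_lap s (\<lambda>z. \<psi> (t, z)) x)"
    proof (cases "t < a")
      case True
      then have "(\<lambda>z. \<psi> (t, z)) = (\<lambda>z. 0)" using a(2) by auto
      moreover have "frac_lap s (\<lambda>z::'a. 0) x = 0" for x by (simp add: frac_lap_def fourier_tr_def)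
      ultimately show ?thesis using True a(2) by simp
    next
      case False
      then have t: "t > 0" using a(1) by simp
      have iQ: "integrable lborel (\<lambda>\<xi>::'a. complex_of_real (?Q t \<xi>))"
        using integrable_powr_heat_symbol[OF s(1) t] by (rule integrable_of_real)
      have "(LINT x|lborel. \<psi> (t, x) * inv_ft (\<lambda>\<xi>. complex_of_real (?Q t \<xi>)) (y - x)) = inv_ft (\<lambda>\<xi>. complex_of_real (?Q t \<xi>) * fourier_tr (\<lambda>z. \<psi> (t, z)) \<xi>) y"
        by (rule conv_inv_ft'[OF integrable_slice[OF c] iQ])
      also have "\<dots> = inv_ft (\<lambda>\<xi>. complex_of_real (?E t \<xi>) * (complex_of_real (?l \<xi>) * fourier_tr (\<lambda>z. \<psi> (t, z)) \<xi>)) y"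
        by (rule arg_cong[where f="\<lambda>m. inv_ft m y"]) (simp add: fun_eq_iff mult_ac)
      also have "\<dots> = (LINT x|lborel. frac_heat_kernel s t (y - x) * frac_lap s (\<lambda>z. \<psi> (t, z)) x)"
        unfolding frac_lap_eq_inv_ft by (rule heat_conv_inv_ft(1)[OF s t frac_lap_slice_integrable[OF s c], symmetric])
      finally show ?thesis using heat_kernel_even[OF s t, of y] by simp
    qed
  qed simp
  also have "\<dots> = (LINT p|lborel. frac_heat_kernel s (fst p) (snd p - y) * frac_lap s (\<lambda>z. \<psi> (fst p, z)) (snd p))"
    using lborel_pair.integral_fst'[of "\<lambda>p. frac_heat_kernel s (fst p) (snd p - y) * frac_lap s (\<lambda>z. \<psi> (fst p, z)) (snd p)"] i
    by (simp add: lborel_prod)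
  finally show ?thesis .
qed

lemma test_fun_facts:
  fixes \<psi> :: "real \<times> 'a::euclidean_space \<Rightarrow> real"
  assumes s: "0 < s" "s < 1" and \<psi>: "test_fun T \<psi>"
  shows "ddir (1, 0) \<psi> \<in> borel_measurable borel"
    "(\<lambda>p. frac_lap s (\<lambda>y. \<psi> (fst p, y)) (snd p)) \<in> borel_measurable borel"
    "\<And>t x. t \<notin> {0<..<T} \<Longrightarrow> ddir (1, 0) \<psi> (t, x) = 0"
    "\<And>t x. t \<notin> {0<..<T} \<Longrightarrow> frac_lap s (\<lambda>y. \<psi> (t, y)) x = 0"
    "\<exists>A. \<forall>t x. \<bar>ddir (1, 0) \<psi> (t, x)\<bar> \<le> A * wt s x"
    "\<exists>A. \<forall>t x. \<bar>frac_lap s (\<lambda>y. \<psi> (t, y)) x\<bar> \<le> A * wt s x"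
proof -
  note c = test_fun_csmooth[OF \<psi>]
  note c' = csmooth_ddir[OF c, of "(1, 0)"]
  obtain a where a: "a > 0" "\<And>t x. t < a \<Longrightarrow> \<psi> (t, x) = 0" "\<And>t x. t < a \<Longrightarrow> ddir (1, 0) \<psi> (t, x) = 0"
    "\<And>t x. t \<ge> T \<Longrightarrow> \<psi> (t, x) = 0" "\<And>t x. t \<ge> T \<Longrightarrow> ddir (1, 0) \<psi> (t, x) = 0"
    using test_fun_time_support[OF \<psi>] by metis
  show "ddir (1, 0) \<psi> \<in> borel_measurable borel" by (rule csmooth_measurable[OF c'])
  show "(\<lambda>p. frac_lap s (\<lambda>y. \<psi> (fst p, y)) (snd p)) \<in> borel_measurable borel"
    by (rule frac_lap_slice_measurable[OF c]) (auto simp: borel_prod[symmetric])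
  show "ddir (1, 0) \<psi> (t, x) = 0" if "t \<notin> {0<..<T}" for t x using that a by (cases "t < a") auto
  show "frac_lap s (\<lambda>y. \<psi> (t, y)) x = 0" if "t \<notin> {0<..<T}" for t x
  proof -
    have "\<psi> (t, y) = 0" for y using that a by (cases "t < a") auto
    then show ?thesis by (simp add: frac_lap_def fourier_tr_def)
  qed
  show "\<exists>A. \<forall>t x. \<bar>ddir (1, 0) \<psi> (t, x)\<bar> \<le> A * wt s x" using csmooth_le_wt[OF s(1) c'] by metis
  show "\<exists>A. \<forall>t x. \<bar>frac_lap s (\<lambda>y. \<psi> (t, y)) x\<bar> \<le> A * wt s x" using frac_lap_slice_bound[OF s c] by metis
qed

text \<open>One Jordan part of the initial datum; the signed case is assembled later as a difference
  of two instances.\<close>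

locale weighted_measure =
  fixes s :: real and \<mu> :: "'a::euclidean_space measure"
  assumes s: "0 < s" "s < 1" and lf: "loc_finite_borel \<mu>"
    and fin: "(\<integral>\<^sup>+ x. ennreal ((1 + norm x) powr (- (real DIM('a) + 2 * s))) \<partial>\<mu>) < \<infinity>"
begin

lemma sets_mu [measurable_cong, simp]: "sets \<mu> = sets borel"
  using lf by (simp add: loc_finite_borel_def)

lemma space_mu [simp]: "space \<mu> = UNIV"
  using sets_eq_imp_space_eq[OF sets_mu] by simp

sublocale sigma_finite_measure \<mu>
proof
  show "\<exists>A. countable A \<and> A \<subseteq> sets \<mu> \<and> \<Union> A = space \<mu> \<and> (\<forall>a\<in>A. emeasure \<mu> a \<noteq> \<infinity>)"
  proof (intro exI conjI)
    show "countable (range (\<lambda>n::nat. cball (0::'a) (real n)))" by simp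
    show "range (\<lambda>n::nat. cball (0::'a) (real n)) \<subseteq> sets \<mu>" by auto
    show "\<Union> (range (\<lambda>n::nat. cball (0::'a) (real n))) = space \<mu>" by (auto intro: real_arch_simple)
    show "\<forall>a\<in>range (\<lambda>n::nat. cball (0::'a) (real n)). emeasure \<mu> a \<noteq> \<infinity>"
      using lf by (auto simp: loc_finite_borel_def less_top[symmetric])
  qed
qed

lemma integrable_wt_mu: "integrable \<mu> (wt s)"
proof -
  obtain C where C: "C > 0" "\<And>x::'a. wt s x \<le> C * (1 + norm x) powr (- (real DIM('a) + 2 * s))"
    using wt_upper[OF s(1), where 'a='a] by blast
  have "integrable \<mu> (\<lambda>x. (1 + norm x) powr (- (real DIM('a) + 2 * s)))"
    using fin by (intro integrableI_nonneg) auto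
  from integrable_mult_right[OF this, of C] show ?thesis
    by (rule Bochner_Integration.integrable_bound) (use C in \<open>auto simp: wt_nonneg intro!: AE_I2 order_trans[OF _ abs_ge_self]\<close>)
qed

definition U :: "real \<Rightarrow> 'a \<Rightarrow> real" where
  "U t x = (\<integral>y. frac_heat_kernel s t (x - y) \<partial>\<mu>)"

lemma U_measurable [measurable (raw)]:
  assumes [measurable]: "f \<in> borel_measurable M" "g \<in> borel_measurable M"
  shows "(\<lambda>z. U (f z) (g z)) \<in> borel_measurable M"
  unfolding U_def by measurable

lemma slice_nn_bound:
  assumes t: "t > 0" and [measurable]: "g \<in> borel_measurable borel" and g: "\<And>x. \<bar>g x\<bar> \<le> A * wt s x"
  shows "(\<integral>\<^sup>+x. ennreal (frac_heat_kernel s t (x - y) * \<bar>g x\<bar>) \<partial>lborel) \<le> ennreal (A * exp (t * heatK s) * wt s y)"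
proof -
  have e: "frac_heat_kernel s t (x - y) = frac_heat_kernel s t (y - x)" for x by (rule heat_kernel_even[OF s t])
  have i: "integrable lborel (\<lambda>x. frac_heat_kernel s t (y - x) * \<bar>g x\<bar>)"
    by (rule heat_conv_bound(1)[OF s t]) (use g in auto)
  have "(\<integral>\<^sup>+x. ennreal (frac_heat_kernel s t (y - x) * \<bar>g x\<bar>) \<partial>lborel) = ennreal (LINT x|lborel. frac_heat_kernel s t (y - x) * \<bar>g x\<bar>)"
    by (rule nn_integral_eq_integral[OF i]) (auto simp: heat_kernel_nonneg[OF s t])
  then show ?thesis unfolding e using heat_conv_bound(2)[OF s t _ g, of y] by (auto intro!: ennreal_leI)
qed

text \<open>For a fixed pole y the space-time integral is at most a multiple of
  \<open>wt s y\<close>, which is integrable for the measure. This is the bound behind every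
  exchange of the measure with Lebesgue integrals.\<close>

lemma spacetime_nn_bound:
  fixes F :: "real \<times> 'a \<Rightarrow> real"
  assumes b: "b > 0" and F: "F \<in> borel_measurable borel" "\<And>t x. \<bar>F (t, x)\<bar> \<le> A * wt s x" "\<And>t x. t \<notin> {0<..<b} \<Longrightarrow> F (t, x) = 0"
  shows "(\<integral>\<^sup>+p. ennreal \<bar>frac_heat_kernel s (fst p) (snd p - y) * F p\<bar> \<partial>lborel) \<le> ennreal (b * (A * exp (b * heatK s) * wt s y))"
proof -
  have [measurable]: "F \<in> borel_measurable (borel \<Otimes>\<^sub>M borel)" using F by (simp add: borel_prod)
  have A: "A \<ge> 0" using order_trans[OF abs_ge_zero F(2)[of 0 0]] wt_pos[OF s(1), of "0::'a"] by (simp add: zero_le_mult_iff)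
  have "(\<integral>\<^sup>+p. ennreal \<bar>frac_heat_kernel s (fst p) (snd p - y) * F p\<bar> \<partial>lborel) = (\<integral>\<^sup>+t. \<integral>\<^sup>+x. ennreal \<bar>frac_heat_kernel s t (x - y) * F (t, x)\<bar> \<partial>lborel \<partial>lborel)"
    unfolding lborel_prod[symmetric, where 'a=real and 'b='a]
    by (subst lborel.nn_integral_fst[symmetric]) auto
  also have "\<dots> \<le> (\<integral>\<^sup>+t. ennreal (A * exp (b * heatK s) * wt s y) * indicator {0<..<b} t \<partial>lborel)"
  proof (rule nn_integral_mono)
    fix t :: real
    show "(\<integral>\<^sup>+x. ennreal \<bar>frac_heat_kernel s t (x - y) * F (t, x)\<bar> \<partial>lborel) \<le> ennreal (A * exp (b * heatK s) * wt s y) * indicator {0<..<b} t"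
    proof (cases "t \<in> {0<..<b}")
      case True
      then have t: "t > 0" by simp
      have "(\<integral>\<^sup>+x. ennreal \<bar>frac_heat_kernel s t (x - y) * F (t, x)\<bar> \<partial>lborel) = (\<integral>\<^sup>+x. ennreal (frac_heat_kernel s t (x - y) * \<bar>F (t, x)\<bar>) \<partial>lborel)"
        by (simp add: abs_mult heat_kernel_nonneg[OF s t])
      also have "\<dots> \<le> ennreal (A * exp (t * heatK s) * wt s y)"
        by (rule slice_nn_bound[OF t _ F(2)]) measurable
      also have "\<dots> \<le> ennreal (A * exp (b * heatK s) * wt s y)"
        using True A heatK_pos[OF s] by (intro ennreal_leI mult_right_mono mult_left_mono wt_nonneg) auto
      finally show ?thesis using True by simp
    next
      case False
      then show ?thesis using F(3) by simp
    qed
  qed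
  also have "\<dots> = ennreal (b * (A * exp (b * heatK s) * wt s y))"
  proof -
    define X where "X = A * exp (b * heatK s) * wt s y"
    have "X \<ge> 0" using A wt_nonneg[of s y] by (simp add: X_def)
    then show ?thesis unfolding X_def[symmetric] using b
      by (subst nn_integral_cmult_indicator) (auto simp: ennreal_mult[symmetric] mult.commute)
  qed
  finally show ?thesis .
qed

lemma spacetime_Fubini:
  fixes F :: "real \<times> 'a \<Rightarrow> real"
  assumes b: "b > 0" and F: "F \<in> borel_measurable borel" "\<And>t x. \<bar>F (t, x)\<bar> \<le> A * wt s x" "\<And>t x. t \<notin> {0<..<b} \<Longrightarrow> F (t, x) = 0"
  shows "integrable lborel (\<lambda>p. U (fst p) (snd p) * F p)"
    "(LINT p|lborel. U (fst p) (snd p) * F p) = (LINT y|\<mu>. LINT p|lborel. frac_heat_kernel s (fst p) (snd p - y) * F p)"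
    "integrable lborel (\<lambda>p. frac_heat_kernel s (fst p) (snd p - y) * F p)"
proof -
  interpret P: pair_sigma_finite "lborel :: (real \<times> 'a) measure" \<mu> ..
  have [measurable]: "F \<in> borel_measurable (borel \<Otimes>\<^sub>M borel)" using F by (simp add: borel_prod)
  have A: "A \<ge> 0" using order_trans[OF abs_ge_zero F(2)[of 0 0]] wt_pos[OF s(1), of "0::'a"] by (simp add: zero_le_mult_iff)
  let ?G = "\<lambda>p y. frac_heat_kernel s (fst p) (snd p - y) * F p"
  have Gm: "case_prod ?G \<in> borel_measurable (lborel \<Otimes>\<^sub>M \<mu>)"
    unfolding lborel_prod[symmetric, where 'a=real and 'b='a] by measurable
  show "integrable lborel (\<lambda>p. ?G p y)" for y
  proof (rule integrableI_bounded)
    show "(\<lambda>p. ?G p y) \<in> borel_measurable lborel" unfolding lborel_prod[symmetric, where 'a=real and 'b='a] by measurable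
    show "(\<integral>\<^sup>+p. ennreal (norm (?G p y)) \<partial>lborel) < \<infinity>"
      using le_less_trans[OF spacetime_nn_bound[OF b F, of y]] by simp
  qed
  have G: "integrable (lborel \<Otimes>\<^sub>M \<mu>) (case_prod ?G)"
  proof (rule integrableI_bounded[OF Gm])
    have "(\<integral>\<^sup>+z. ennreal (norm (case_prod ?G z)) \<partial>(lborel \<Otimes>\<^sub>M \<mu>)) = (\<integral>\<^sup>+y. \<integral>\<^sup>+p. ennreal \<bar>?G p y\<bar> \<partial>lborel \<partial>\<mu>)"
      using P.nn_integral_snd[of "\<lambda>z. ennreal (norm (case_prod ?G z))"] Gm by (simp add: case_prod_beta)
    also have "\<dots> \<le> (\<integral>\<^sup>+y. ennreal (b * (A * exp (b * heatK s) * wt s y)) \<partial>\<mu>)"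
      by (intro nn_integral_mono spacetime_nn_bound[OF b F])
    also have "\<dots> < \<infinity>"
    proof -
      have "integrable \<mu> (\<lambda>y. b * (A * exp (b * heatK s) * wt s y))" by (intro integrable_mult_right integrable_wt_mu)
      then show ?thesis using A b by (subst nn_integral_eq_integral) (auto simp: wt_nonneg)
    qed
    finally show "(\<integral>\<^sup>+z. ennreal (norm (case_prod ?G z)) \<partial>(lborel \<Otimes>\<^sub>M \<mu>)) < \<infinity>" .
  qed
  have eq: "(LINT y|\<mu>. ?G p y) = U (fst p) (snd p) * F p" for p by (simp add: U_def)
  show "integrable lborel (\<lambda>p. U (fst p) (snd p) * F p)" using P.integrable_fst[OF G] unfolding eq .
  show "(LINT p|lborel. U (fst p) (snd p) * F p) = (LINT y|\<mu>. LINT p|lborel. ?G p y)"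
    using P.Fubini_integral[OF G] unfolding eq by (rule sym)
qed

lemma slice_Fubini:
  assumes t: "t > 0" and g: "g \<in> borel_measurable borel" "\<And>x. \<bar>g x\<bar> \<le> A * wt s x"
  shows "integrable lborel (\<lambda>x. U t x * g x)"
    "(LINT x|lborel. U t x * g x) = (LINT y|\<mu>. LINT x|lborel. frac_heat_kernel s t (y - x) * g x)"
proof -
  interpret P: pair_sigma_finite "lborel :: 'a measure" \<mu> ..
  note [measurable] = g(1)
  have A: "A \<ge> 0" using order_trans[OF abs_ge_zero g(2)[of 0]] wt_pos[OF s(1), of "0::'a"] by (simp add: zero_le_mult_iff)
  let ?G = "\<lambda>x y. frac_heat_kernel s t (x - y) * g x"
  have Gm: "case_prod ?G \<in> borel_measurable (lborel \<Otimes>\<^sub>M \<mu>)" by measurable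
  have G: "integrable (lborel \<Otimes>\<^sub>M \<mu>) (case_prod ?G)"
  proof (rule integrableI_bounded[OF Gm])
    have "(\<integral>\<^sup>+z. ennreal (norm (case_prod ?G z)) \<partial>(lborel \<Otimes>\<^sub>M \<mu>)) = (\<integral>\<^sup>+y. \<integral>\<^sup>+x. ennreal \<bar>?G x y\<bar> \<partial>lborel \<partial>\<mu>)"
      using P.nn_integral_snd[of "\<lambda>z. ennreal (norm (case_prod ?G z))"] Gm by (simp add: case_prod_beta)
    also have "\<dots> \<le> (\<integral>\<^sup>+y. ennreal (A * exp (t * heatK s) * wt s y) \<partial>\<mu>)"
      using slice_nn_bound[OF t g] by (intro nn_integral_mono) (simp add: abs_mult heat_kernel_nonneg[OF s t])
    also have "\<dots> < \<infinity>"
    proof -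
      have "integrable \<mu> (\<lambda>y. A * exp (t * heatK s) * wt s y)" by (intro integrable_mult_right integrable_wt_mu)
      then show ?thesis using A by (subst nn_integral_eq_integral) (auto simp: wt_nonneg)
    qed
    finally show "(\<integral>\<^sup>+z. ennreal (norm (case_prod ?G z)) \<partial>(lborel \<Otimes>\<^sub>M \<mu>)) < \<infinity>" .
  qed
  have eq: "(LINT y|\<mu>. ?G x y) = U t x * g x" for x by (simp add: U_def)
  show "integrable lborel (\<lambda>x. U t x * g x)" using P.integrable_fst[OF G] unfolding eq .
  show "(LINT x|lborel. U t x * g x) = (LINT y|\<mu>. LINT x|lborel. frac_heat_kernel s t (y - x) * g x)"
    using P.Fubini_integral[OF G] unfolding eq heat_kernel_even[OF s t, of y for y] by (rule sym)
qed

lemma U_weak_solution: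
  assumes \<psi>: "test_fun T \<psi>" and T: "T > 0"
  shows "integrable lborel (\<lambda>p. U (fst p) (snd p) * ddir (1, 0) \<psi> p)"
    "integrable lborel (\<lambda>p. U (fst p) (snd p) * frac_lap s (\<lambda>y. \<psi> (fst p, y)) (snd p))"
    "(LINT p|lborel. U (fst p) (snd p) * ddir (1, 0) \<psi> p) = (LINT p|lborel. U (fst p) (snd p) * frac_lap s (\<lambda>y. \<psi> (fst p, y)) (snd p))"
proof -
  note f = test_fun_facts[OF s \<psi>]
  obtain A1 where A1: "\<And>t x. \<bar>ddir (1, 0) \<psi> (t, x)\<bar> \<le> A1 * wt s x" using f(5) by blast
  obtain A2 where A2: "\<And>t x. \<bar>frac_lap s (\<lambda>y. \<psi> (t, y)) x\<bar> \<le> A2 * wt s x" using f(6) by blast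
  note S1 = spacetime_Fubini[OF T f(1) A1 f(3)]
  have S2: "integrable lborel (\<lambda>p. U (fst p) (snd p) * frac_lap s (\<lambda>y. \<psi> (fst p, y)) (snd p))"
    "(LINT p|lborel. U (fst p) (snd p) * frac_lap s (\<lambda>y. \<psi> (fst p, y)) (snd p)) = (LINT y|\<mu>. LINT p|lborel. frac_heat_kernel s (fst p) (snd p - y) * frac_lap s (\<lambda>y. \<psi> (fst p, y)) (snd p))"
    "integrable lborel (\<lambda>p. frac_heat_kernel s (fst p) (snd p - y) * frac_lap s (\<lambda>y. \<psi> (fst p, y)) (snd p))" for y
    using A2 f(4) by (intro spacetime_Fubini[OF T f(2), of A2]; simp)+
  show "integrable lborel (\<lambda>p. U (fst p) (snd p) * ddir (1, 0) \<psi> p)" by (rule S1(1))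
  show "integrable lborel (\<lambda>p. U (fst p) (snd p) * frac_lap s (\<lambda>y. \<psi> (fst p, y)) (snd p))" by (rule S2(1))
  show "(LINT p|lborel. U (fst p) (snd p) * ddir (1, 0) \<psi> p) = (LINT p|lborel. U (fst p) (snd p) * frac_lap s (\<lambda>y. \<psi> (fst p, y)) (snd p))"
  proof -
    note S1(2)
    also have "(LINT y|\<mu>. LINT p|lborel. frac_heat_kernel s (fst p) (snd p - y) * ddir (1, 0) \<psi> p)
       = (LINT y|\<mu>. LINT p|lborel. frac_heat_kernel s (fst p) (snd p - y) * frac_lap s (\<lambda>y. \<psi> (fst p, y)) (snd p))"
      by (rule Bochner_Integration.integral_cong[OF refl heat_pairing_identity[OF s \<psi> S2(3)]])
    also note S2(2)[symmetric]
    finally show ?thesis .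
  qed
qed

section \<open>Integrability and initial trace of the potential\<close>

lemma Phi_weight_le_wt:
  obtains C where "C > 0" "\<And>x::'a. Phi_weight s x \<le> C * wt s x" "\<And>x::'a. wt s x \<le> C * Phi_weight s x"
proof -
  let ?p = "real DIM('a) + 2 * s"
  obtain c where c: "c > 0" "\<And>x::'a. c * (1 + norm x) powr (- ?p) \<le> wt s x" using wt_ge[OF s(1), where 'a='a] by blast
  obtain C where C: "C > 0" "\<And>x::'a. wt s x \<le> C * (1 + norm x) powr (- ?p)" using wt_upper[OF s(1), where 'a='a] by blast
  let ?D = "2048 powr (?p / 8)"
  show ?thesis
  proof
    show "?D / c + C > 0" using c C by (simp add: add_pos_pos)
    fix x :: 'a
    have "Phi_weight s x \<le> ?D * (1 + norm x) powr (- ?p)" by (rule Phi_weight_bounds[OF s(1)])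
    also have "\<dots> = ?D / c * (c * (1 + norm x) powr (- ?p))" using c by simp
    also have "\<dots> \<le> ?D / c * wt s x" using c by (intro mult_left_mono) auto
    also have "\<dots> \<le> (?D / c + C) * wt s x" using C wt_nonneg[of s x] by (intro mult_right_mono) auto
    finally show "Phi_weight s x \<le> (?D / c + C) * wt s x" .
    have "wt s x \<le> C * (1 + norm x) powr (- ?p)" by (rule C)
    also have "\<dots> \<le> C * Phi_weight s x" using C Phi_weight_bounds(1)[OF s(1), of x] by (intro mult_left_mono) auto
    also have "\<dots> \<le> (?D / c + C) * Phi_weight s x" using c by (intro mult_right_mono) (auto simp: Phi_weight_def)
    finally show "wt s x \<le> (?D / c + C) * Phi_weight s x" .
  qed
qed

lemma Phi_weight_measurable [measurable]: "Phi_weight s \<in> borel_measurable borel"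
  unfolding Phi_weight_def[abs_def] by measurable

lemma U_Phi_integrable:
  assumes T: "T > 0"
  shows "integrable lborel (\<lambda>p. U (fst p) (snd p) * (indicator {0<..<T} (fst p) * Phi_weight s (snd p)))"
proof -
  obtain C where C: "C > 0" "\<And>x::'a. Phi_weight s x \<le> C * wt s x" using Phi_weight_le_wt by metis
  have "Phi_weight s x \<ge> 0" for x :: 'a by (simp add: Phi_weight_def)
  moreover have "0 \<le> C * wt s x" for x :: 'a using C wt_nonneg[of s x] by simp
  ultimately show ?thesis
    using C by (intro spacetime_Fubini(1)[OF T, of _ C]) (auto simp: borel_prod[symmetric] indicator_def)
qed

text \<open>Fubini moves the kernel onto \<psi>. The smoothed \<psi> converges pointwise by
  \<open>heat_approx_identity\<close> and stays below a multiple of \<open>wt s\<close>, uniformly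
  for times below \<open>T\<close>, so dominated convergence holds for the measure.\<close>

lemma U_trace:
  assumes T: "T > 0" and \<psi>: "continuous_on UNIV \<psi>" "compact (closure {x. \<psi> x \<noteq> 0})"
  shows "((\<lambda>t. LINT x|lborel. U t x * \<psi> x) \<longlongrightarrow> integral\<^sup>L \<mu> \<psi>) (at 0 within {0<..<T})"
proof -
  obtain R B where B: "B \<ge> 0" "\<And>x. \<bar>\<psi> x\<bar> \<le> B" "\<And>x. norm x > R \<Longrightarrow> \<psi> x = 0" using compact_support_bounds[OF \<psi>] by metis
  obtain A where A: "A \<ge> 0" "\<And>(f :: 'a \<Rightarrow> real) x. (\<And>x. \<bar>f x\<bar> \<le> B) \<Longrightarrow> (\<And>x. norm x > R \<Longrightarrow> f x = 0) \<Longrightarrow> \<bar>f x\<bar> \<le> A * wt s x"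
    using bounded_support_le_wt[OF s(1) B(1), where R=R and 'a='a] by metis
  have le: "\<bar>\<psi> x\<bar> \<le> A * wt s x" for x using A(2)[of \<psi> x] B by blast
  have [measurable]: "\<psi> \<in> borel_measurable borel" using \<psi>(1) by (rule borel_measurable_continuous_onI)
  have cont: "isCont \<psi> x" for x using \<psi>(1) by (simp add: continuous_on_eq_continuous_at)
  show ?thesis unfolding tendsto_at_iff_sequentially comp_def
  proof (intro allI impI)
    fix X :: "nat \<Rightarrow> real" assume "\<forall>i. X i \<in> {0<..<T} - {0}" and X0: "X \<longlonglongrightarrow> 0"
    then have X: "X n > 0" "X n < T" for n by auto
    have "(\<lambda>n. LINT y|\<mu>. LINT x|lborel. frac_heat_kernel s (X n) (y - x) * \<psi> x) \<longlonglongrightarrow> integral\<^sup>L \<mu> \<psi>"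
    proof (rule integral_dominated_convergence)
      show "integrable \<mu> (\<lambda>y. A * exp (T * heatK s) * wt s y)" by (intro integrable_mult_right integrable_wt_mu)
      show "AE y in \<mu>. (\<lambda>n. LINT x|lborel. frac_heat_kernel s (X n) (y - x) * \<psi> x) \<longlonglongrightarrow> \<psi> y"
        by (intro AE_I2 heat_approx_identity[OF s _ B(2) cont X(1) X0]) measurable
      show "AE y in \<mu>. norm (LINT x|lborel. frac_heat_kernel s (X n) (y - x) * \<psi> x) \<le> A * exp (T * heatK s) * wt s y" for n
      proof (rule AE_I2)
        fix y
        have "\<bar>LINT x|lborel. frac_heat_kernel s (X n) (y - x) * \<psi> x\<bar> \<le> A * exp (X n * heatK s) * wt s y"
          by (rule heat_conv_bound(3)[OF s X(1) _ le]) measurable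
        also have "\<dots> \<le> A * exp (T * heatK s) * wt s y"
          using X(2)[of n] heatK_pos[OF s] A(1) by (intro mult_right_mono mult_left_mono wt_nonneg) auto
        finally show "norm (LINT x|lborel. frac_heat_kernel s (X n) (y - x) * \<psi> x) \<le> A * exp (T * heatK s) * wt s y" by simp
      qed
    qed measurable
    then show "(\<lambda>n. LINT x|lborel. U (X n) x * \<psi> x) \<longlonglongrightarrow> integral\<^sup>L \<mu> \<psi>"
      by (simp add: slice_Fubini(2)[OF X(1) _ le])
  qed
qed

end

section \<open>Bump functions\<close>

lemma C_k_const: "C_k n (\<lambda>_. c)"
  by (induction n arbitrary: c) (auto simp: frechet_derivative_const)

lemma C_k_Suc_imp: "C_k (Suc n) f \<Longrightarrow> C_k n f"
proof (induction n arbitrary: f)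
  case 0
  then show ?case by (auto intro: differentiable_imp_continuous_on)
next
  case (Suc n)
  have "f differentiable_on UNIV" "\<forall>v. C_k (Suc n) (\<lambda>x. frechet_derivative f (at x) v)"
    using Suc.prems unfolding C_k.simps(2)[of "Suc n"] by blast+
  then show ?case using Suc.IH unfolding C_k.simps(2)[of n f] by blast
qed

lemma C_k_add: "C_k n f \<Longrightarrow> C_k n g \<Longrightarrow> C_k n (\<lambda>x. f x + g x)"
proof (induction n arbitrary: f g)
  case 0
  then show ?case by (auto intro: continuous_on_add)
next
  case (Suc n)
  have d: "f differentiable at x" "g differentiable at x" for x using Suc.prems by (auto simp: differentiable_on_def)
  have "frechet_derivative (\<lambda>x. f x + g x) (at x) v = frechet_derivative f (at x) v + frechet_derivative g (at x) v" for x v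
    using frechet_derivative_at[OF has_derivative_add[OF d[of x, unfolded frechet_derivative_works]]] by metis
  then show ?case using Suc by (auto simp: differentiable_on_def intro!: differentiable_add)
qed

lemma C_k_mult: "C_k n f \<Longrightarrow> C_k n g \<Longrightarrow> C_k n (\<lambda>x. f x * g x)"
proof (induction n arbitrary: f g)
  case 0
  then show ?case by (auto intro: continuous_on_mult)
next
  case (Suc n)
  have d: "f differentiable at x" "g differentiable at x" for x using Suc.prems by (auto simp: differentiable_on_def)
  have eq: "frechet_derivative (\<lambda>x. f x * g x) (at x) v = f x * frechet_derivative g (at x) v + frechet_derivative f (at x) v * g x" for x v
    using frechet_derivative_at[OF has_derivative_mult[OF d[of x, unfolded frechet_derivative_works]]] by metis
  have "C_k n (\<lambda>x. f x * frechet_derivative g (at x) v + frechet_derivative f (at x) v * g x)" for v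
    using Suc.prems C_k_Suc_imp[OF Suc.prems(1)] C_k_Suc_imp[OF Suc.prems(2)] by (intro C_k_add Suc.IH) auto
  then show ?case using d by (auto simp: differentiable_on_def eq intro!: differentiable_mult)
qed

lemma smooth_fun_mult: "smooth_fun f \<Longrightarrow> smooth_fun g \<Longrightarrow> smooth_fun (\<lambda>x. f x * g x)"
  by (simp add: smooth_fun_def C_k_mult)

lemma smooth_fun_const: "smooth_fun (\<lambda>_. c)"
  by (simp add: smooth_fun_def C_k_const)

lemma smooth_fun_prod: "finite I \<Longrightarrow> (\<And>i. i \<in> I \<Longrightarrow> smooth_fun (f i)) \<Longrightarrow> smooth_fun (\<lambda>x. \<Prod>i\<in>I. f i x)"
  by (induction I rule: finite_induct) (auto intro: smooth_fun_const smooth_fun_mult)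

text \<open>\<open>hs\<close> lists the successive derivatives of a function of one variable. The
  constant \<open>k\<close> and the index \<open>j\<close> are generalised because a directional
  derivative has the same shape, with the factor \<open>u v\<close> absorbed in \<open>k\<close> and
  \<open>j\<close> raised by one.\<close>

lemma C_k_compose_affine:
  fixes u :: "'e::real_normed_vector \<Rightarrow> real"
  assumes u: "bounded_linear u" and hs: "\<And>j x. (hs j has_real_derivative hs (Suc j) x) (at x)"
  shows "C_k n (\<lambda>x. k * hs j (c + u x))"
proof (induction n arbitrary: k j)
  have der: "((\<lambda>x. k * hs j (c + u x)) has_derivative (\<lambda>v. k * (u v * hs (Suc j) (c + u x)))) (at x)" for k j x
  proof -
    have "((\<lambda>x. c + u x) has_derivative u) (at x)"
      using has_derivative_add[OF has_derivative_const bounded_linear_imp_has_derivative[OF u]] by simp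
    from DERIV_compose_FDERIV[OF hs this] show ?thesis
      by (intro has_derivative_mult_right) (simp add: mult.commute)
  qed
  {
    case 0
    have "(\<lambda>x. k * hs j (c + u x)) differentiable at x" for x using der[of k j x] by (auto simp: differentiable_def)
    then show ?case by (simp add: continuous_at_imp_continuous_on differentiable_imp_continuous_within)
  next
    case (Suc n)
    have "frechet_derivative (\<lambda>x. k * hs j (c + u x)) (at x) v = (k * u v) * hs (Suc j) (c + u x)" for x v
      using frechet_derivative_at[OF der[of k j x]] by (metis mult.assoc)
    moreover have "(\<lambda>x. k * hs j (c + u x)) differentiable at x" for x using der[of k j x] by (auto simp: differentiable_def)
    ultimately show ?case using Suc.IH by (simp add: differentiable_on_def)
  }
qed

lemma smooth_fun_compose_affine:
  assumes "bounded_linear u" "\<And>j x. (hs j has_real_derivative hs (Suc j) x) (at x)"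
  shows "smooth_fun (\<lambda>x. hs 0 (c + u x))"
  using C_k_compose_affine[where hs=hs and u=u and k=1 and j=0 and c=c, OF assms] by (simp add: smooth_fun_def)

lemma smooth_fun_affine:
  assumes "bounded_linear u" shows "smooth_fun (\<lambda>x. c + u x)"
proof -
  \<comment> \<open>The successive derivatives of the identity: x, 1, 0, 0, and so on.\<close>
  let ?hs = "\<lambda>j x::real. if j = 0 then x else if j = Suc 0 then 1 else (0::real)"
  have "(?hs j has_real_derivative ?hs (Suc j) x) (at x)" for j x
    by (cases "j = 0") auto
  from smooth_fun_compose_affine[where hs="?hs", OF assms this] show ?thesis by simp
qed

text \<open>The derivative of p(1/x) exp(-1/x) is q(1/x) exp(-1/x) with q(y) = y^2 (p(y) - p'(y));
  the recursion is this rule, and \<open>[:0, 0, 1:]\<close> is y^2.\<close>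

fun kap_poly :: "nat \<Rightarrow> real poly" where
  "kap_poly 0 = 1"
| "kap_poly (Suc j) = [:0, 0, 1:] * (kap_poly j - pderiv (kap_poly j))"

text \<open>The j-th derivative of the classical smooth function exp(-1/x), extended by zero to the
  left half line.\<close>

definition kapd :: "nat \<Rightarrow> real \<Rightarrow> real" where
  "kapd j x = (if x \<le> 0 then 0 else poly (kap_poly j) (1 / x) * exp (- (1 / x)))"

abbreviation kap :: "real \<Rightarrow> real" where "kap \<equiv> kapd 0"

lemma poly_exp_tendsto_0: "((\<lambda>y. poly p y * exp (- y)) \<longlongrightarrow> 0) at_top" for p :: "real poly"
proof -
  have "((\<lambda>y. \<Sum>i\<le>degree p. coeff p i * (y ^ i / exp y)) \<longlongrightarrow> (\<Sum>i\<le>degree p. coeff p i * 0)) at_top"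
    by (intro tendsto_sum tendsto_mult_left tendsto_power_div_exp_0)
  then show ?thesis by (simp add: poly_altdef sum_distrib_right exp_minus divide_inverse mult.assoc)
qed

lemma kapd_has_derivative: "(kapd j has_real_derivative kapd (Suc j) x) (at x)"
proof -
  consider "x < 0" | "x > 0" | "x = 0" by linarith
  then show ?thesis
  proof cases
    case 1
    have "((\<lambda>_. 0) has_real_derivative 0) (at x)" by simp
    then have "(kapd j has_real_derivative 0) (at x)"
      by (rule has_field_derivative_transform_within_open[where S="{..<0}"]) (use 1 in \<open>auto simp: kapd_def\<close>)
    then show ?thesis using 1 by (simp add: kapd_def)
  next
    case 2
    have "((\<lambda>x. poly (kap_poly j) (1 / x) * exp (- (1 / x))) has_real_derivative
      (poly (pderiv (kap_poly j)) (1 / x) * (- (1 / x\<^sup>2)) * exp (- (1 / x)) + exp (- (1 / x)) * (1 / x\<^sup>2) * poly (kap_poly j) (1 / x))) (at x)"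
      using 2 by (auto intro!: derivative_eq_intros DERIV_chain2[OF poly_DERIV] simp: power2_eq_square field_simps)
    moreover have "poly (pderiv (kap_poly j)) (1 / x) * (- (1 / x\<^sup>2)) * exp (- (1 / x)) + exp (- (1 / x)) * (1 / x\<^sup>2) * poly (kap_poly j) (1 / x) = kapd (Suc j) x"
      using 2 by (simp add: kapd_def power2_eq_square field_simps)
    ultimately have "((\<lambda>x. poly (kap_poly j) (1 / x) * exp (- (1 / x))) has_real_derivative kapd (Suc j) x) (at x)" by simp
    then show ?thesis
      by (rule has_field_derivative_transform_within_open[where S="{0<..}"]) (use 2 in \<open>auto simp: kapd_def\<close>)
  next
    \<comment> \<open>At the origin the difference quotient from the right is a polynomial in 1/h
      times exp(-1/h), which tends to 0; from the left it vanishes.\<close>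
    case 3
    have "((\<lambda>h. kapd j h / h) \<longlongrightarrow> 0) (at_right 0)"
    proof -
      have "((\<lambda>h. poly ([:0, 1:] * kap_poly j) (inverse h) * exp (- inverse h)) \<longlongrightarrow> 0) (at_right 0)"
        by (rule filterlim_compose[OF poly_exp_tendsto_0 filterlim_inverse_at_top_right])
      then show ?thesis
        by (rule Lim_transform_eventually) (auto simp: eventually_at_right_less kapd_def field_simps intro!: eventually_at_rightI[of 0 1])
    qed
    moreover have "((\<lambda>h. kapd j h / h) \<longlongrightarrow> 0) (at_left 0)"
    proof -
      have "((\<lambda>h. 0::real) \<longlongrightarrow> 0) (at_left 0)" by simp
      then show ?thesis
        by (rule Lim_transform_eventually) (auto simp: kapd_def intro!: eventually_at_leftI[of "-1" 0])
    qed
    ultimately have "((\<lambda>h. kapd j h / h) \<longlongrightarrow> 0) (at 0)" by (rule filterlim_split_at_real[rotated])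
    then have "(kapd j has_real_derivative 0) (at 0)"
      by (simp add: DERIV_def kapd_def)
    then show ?thesis using 3 by (simp add: kapd_def)
  qed
qed

lemma smooth_kap_affine: "bounded_linear u \<Longrightarrow> smooth_fun (\<lambda>x. kap (c + u x))"
  using smooth_fun_compose_affine[of u kapd c] kapd_has_derivative by blast

lemma kap_0: "x \<le> 0 \<Longrightarrow> kap x = 0"
  by (simp add: kapd_def)

lemma kap_bounds: "0 \<le> kap x" "kap x \<le> 1"
  by (auto simp: kapd_def)

lemma kap_pos: "x > 0 \<Longrightarrow> kap x > 0"
  by (simp add: kapd_def)

lemma kap_continuous: "continuous_on S (kapd j)"
  by (meson DERIV_isCont continuous_at_imp_continuous_on kapd_has_derivative)

lemma kapd_measurable [measurable]: "kapd j \<in> borel_measurable borel"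
  by (intro borel_measurable_continuous_onI kap_continuous)

lemma kap1_eq: "kapd (Suc 0) x = (if x \<le> 0 then 0 else exp (- (1 / x)) / x\<^sup>2)"
  by (simp add: kapd_def power2_eq_square)

text \<open>The second bound is scale invariant: it controls (t - \<tau>) times the derivative of
  the cutoff \<open>kap (n * (t - \<tau>))\<close> for all n at once. The third shows that the
  cutoff derivative fades away from its transition zone.\<close>

lemma kap1_bounds: "0 \<le> kapd (Suc 0) x" "\<bar>x * kapd (Suc 0) x\<bar> \<le> 1" "x > 0 \<Longrightarrow> kapd (Suc 0) x \<le> 1 / x\<^sup>2"
proof -
  show "0 \<le> kapd (Suc 0) x" by (simp add: kap1_eq)
  show "x > 0 \<Longrightarrow> kapd (Suc 0) x \<le> 1 / x\<^sup>2" by (simp add: kap1_eq divide_right_mono)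
  show "\<bar>x * kapd (Suc 0) x\<bar> \<le> 1"
  proof (cases "x \<le> 0")
    case False
    then have "\<bar>x * kapd (Suc 0) x\<bar> = (1 / x) * exp (- (1 / x))" by (simp add: kap1_eq power2_eq_square)
    also have "\<dots> \<le> 1"
    proof -
      have "1 / x \<le> exp (1 / x)" using exp_ge_add_one_self[of "1/x"] by linarith
      then have "(1 / x) * exp (- (1 / x)) \<le> exp (1 / x) * exp (- (1 / x))" by (intro mult_right_mono) auto
      then show ?thesis by (simp add: exp_minus)
    qed
    finally show ?thesis .
  qed (simp add: kap1_eq)
qed

text \<open>Offset 0 serves the faces of boxes and the final time. Offset -1 makes the cutoff vanish
  on a neighbourhood of the initial time, as a test function must.\<close>

lemma kap_lim: "(\<lambda>n. kap (real n * x + c)) \<longlonglongrightarrow> indicator {0<..} x" if "x > 0 \<or> c \<le> 0"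
proof (cases "x > 0")
  case True
  have lim: "filterlim (\<lambda>n. real n * x + c) at_top sequentially"
    using filterlim_tendsto_add_at_top[OF tendsto_const[of c] filterlim_tendsto_pos_mult_at_top[OF tendsto_const True filterlim_real_sequentially]]
    by (simp add: ac_simps)
  then have "(\<lambda>n. exp (- (1 / (real n * x + c)))) \<longlonglongrightarrow> exp (- 0)"
    by (intro tendsto_intros tendsto_divide_0[OF tendsto_const] filterlim_at_top_imp_at_infinity)
  moreover have "eventually (\<lambda>n. exp (- (1 / (real n * x + c))) = kap (real n * x + c)) sequentially"
  proof -
    have "eventually (\<lambda>n. real n * x + c > 0) sequentially" using lim unfolding filterlim_at_top_dense by blast
    then show ?thesis by eventually_elim (simp add: kapd_def)
  qed
  ultimately have "(\<lambda>n. kap (real n * x + c)) \<longlonglongrightarrow> exp (- 0)" by (rule Lim_transform_eventually)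
  then show ?thesis using True by simp
next
  case False
  then have "real n * x + c \<le> 0" for n using that by (simp add: add_nonpos_nonpos mult_nonneg_nonpos)
  then show ?thesis using False by (simp add: kap_0)
qed

lemma kap1_lim: "(\<lambda>n. (real n * x) * kapd (Suc 0) (real n * x)) \<longlonglongrightarrow> 0"
proof (cases "x > 0")
  case True
  have "filterlim (\<lambda>n. real n * x) at_top sequentially"
    using filterlim_tendsto_pos_mult_at_top[OF tendsto_const True filterlim_real_sequentially] by (simp add: ac_simps)
  then have "(\<lambda>n. 1 / (real n * x)) \<longlonglongrightarrow> 0"
    by (intro tendsto_divide_0[OF tendsto_const] filterlim_at_top_imp_at_infinity)
  moreover have "eventually (\<lambda>n. norm ((real n * x) * kapd (Suc 0) (real n * x)) \<le> 1 / (real n * x)) sequentially"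
    using eventually_gt_at_top[of 0]
  proof eventually_elim
    case (elim n)
    then have "real n * x > 0" using True by simp
    then have "norm ((real n * x) * kapd (Suc 0) (real n * x)) = (real n * x) * kapd (Suc 0) (real n * x)"
      unfolding real_norm_def by (rule abs_of_nonneg[OF mult_nonneg_nonneg[OF less_imp_le kap1_bounds(1)]])
    also have "\<dots> \<le> (real n * x) * (1 / (real n * x)\<^sup>2)"
      using \<open>real n * x > 0\<close> by (intro mult_left_mono kap1_bounds) auto
    also have "y * (1 / y\<^sup>2) = 1 / y" if "y > 0" for y :: real using that by (simp add: power2_eq_square)
    note this[OF \<open>real n * x > 0\<close>]
    finally show ?case .
  qed
  ultimately show ?thesis by (rule Lim_null_comparison[rotated])
next
  case False
  then have "real n * x \<le> 0" for n by (simp add: mult_nonneg_nonpos)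
  then show ?thesis by (simp add: kap1_eq)
qed

text \<open>One factor per face of the box: the product is positive exactly inside
  \<open>box \<alpha> \<beta>\<close> for positive \<open>k\<close>, tends to its indicator as
  \<open>k\<close> grows, and translating it just moves the two corners.\<close>

definition bump :: "real \<Rightarrow> 'a::euclidean_space \<Rightarrow> 'a \<Rightarrow> 'a \<Rightarrow> real" where
  "bump k \<alpha> \<beta> x = (\<Prod>b\<in>Basis. kap (k * (x \<bullet> b - \<alpha> \<bullet> b)) * kap (k * (\<beta> \<bullet> b - x \<bullet> b)))"

lemma bump_translate: "bump k \<alpha> \<beta> (x - z) = bump k (\<alpha> + z) (\<beta> + z) x"
  by (simp add: bump_def inner_diff_left inner_add_left algebra_simps)

lemma bump_bounds: "0 \<le> bump k \<alpha> \<beta> x" "bump k \<alpha> \<beta> x \<le> 1"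
proof -
  show "0 \<le> bump k \<alpha> \<beta> x" by (auto simp: bump_def kap_bounds intro!: prod_nonneg mult_nonneg_nonneg)
  show "bump k \<alpha> \<beta> x \<le> 1" unfolding bump_def
    by (intro prod_le_1 conjI mult_nonneg_nonneg mult_le_one kap_bounds)
qed

lemma bump_support:
  assumes "k > 0" "bump k \<alpha> \<beta> x \<noteq> 0" shows "x \<in> box \<alpha> \<beta>"
proof -
  have "kap (k * (x \<bullet> b - \<alpha> \<bullet> b)) * kap (k * (\<beta> \<bullet> b - x \<bullet> b)) \<noteq> 0" if "b \<in> Basis" for b
    using assms that by (auto simp: bump_def)
  then have "k * (x \<bullet> b - \<alpha> \<bullet> b) > 0 \<and> k * (\<beta> \<bullet> b - x \<bullet> b) > 0" if "b \<in> Basis" for b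
    using that kap_0 by (metis mult_zero_left mult_zero_right not_le)
  then show ?thesis using assms(1) by (auto simp: box_def zero_less_mult_iff)
qed

lemma bump_smooth:
  assumes "bounded_linear P"
  shows "smooth_fun (\<lambda>p. bump k \<alpha> \<beta> (P p))"
proof -
  have 1: "smooth_fun (\<lambda>p. kap (- (k * (\<alpha> \<bullet> b)) + k * (P p \<bullet> b)))" for b
    by (rule smooth_kap_affine) (intro bounded_linear_const_mult bounded_linear_inner_left_comp assms)
  have 2: "smooth_fun (\<lambda>p. kap (k * (\<beta> \<bullet> b) + (- k) * (P p \<bullet> b)))" for b
    by (rule smooth_kap_affine) (intro bounded_linear_const_mult bounded_linear_inner_left_comp assms)
  have "smooth_fun (\<lambda>p. \<Prod>b\<in>Basis. kap (- (k * (\<alpha> \<bullet> b)) + k * (P p \<bullet> b)) * kap (k * (\<beta> \<bullet> b) + (- k) * (P p \<bullet> b)))"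
    by (intro smooth_fun_prod smooth_fun_mult 1 2) auto
  moreover have "(\<lambda>p. \<Prod>b\<in>Basis. kap (- (k * (\<alpha> \<bullet> b)) + k * (P p \<bullet> b)) * kap (k * (\<beta> \<bullet> b) + (- k) * (P p \<bullet> b))) = (\<lambda>p. bump k \<alpha> \<beta> (P p))"
    by (simp add: bump_def algebra_simps)
  ultimately show ?thesis by simp
qed

lemma bump_lim: "(\<lambda>n. bump (real n) \<alpha> \<beta> x) \<longlonglongrightarrow> indicator (box \<alpha> \<beta>) (x::'a::euclidean_space)"
proof -
  have "(\<lambda>n. bump (real n) \<alpha> \<beta> x) \<longlonglongrightarrow> (\<Prod>b\<in>Basis. indicator {0<..} (x \<bullet> b - \<alpha> \<bullet> b) * indicator {0<..} (\<beta> \<bullet> b - x \<bullet> b))"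
  proof -
    have "(\<lambda>n. kap (real n * z)) \<longlonglongrightarrow> indicator {0<..} z" for z using kap_lim[of z 0] by simp
    then show ?thesis unfolding bump_def by (intro tendsto_prod tendsto_mult)
  qed
  moreover have "(\<Prod>b\<in>Basis. indicator {0<..} (x \<bullet> b - \<alpha> \<bullet> b) * indicator {0<..} (\<beta> \<bullet> b - x \<bullet> b)) = (indicator (box \<alpha> \<beta>) x :: real)"
  proof (cases "x \<in> box \<alpha> \<beta>")
    case True
    then show ?thesis by (auto simp: box_def intro!: prod.neutral)
  next
    case False
    then obtain b where "b \<in> Basis" "\<not> (\<alpha> \<bullet> b < x \<bullet> b \<and> x \<bullet> b < \<beta> \<bullet> b)" by (auto simp: box_def)
    then show ?thesis using False by (intro trans[OF prod_zero]) (auto intro!: bexI[of _ b] simp: indicator_def)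
  qed
  ultimately show ?thesis by simp
qed

lemma csmooth_timebump:
  fixes \<theta> :: "real \<Rightarrow> real"
  assumes \<theta>: "smooth_fun (\<lambda>p::real \<times> 'a::euclidean_space. \<theta> (fst p))" and sup: "\<And>\<tau>. \<theta> \<tau> \<noteq> 0 \<Longrightarrow> a \<le> \<tau> \<and> \<tau> \<le> b" and k: "k > 0"
  shows "csmooth (\<lambda>p::real \<times> 'a. \<theta> (fst p) * bump k \<alpha> \<beta> (snd p))"
    "closure {p::real \<times> 'a. \<theta> (fst p) * bump k \<alpha> \<beta> (snd p) \<noteq> 0} \<subseteq> {a..b} \<times> cbox \<alpha> \<beta>"
proof -
  have "{p::real \<times> 'a. \<theta> (fst p) * bump k \<alpha> \<beta> (snd p) \<noteq> 0} \<subseteq> {a..b} \<times> cbox \<alpha> \<beta>"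
  proof
    fix p :: "real \<times> 'a" assume "p \<in> {p. \<theta> (fst p) * bump k \<alpha> \<beta> (snd p) \<noteq> 0}"
    then have "\<theta> (fst p) \<noteq> 0" "bump k \<alpha> \<beta> (snd p) \<noteq> 0" by auto
    then have "fst p \<in> {a..b}" "snd p \<in> cbox \<alpha> \<beta>"
      using sup[of "fst p"] bump_support[OF k, of \<alpha> \<beta> "snd p"] box_subset_cbox[of \<alpha> \<beta>] by auto
    then show "p \<in> {a..b} \<times> cbox \<alpha> \<beta>" by (simp add: mem_Times_iff)
  qed
  then show 1: "closure {p::real \<times> 'a. \<theta> (fst p) * bump k \<alpha> \<beta> (snd p) \<noteq> 0} \<subseteq> {a..b} \<times> cbox \<alpha> \<beta>"
    by (rule closure_minimal) (auto intro: closed_Times)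
  have "compact ({a..b} \<times> cbox \<alpha> \<beta>)" by (intro compact_Times) auto
  then have "compact (closure {p::real \<times> 'a. \<theta> (fst p) * bump k \<alpha> \<beta> (snd p) \<noteq> 0})"
    using 1 compact_Int_closed[of "{a..b} \<times> cbox \<alpha> \<beta>" "closure {p::real \<times> 'a. \<theta> (fst p) * bump k \<alpha> \<beta> (snd p) \<noteq> 0}"] by (simp add: Int_absorb1)
  moreover have "smooth_fun (\<lambda>p::real \<times> 'a. \<theta> (fst p) * bump k \<alpha> \<beta> (snd p))"
    by (intro smooth_fun_mult \<theta> bump_smooth bounded_linear_snd)
  ultimately show "csmooth (\<lambda>p::real \<times> 'a. \<theta> (fst p) * bump k \<alpha> \<beta> (snd p))" by (simp add: csmooth_def)
qed

lemma fourier_tr_cmult: "fourier_tr (\<lambda>y. c * f y) \<xi> = complex_of_real c * fourier_tr f \<xi>"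
  by (simp add: fourier_tr_def mult.assoc)

lemma frac_lap_cmult: "frac_lap s (\<lambda>y. c * f y) x = c * frac_lap s f x"
proof -
  have "(\<lambda>\<xi>. complex_of_real (norm \<xi> powr (2 * s)) * fourier_tr (\<lambda>y. c * f y) \<xi>) = (\<lambda>\<xi>. complex_of_real c * (complex_of_real (norm \<xi> powr (2 * s)) * fourier_tr f \<xi>))"
    by (simp add: fourier_tr_cmult mult.left_commute)
  then show ?thesis unfolding frac_lap_eq_inv_ft by (simp only: inv_ft_cmult)
qed

text \<open>The results on slices apply once the bump is written as a multiple of a slice of a
  smooth compactly supported function on space-time.\<close>

lemma bump_facts:
  fixes \<alpha> \<beta> :: "'a::euclidean_space"
  assumes s: "0 < s" "s < 1" and k: "k > 0"
  shows "integrable lborel (fourier_tr (bump k \<alpha> \<beta>))"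
    "inv_ft (fourier_tr (bump k \<alpha> \<beta>)) = bump k \<alpha> \<beta>"
    "integrable lborel (\<lambda>\<xi>. complex_of_real (norm \<xi> powr (2 * s)) * fourier_tr (bump k \<alpha> \<beta>) \<xi>)"
    "\<exists>A\<ge>0. (\<forall>x. \<bar>bump k \<alpha> \<beta> x\<bar> \<le> A * wt s x) \<and> (\<forall>x. \<bar>frac_lap s (bump k \<alpha> \<beta>) x\<bar> \<le> A * wt s x)"
    "bump k \<alpha> \<beta> \<in> borel_measurable borel" "frac_lap s (bump k \<alpha> \<beta>) \<in> borel_measurable borel"
proof -
  \<comment> \<open>An auxiliary time profile supported in the unit interval; the slice at time 1/2
    is the bump times the positive number \<open>d\<close>.\<close>
  let ?\<theta> = "\<lambda>\<tau>. kap (0 + \<tau>) * kap (1 + (- 1) * \<tau>)"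
  have sm: "smooth_fun (\<lambda>p::real \<times> 'a. ?\<theta> (fst p))"
    by (intro smooth_fun_mult smooth_kap_affine bounded_linear_fst bounded_linear_const_mult)
  have sup: "0 \<le> \<tau> \<and> \<tau> \<le> 1" if "?\<theta> \<tau> \<noteq> 0" for \<tau>
    using that by (cases "\<tau> \<le> 0"; cases "\<tau> \<ge> 1") (simp_all add: kap_0)
  define \<psi> where "\<psi> = (\<lambda>p::real \<times> 'a. ?\<theta> (fst p) * bump k \<alpha> \<beta> (snd p))"
  have c: "csmooth \<psi>" unfolding \<psi>_def by (rule csmooth_timebump(1)[OF sm sup k])
  define d where "d = ?\<theta> (1/2)"
  have d: "d > 0" unfolding d_def by (intro mult_pos_pos kap_pos) auto
  have sl: "(\<lambda>y. \<psi> (1/2, y)) = (\<lambda>y. d * bump k \<alpha> \<beta> y)" by (simp add: \<psi>_def d_def)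
  have F: "fourier_tr (bump k \<alpha> \<beta>) \<xi> = complex_of_real (1 / d) * fourier_tr (\<lambda>y. \<psi> (1/2, y)) \<xi>" for \<xi>
    unfolding sl fourier_tr_cmult using d by simp
  show "integrable lborel (fourier_tr (bump k \<alpha> \<beta>))"
    unfolding F[abs_def] by (intro integrable_mult_right fourier_inversion_slice[OF c])
  show "inv_ft (fourier_tr (bump k \<alpha> \<beta>)) = bump k \<alpha> \<beta>"
  proof
    fix x
    have "inv_ft (fourier_tr (bump k \<alpha> \<beta>)) x = 1 / d * inv_ft (fourier_tr (\<lambda>y. \<psi> (1/2, y))) x"
      unfolding F[abs_def] inv_ft_cmult ..
    also have "inv_ft (fourier_tr (\<lambda>y. \<psi> (1/2, y))) x = \<psi> (1/2, x)"
      by (rule fourier_inversion_slice(2)[OF c, of "1/2" x])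
    also have "\<psi> (1/2, x) = d * bump k \<alpha> \<beta> x" by (simp add: \<psi>_def d_def)
    finally have "inv_ft (fourier_tr (bump k \<alpha> \<beta>)) x = 1 / d * (d * bump k \<alpha> \<beta> x)" .
    then show "inv_ft (fourier_tr (bump k \<alpha> \<beta>)) x = bump k \<alpha> \<beta> x" using d by simp
  qed
  have "(\<lambda>\<xi>. complex_of_real (norm \<xi> powr (2 * s)) * fourier_tr (bump k \<alpha> \<beta>) \<xi>) = (\<lambda>\<xi>. complex_of_real (1 / d) * (complex_of_real (norm \<xi> powr (2 * s)) * fourier_tr (\<lambda>y. \<psi> (1/2, y)) \<xi>))"
    by (simp add: F mult.left_commute)
  then show "integrable lborel (\<lambda>\<xi>. complex_of_real (norm \<xi> powr (2 * s)) * fourier_tr (bump k \<alpha> \<beta>) \<xi>)"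
    using integrable_mult_right[OF frac_lap_slice_integrable[OF s c, of "1/2"], of "complex_of_real (1 / d)"] by (simp only:)
  obtain A1 where A1: "A1 \<ge> 0" "\<And>t x. \<bar>\<psi> (t, x)\<bar> \<le> A1 * wt s x" using csmooth_le_wt[OF s(1) c] by blast
  obtain A2 where A2: "A2 \<ge> 0" "\<And>t x. \<bar>frac_lap s (\<lambda>y. \<psi> (t, y)) x\<bar> \<le> A2 * wt s x" using frac_lap_slice_bound[OF s c] by blast
  have "\<bar>bump k \<alpha> \<beta> x\<bar> \<le> (A1 + A2) / d * wt s x" for x
  proof -
    have "d * \<bar>bump k \<alpha> \<beta> x\<bar> \<le> A1 * wt s x" using A1(2)[of "1/2" x] d using fun_cong[OF sl, of x] by (simp add: abs_mult)
    also have "\<dots> \<le> (A1 + A2) * wt s x" using A2(1) by (intro mult_right_mono wt_nonneg) auto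
    finally show ?thesis using d by (simp add: field_simps)
  qed
  moreover have "\<bar>frac_lap s (bump k \<alpha> \<beta>) x\<bar> \<le> (A1 + A2) / d * wt s x" for x
  proof -
    have "d * \<bar>frac_lap s (bump k \<alpha> \<beta>) x\<bar> \<le> A2 * wt s x"
      using A2(2)[of "1/2" x] d unfolding sl frac_lap_cmult by (simp add: abs_mult)
    also have "\<dots> \<le> (A1 + A2) * wt s x" using A1(1) by (intro mult_right_mono wt_nonneg) auto
    finally show ?thesis using d by (simp add: field_simps)
  qed
  ultimately show "\<exists>A\<ge>0. (\<forall>x. \<bar>bump k \<alpha> \<beta> x\<bar> \<le> A * wt s x) \<and> (\<forall>x. \<bar>frac_lap s (bump k \<alpha> \<beta>) x\<bar> \<le> A * wt s x)"
    using A1(1) A2(1) d by (intro exI[of _ "(A1 + A2) / d"]) auto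
  show m: "bump k \<alpha> \<beta> \<in> borel_measurable borel" unfolding bump_def[abs_def] by measurable
  show "frac_lap s (bump k \<alpha> \<beta>) \<in> borel_measurable borel"
  proof -
    have "fourier_tr (bump k \<alpha> \<beta>) \<in> borel_measurable borel" by (rule fourier_tr_measurable[OF m])
    note [measurable] = this
    show ?thesis unfolding frac_lap_eq_inv_ft by (rule borel_measurable_inv_ft) measurable
  qed
qed

section \<open>Uniqueness\<close>

lemma DERIV_integral:
  fixes f f' :: "real \<Rightarrow> 'p \<Rightarrow> real"
  assumes x0: "a < x0" "x0 < b"
    and int: "\<And>x. a < x \<Longrightarrow> x < b \<Longrightarrow> integrable M (f x)"
    and meas: "f' x0 \<in> borel_measurable M"
    and der: "\<And>x p. a < x \<Longrightarrow> x < b \<Longrightarrow> ((\<lambda>x. f x p) has_real_derivative f' x p) (at x)"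
    and B: "integrable M B" "\<And>x p. a < x \<Longrightarrow> x < b \<Longrightarrow> \<bar>f' x p\<bar> \<le> B p"
  shows "((\<lambda>x. LINT p|M. f x p) has_real_derivative (LINT p|M. f' x0 p)) (at x0)"
  unfolding has_field_derivative_iff tendsto_at_iff_sequentially comp_def
proof (intro allI impI)
  fix X :: "nat \<Rightarrow> real" assume X: "\<forall>i. X i \<in> UNIV - {x0}" "X \<longlonglongrightarrow> x0"
  have "eventually (\<lambda>n. X n \<in> {a<..<b}) sequentially"
    using topological_tendstoD[OF X(2), of "{a<..<b}"] x0 by simp
  then obtain N where N: "\<And>n. n \<ge> N \<Longrightarrow> X n \<in> {a<..<b}" by (auto simp: eventually_sequentially)
  let ?Y = "\<lambda>n. X (n + N)"
  have Y: "a < ?Y n" "?Y n < b" "?Y n \<noteq> x0" for n using N[of "n + N"] X(1) by auto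
  have "(\<lambda>n. LINT p|M. (f (?Y n) p - f x0 p) / (?Y n - x0)) \<longlonglongrightarrow> (LINT p|M. f' x0 p)"
  proof (rule integral_dominated_convergence[OF meas _ B(1)])
    show "(\<lambda>p. (f (?Y n) p - f x0 p) / (?Y n - x0)) \<in> borel_measurable M" for n
      using int[OF Y(1,2)] int[OF x0] by measurable
    show "AE p in M. (\<lambda>n. (f (?Y n) p - f x0 p) / (?Y n - x0)) \<longlonglongrightarrow> f' x0 p"
    proof (rule AE_I2)
      fix p
      have "((\<lambda>y. (f y p - f x0 p) / (y - x0)) \<longlongrightarrow> f' x0 p) (at x0)" using der[OF x0, of p] by (simp add: has_field_derivative_iff)
      moreover have "filterlim ?Y (at x0) sequentially"
        using LIMSEQ_ignore_initial_segment[OF X(2), of N] Y(3) by (auto simp: filterlim_at)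
      ultimately show "(\<lambda>n. (f (?Y n) p - f x0 p) / (?Y n - x0)) \<longlonglongrightarrow> f' x0 p" by (rule filterlim_compose)
    qed
    show "AE p in M. norm ((f (?Y n) p - f x0 p) / (?Y n - x0)) \<le> B p" for n
    proof (rule AE_I2)
      fix p
      have "norm (f (?Y n) p - f x0 p) \<le> B p * norm (?Y n - x0)"
        by (rule field_differentiable_bound[of "{a<..<b}" "\<lambda>x. f x p" "\<lambda>x. f' x p"])
          (use Y x0 B(2) in \<open>auto intro: has_field_derivative_at_within der\<close>)
      then show "norm ((f (?Y n) p - f x0 p) / (?Y n - x0)) \<le> B p"
        using Y(3)[of n] by (simp add: norm_divide divide_le_eq)
    qed
  qed
  moreover have "(LINT p|M. (f (?Y n) p - f x0 p) / (?Y n - x0)) = ((LINT p|M. f (?Y n) p) - (LINT p|M. f x0 p)) / (?Y n - x0)" for n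
    using int[OF Y(1,2)] int[OF x0] by simp
  ultimately have "(\<lambda>n. ((LINT p|M. f (?Y n) p) - (LINT p|M. f x0 p)) / (?Y n - x0)) \<longlonglongrightarrow> (LINT p|M. f' x0 p)" by (simp only:)
  then show "(\<lambda>n. ((LINT p|M. f (X n) p) - (LINT p|M. f x0 p)) / (X n - x0)) \<longlonglongrightarrow> (LINT p|M. f' x0 p)"
    by (rule LIMSEQ_offset[where k=N])
qed

text \<open>The time profile of the uniqueness proof. Integrating the step twice makes it
  continuously differentiable, so pairings with it can be differentiated in the final time although
  the solution has no regularity in time.\<close>

lemma half_square_pos_part_DERIV: "((\<lambda>u. (max 0 (u - c))\<^sup>2 / 2) has_real_derivative max 0 (x - c)) (at x)"
proof -
  consider "x < c" | "x > c" | "x = c" by linarith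
  then show ?thesis
  proof cases
    case 1
    have "((\<lambda>_. 0) has_real_derivative 0) (at x)" by simp
    then have "((\<lambda>u. (max 0 (u - c))\<^sup>2 / 2) has_real_derivative 0) (at x)"
      by (rule has_field_derivative_transform_within_open[where S="{..<c}"]) (use 1 in auto)
    then show ?thesis using 1 by simp
  next
    case 2
    have "((\<lambda>u. (u - c)\<^sup>2 / 2) has_real_derivative (x - c)) (at x)" by (auto intro!: derivative_eq_intros)
    then have "((\<lambda>u. (max 0 (u - c))\<^sup>2 / 2) has_real_derivative (x - c)) (at x)"
      by (rule has_field_derivative_transform_within_open[where S="{c<..}"]) (use 2 in auto)
    then show ?thesis using 2 by simp
  next
    case 3
    have "((\<lambda>h::real. (max 0 h)\<^sup>2 / 2 / h) \<longlongrightarrow> 0) (at 0)"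
    proof (rule Lim_null_comparison)
      show "((\<lambda>h::real. \<bar>h\<bar>) \<longlongrightarrow> 0) (at 0)" using tendsto_rabs[OF tendsto_ident_at[of 0 UNIV]] by simp
      show "\<forall>\<^sub>F h in at 0. norm ((max 0 h)\<^sup>2 / 2 / h) \<le> \<bar>h\<bar>"
        by (intro always_eventually allI) (auto simp: max_def power2_eq_square abs_mult)
    qed
    then show ?thesis using 3 by (simp add: DERIV_def)
  qed
qed

lemma kap1_scaled_integral_le:
  assumes n: "n > 0" and d: "d > 0"
  shows "integrable lborel (\<lambda>\<tau>. indicator {0..d} \<tau> * (n * kapd (Suc 0) (- 1 + n * \<tau>)))"
    "(LINT \<tau>|lborel. indicator {0..d} \<tau> * (n * kapd (Suc 0) (- 1 + n * \<tau>))) \<le> 1"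
proof -
  have d1: "((\<lambda>\<tau>. kap (- 1 + n * \<tau>)) has_vector_derivative n * kapd (Suc 0) (- 1 + n * \<tau>)) (at \<tau> within {0..d})" for \<tau>
  proof -
    have "((\<lambda>\<tau>. - 1 + n * \<tau>) has_real_derivative n) (at \<tau>)" by (auto intro!: derivative_eq_intros)
    from DERIV_chain2[OF kapd_has_derivative this]
    have "((\<lambda>\<tau>. kap (- 1 + n * \<tau>)) has_real_derivative n * kapd (Suc 0) (- 1 + n * \<tau>)) (at \<tau>)" by (simp add: mult.commute)
    then show ?thesis by (simp add: has_real_derivative_iff_has_vector_derivative has_vector_derivative_at_within)
  qed
  have c: "continuous_on {0..d} (\<lambda>\<tau>. n * kapd (Suc 0) (- 1 + n * \<tau>))"
    by (intro continuous_intros continuous_on_compose2[OF kap_continuous[of UNIV]]) auto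
  have h: "has_bochner_integral lborel (\<lambda>\<tau>. indicator {0..d} \<tau> *\<^sub>R (n * kapd (Suc 0) (- 1 + n * \<tau>))) (kap (- 1 + n * d) - kap (- 1 + n * 0))"
    by (rule has_bochner_integral_FTC_Icc) (use d d1 c in auto)
  show "integrable lborel (\<lambda>\<tau>. indicator {0..d} \<tau> * (n * kapd (Suc 0) (- 1 + n * \<tau>)))"
    "(LINT \<tau>|lborel. indicator {0..d} \<tau> * (n * kapd (Suc 0) (- 1 + n * \<tau>))) \<le> 1"
    using h kap_bounds(2)[of "- 1 + n * d"] by (auto simp: has_bochner_integral_iff kap_0)
qed

text \<open>The derivative of the initial cutoff has mass at most 1, lives near 0 and is of order
  1/n at a fixed distance from 0. Integrals against it see only the behaviour of \<open>F\<close>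
  near 0, and the null set \<open>E\<close> is invisible to them.\<close>

lemma kap1_concentrates:
  fixes F :: "real \<Rightarrow> real"
  assumes F: "integrable lborel F" and Fz: "\<And>\<tau>. \<tau> \<notin> {0<..<T} \<Longrightarrow> F \<tau> = 0" and T: "T > 0"
    and E: "E \<in> null_sets lborel" "(F \<longlongrightarrow> 0) (at 0 within {0<..<T} - E)"
    and g: "\<And>n \<tau>. 0 < \<tau> \<Longrightarrow> \<tau> < T \<Longrightarrow> \<bar>g n \<tau>\<bar> \<le> M" "\<And>n. g n \<in> borel_measurable borel"
  shows "(\<lambda>n. LINT \<tau>|lborel. (real (Suc n) * kapd (Suc 0) (- 1 + real (Suc n) * \<tau>)) * (g n \<tau> * F \<tau>)) \<longlonglongrightarrow> 0"
proof -
  note [measurable] = g(2)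
  have [measurable]: "F \<in> borel_measurable borel" using F by (simp add: integrable_iff_bounded)
  have M: "M \<ge> 0" using g(1)[of "T/2" 0] T by simp
  let ?K = "\<lambda>n \<tau>. real (Suc n) * kapd (Suc 0) (- 1 + real (Suc n) * \<tau>)"
  show ?thesis
  proof (rule LIMSEQ_I)
    fix r :: real assume r: "r > 0"
    \<comment> \<open>The denominator is \<open>M + 1\<close> because \<open>M\<close> may be zero;
      half of \<open>r\<close> is left for the range beyond \<open>d\<close>.\<close>
    define e where "e = (r / 2) / (M + 1)"
    have e: "e > 0" "M * e \<le> r / 2"
    proof -
      show "e > 0" using r M by (simp add: e_def)
      have "c * (q / c) = q" if "c \<noteq> 0" for c q :: real using that by simp
      from this[of "M + 1" "r / 2"] M have *: "(M + 1) * e = r / 2" unfolding e_def by linarith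
      have "M * e \<le> (M + 1) * e" using \<open>e > 0\<close> by simp
      also note *
      finally show "M * e \<le> r / 2" .
    qed
    obtain d where d: "d > 0" "\<And>\<tau>. \<tau> \<in> {0<..<T} - E \<Longrightarrow> \<tau> < d \<Longrightarrow> \<bar>F \<tau>\<bar> < e"
      using E(2) e(1) unfolding Lim_within by (fastforce simp: dist_real_def)
    define I where "I = (LINT \<tau>|lborel. \<bar>F \<tau>\<bar>)"
    have I: "I \<ge> 0" by (simp add: I_def)
    obtain n1 :: nat where n1: "real n1 > 2 / d" using reals_Archimedean2 by blast
    obtain n2 :: nat where n2: "real n2 > 8 * (M * I) / (d\<^sup>2 * r)" using reals_Archimedean2 by blast
    have "norm ((LINT \<tau>|lborel. ?K n \<tau> * (g n \<tau> * F \<tau>)) - 0) < r" if n: "n \<ge> max n1 n2" for n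
    proof -
      let ?m = "real (Suc n)"
      have m1: "?m > 2 / d" and m2: "?m > 8 * (M * I) / (d\<^sup>2 * r)" using n n1 n2 by auto
      \<comment> \<open>As \<open>?m * d\<close> exceeds 2, the shift by -1 costs at most half of
        the argument, and the inverse-square bound on the derivative of \<open>kap\<close>
        applies.\<close>
      have far: "?K n \<tau> \<le> 4 / (?m * d\<^sup>2)" if "\<tau> \<ge> d" for \<tau>
      proof -
        have md: "?m * d > 2" using m1 d by (simp add: field_simps)
        have "?m * d \<le> ?m * \<tau>" using that by (intro mult_left_mono) auto
        then have z: "- 1 + ?m * \<tau> \<ge> ?m * d / 2" using md by linarith
        have "kapd (Suc 0) (- 1 + ?m * \<tau>) \<le> 1 / (- 1 + ?m * \<tau>)\<^sup>2" using z md by (intro kap1_bounds) linarith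
        also have "\<dots> \<le> 1 / (?m * d / 2)\<^sup>2" using z md d by (intro divide_left_mono power_mono mult_pos_pos) auto
        finally have "?m * kapd (Suc 0) (- 1 + ?m * \<tau>) \<le> ?m * (1 / (?m * d / 2)\<^sup>2)" by (intro mult_left_mono) auto
        also have "\<dots> = 4 / (?m * d\<^sup>2)" by (simp add: power2_eq_square field_simps del: of_nat_Suc)
        finally show ?thesis .
      qed
      let ?R = "\<lambda>\<tau>. (indicator {0..d} \<tau> * ?K n \<tau>) * (M * e) + 4 / (?m * d\<^sup>2) * (M * \<bar>F \<tau>\<bar>)"
      have kk: "integrable lborel (\<lambda>\<tau>. indicator {0..d} \<tau> * ?K n \<tau>)" "(LINT \<tau>|lborel. indicator {0..d} \<tau> * ?K n \<tau>) \<le> 1"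
        by (rule kap1_scaled_integral_le; use d in simp)+
      have iR: "integrable lborel ?R" using kk(1) F by (intro Bochner_Integration.integrable_add integrable_mult_left integrable_mult_right integrable_abs)
      have K0: "?K n \<tau> \<ge> 0" for \<tau> using kap1_bounds(1) by simp
      have le: "norm (?K n \<tau> * (g n \<tau> * F \<tau>)) \<le> ?R \<tau>" if "\<tau> \<notin> E" for \<tau>
      proof (cases "\<tau> \<in> {0<..<T}")
        case False
        then show ?thesis using Fz[OF False] K0[of \<tau>] M e(1) d by simp
      next
        case True
        have gF: "\<bar>g n \<tau> * F \<tau>\<bar> \<le> M * \<bar>F \<tau>\<bar>" unfolding abs_mult using g(1)[of \<tau> n] True by (intro mult_right_mono) auto
        show ?thesis
        proof (cases "\<tau> < d")
          case l: True
          have "norm (?K n \<tau> * (g n \<tau> * F \<tau>)) \<le> ?K n \<tau> * (M * \<bar>F \<tau>\<bar>)"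
            unfolding real_norm_def abs_mult[of "?K n \<tau>"] using K0[of \<tau>] gF by (intro mult_mono) auto
          also have "\<dots> \<le> ?K n \<tau> * (M * e)"
            using d(2)[of \<tau>] True that l M K0[of \<tau>] by (intro mult_left_mono) auto
          also have "\<dots> \<le> ?R \<tau>" using True l M d K0[of \<tau>] by simp
          finally show ?thesis .
        next
          case False
          have "norm (?K n \<tau> * (g n \<tau> * F \<tau>)) \<le> ?K n \<tau> * (M * \<bar>F \<tau>\<bar>)"
            unfolding real_norm_def abs_mult[of "?K n \<tau>"] using K0[of \<tau>] gF by (intro mult_mono) auto
          also have "\<dots> \<le> 4 / (?m * d\<^sup>2) * (M * \<bar>F \<tau>\<bar>)" using far[of \<tau>] False M by (intro mult_right_mono) auto
          also have "\<dots> \<le> ?R \<tau>" using K0[of \<tau>] M e by simp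
          finally show ?thesis .
        qed
      qed
      have AE: "AE \<tau> in lborel. norm (?K n \<tau> * (g n \<tau> * F \<tau>)) \<le> ?R \<tau>"
        using AE_not_in[OF E(1)] by eventually_elim (rule le)
      have "norm (LINT \<tau>|lborel. ?K n \<tau> * (g n \<tau> * F \<tau>)) \<le> (LINT \<tau>|lborel. ?R \<tau>)"
      proof -
        have iK: "integrable lborel (\<lambda>\<tau>. ?K n \<tau> * (g n \<tau> * F \<tau>))"
          by (rule Bochner_Integration.integrable_bound[OF iR]) (use AE in \<open>auto elim!: eventually_mono intro: order_trans[OF _ abs_ge_self]\<close>)
        have "norm (LINT \<tau>|lborel. ?K n \<tau> * (g n \<tau> * F \<tau>)) \<le> (LINT \<tau>|lborel. norm (?K n \<tau> * (g n \<tau> * F \<tau>)))" by (rule integral_norm_bound)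
        also have "\<dots> \<le> (LINT \<tau>|lborel. ?R \<tau>)" by (rule integral_mono_AE[OF integrable_norm[OF iK] iR AE])
        finally show ?thesis .
      qed
      also have "\<dots> = (LINT \<tau>|lborel. indicator {0..d} \<tau> * ?K n \<tau>) * (M * e) + 4 / (?m * d\<^sup>2) * (M * I)"
        using kk(1) F by (simp add: I_def)
      also have "\<dots> \<le> 1 * (M * e) + 4 / (?m * d\<^sup>2) * (M * I)"
        using kk(2) M e by (intro add_right_mono mult_right_mono) auto
      also have "\<dots> < r"
      proof -
        have "8 * (M * I) < ?m * (d\<^sup>2 * r)" using m2 d r by (simp add: pos_divide_less_eq del: of_nat_Suc)
        then have "4 / (?m * d\<^sup>2) * (M * I) < r / 2" using d by (simp add: divide_less_eq field_simps del: of_nat_Suc)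
        then show ?thesis using e(2) by linarith
      qed
      finally show ?thesis by simp
    qed
    then show "\<exists>no. \<forall>n\<ge>no. norm ((LINT \<tau>|lborel. ?K n \<tau> * (g n \<tau> * F \<tau>)) - 0) < r" by blast
  qed
qed

text \<open>Convolution with the kernel is an average over translates. An identity known for all
  translates of one function thus passes to its smoothing, though the smoothing itself is not an
  admissible test function.\<close>

lemma heat_superposition:
  fixes G :: "real \<times> 'a::euclidean_space \<Rightarrow> real" and g :: "'a \<Rightarrow> real"
  assumes s: "0 < s" "s < 1" and a: "a > 0" and G: "G \<in> borel_measurable borel" "integrable lborel (\<lambda>p. G p * wt s (snd p))"
    and g: "g \<in> borel_measurable borel" "\<And>y. \<bar>g y\<bar> \<le> A * wt s y"
  shows "(LINT p|lborel. G p * (LINT y|lborel. frac_heat_kernel s a (snd p - y) * g y))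
       = (LINT z|lborel. frac_heat_kernel s a z * (LINT p|lborel. G p * g (snd p - z)))"
proof -
  note [measurable] = g(1)
  have [measurable]: "G \<in> borel_measurable (borel \<Otimes>\<^sub>M borel)" using G by (simp add: borel_prod)
  let ?P = "frac_heat_kernel s a :: 'a \<Rightarrow> real"
  have refl: "(LINT y|lborel. ?P (x - y) * h y) = (LINT z|lborel. ?P z * h (x - z))" "integrable lborel (\<lambda>z. ?P z * h (x - z))"
    if "h \<in> borel_measurable borel" "\<And>y. \<bar>h y\<bar> \<le> A * wt s y" for h x
  proof -
    have i: "integrable lborel (\<lambda>y. ?P (x - y) * h y)" by (rule heat_conv_bound(1)[OF s a that])
    show "integrable lborel (\<lambda>z. ?P z * h (x - z))" using lborel_reflect(1)[OF i, of x] by simp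
    show "(LINT y|lborel. ?P (x - y) * h y) = (LINT z|lborel. ?P z * h (x - z))" using lborel_reflect(2)[OF i, of x] by simp
  qed
  have absb: "(LINT z|lborel. ?P z * \<bar>g (x - z)\<bar>) \<le> A * exp (a * heatK s) * wt s x" for x
    using refl(1)[of "\<lambda>y. \<bar>g y\<bar>" x] heat_conv_bound(2)[OF s a g, of x] g(2) by simp
  let ?F = "\<lambda>p z. G p * (?P z * g (snd p - z))"
  have Fm: "case_prod ?F \<in> borel_measurable (lborel \<Otimes>\<^sub>M lborel)"
    unfolding lborel_prod[symmetric, where 'a=real and 'b='a] by measurable
  have nrm: "(LINT z|lborel. norm (?F p z)) = \<bar>G p\<bar> * (LINT z|lborel. ?P z * \<bar>g (snd p - z)\<bar>)" for p
    by (simp add: abs_mult heat_kernel_nonneg[OF s a])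
  have F: "integrable (lborel \<Otimes>\<^sub>M lborel) (case_prod ?F)"
  proof (rule lborel_pair.Fubini_integrable[OF Fm])
    have i: "integrable lborel (\<lambda>p. (A * exp (a * heatK s)) * (G p * wt s (snd p)))" using G(2) by (rule integrable_mult_right)
    show "integrable lborel (\<lambda>p. LINT z|lborel. norm (case_prod ?F (p, z)))"
      unfolding prod.case nrm
    proof (rule Bochner_Integration.integrable_bound[OF i])
      show "(\<lambda>p. \<bar>G p\<bar> * (LINT z|lborel. ?P z * \<bar>g (snd p - z)\<bar>)) \<in> borel_measurable lborel"
        unfolding lborel_prod[symmetric, where 'a=real and 'b='a] by measurable
      show "AE p in lborel. norm (\<bar>G p\<bar> * (LINT z|lborel. ?P z * \<bar>g (snd p - z)\<bar>)) \<le> norm ((A * exp (a * heatK s)) * (G p * wt s (snd p)))"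
      proof (rule AE_I2)
        fix p :: "real \<times> 'a"
        have 0: "0 \<le> (LINT z|lborel. ?P z * \<bar>g (snd p - z)\<bar>)"
          by (intro Bochner_Integration.integral_nonneg) (simp add: heat_kernel_nonneg[OF s a])
        have "\<bar>G p\<bar> * (LINT z|lborel. ?P z * \<bar>g (snd p - z)\<bar>) \<le> \<bar>G p\<bar> * (A * exp (a * heatK s) * wt s (snd p))"
          by (intro mult_left_mono absb) simp
        also have "\<dots> \<le> \<bar>G p * (A * exp (a * heatK s) * wt s (snd p))\<bar>"
          unfolding abs_mult[of "G p"] by (intro mult_left_mono abs_ge_self) simp
        finally show "norm (\<bar>G p\<bar> * (LINT z|lborel. ?P z * \<bar>g (snd p - z)\<bar>)) \<le> norm ((A * exp (a * heatK s)) * (G p * wt s (snd p)))"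
          using 0 by (simp add: abs_mult mult_ac)
      qed
    qed
    show "AE p in lborel. integrable lborel (\<lambda>z. case_prod ?F (p, z))"
      unfolding prod.case using refl(2)[OF g] by (intro AE_I2 integrable_mult_right)
  qed
  have "(LINT p|lborel. G p * (LINT y|lborel. ?P (snd p - y) * g y)) = (LINT p|lborel. LINT z|lborel. ?F p z)"
    by (simp add: refl(1)[OF g])
  also have "\<dots> = (LINT z|lborel. LINT p|lborel. ?F p z)"
    using lborel_pair.Fubini_integral[OF F] by simp
  also have "\<dots> = (LINT z|lborel. ?P z * (LINT p|lborel. G p * g (snd p - z)))"
  proof (rule Bochner_Integration.integral_cong)
    fix z
    have "(LINT p|lborel. ?F p z) = (LINT p|lborel. ?P z * (G p * g (snd p - z)))" by (simp add: mult_ac)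
    then show "(LINT p|lborel. ?F p z) = ?P z * (LINT p|lborel. G p * g (snd p - z))" by (simp only: integral_mult_right_zero)
  qed simp
  finally show ?thesis .
qed

text \<open>The difference of two solutions, taken Borel measurable and set to zero outside the
  strip, so that all integrals run over the whole space with \<open>lborel\<close>.\<close>

locale zero_trace_solution =
  fixes s T :: real and w :: "real \<times> 'a::euclidean_space \<Rightarrow> real"
  assumes s: "0 < s" "s < 1" and T: "0 < T"
    and w: "w \<in> borel_measurable borel"
    and w_zero: "\<And>p. fst p \<notin> {0<..<T} \<Longrightarrow> w p = 0"
    and w_int: "integrable lborel (\<lambda>p. w p * wt s (snd p))"
    and weak: "\<And>\<psi>. test_fun T \<psi> \<Longrightarrow> (LINT p|lborel. w p * ddir (1, 0) \<psi> p) = (LINT p|lborel. w p * frac_lap s (\<lambda>y. \<psi> (fst p, y)) (snd p))"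
    and trace: "\<And>\<phi>. continuous_on UNIV \<phi> \<Longrightarrow> compact (closure {x. \<phi> x \<noteq> 0}) \<Longrightarrow>
       \<exists>E\<in>null_sets lborel. ((\<lambda>t. LINT x|lborel. w (t, x) * \<phi> x) \<longlongrightarrow> 0) (at 0 within {0<..<T} - E)"
begin

lemma w_measurable [measurable]: "w \<in> borel_measurable (borel \<Otimes>\<^sub>M borel)"
  using w by (simp add: borel_prod)

lemma integrable_w_mult:
  fixes H :: "real \<times> 'a \<Rightarrow> real"
  assumes "H \<in> borel_measurable (borel \<Otimes>\<^sub>M borel)" "\<And>\<tau> x. \<tau> \<in> {0<..<T} \<Longrightarrow> \<bar>H (\<tau>, x)\<bar> \<le> C * wt s x"
  shows "integrable lborel (\<lambda>p. w p * H p)"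
proof (rule Bochner_Integration.integrable_bound[OF integrable_mult_right[OF w_int, of C]])
  note [measurable] = assms(1)
  show "(\<lambda>p. w p * H p) \<in> borel_measurable lborel" using w assms(1) by (simp add: borel_prod)
  show "AE p in lborel. norm (w p * H p) \<le> norm (C * (w p * wt s (snd p)))"
  proof (rule AE_I2)
    fix p
    show "norm (w p * H p) \<le> norm (C * (w p * wt s (snd p)))"
    proof (cases "fst p \<in> {0<..<T}")
      case True
      have "\<bar>H p\<bar> \<le> \<bar>C * wt s (snd p)\<bar>" using assms(2)[OF True, of "snd p"] by simp
      then have "\<bar>w p\<bar> * \<bar>H p\<bar> \<le> \<bar>w p\<bar> * \<bar>C * wt s (snd p)\<bar>" by (intro mult_left_mono) auto
      then show ?thesis by (simp add: abs_mult mult_ac)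
    qed (simp add: w_zero)
  qed
qed

lemma w_dominated_convergence:
  fixes H :: "nat \<Rightarrow> real \<times> 'a \<Rightarrow> real"
  assumes H: "\<And>n. H n \<in> borel_measurable (borel \<Otimes>\<^sub>M borel)" "h \<in> borel_measurable (borel \<Otimes>\<^sub>M borel)"
    and b: "\<And>n \<tau> x. \<tau> \<in> {0<..<T} \<Longrightarrow> \<bar>H n (\<tau>, x)\<bar> \<le> C * wt s x"
    and lim: "\<And>\<tau> x. \<tau> \<in> {0<..<T} \<Longrightarrow> (\<lambda>n. H n (\<tau>, x)) \<longlonglongrightarrow> h (\<tau>, x)"
  shows "(\<lambda>n. LINT p|lborel. w p * H n p) \<longlonglongrightarrow> (LINT p|lborel. w p * h p)"
proof (rule integral_dominated_convergence)
  note [measurable] = H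
  show "integrable lborel (\<lambda>p. C * \<bar>w p * wt s (snd p)\<bar>)" using w_int by (intro integrable_mult_right integrable_abs)
  show "(\<lambda>p. w p * h p) \<in> borel_measurable lborel" "(\<lambda>p. w p * H n p) \<in> borel_measurable lborel" for n
    using w H by (simp_all add: borel_prod)
  show "AE p in lborel. (\<lambda>n. w p * H n p) \<longlonglongrightarrow> w p * h p"
  proof (rule AE_I2)
    fix p
    show "(\<lambda>n. w p * H n p) \<longlonglongrightarrow> w p * h p"
      using lim[of "fst p" "snd p"] by (cases "fst p \<in> {0<..<T}") (auto simp: w_zero intro!: tendsto_mult_left)
  qed
  show "AE p in lborel. norm (w p * H n p) \<le> C * \<bar>w p * wt s (snd p)\<bar>" for n
  proof (rule AE_I2)
    fix p
    show "norm (w p * H n p) \<le> C * \<bar>w p * wt s (snd p)\<bar>"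
    proof (cases "fst p \<in> {0<..<T}")
      case True
      have "\<bar>w p\<bar> * \<bar>H n p\<bar> \<le> \<bar>w p\<bar> * (C * wt s (snd p))" using b[OF True, of n "snd p"] by (intro mult_left_mono) auto
      then show ?thesis by (simp add: abs_mult wt_nonneg mult_ac)
    qed (simp add: w_zero)
  qed
qed

text \<open>The profile \<open>(max 0 (t - \<tau>))\<^sup>2 / 2\<close> is neither smooth at t nor
  zero near time 0. Smooth cutoffs of width about 1/n repair both defects. In the limit the cutoff
  at t leaves no trace because of the quadratic zero, and the one at 0 contributes the vanishing
  initial trace.\<close>

lemma tested_identity:
  assumes k: "k > 0" and t: "0 < t" "t < T"
  shows "(LINT p|lborel. w p * (max 0 (t - fst p) * bump k \<alpha> \<beta> (snd p)))
       = - (LINT p|lborel. w p * ((max 0 (t - fst p))\<^sup>2 / 2 * frac_lap s (bump k \<alpha> \<beta>) (snd p)))"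
proof -
  let ?\<phi> = "bump k \<alpha> \<beta>"
  obtain A where A: "A \<ge> 0" "\<And>x. \<bar>?\<phi> x\<bar> \<le> A * wt s x" "\<And>x. \<bar>frac_lap s ?\<phi> x\<bar> \<le> A * wt s x"
    using bump_facts(4)[OF s k, of \<alpha> \<beta>] by blast
  note [measurable] = bump_facts(5,6)[OF s k, of \<alpha> \<beta>]
  define N where "N n = real (Suc n)" for n
  have N: "N n > 0" for n by (simp add: N_def)
  \<comment> \<open>The factor \<open>kap\<close> replaces the positive part at time t. Every factor
    is a constant, an affine function or \<open>kap\<close> of an affine function, the forms for
    which smoothness is available.\<close>
  define J where "J n \<tau> = (t + (- 1) * \<tau>) * (t + (- 1) * \<tau>) * ((1/2) * kap (N n * t + (- N n) * \<tau>))" for n \<tau>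
  define J' where "J' n \<tau> = - ((t - \<tau>) * kap (N n * t + (- N n) * \<tau>)) - (t - \<tau>) / 2 * ((N n * (t - \<tau>)) * kapd (Suc 0) (N n * (t - \<tau>)))" for n \<tau>
  define K where "K n \<tau> = N n * kapd (Suc 0) (- 1 + N n * \<tau>)" for n \<tau>
  \<comment> \<open>The shift by -1 confines the support to times between \<open>1 / N n\<close> and
    t.\<close>
  define \<theta> where "\<theta> n \<tau> = kap (- 1 + N n * \<tau>) * J n \<tau>" for n \<tau>
  have [measurable]: "J n \<in> borel_measurable borel" "J' n \<in> borel_measurable borel" "K n \<in> borel_measurable borel" "\<theta> n \<in> borel_measurable borel" for n
    unfolding J_def[abs_def] J'_def[abs_def] K_def[abs_def] \<theta>_def[abs_def] by measurable
  have Nt: "N n * t + (- N n) * \<tau> = N n * (t - \<tau>)" for n \<tau> by (simp add: algebra_simps)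
  have dJ: "(J n has_real_derivative J' n \<tau>) (at \<tau>)" for n \<tau>
  proof -
    have 1: "((\<lambda>\<tau>. N n * t + (- N n) * \<tau>) has_real_derivative - N n) (at \<tau>)" by (auto intro!: derivative_eq_intros)
    from DERIV_chain2[OF kapd_has_derivative this]
    have 2: "((\<lambda>\<tau>. kap (N n * t + (- N n) * \<tau>)) has_real_derivative kapd (Suc 0) (N n * t + (- N n) * \<tau>) * (- N n)) (at \<tau>)" .
    have 3: "((\<lambda>\<tau>. (t + (- 1) * \<tau>) * (t + (- 1) * \<tau>)) has_real_derivative - 2 * (t - \<tau>)) (at \<tau>)"
      by (auto intro!: derivative_eq_intros simp: algebra_simps)
    have "(J n has_real_derivative (- 2 * (t - \<tau>) * ((1/2) * kap (N n * t + (- N n) * \<tau>)) + (1/2) * (kapd (Suc 0) (N n * t + (- N n) * \<tau>) * (- N n)) * ((t + (- 1) * \<tau>) * (t + (- 1) * \<tau>)))) (at \<tau>)"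
      unfolding J_def[abs_def] by (rule DERIV_mult[OF 3 DERIV_cmult[OF 2]])
    moreover have "- 2 * (t - \<tau>) * ((1/2) * x) + (1/2) * (y * (- N n)) * ((t + (- 1) * \<tau>) * (t + (- 1) * \<tau>))
       = - ((t - \<tau>) * x) - (t - \<tau>) / 2 * ((N n * (t - \<tau>)) * y)" for x y
      by (simp add: field_simps)
    ultimately show ?thesis unfolding J'_def Nt by (simp only:)
  qed
  have d\<theta>: "(\<theta> n has_real_derivative K n \<tau> * J n \<tau> + kap (- 1 + N n * \<tau>) * J' n \<tau>) (at \<tau>)" for n \<tau>
  proof -
    have "((\<lambda>\<tau>. - 1 + N n * \<tau>) has_real_derivative N n) (at \<tau>)" by (auto intro!: derivative_eq_intros)
    from DERIV_mult[OF DERIV_chain2[OF kapd_has_derivative this] dJ]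
    show ?thesis unfolding \<theta>_def[abs_def] K_def by (simp add: mult_ac add.commute)
  qed
  have sm: "smooth_fun (\<lambda>p::real \<times> 'a. \<theta> n (fst p))" for n
    unfolding \<theta>_def J_def
    by (intro smooth_fun_mult smooth_kap_affine smooth_fun_affine smooth_fun_const bounded_linear_const_mult bounded_linear_fst)
  have sup: "1 / N n \<le> \<tau> \<and> \<tau> \<le> t" if "\<theta> n \<tau> \<noteq> 0" for n \<tau>
  proof -
    have "kap (- 1 + N n * \<tau>) \<noteq> 0" "kap (N n * (t - \<tau>)) \<noteq> 0" using that unfolding \<theta>_def J_def Nt by auto
    then have "- 1 + N n * \<tau> > 0" "N n * (t - \<tau>) > 0" using kap_0 not_le by blast+
    then show ?thesis using N[of n] by (simp add: field_simps zero_less_mult_iff)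
  qed
  have tf: "test_fun T (\<lambda>p. \<theta> n (fst p) * ?\<phi> (snd p))" for n
  proof -
    have cs1: "csmooth (\<lambda>p::real \<times> 'a. \<theta> n (fst p) * ?\<phi> (snd p))"
      by (rule csmooth_timebump(1)[OF sm sup k])
    have cs2: "closure {p::real \<times> 'a. \<theta> n (fst p) * ?\<phi> (snd p) \<noteq> 0} \<subseteq> {1 / N n..t} \<times> cbox \<alpha> \<beta>"
      by (rule csmooth_timebump(2)[OF sm sup k])
    have "0 \<le> \<theta> n \<tau>" for \<tau> unfolding \<theta>_def J_def by (intro mult_nonneg_nonneg kap_bounds zero_le_square) auto
    moreover have "closure {p::real \<times> 'a. \<theta> n (fst p) * ?\<phi> (snd p) \<noteq> 0} \<subseteq> {0<..<T} \<times> UNIV"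
    proof (rule order_trans[OF cs2])
      have "0 < 1 / N n" using N[of n] by simp
      then show "{1 / N n..t} \<times> cbox \<alpha> \<beta> \<subseteq> {0<..<T} \<times> UNIV"
        using t(2) less_le_trans by (auto simp del: zero_less_divide_1_iff)
    qed
    ultimately show ?thesis using cs1 bump_bounds(1)[of k \<alpha> \<beta>] by (simp add: test_fun_def csmooth_def)
  qed
  have dd: "ddir (1, 0) (\<lambda>p. \<theta> n (fst p) * ?\<phi> (snd p)) p = K n (fst p) * J n (fst p) * ?\<phi> (snd p) + kap (- 1 + N n * fst p) * J' n (fst p) * ?\<phi> (snd p)" for n p
  proof -
    have "((\<lambda>\<tau>. \<theta> n \<tau> * ?\<phi> (snd p)) has_real_derivative (K n (fst p) * J n (fst p) + kap (- 1 + N n * fst p) * J' n (fst p)) * ?\<phi> (snd p)) (at (fst p))"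
      by (rule DERIV_cmult_right[OF d\<theta>])
    from DERIV_imp_deriv[OF this] show ?thesis
      using deriv_eq_ddir[OF test_fun_csmooth[OF tf[of n]], of "snd p" "fst p"] by (simp add: algebra_simps)
  qed
  let ?a = "\<lambda>n p. K n (fst p) * J n (fst p) * ?\<phi> (snd p)"
  let ?b = "\<lambda>n p. kap (- 1 + N n * fst p) * J' n (fst p) * ?\<phi> (snd p)"
  have tT: "\<bar>t - \<tau>\<bar> \<le> T" if "\<tau> \<in> {0<..<T}" for \<tau> using that t by auto
  have J_le: "\<bar>J n \<tau>\<bar> \<le> T\<^sup>2 / 2" if "\<tau> \<in> {0<..<T}" for n \<tau>
  proof -
    have "\<bar>J n \<tau>\<bar> = \<bar>t - \<tau>\<bar> * \<bar>t - \<tau>\<bar> * (1/2 * kap (N n * t + (- N n) * \<tau>))" using kap_bounds(1) by (simp add: J_def abs_mult)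
    also have "\<dots> \<le> T * T * (1/2 * 1)" using tT[OF that] kap_bounds T by (intro mult_mono) auto
    finally show ?thesis by (simp add: power2_eq_square)
  qed
  have J'_le: "\<bar>J' n \<tau>\<bar> \<le> 2 * T" if "\<tau> \<in> {0<..<T}" for n \<tau>
  proof -
    have "\<bar>J' n \<tau>\<bar> \<le> \<bar>(t - \<tau>) * kap (N n * t + (- N n) * \<tau>)\<bar> + \<bar>(t - \<tau>) / 2 * ((N n * (t - \<tau>)) * kapd (Suc 0) (N n * (t - \<tau>)))\<bar>"
      unfolding J'_def by linarith
    also have "\<dots> \<le> T * 1 + T * 1" unfolding abs_mult[of "t - \<tau>"] abs_mult[of "(t - \<tau>)/2"]
      using tT[OF that] kap_bounds[of "N n * t + (- N n) * \<tau>"] kap1_bounds(2)[of "N n * (t - \<tau>)"] T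
      by (intro add_mono mult_mono) auto
    finally show ?thesis by simp
  qed
  have \<phi>0: "A * wt s x \<ge> 0" for x :: 'a using A wt_nonneg[of s x] by simp
  have b_le: "\<bar>?b n (\<tau>, x)\<bar> \<le> (2 * T * A) * wt s x" if "\<tau> \<in> {0<..<T}" for n \<tau> x
  proof -
    have "\<bar>?b n (\<tau>, x)\<bar> = kap (- 1 + N n * \<tau>) * \<bar>J' n \<tau>\<bar> * \<bar>?\<phi> x\<bar>" using kap_bounds(1) by (simp add: abs_mult)
    also have "\<dots> \<le> 1 * (2 * T) * (A * wt s x)" using J'_le[OF that, of n] A(2)[of x] kap_bounds T \<phi>0 by (intro mult_mono) auto
    finally show ?thesis by (simp add: mult_ac)
  qed
  have \<theta>_le: "\<bar>\<theta> n \<tau> * frac_lap s ?\<phi> x\<bar> \<le> (T\<^sup>2 / 2 * A) * wt s x" if "\<tau> \<in> {0<..<T}" for n \<tau> x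
  proof -
    have "\<bar>\<theta> n \<tau> * frac_lap s ?\<phi> x\<bar> = kap (- 1 + N n * \<tau>) * \<bar>J n \<tau>\<bar> * \<bar>frac_lap s ?\<phi> x\<bar>" using kap_bounds(1) by (simp add: abs_mult \<theta>_def)
    also have "\<dots> \<le> 1 * (T\<^sup>2 / 2) * (A * wt s x)" using J_le[OF that, of n] A(3)[of x] kap_bounds T \<phi>0 by (intro mult_mono) auto
    finally show ?thesis by (simp add: mult_ac)
  qed
  \<comment> \<open>This bound grows with n and serves only for the integrability of each single
    term; the limit of these terms is found from the initial trace.\<close>
  have K_le: "K n \<tau> \<le> N n * 4" for n \<tau>
  proof -
    have "kapd (Suc 0) z \<le> 4" for z
    proof (cases "z \<le> 0")
      case False
      have "1 / z / 2 \<le> exp (1 / z / 2)" using exp_ge_add_one_self[of "1 / z / 2"] by linarith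
      then have "(1 / z / 2)\<^sup>2 \<le> (exp (1 / z / 2))\<^sup>2" using False by (intro power_mono) auto
      then have "1 / z\<^sup>2 \<le> 4 * exp (1 / z)" by (simp add: power_divide flip: exp_double)
      then have "exp (- (1 / z)) * (1 / z\<^sup>2) \<le> exp (- (1 / z)) * (4 * exp (1 / z))" by (intro mult_left_mono) auto
      also have "\<dots> = 4" by (simp add: exp_minus)
      finally show ?thesis using False by (simp add: kap1_eq)
    qed (simp add: kap1_eq)
    then show ?thesis unfolding K_def using N[of n] by (intro mult_left_mono) auto
  qed
  have K0: "K n \<tau> \<ge> 0" for n \<tau> unfolding K_def using N[of n] kap1_bounds(1) by simp
  have a_le: "\<bar>?a n (\<tau>, x)\<bar> \<le> (N n * 4 * (T\<^sup>2 / 2) * A) * wt s x" if "\<tau> \<in> {0<..<T}" for n \<tau> x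
  proof -
    have "\<bar>?a n (\<tau>, x)\<bar> = K n \<tau> * \<bar>J n \<tau>\<bar> * \<bar>?\<phi> x\<bar>" using K0 by (simp add: abs_mult)
    also have "\<dots> \<le> (N n * 4) * (T\<^sup>2 / 2) * (A * wt s x)" using J_le[OF that, of n] A(2)[of x] K_le[of n \<tau>] T \<phi>0 N[of n] by (intro mult_mono) auto
    finally show ?thesis by (simp add: mult_ac)
  qed
  have ma: "?a n \<in> borel_measurable (borel \<Otimes>\<^sub>M borel)" and mb: "?b n \<in> borel_measurable (borel \<Otimes>\<^sub>M borel)" for n by measurable
  have ia: "integrable lborel (\<lambda>p. w p * ?a n p)" for n by (rule integrable_w_mult[OF ma a_le])
  have ib: "integrable lborel (\<lambda>p. w p * ?b n p)" for n by (rule integrable_w_mult[OF mb b_le])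
  have eq: "(LINT p|lborel. w p * ?a n p) + (LINT p|lborel. w p * ?b n p) = (LINT p|lborel. w p * (\<theta> n (fst p) * frac_lap s ?\<phi> (snd p)))" for n
  proof -
    have "(LINT p|lborel. w p * ?a n p) + (LINT p|lborel. w p * ?b n p) = (LINT p|lborel. w p * ddir (1, 0) (\<lambda>p. \<theta> n (fst p) * ?\<phi> (snd p)) p)"
      unfolding dd distrib_left using ia ib by (rule Bochner_Integration.integral_add[symmetric])
    also have "\<dots> = (LINT p|lborel. w p * (\<theta> n (fst p) * frac_lap s ?\<phi> (snd p)))"
      using weak[OF tf[of n]] by (simp add: frac_lap_cmult)
    finally show ?thesis .
  qed
  have kl: "(\<lambda>n. kap (- 1 + N n * \<tau>)) \<longlonglongrightarrow> 1" if "\<tau> > 0" for \<tau>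
    using LIMSEQ_Suc[OF kap_lim[of \<tau> "- 1"]] that by (simp add: N_def add.commute)
  have kl2: "(\<lambda>n. kap (N n * t + (- N n) * \<tau>)) \<longlonglongrightarrow> indicator {0<..} (t - \<tau>)" for \<tau>
    unfolding Nt using LIMSEQ_Suc[OF kap_lim[of "t - \<tau>" 0]] by (simp add: N_def)
  have kl3: "(\<lambda>n. (N n * (t - \<tau>)) * kapd (Suc 0) (N n * (t - \<tau>))) \<longlonglongrightarrow> 0" for \<tau>
    unfolding N_def using LIMSEQ_Suc[OF kap1_lim[of "t - \<tau>"]] by simp
  have lb: "(\<lambda>n. LINT p|lborel. w p * ?b n p) \<longlonglongrightarrow> (LINT p|lborel. w p * (- (max 0 (t - fst p) * ?\<phi> (snd p))))"
  proof (rule w_dominated_convergence[OF mb _ b_le])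
    show "(\<lambda>n. ?b n (\<tau>, x)) \<longlonglongrightarrow> - (max 0 (t - fst (\<tau>, x)) * ?\<phi> (snd (\<tau>, x)))" if "\<tau> \<in> {0<..<T}" for \<tau> x
    proof -
      have "(\<lambda>n. kap (- 1 + N n * \<tau>) * (- ((t - \<tau>) * kap (N n * t + (- N n) * \<tau>)) - (t - \<tau>) / 2 * ((N n * (t - \<tau>)) * kapd (Suc 0) (N n * (t - \<tau>)))) * ?\<phi> x)
         \<longlonglongrightarrow> 1 * (- ((t - \<tau>) * indicator {0<..} (t - \<tau>)) - (t - \<tau>) / 2 * 0) * ?\<phi> x"
        using that by (intro tendsto_intros kl kl2 kl3) auto
      moreover have "1 * (- ((t - \<tau>) * indicator {0<..} (t - \<tau>)) - (t - \<tau>) / 2 * 0) * ?\<phi> x = - (max 0 (t - \<tau>) * ?\<phi> x)"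
        by (cases "\<tau> < t") (auto simp: max_def algebra_simps)
      ultimately show ?thesis unfolding J'_def fst_conv snd_conv by (simp only:)
    qed
  qed measurable
  have l\<theta>: "(\<lambda>n. LINT p|lborel. w p * (\<theta> n (fst p) * frac_lap s ?\<phi> (snd p))) \<longlonglongrightarrow> (LINT p|lborel. w p * ((max 0 (t - fst p))\<^sup>2 / 2 * frac_lap s ?\<phi> (snd p)))"
  proof (rule w_dominated_convergence)
    show "\<bar>\<theta> n (fst (\<tau>, x)) * frac_lap s ?\<phi> (snd (\<tau>, x))\<bar> \<le> (T\<^sup>2 / 2 * A) * wt s x" if "\<tau> \<in> {0<..<T}" for n \<tau> x using \<theta>_le[OF that] by simp
    show "(\<lambda>n. \<theta> n (fst (\<tau>, x)) * frac_lap s ?\<phi> (snd (\<tau>, x))) \<longlonglongrightarrow> (max 0 (t - fst (\<tau>, x)))\<^sup>2 / 2 * frac_lap s ?\<phi> (snd (\<tau>, x))" if "\<tau> \<in> {0<..<T}" for \<tau> x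
    proof -
      have "(\<lambda>n. kap (- 1 + N n * \<tau>) * ((t + (- 1) * \<tau>) * (t + (- 1) * \<tau>) * ((1/2) * kap (N n * t + (- N n) * \<tau>))) * frac_lap s ?\<phi> x)
         \<longlonglongrightarrow> 1 * ((t + (- 1) * \<tau>) * (t + (- 1) * \<tau>) * ((1/2) * indicator {0<..} (t - \<tau>))) * frac_lap s ?\<phi> x"
        using that by (intro tendsto_intros kl kl2) auto
      moreover have "1 * ((t + (- 1) * \<tau>) * (t + (- 1) * \<tau>) * ((1/2) * indicator {0<..} (t - \<tau>))) * frac_lap s ?\<phi> x = (max 0 (t - \<tau>))\<^sup>2 / 2 * frac_lap s ?\<phi> x"
        by (cases "\<tau> < t") (auto simp: max_def power2_eq_square)
      ultimately show ?thesis unfolding \<theta>_def J_def fst_conv snd_conv by (simp only:)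
    qed
  qed measurable
  \<comment> \<open>The term carrying the derivative of the initial cutoff. Integrated over x first,
    it is a concentrating time integral of the pairing of \<open>w\<close> with the bump, which
    tends to 0 off a null set.\<close>
  have la: "(\<lambda>n. LINT p|lborel. w p * ?a n p) \<longlonglongrightarrow> 0"
  proof -
    let ?F = "\<lambda>\<tau>. LINT x|lborel. w (\<tau>, x) * ?\<phi> x"
    have i\<phi>: "integrable lborel (\<lambda>p. w p * ?\<phi> (snd p))" by (rule integrable_w_mult[where C=A]) (use A(2) in auto)
    then have i\<phi>': "integrable (lborel \<Otimes>\<^sub>M lborel) (\<lambda>p. w p * ?\<phi> (snd p))" by (simp add: lborel_prod)
    have iF: "integrable lborel ?F" using lborel_pair.integrable_fst'[OF i\<phi>'] by simp
    have c\<phi>: "continuous_on UNIV ?\<phi>" using smooth_fun_continuous[OF bump_smooth[OF bounded_linear_ident]] by simp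
    have "closure {x. ?\<phi> x \<noteq> 0} \<subseteq> cbox \<alpha> \<beta>"
      by (rule closure_minimal) (use bump_support[OF k, of \<alpha> \<beta>] box_subset_cbox[of \<alpha> \<beta>] in auto)
    then have "compact (closure {x. ?\<phi> x \<noteq> 0})"
      using compact_Int_closed[of "cbox \<alpha> \<beta>" "closure {x. ?\<phi> x \<noteq> 0}"] by (simp add: Int_absorb1)
    from trace[OF c\<phi> this] obtain E where E: "E \<in> null_sets lborel" "(?F \<longlongrightarrow> 0) (at 0 within {0<..<T} - E)" by blast
    have "(\<lambda>n. LINT \<tau>|lborel. (real (Suc n) * kapd (Suc 0) (- 1 + real (Suc n) * \<tau>)) * (J n \<tau> * ?F \<tau>)) \<longlonglongrightarrow> 0"
      by (rule kap1_concentrates[OF iF _ T E, of J "T\<^sup>2 / 2"]) (use J_le w_zero in auto)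
    moreover have "(LINT p|lborel. w p * ?a n p) = (LINT \<tau>|lborel. (real (Suc n) * kapd (Suc 0) (- 1 + real (Suc n) * \<tau>)) * (J n \<tau> * ?F \<tau>))" for n
    proof -
      have "(LINT p|lborel. w p * ?a n p) = (LINT \<tau>|lborel. LINT x|lborel. w (\<tau>, x) * ?a n (\<tau>, x))"
        using lborel_pair.integral_fst'[of "\<lambda>p. w p * ?a n p"] ia[of n] by (simp add: lborel_prod)
      also have "\<dots> = (LINT \<tau>|lborel. K n \<tau> * (J n \<tau> * ?F \<tau>))"
      proof (rule Bochner_Integration.integral_cong)
        fix \<tau>
        have "(LINT x|lborel. w (\<tau>, x) * ?a n (\<tau>, x)) = (LINT x|lborel. (K n \<tau> * J n \<tau>) * (w (\<tau>, x) * ?\<phi> x))" by (simp add: mult_ac)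
        then show "(LINT x|lborel. w (\<tau>, x) * ?a n (\<tau>, x)) = K n \<tau> * (J n \<tau> * ?F \<tau>)" by (simp only: integral_mult_right_zero mult.assoc)
      qed simp
      finally show ?thesis by (simp add: K_def N_def)
    qed
    ultimately show ?thesis by simp
  qed
  have "(\<lambda>n. (LINT p|lborel. w p * ?a n p) + (LINT p|lborel. w p * ?b n p)) \<longlonglongrightarrow> 0 + (LINT p|lborel. w p * (- (max 0 (t - fst p) * ?\<phi> (snd p))))"
    by (intro tendsto_add la lb)
  then have "(\<lambda>n. LINT p|lborel. w p * (\<theta> n (fst p) * frac_lap s ?\<phi> (snd p))) \<longlonglongrightarrow> - (LINT p|lborel. w p * (max 0 (t - fst p) * ?\<phi> (snd p)))"
    unfolding eq by simp
  from LIMSEQ_unique[OF this l\<theta>] show ?thesis by simp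
qed

end

section \<open>Smoothing at scale a and the transport argument\<close>

lemma frac_lap_translate:
  fixes f :: "'a::euclidean_space \<Rightarrow> real"
  assumes f: "integrable lborel f"
  shows "frac_lap s (\<lambda>y. f (y - z)) x = frac_lap s f (x - z)"
proof -
  have ft: "fourier_tr (\<lambda>y. f (y - z)) \<xi> = cis (- (z \<bullet> \<xi>)) * fourier_tr f \<xi>" for \<xi>
  proof -
    let ?h = "\<lambda>y. complex_of_real (f y) * cis (- (y \<bullet> \<xi>)) * cis (- (z \<bullet> \<xi>))"
    have i: "integrable lborel ?h"
      using f by (intro integrable_mult_left integrable_mult_cis(2) integrable_of_real)
    have "fourier_tr (\<lambda>y. f (y - z)) \<xi> = (LINT y|lborel. ?h (y - z))"
      unfolding fourier_tr_def by (intro Bochner_Integration.integral_cong refl) (simp add: mult.assoc cis_mult inner_diff_left)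
    also have "\<dots> = (LINT y|lborel. ?h y)" by (rule lborel_reflect(4)[OF i])
    also have "\<dots> = fourier_tr f \<xi> * cis (- (z \<bullet> \<xi>))" unfolding fourier_tr_def by (rule integral_mult_left_zero)
    finally show ?thesis by (simp only: mult.commute)
  qed
  have "complex_of_real (norm \<xi> powr (2 * s)) * fourier_tr (\<lambda>y. f (y - z)) \<xi> * cis (x \<bullet> \<xi>) = complex_of_real (norm \<xi> powr (2 * s)) * fourier_tr f \<xi> * cis ((x - z) \<bullet> \<xi>)" for \<xi>
  proof -
    have "cis ((x - z) \<bullet> \<xi>) = cis (- (z \<bullet> \<xi>)) * cis (x \<bullet> \<xi>)" by (simp add: cis_mult inner_diff_left)
    then show ?thesis unfolding ft by (simp only: mult_ac)
  qed
  then show ?thesis unfolding frac_lap_def by (simp only:)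
qed

text \<open>The heat flow for time \<open>a\<close> of the function with symbol \<open>m\<close>; on
  the Fourier side the dependence on \<open>a\<close> is explicit and easily differentiated.\<close>

definition smoothed :: "real \<Rightarrow> real \<Rightarrow> ('a::euclidean_space \<Rightarrow> complex) \<Rightarrow> 'a \<Rightarrow> real" where
  "smoothed s a m = inv_ft (\<lambda>\<xi>. complex_of_real (exp (- a * norm \<xi> powr (2 * s))) * m \<xi>)"

lemma smoothed_measurable [measurable]:
  assumes [measurable]: "m \<in> borel_measurable borel"
  shows "smoothed s a m \<in> borel_measurable borel"
  unfolding smoothed_def by measurable

text \<open>Differentiation under the frequency integral; integrability of the multiplied symbol
  gives a majorant that is uniform in \<open>a\<close>.\<close>

lemma smoothed_DERIV:
  fixes m :: "'a::euclidean_space \<Rightarrow> complex"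
  assumes a: "a > 0" and m: "integrable lborel m" and m2: "integrable lborel (\<lambda>\<xi>. complex_of_real (norm \<xi> powr (2 * s)) * m \<xi>)"
  shows "((\<lambda>a. smoothed s a m x) has_real_derivative - smoothed s a (\<lambda>\<xi>. complex_of_real (norm \<xi> powr (2 * s)) * m \<xi>) x) (at a)"
proof -
  have [measurable]: "m \<in> borel_measurable borel" using m by (simp add: integrable_iff_bounded)
  let ?l = "\<lambda>\<xi>::'a. norm \<xi> powr (2 * s)"
  let ?r = "\<lambda>\<xi>. Re (m \<xi> * cis (x \<bullet> \<xi>))"
  have r_le: "\<bar>?r \<xi>\<bar> \<le> norm (m \<xi>)" for \<xi>
    using abs_Re_le_cmod[of "m \<xi> * cis (x \<bullet> \<xi>)"] by (simp only: norm_mult norm_cis mult_1_right)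
  have eq: "smoothed s a n x = (2 * pi) powr (- real DIM('a)) * (LINT \<xi>|lborel. exp (- a * ?l \<xi>) * Re (n \<xi> * cis (x \<bullet> \<xi>)))"
    if "integrable lborel n" "a > 0" for a n
  proof -
    have [measurable]: "n \<in> borel_measurable borel" using that by (simp add: integrable_iff_bounded)
    have i: "integrable lborel (\<lambda>\<xi>. complex_of_real (exp (- a * ?l \<xi>)) * n \<xi> * cis (x \<bullet> \<xi>))"
      using that by (intro Bochner_Integration.integrable_bound[OF that(1)]) (auto simp: norm_mult intro!: AE_I2 mult_left_le_one_le)
    have "smoothed s a n x = (2 * pi) powr (- real DIM('a)) * Re (LINT \<xi>|lborel. complex_of_real (exp (- a * ?l \<xi>)) * n \<xi> * cis (x \<bullet> \<xi>))"
      by (simp add: smoothed_def inv_ft_def inv_ftc_def)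
    also have "Re (LINT \<xi>|lborel. complex_of_real (exp (- a * ?l \<xi>)) * n \<xi> * cis (x \<bullet> \<xi>)) = (LINT \<xi>|lborel. Re (complex_of_real (exp (- a * ?l \<xi>)) * n \<xi> * cis (x \<bullet> \<xi>)))"
      by (rule integral_Re[OF i, symmetric])
    also have "\<dots> = (LINT \<xi>|lborel. exp (- a * ?l \<xi>) * Re (n \<xi> * cis (x \<bullet> \<xi>)))"
      by (simp add: mult.assoc)
    finally show ?thesis .
  qed
  have "((\<lambda>a. LINT \<xi>|lborel. exp (- a * ?l \<xi>) * ?r \<xi>) has_real_derivative (LINT \<xi>|lborel. - ?l \<xi> * exp (- a * ?l \<xi>) * ?r \<xi>)) (at a)"
  proof (rule DERIV_integral[of 0 a "a + 1" lborel _ _ "\<lambda>\<xi>. ?l \<xi> * norm (m \<xi>)"])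
    show "integrable lborel (\<lambda>\<xi>. exp (- b * ?l \<xi>) * ?r \<xi>)" if "0 < b" for b
    proof (rule Bochner_Integration.integrable_bound[OF m])
      show "AE \<xi> in lborel. norm (exp (- b * ?l \<xi>) * ?r \<xi>) \<le> norm (m \<xi>)"
      proof (rule AE_I2)
        fix \<xi>
        have "norm (exp (- b * ?l \<xi>) * ?r \<xi>) \<le> 1 * norm (m \<xi>)"
          unfolding real_norm_def abs_mult[of "exp _"] using that by (intro mult_mono r_le) auto
        then show "norm (exp (- b * ?l \<xi>) * ?r \<xi>) \<le> norm (m \<xi>)" by (simp only: mult_1)
      qed
    qed measurable
    show "((\<lambda>b. exp (- b * ?l \<xi>) * ?r \<xi>) has_real_derivative - ?l \<xi> * exp (- b * ?l \<xi>) * ?r \<xi>) (at b)" for b \<xi>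
      by (auto intro!: derivative_eq_intros)
    show "integrable lborel (\<lambda>\<xi>. ?l \<xi> * norm (m \<xi>))" using integrable_norm[OF m2] by (simp add: norm_mult)
    show "\<bar>- ?l \<xi> * exp (- b * ?l \<xi>) * ?r \<xi>\<bar> \<le> ?l \<xi> * norm (m \<xi>)" if "0 < b" for b \<xi>
    proof -
      have "\<bar>- ?l \<xi> * exp (- b * ?l \<xi>) * ?r \<xi>\<bar> = ?l \<xi> * (exp (- b * ?l \<xi>) * \<bar>?r \<xi>\<bar>)" by (simp add: abs_mult)
      also have "\<dots> \<le> ?l \<xi> * (1 * norm (m \<xi>))"
        using that by (intro mult_left_mono mult_mono r_le) auto
      finally show ?thesis by (simp only: mult_1)
    qed
  qed (use a in auto)
  from DERIV_cmult[OF this, of "(2 * pi) powr (- real DIM('a))"]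
  have "((\<lambda>a. (2 * pi) powr (- real DIM('a)) * (LINT \<xi>|lborel. exp (- a * ?l \<xi>) * ?r \<xi>)) has_real_derivative (2 * pi) powr (- real DIM('a)) * (LINT \<xi>|lborel. - ?l \<xi> * exp (- a * ?l \<xi>) * ?r \<xi>)) (at a)" .
  then have "((\<lambda>a. smoothed s a m x) has_real_derivative (2 * pi) powr (- real DIM('a)) * (LINT \<xi>|lborel. - ?l \<xi> * exp (- a * ?l \<xi>) * ?r \<xi>)) (at a)"
    by (rule has_field_derivative_transform_within_open[where S="{0<..}"]) (use a eq[OF m] in auto)
  moreover have "(2 * pi) powr (- real DIM('a)) * (LINT \<xi>|lborel. - ?l \<xi> * exp (- a * ?l \<xi>) * ?r \<xi>) = - smoothed s a (\<lambda>\<xi>. complex_of_real (?l \<xi>) * m \<xi>) x"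
  proof -
    have "- ?l \<xi> * exp (- a * ?l \<xi>) * ?r \<xi> = - (exp (- a * ?l \<xi>) * Re (complex_of_real (?l \<xi>) * m \<xi> * cis (x \<bullet> \<xi>)))" for \<xi>
      by (simp add: mult.assoc)
    then show ?thesis unfolding eq[OF m2 a] by (simp only: Bochner_Integration.integral_minus mult_minus_right)
  qed
  ultimately show ?thesis by simp
qed

context zero_trace_solution
begin

context
  fixes k :: real and \<alpha> \<beta> :: 'a assumes k: "k > 0"
begin

abbreviation (input) "bphi \<equiv> bump k \<alpha> \<beta>"
abbreviation (input) "bhat \<equiv> fourier_tr (bump k \<alpha> \<beta>)"
abbreviation (input) "bhat2 \<equiv> \<lambda>\<xi>. complex_of_real (norm \<xi> powr (2 * s)) * fourier_tr (bump k \<alpha> \<beta>) \<xi>"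

lemma smoothed_bump:
  assumes a: "a > 0"
  shows "smoothed s a bhat x = (LINT y|lborel. frac_heat_kernel s a (x - y) * bphi y)"
    "smoothed s a bhat2 x = (LINT y|lborel. frac_heat_kernel s a (x - y) * frac_lap s bphi y)"
proof -
  show "smoothed s a bhat x = (LINT y|lborel. frac_heat_kernel s a (x - y) * bphi y)"
    unfolding smoothed_def using heat_conv_inv_ft(1)[OF s a bump_facts(1)[OF s k, of \<alpha> \<beta>], of x] bump_facts(2)[OF s k, of \<alpha> \<beta>] by simp
  show "smoothed s a bhat2 x = (LINT y|lborel. frac_heat_kernel s a (x - y) * frac_lap s bphi y)"
    unfolding smoothed_def frac_lap_eq_inv_ft using heat_conv_inv_ft(1)[OF s a bump_facts(3)[OF s k, of \<alpha> \<beta>], of x] by simp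
qed

lemma smoothed_bump_bound:
  obtains A where "A \<ge> 0" "\<And>a x. a > 0 \<Longrightarrow> \<bar>smoothed s a bhat x\<bar> \<le> A * exp (a * heatK s) * wt s x"
    "\<And>a x. a > 0 \<Longrightarrow> \<bar>smoothed s a bhat2 x\<bar> \<le> A * exp (a * heatK s) * wt s x"
proof -
  obtain A where A: "A \<ge> 0" "\<And>x. \<bar>bphi x\<bar> \<le> A * wt s x" "\<And>x. \<bar>frac_lap s bphi x\<bar> \<le> A * wt s x"
    using bump_facts(4)[OF s k, of \<alpha> \<beta>] by blast
  show ?thesis
  proof (rule that[OF A(1)])
    fix a :: real and x :: 'a assume a: "a > 0"
    show "\<bar>smoothed s a bhat x\<bar> \<le> A * exp (a * heatK s) * wt s x"
      unfolding smoothed_bump(1)[OF a] by (rule heat_conv_bound(3)[OF s a bump_facts(5)[OF s k] A(2)])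
    show "\<bar>smoothed s a bhat2 x\<bar> \<le> A * exp (a * heatK s) * wt s x"
      unfolding smoothed_bump(2)[OF a] by (rule heat_conv_bound(3)[OF s a bump_facts(6)[OF s k] A(3)])
  qed
qed

text \<open>Every translate of the bump is a bump with shifted corners, so
  \<open>tested_identity\<close> holds for all of them, and averaging against the kernel gives the
  claim. Times \<open>t \<le> 0\<close> are included, where both sides vanish, so that the transport
  argument can start at a negative time.\<close>

lemma smoothed_identity:
  assumes a: "a > 0" and t: "t < T"
  shows "(LINT p|lborel. w p * (max 0 (t - fst p) * smoothed s a bhat (snd p)))
       = - (LINT p|lborel. w p * ((max 0 (t - fst p))\<^sup>2 / 2 * smoothed s a bhat2 (snd p)))"
proof (cases "t \<le> 0")
  case True
  have "w p * (max 0 (t - fst p) * c) = 0" "w p * ((max 0 (t - fst p))\<^sup>2 / 2 * c) = 0" for p c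
    using True w_zero[of p] by (cases "fst p \<in> {0<..<T}"; simp)+
  then show ?thesis by (simp only: Bochner_Integration.integral_zero minus_zero)
next
  case False
  obtain A where A: "A \<ge> 0" "\<And>x. \<bar>bphi x\<bar> \<le> A * wt s x" "\<And>x. \<bar>frac_lap s bphi x\<bar> \<le> A * wt s x"
    using bump_facts(4)[OF s k, of \<alpha> \<beta>] by blast
  note m = bump_facts(5,6)[OF s k, of \<alpha> \<beta>]
  note [measurable] = m
  have ib: "integrable lborel bphi"
    by (rule Bochner_Integration.integrable_bound[OF integrable_mult_right[OF integrable_wt_space[OF s(1)], of A]])
       (use A in \<open>auto intro!: AE_I2 order_trans[OF _ abs_ge_self]\<close>)
  let ?G2 = "\<lambda>p. w p * max 0 (t - fst p)" and ?G3 = "\<lambda>p. w p * ((max 0 (t - fst p))\<^sup>2 / 2)"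
  have mG: "?G2 \<in> borel_measurable borel" "?G3 \<in> borel_measurable borel"
    by (simp_all only: borel_prod[symmetric]) measurable
  have mx: "max 0 (t - \<tau>) \<le> T" if "\<tau> \<in> {0<..<T}" for \<tau> using that t by auto
  have iG: "integrable lborel (\<lambda>p. ?G2 p * wt s (snd p))" "integrable lborel (\<lambda>p. ?G3 p * wt s (snd p))"
  proof -
    have "integrable lborel (\<lambda>p. w p * (max 0 (t - fst p) * wt s (snd p)))"
    proof (rule integrable_w_mult[where C=T])
      show "\<bar>max 0 (t - fst (\<tau>, x)) * wt s (snd (\<tau>, x))\<bar> \<le> T * wt s x" if "\<tau> \<in> {0<..<T}" for \<tau> x
        using mx[OF that] wt_nonneg[of s x] T by (auto simp: abs_mult intro!: mult_right_mono)
    qed measurable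
    then show "integrable lborel (\<lambda>p. ?G2 p * wt s (snd p))" by (simp only: mult.assoc)
    have "integrable lborel (\<lambda>p. w p * ((max 0 (t - fst p))\<^sup>2 / 2 * wt s (snd p)))"
    proof (rule integrable_w_mult[where C="T\<^sup>2 / 2"])
      show "\<bar>(max 0 (t - fst (\<tau>, x)))\<^sup>2 / 2 * wt s (snd (\<tau>, x))\<bar> \<le> T\<^sup>2 / 2 * wt s x" if "\<tau> \<in> {0<..<T}" for \<tau> x
        using power_mono[OF mx[OF that], of 2] wt_nonneg[of s x] by (auto simp: abs_mult intro!: mult_right_mono)
    qed measurable
    then show "integrable lborel (\<lambda>p. ?G3 p * wt s (snd p))" by (simp only: mult.assoc)
  qed
  have "(LINT p|lborel. w p * (max 0 (t - fst p) * smoothed s a bhat (snd p))) = (LINT p|lborel. ?G2 p * (LINT y|lborel. frac_heat_kernel s a (snd p - y) * bphi y))"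
    by (simp only: smoothed_bump[OF a] mult.assoc)
  also have "\<dots> = (LINT z|lborel. frac_heat_kernel s a z * (LINT p|lborel. ?G2 p * bphi (snd p - z)))"
    by (rule heat_superposition[OF s a mG(1) iG(1) m(1) A(2)])
  also have "\<dots> = (LINT z|lborel. frac_heat_kernel s a z * (- (LINT p|lborel. ?G3 p * frac_lap s bphi (snd p - z))))"
  proof (rule Bochner_Integration.integral_cong[OF refl])
    fix z :: 'a
    have "(LINT p|lborel. ?G2 p * bphi (snd p - z)) = (LINT p|lborel. w p * (max 0 (t - fst p) * bump k (\<alpha> + z) (\<beta> + z) (snd p)))"
      by (simp only: bump_translate mult.assoc)
    also have "\<dots> = - (LINT p|lborel. w p * ((max 0 (t - fst p))\<^sup>2 / 2 * frac_lap s (bump k (\<alpha> + z) (\<beta> + z)) (snd p)))"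
      by (rule tested_identity[OF k _ t]) (use False in simp)
    also have "bump k (\<alpha> + z) (\<beta> + z) = (\<lambda>y. bphi (y - z))" by (simp add: bump_translate fun_eq_iff)
    finally show "frac_heat_kernel s a z * (LINT p|lborel. ?G2 p * bphi (snd p - z)) = frac_heat_kernel s a z * (- (LINT p|lborel. ?G3 p * frac_lap s bphi (snd p - z)))"
      by (simp only: frac_lap_translate[OF ib] mult.assoc)
  qed
  also have "\<dots> = - (LINT z|lborel. frac_heat_kernel s a z * (LINT p|lborel. ?G3 p * frac_lap s bphi (snd p - z)))" by simp
  also have "(LINT z|lborel. frac_heat_kernel s a z * (LINT p|lborel. ?G3 p * frac_lap s bphi (snd p - z))) = (LINT p|lborel. ?G3 p * (LINT y|lborel. frac_heat_kernel s a (snd p - y) * frac_lap s bphi y))"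
    by (rule heat_superposition[OF s a mG(2) iG(2) m(2) A(3), symmetric])
  also have "\<dots> = (LINT p|lborel. w p * ((max 0 (t - fst p))\<^sup>2 / 2 * smoothed s a bhat2 (snd p)))"
    by (simp only: smoothed_bump[OF a] mult.assoc)
  finally show ?thesis .
qed

text \<open>The pairing with the smoothing at scale \<open>b - x\<close> does not depend on \<open>x\<close>: the smoothed solution
  solves a transport equation in the two time variables.\<close>

lemma smoothed_pairing_zero:
  assumes a: "a > 0" and t: "0 < t" "t < T"
  shows "(LINT p|lborel. w p * ((max 0 (t - fst p))\<^sup>2 / 2 * smoothed s a bhat (snd p))) = 0"
proof -
  \<comment> \<open>Along the characteristic the smoothing scale is \<open>b - x\<close>, which
    equals \<open>a\<close> at \<open>x = t\<close>. Up to \<open>T'\<close> this scale stays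
    positive and the time stays below \<open>T\<close>.\<close>
  define b where "b = a + t"
  define T' where "T' = min T b"
  have tT': "t < T'" using a t by (simp add: T'_def b_def)
  obtain A where A: "A \<ge> 0" "\<And>a x. a > 0 \<Longrightarrow> \<bar>smoothed s a bhat x\<bar> \<le> A * exp (a * heatK s) * wt s x"
    "\<And>a x. a > 0 \<Longrightarrow> \<bar>smoothed s a bhat2 x\<bar> \<le> A * exp (a * heatK s) * wt s x" using smoothed_bump_bound by blast
  have [measurable]: "bhat \<in> borel_measurable borel" "bhat2 \<in> borel_measurable borel"
    using bump_facts(1,3)[OF s k, of \<alpha> \<beta>] by (simp_all add: integrable_iff_bounded)
  define q where "q x = (LINT p|lborel. w p * ((max 0 (x - fst p))\<^sup>2 / 2 * smoothed s (b - x) bhat (snd p)))" for x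
  \<comment> \<open>For x above -1 the scale \<open>b - x\<close> is below \<open>b + 1\<close>, so
    this constant is uniform along the whole interval.\<close>
  define D where "D = A * exp ((b + 1) * heatK s)"
  have D: "\<bar>smoothed s (b - x) bhat y\<bar> \<le> D * wt s y" "\<bar>smoothed s (b - x) bhat2 y\<bar> \<le> D * wt s y" if "-1 < x" "x < T'" for x y
  proof -
    have bx: "b - x > 0" using that by (simp add: T'_def)
    have "A * exp ((b - x) * heatK s) * wt s y \<le> D * wt s y" unfolding D_def
      using that A(1) heatK_pos[OF s] by (intro mult_right_mono mult_left_mono wt_nonneg) auto
    then show "\<bar>smoothed s (b - x) bhat y\<bar> \<le> D * wt s y" "\<bar>smoothed s (b - x) bhat2 y\<bar> \<le> D * wt s y"
      using A(2,3)[OF bx, of y] by linarith+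
  qed
  have Dp: "0 \<le> D * wt s y" for y :: 'a using A(1) wt_nonneg[of s y] by (simp add: D_def)
  have mx: "max 0 (x - \<tau>) \<le> T" "(max 0 (x - \<tau>))\<^sup>2 / 2 \<le> T\<^sup>2 / 2" if "\<tau> \<in> {0<..<T}" "x < T'" for x \<tau>
  proof -
    show 1: "max 0 (x - \<tau>) \<le> T" using that by (auto simp: T'_def)
    show "(max 0 (x - \<tau>))\<^sup>2 / 2 \<le> T\<^sup>2 / 2" using power_mono[OF 1, of 2] by simp
  qed
  let ?u = "\<lambda>x p. max 0 (x - fst p) * smoothed s (b - x) bhat (snd p)"
  let ?v = "\<lambda>x p. (max 0 (x - fst p))\<^sup>2 / 2 * smoothed s (b - x) bhat2 (snd p)"
  let ?f = "\<lambda>x p. (max 0 (x - fst p))\<^sup>2 / 2 * smoothed s (b - x) bhat (snd p)"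
  have bu: "\<bar>?u x (\<tau>, y)\<bar> \<le> (T * D) * wt s y" if "-1 < x" "x < T'" "\<tau> \<in> {0<..<T}" for x \<tau> y
  proof -
    have "\<bar>?u x (\<tau>, y)\<bar> = max 0 (x - \<tau>) * \<bar>smoothed s (b - x) bhat y\<bar>" by (simp add: abs_mult)
    also have "\<dots> \<le> T * (D * wt s y)" using mx(1)[OF that(3,2)] D(1)[OF that(1,2)] T by (intro mult_mono) auto
    finally show ?thesis by (simp add: mult.assoc)
  qed
  have bv: "\<bar>?v x (\<tau>, y)\<bar> \<le> (T\<^sup>2 / 2 * D) * wt s y" if "-1 < x" "x < T'" "\<tau> \<in> {0<..<T}" for x \<tau> y
  proof -
    have "\<bar>?v x (\<tau>, y)\<bar> = (max 0 (x - \<tau>))\<^sup>2 / 2 * \<bar>smoothed s (b - x) bhat2 y\<bar>" by (simp add: abs_mult)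
    also have "\<dots> \<le> T\<^sup>2 / 2 * (D * wt s y)" using mx(2)[OF that(3,2)] D(2)[OF that(1,2)] T by (intro mult_mono) auto
    finally show ?thesis by (simp add: mult.assoc)
  qed
  have bf: "\<bar>?f x (\<tau>, y)\<bar> \<le> (T\<^sup>2 / 2 * D) * wt s y" if "-1 < x" "x < T'" "\<tau> \<in> {0<..<T}" for x \<tau> y
  proof -
    have "\<bar>?f x (\<tau>, y)\<bar> = (max 0 (x - \<tau>))\<^sup>2 / 2 * \<bar>smoothed s (b - x) bhat y\<bar>" by (simp add: abs_mult)
    also have "\<dots> \<le> T\<^sup>2 / 2 * (D * wt s y)" using mx(2)[OF that(3,2)] D(1)[OF that(1,2)] T by (intro mult_mono) auto
    finally show ?thesis by (simp add: mult.assoc)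
  qed
  have mu: "?u x \<in> borel_measurable (borel \<Otimes>\<^sub>M borel)" "?v x \<in> borel_measurable (borel \<Otimes>\<^sub>M borel)" "?f x \<in> borel_measurable (borel \<Otimes>\<^sub>M borel)" for x
    by measurable
  have iu: "integrable lborel (\<lambda>p. w p * ?u x p)" "integrable lborel (\<lambda>p. w p * ?v x p)" "integrable lborel (\<lambda>p. w p * ?f x p)"
    if "-1 < x" "x < T'" for x
    using integrable_w_mult[OF mu(1) bu[OF that]] integrable_w_mult[OF mu(2) bv[OF that]] integrable_w_mult[OF mu(3) bf[OF that]] by auto
  \<comment> \<open>The term \<open>?u\<close> comes from the time profile and \<open>?v\<close>
    from the smoothing, whose sign flips because the scale decreases in x; by
    \<open>smoothed_identity\<close> their pairings cancel.\<close>
  have der: "(q has_real_derivative 0) (at x)" if x: "-1 < x" "x < T'" for x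
  proof -
    have "((\<lambda>x. LINT p|lborel. w p * ?f x p) has_real_derivative (LINT p|lborel. w p * (?u x p + ?v x p))) (at x)"
    proof (rule DERIV_integral[of "-1" x T' lborel _ _ "\<lambda>p. (T * D + T\<^sup>2 / 2 * D) * \<bar>w p * wt s (snd p)\<bar>"])
      show "(\<lambda>p. w p * (?u x p + ?v x p)) \<in> borel_measurable lborel" using w mu by (simp add: borel_prod)
      show "integrable lborel (\<lambda>p. (T * D + T\<^sup>2 / 2 * D) * \<bar>w p * wt s (snd p)\<bar>)" using w_int by (intro integrable_mult_right integrable_abs)
      fix z :: real and p :: "real \<times> 'a" assume z: "-1 < z" "z < T'"
      have bz: "b - z > 0" using z by (simp add: T'_def)
      have "((\<lambda>z. b - z) has_real_derivative - 1) (at z)" by (auto intro!: derivative_eq_intros)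
      from DERIV_chain2[OF smoothed_DERIV[OF bz bump_facts(1,3)[OF s k, of \<alpha> \<beta>], of "snd p"] this]
      have "((\<lambda>z. smoothed s (b - z) bhat (snd p)) has_real_derivative smoothed s (b - z) bhat2 (snd p)) (at z)" by simp
      from DERIV_cmult[OF DERIV_mult[OF half_square_pos_part_DERIV this], of "w p" "fst p"]
      show "((\<lambda>z. w p * ?f z p) has_real_derivative w p * (?u z p + ?v z p)) (at z)" by (simp add: algebra_simps)
      show "\<bar>w p * (?u z p + ?v z p)\<bar> \<le> (T * D + T\<^sup>2 / 2 * D) * \<bar>w p * wt s (snd p)\<bar>"
      proof (cases "fst p \<in> {0<..<T}")
        case True
        have "\<bar>?u z p + ?v z p\<bar> \<le> (T * D + T\<^sup>2 / 2 * D) * wt s (snd p)"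
          using bu[OF z True, of "snd p"] bv[OF z True, of "snd p"] by (simp add: distrib_right)
        then have "\<bar>w p\<bar> * \<bar>?u z p + ?v z p\<bar> \<le> \<bar>w p\<bar> * ((T * D + T\<^sup>2 / 2 * D) * wt s (snd p))" by (intro mult_left_mono) auto
        then show ?thesis by (simp add: abs_mult wt_nonneg mult_ac)
      qed (simp add: w_zero)
    qed (use x iu in auto)
    moreover have "(LINT p|lborel. w p * (?u x p + ?v x p)) = (LINT p|lborel. w p * ?u x p) + (LINT p|lborel. w p * ?v x p)"
      unfolding distrib_left by (rule Bochner_Integration.integral_add[OF iu(1,2)[OF x]])
    moreover have "\<dots> = 0"
      using smoothed_identity[of "b - x" x] x by (simp add: T'_def)
    ultimately show ?thesis unfolding q_def[abs_def] by simp
  qed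
  have "\<exists>c. \<forall>x\<in>{-1<..<T'}. q x = c"
    by (rule has_field_derivative_zero_constant) (auto intro: has_field_derivative_at_within der)
  \<comment> \<open>Any negative point would do: there the profile vanishes wherever
    \<open>w\<close> does not.\<close>
  then have "q t = q (-1/2)" using tT' t by auto
  also have "q (-1/2) = 0"
  proof -
    have "w p * ?f (-1/2) p = 0" for p using w_zero[of p] by (cases "fst p \<in> {0<..<T}") auto
    then show ?thesis unfolding q_def by (simp only: Bochner_Integration.integral_zero)
  qed
  finally show ?thesis by (simp add: q_def b_def)
qed

lemma bump_pairing_zero:
  assumes t: "0 < t" "t < T"
  shows "(LINT p|lborel. w p * ((max 0 (t - fst p))\<^sup>2 / 2 * bphi (snd p))) = 0"
proof -
  obtain A where A: "A \<ge> 0" "\<And>a x. a > 0 \<Longrightarrow> \<bar>smoothed s a bhat x\<bar> \<le> A * exp (a * heatK s) * wt s x"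
    "\<And>a x. a > 0 \<Longrightarrow> \<bar>smoothed s a bhat2 x\<bar> \<le> A * exp (a * heatK s) * wt s x" using smoothed_bump_bound by blast
  have i: "integrable lborel bhat" by (rule bump_facts(1)[OF s k])
  have [measurable]: "bhat \<in> borel_measurable borel" using i by (simp add: integrable_iff_bounded)
  note [measurable] = bump_facts(5)[OF s k, of \<alpha> \<beta>]
  define e where "e n = inverse (real (Suc n))" for n
  have e: "e n > 0" "e n \<le> 1" for n by (simp_all add: e_def inverse_le_1_iff)
  have e0: "e \<longlonglongrightarrow> 0" unfolding e_def by (rule LIMSEQ_inverse_real_of_nat)
  have "(\<lambda>n. LINT p|lborel. w p * ((max 0 (t - fst p))\<^sup>2 / 2 * smoothed s (e n) bhat (snd p))) \<longlonglongrightarrow> (LINT p|lborel. w p * ((max 0 (t - fst p))\<^sup>2 / 2 * bphi (snd p)))"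
  proof (rule w_dominated_convergence[where C="T\<^sup>2 / 2 * (A * exp (heatK s))"])
    show "\<bar>(max 0 (t - fst (\<tau>, x)))\<^sup>2 / 2 * smoothed s (e n) bhat (snd (\<tau>, x))\<bar> \<le> T\<^sup>2 / 2 * (A * exp (heatK s)) * wt s x" if "\<tau> \<in> {0<..<T}" for n \<tau> x
    proof -
      have 1: "max 0 (t - \<tau>) \<le> T" using that t by auto
      have "\<bar>smoothed s (e n) bhat x\<bar> \<le> A * exp (e n * heatK s) * wt s x" by (rule A(2)[OF e(1)])
      also have "\<dots> \<le> A * exp (heatK s) * wt s x" using A(1) e(2)[of n] heatK_pos[OF s] by (intro mult_right_mono mult_left_mono wt_nonneg) auto
      finally have "(max 0 (t - \<tau>))\<^sup>2 / 2 * \<bar>smoothed s (e n) bhat x\<bar> \<le> T\<^sup>2 / 2 * (A * exp (heatK s) * wt s x)"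
        using power_mono[OF 1, of 2] by (intro mult_mono) auto
      then show ?thesis by (simp add: abs_mult mult_ac)
    qed
    show "(\<lambda>n. (max 0 (t - fst (\<tau>, x)))\<^sup>2 / 2 * smoothed s (e n) bhat (snd (\<tau>, x))) \<longlonglongrightarrow> (max 0 (t - fst (\<tau>, x)))\<^sup>2 / 2 * bphi (snd (\<tau>, x))" for \<tau> x
    proof -
      have "(\<lambda>n. smoothed s (e n) bhat x) \<longlonglongrightarrow> inv_ft bhat x" unfolding smoothed_def
      proof (rule inv_ft_dominated_convergence)
        show "integrable lborel (\<lambda>\<xi>. norm (bhat \<xi>))" using i by simp
        show "norm (complex_of_real (exp (- e n * norm \<xi> powr (2 * s))) * bhat \<xi>) \<le> norm (bhat \<xi>)" for n \<xi>
          unfolding norm_mult norm_of_real using e(1)[of n] by (intro mult_left_le_one_le) auto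
        show "AE \<xi> in lborel. (\<lambda>n. complex_of_real (exp (- e n * norm \<xi> powr (2 * s))) * bhat \<xi>) \<longlonglongrightarrow> bhat \<xi>"
        proof (rule AE_I2)
          fix \<xi> :: 'a
          have "(\<lambda>n. complex_of_real (exp (- e n * norm \<xi> powr (2 * s))) * bhat \<xi>) \<longlonglongrightarrow> complex_of_real (exp (- 0 * norm \<xi> powr (2 * s))) * bhat \<xi>"
            by (intro tendsto_intros e0)
          then show "(\<lambda>n. complex_of_real (exp (- e n * norm \<xi> powr (2 * s))) * bhat \<xi>) \<longlonglongrightarrow> bhat \<xi>" by simp
        qed
      qed auto
      then show ?thesis unfolding bump_facts(2)[OF s k] fst_conv snd_conv by (intro tendsto_mult_left)
    qed
  qed measurable
  then have "(\<lambda>n. 0) \<longlonglongrightarrow> (LINT p|lborel. w p * ((max 0 (t - fst p))\<^sup>2 / 2 * bphi (snd p)))"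
    by (simp only: smoothed_pairing_zero[OF e(1) t])
  then show ?thesis by (simp add: LIMSEQ_const_iff)
qed

end

end

section \<open>From vanishing pairings to vanishing almost everywhere\<close>

context zero_trace_solution
begin

text \<open>First differentiation in t: the pairing with the quadratic profile vanishes for all t in
  the open interval, hence so does its derivative.\<close>

lemma bump_pairing_linear_zero:
  assumes k: "k > 0" and t: "0 < t" "t < T"
  shows "(LINT p|lborel. w p * (max 0 (t - fst p) * bump k \<alpha> \<beta> (snd p))) = 0"
proof -
  let ?\<phi> = "bump k \<alpha> \<beta>"
  obtain A where A: "A \<ge> 0" "\<And>x. \<bar>?\<phi> x\<bar> \<le> A * wt s x" "\<And>x. \<bar>frac_lap s ?\<phi> x\<bar> \<le> A * wt s x"
    using bump_facts(4)[OF s k, of \<alpha> \<beta>] by blast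
  note [measurable] = bump_facts(5)[OF s k, of \<alpha> \<beta>]
  let ?f = "\<lambda>x p. (max 0 (x - fst p))\<^sup>2 / 2 * ?\<phi> (snd p)"
  let ?u = "\<lambda>x p. max 0 (x - fst p) * ?\<phi> (snd p)"
  have mx: "max 0 (x - \<tau>) \<le> T" "(max 0 (x - \<tau>))\<^sup>2 / 2 \<le> T\<^sup>2 / 2" if "\<tau> \<in> {0<..<T}" "x < T" for x \<tau>
  proof -
    show 1: "max 0 (x - \<tau>) \<le> T" using that by auto
    show "(max 0 (x - \<tau>))\<^sup>2 / 2 \<le> T\<^sup>2 / 2" using power_mono[OF 1, of 2] by simp
  qed
  have mf: "?f x \<in> borel_measurable (borel \<Otimes>\<^sub>M borel)" "?u x \<in> borel_measurable (borel \<Otimes>\<^sub>M borel)" for x by measurable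
  have bf: "\<bar>?f x (\<tau>, y)\<bar> \<le> (T\<^sup>2 / 2 * A) * wt s y" if "x < T" "\<tau> \<in> {0<..<T}" for x \<tau> y
  proof -
    have "\<bar>?f x (\<tau>, y)\<bar> = (max 0 (x - \<tau>))\<^sup>2 / 2 * \<bar>?\<phi> y\<bar>" by (simp add: abs_mult)
    also have "\<dots> \<le> T\<^sup>2 / 2 * (A * wt s y)" using mx(2)[OF that(2,1)] A(2) T by (intro mult_mono) auto
    finally show ?thesis by (simp add: mult.assoc)
  qed
  have bu: "\<bar>?u x (\<tau>, y)\<bar> \<le> (T * A) * wt s y" if "x < T" "\<tau> \<in> {0<..<T}" for x \<tau> y
  proof -
    have "\<bar>?u x (\<tau>, y)\<bar> = max 0 (x - \<tau>) * \<bar>?\<phi> y\<bar>" by (simp add: abs_mult)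
    also have "\<dots> \<le> T * (A * wt s y)" using mx(1)[OF that(2,1)] A(2) T by (intro mult_mono) auto
    finally show ?thesis by (simp add: mult.assoc)
  qed
  have "((\<lambda>x. LINT p|lborel. w p * ?f x p) has_real_derivative (LINT p|lborel. w p * ?u t p)) (at t)"
  proof (rule DERIV_integral[of 0 t T lborel _ _ "\<lambda>p. (T * A) * \<bar>w p * wt s (snd p)\<bar>"])
    show "(\<lambda>p. w p * ?u t p) \<in> borel_measurable lborel" using w mf by (simp add: borel_prod)
    show "integrable lborel (\<lambda>p. (T * A) * \<bar>w p * wt s (snd p)\<bar>)" using w_int by (intro integrable_mult_right integrable_abs)
    show "integrable lborel (\<lambda>p. w p * ?f x p)" if "x < T" for x by (rule integrable_w_mult[OF mf(1) bf[OF that]])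
    fix z :: real and p :: "real \<times> 'a" assume z: "0 < z" "z < T"
    have "((\<lambda>z. (max 0 (z - fst p))\<^sup>2 / 2) has_real_derivative max 0 (z - fst p)) (at z)"
      by (rule half_square_pos_part_DERIV)
    from DERIV_cmult[OF DERIV_cmult_right[OF this, of "?\<phi> (snd p)"], of "w p"]
    show "((\<lambda>z. w p * ?f z p) has_real_derivative w p * ?u z p) (at z)" .
    show "\<bar>w p * ?u z p\<bar> \<le> (T * A) * \<bar>w p * wt s (snd p)\<bar>"
    proof (cases "fst p \<in> {0<..<T}")
      case True
      have "\<bar>w p\<bar> * \<bar>?u z p\<bar> \<le> \<bar>w p\<bar> * ((T * A) * wt s (snd p))" using bu[OF z(2) True, of "snd p"] by (intro mult_left_mono) auto
      then show ?thesis by (simp add: abs_mult wt_nonneg mult_ac)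
    qed (simp add: w_zero)
  qed (use t in auto)
  moreover have "((\<lambda>x. LINT p|lborel. w p * ?f x p) has_real_derivative 0) (at t)"
  proof (rule has_field_derivative_transform_within_open[where S="{0<..<T}" and f="\<lambda>_. 0"])
    show "(0::real) = (LINT p|lborel. w p * ?f x p)" if "x \<in> {0<..<T}" for x
      using bump_pairing_zero[OF k, of x \<alpha> \<beta>] that by simp
  qed (use t in auto)
  ultimately show ?thesis by (rule DERIV_unique)
qed

text \<open>The positive part has a corner, so the second differentiation uses forward difference
  quotients. They are bounded by 1 and converge to the indicator of \<open>{..t}\<close>, end point
  included.\<close>

lemma bump_pairing_step_zero:
  assumes k: "k > 0" and t: "0 < t" "t < T"
  shows "(LINT p|lborel. w p * (indicator {..t} (fst p) * bump k \<alpha> \<beta> (snd p))) = 0"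
proof -
  let ?\<phi> = "bump k \<alpha> \<beta>"
  obtain A where A: "A \<ge> 0" "\<And>x. \<bar>?\<phi> x\<bar> \<le> A * wt s x" "\<And>x. \<bar>frac_lap s ?\<phi> x\<bar> \<le> A * wt s x"
    using bump_facts(4)[OF s k, of \<alpha> \<beta>] by blast
  note [measurable] = bump_facts(5)[OF s k, of \<alpha> \<beta>]
  \<comment> \<open>At most half the distance from t to \<open>T\<close>, so that
    \<open>t + h n\<close> remains admissible.\<close>
  define h where "h n = (T - t) / 2 * inverse (real (Suc n))" for n
  have h0: "h n > 0" for n using t by (simp add: h_def)
  have hT: "t + h n < T" for n
  proof -
    have "h n \<le> (T - t) / 2 * 1" unfolding h_def using t by (intro mult_left_mono) (auto simp: inverse_le_1_iff)
    then show ?thesis using t by simp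
  qed
  have hl: "h \<longlonglongrightarrow> 0" unfolding h_def using tendsto_mult_right_zero[OF LIMSEQ_inverse_real_of_nat] by simp
  let ?H = "\<lambda>n p. (max 0 (t + h n - fst p) - max 0 (t - fst p)) / h n * ?\<phi> (snd p)"
  have q1: "\<bar>(max 0 (t + h n - \<tau>) - max 0 (t - \<tau>)) / h n\<bar> \<le> 1" for n \<tau>
  proof -
    have "\<bar>max 0 (t + h n - \<tau>) - max 0 (t - \<tau>)\<bar> \<le> h n" using h0[of n] by (auto simp: max_def abs_if)
    then show ?thesis using h0[of n] by (simp add: abs_divide divide_le_eq_1)
  qed
  have lim: "(\<lambda>n. LINT p|lborel. w p * ?H n p) \<longlonglongrightarrow> (LINT p|lborel. w p * (indicator {..t} (fst p) * ?\<phi> (snd p)))"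
  proof (rule w_dominated_convergence[where C=A])
    show "\<bar>?H n (\<tau>, x)\<bar> \<le> A * wt s x" for n \<tau> x
    proof -
      have "\<bar>?H n (\<tau>, x)\<bar> \<le> 1 * (A * wt s x)" unfolding abs_mult fst_conv snd_conv using A(2)[of x] by (intro mult_mono q1) auto
      then show ?thesis by simp
    qed
    show "(\<lambda>n. ?H n (\<tau>, x)) \<longlonglongrightarrow> indicator {..t} (fst (\<tau>, x)) * ?\<phi> (snd (\<tau>, x))" for \<tau> x
    proof -
      have "(\<lambda>n. (max 0 (t + h n - \<tau>) - max 0 (t - \<tau>)) / h n) \<longlonglongrightarrow> indicator {..t} \<tau>"
      proof (cases "\<tau> \<le> t")
        case True
        then have "(max 0 (t + h n - \<tau>) - max 0 (t - \<tau>)) / h n = 1" for n using h0[of n] by (simp add: max_def)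
        then show ?thesis using True by simp
      next
        case False
        have "eventually (\<lambda>n. h n < \<tau> - t) sequentially" using order_tendstoD(2)[OF hl, of "\<tau> - t"] False by simp
        then have "eventually (\<lambda>n. (max 0 (t + h n - \<tau>) - max 0 (t - \<tau>)) / h n = indicator {..t} \<tau>) sequentially"
          by eventually_elim (use False in \<open>simp add: max_def\<close>)
        then show ?thesis by (rule tendsto_eventually)
      qed
      then show ?thesis unfolding fst_conv snd_conv by (rule tendsto_mult_right)
    qed
  qed measurable
  have z: "(LINT p|lborel. w p * ?H n p) = 0" for n
  proof -
    let ?u = "\<lambda>x p. w p * (max 0 (x - fst p) * ?\<phi> (snd p))"
    have i: "integrable lborel (?u x)" if "x < T" for x
    proof (rule integrable_w_mult[where C="T * A"])
      show "\<bar>max 0 (x - fst (\<tau>, y)) * ?\<phi> (snd (\<tau>, y))\<bar> \<le> T * A * wt s y" if "\<tau> \<in> {0<..<T}" for \<tau> y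
      proof -
        have "\<bar>max 0 (x - \<tau>)\<bar> * \<bar>?\<phi> y\<bar> \<le> T * (A * wt s y)" using that \<open>x < T\<close> A(2) T by (intro mult_mono) auto
        then show ?thesis by (simp add: abs_mult mult.assoc)
      qed
    qed measurable
    have "w p * ?H n p = (?u (t + h n) p - ?u t p) / h n" for p by (simp add: field_simps)
    then have "(LINT p|lborel. w p * ?H n p) = ((LINT p|lborel. ?u (t + h n) p) - (LINT p|lborel. ?u t p)) / h n"
      using i[OF hT] i[OF t(2)] by (simp only: integral_divide_zero Bochner_Integration.integral_diff)
    then show ?thesis using bump_pairing_linear_zero[OF k _ hT, of n \<alpha> \<beta>] bump_pairing_linear_zero[OF k t, of \<alpha> \<beta>] h0[of n] t by simp
  qed
  show ?thesis using lim unfolding z by (simp add: LIMSEQ_const_iff)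
qed

lemma box_bound:
  obtains A where "A \<ge> 0" "\<And>x. indicator (box \<alpha> \<beta>) (x::'a) \<le> A * wt s x"
proof -
  obtain R where R: "\<And>x. x \<in> box \<alpha> \<beta> \<Longrightarrow> norm x \<le> R" using bounded_box[of \<alpha> \<beta>] by (auto simp: bounded_iff)
  obtain A where A: "A \<ge> 0" "\<And>(f :: 'a \<Rightarrow> real) x. (\<And>x. \<bar>f x\<bar> \<le> 1) \<Longrightarrow> (\<And>x. norm x > R \<Longrightarrow> f x = 0) \<Longrightarrow> \<bar>f x\<bar> \<le> A * wt s x"
    using bounded_support_le_wt[OF s(1), of 1 R, where 'a='a] by auto
  have "\<bar>indicator (box \<alpha> \<beta>) x :: real\<bar> \<le> A * wt s x" for x
    by (rule A(2)) (use R in \<open>fastforce simp: indicator_def\<close>)+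
  then show ?thesis using that[OF A(1)] by simp
qed

lemma half_space_pairing_zero:
  "(LINT p|lborel. w p * (indicator {..t} (fst p) * indicator (box \<alpha> \<beta>) (snd p))) = 0"
proof -
  obtain A where A: "A \<ge> 0" "\<And>x. indicator (box \<alpha> \<beta>) (x::'a) \<le> A * wt s x" using box_bound by blast
  have inside: "(LINT p|lborel. w p * (indicator {..t} (fst p) * indicator (box \<alpha> \<beta>) (snd p))) = 0" if t: "0 < t" "t < T" for t
  proof -
    have "(\<lambda>n. LINT p|lborel. w p * (indicator {..t} (fst p) * bump (real (Suc n)) \<alpha> \<beta> (snd p))) \<longlonglongrightarrow> (LINT p|lborel. w p * (indicator {..t} (fst p) * indicator (box \<alpha> \<beta>) (snd p)))"
    proof (rule w_dominated_convergence[where C=A])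
      show "(\<lambda>p. indicator {..t} (fst p) * bump (real (Suc n)) \<alpha> \<beta> (snd p)) \<in> borel_measurable (borel \<Otimes>\<^sub>M borel)" for n
      proof -
        have [measurable]: "bump (real (Suc n)) \<alpha> \<beta> \<in> borel_measurable borel" by (rule bump_facts(5)[OF s]) simp
        show ?thesis by measurable
      qed
      show "\<bar>indicator {..t} (fst (\<tau>, x)) * bump (real (Suc n)) \<alpha> \<beta> (snd (\<tau>, x))\<bar> \<le> A * wt s x" for n \<tau> x
      proof -
        have "bump (real (Suc n)) \<alpha> \<beta> x \<le> indicator (box \<alpha> \<beta>) x"
          using bump_support[of "real (Suc n)" \<alpha> \<beta> x] bump_bounds(2)[of "real (Suc n)" \<alpha> \<beta> x]
          by (cases "bump (real (Suc n)) \<alpha> \<beta> x = 0") (auto simp: indicator_def)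
        then have "\<bar>bump (real (Suc n)) \<alpha> \<beta> x\<bar> \<le> A * wt s x" using A(2)[of x] bump_bounds(1)[of "real (Suc n)" \<alpha> \<beta> x] by linarith
        moreover have "\<bar>indicator {..t} \<tau> * bump (real (Suc n)) \<alpha> \<beta> x\<bar> \<le> \<bar>bump (real (Suc n)) \<alpha> \<beta> x\<bar>" by (simp add: indicator_def)
        ultimately show ?thesis unfolding fst_conv snd_conv by linarith
      qed
      show "(\<lambda>n. indicator {..t} (fst (\<tau>, x)) * bump (real (Suc n)) \<alpha> \<beta> (snd (\<tau>, x))) \<longlonglongrightarrow> indicator {..t} (fst (\<tau>, x)) * indicator (box \<alpha> \<beta>) (snd (\<tau>, x))" for \<tau> x
        unfolding fst_conv snd_conv by (intro tendsto_mult_left LIMSEQ_Suc[OF bump_lim])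
    qed measurable
    then show ?thesis using bump_pairing_step_zero[OF _ t] by (simp add: LIMSEQ_const_iff del: of_nat_Suc)
  qed
  consider "t \<le> 0" | "0 < t" "t < T" | "T \<le> t" by linarith
  then show ?thesis
  proof cases
    case 1
    have "w p * (indicator {..t} (fst p) * indicator (box \<alpha> \<beta>) (snd p)) = 0" for p
      using 1 w_zero[of p] by (cases "fst p \<in> {0<..<T}") auto
    then show ?thesis by (simp only: Bochner_Integration.integral_zero)
  next
    case 2 then show ?thesis by (rule inside)
  next
    case 3
    \<comment> \<open>Times beyond \<open>T\<close> are reached from below: \<open>w\<close>
      vanishes from \<open>T\<close> on, so the indicators agree in the limit wherever
      \<open>w\<close> can be nonzero.\<close>
    define t' where "t' n = T - T / 2 * inverse (real (Suc n))" for n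
    have h1: "T / 2 * inverse (real (Suc n)) \<le> T / 2 * 1" for n
      using T by (intro mult_left_mono) (auto simp: inverse_le_1_iff)
    have h2: "T / 2 * inverse (real (Suc n)) > 0" for n using T by simp
    have t': "0 < t' n" "t' n < T" for n using T h1[of n] h2[of n] unfolding t'_def by linarith+
    have "t' \<longlonglongrightarrow> T - T / 2 * 0" unfolding t'_def by (intro tendsto_intros LIMSEQ_inverse_real_of_nat)
    then have tl: "t' \<longlonglongrightarrow> T" by simp
    have "(\<lambda>n. LINT p|lborel. w p * (indicator {..t' n} (fst p) * indicator (box \<alpha> \<beta>) (snd p))) \<longlonglongrightarrow> (LINT p|lborel. w p * (indicator {..t} (fst p) * indicator (box \<alpha> \<beta>) (snd p)))"
    proof (rule w_dominated_convergence[where C=A])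
      show "\<bar>indicator {..t' n} (fst (\<tau>, x)) * indicator (box \<alpha> \<beta>) (snd (\<tau>, x))\<bar> \<le> A * wt s x" for n \<tau> x
        using A(2)[of x] A(1) wt_nonneg[of s x] by (auto simp: indicator_def)
      show "(\<lambda>n. indicator {..t' n} (fst (\<tau>, x)) * indicator (box \<alpha> \<beta>) (snd (\<tau>, x))) \<longlonglongrightarrow> (indicator {..t} (fst (\<tau>, x)) * indicator (box \<alpha> \<beta>) (snd (\<tau>, x)) :: real)" if "\<tau> \<in> {0<..<T}" for \<tau> x
      proof -
        have "eventually (\<lambda>n. t' n > \<tau>) sequentially" using order_tendstoD(1)[OF tl, of \<tau>] that by simp
        then have "eventually (\<lambda>n. indicator {..t' n} \<tau> * indicator (box \<alpha> \<beta>) x = (indicator {..t} \<tau> * indicator (box \<alpha> \<beta>) x :: real)) sequentially"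
          by eventually_elim (use that 3 in auto)
        then show ?thesis by (simp add: tendsto_eventually)
      qed
    qed measurable
    then show ?thesis by (simp add: inside[OF t'] LIMSEQ_const_iff)
  qed
qed

lemma box_pairing_zero: "(LINT p|lborel. w p * indicator (box u v) p) = 0"
proof -
  obtain c \<alpha> where u: "u = (c, \<alpha>)" by (cases u)
  obtain d \<beta> where v: "v = (d, \<beta>)" by (cases v)
  have box: "box u v = {c<..<d} \<times> box \<alpha> \<beta>"
    unfolding u v by (auto simp: box_def Basis_prod_def)
  show ?thesis
  proof (cases "c < d")
    case False
    then have "box u v = {}" unfolding box by auto
    then show ?thesis by simp
  next
    case True
    obtain A where A: "A \<ge> 0" "\<And>x. indicator (box \<alpha> \<beta>) (x::'a) \<le> A * wt s x" using box_bound by blast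
    \<comment> \<open>Strictly below \<open>d\<close>, so the closed half lines
      \<open>{..e n}\<close> exhaust the open one. Early terms may lie below \<open>c\<close>; the
      difference is then negative but still bounded by the same majorant.\<close>
    define e where "e n = d - inverse (real (Suc n))" for n
    have el: "e \<longlonglongrightarrow> d" unfolding e_def using tendsto_diff[OF tendsto_const LIMSEQ_inverse_real_of_nat, of d] by simp
    let ?B = "\<lambda>t p. indicator {..t} (fst p) * (indicator (box \<alpha> \<beta>) (snd p) :: real)"
    have i: "integrable lborel (\<lambda>p. w p * ?B t p)" for t
    proof (rule integrable_w_mult[where C=A])
      show "\<bar>?B t (\<tau>, x)\<bar> \<le> A * wt s x" for \<tau> x
        using A(2)[of x] A(1) wt_nonneg[of s x] by (auto simp: indicator_def)
    qed measurable
    have "(\<lambda>n. LINT p|lborel. w p * (?B (e n) p - ?B c p)) \<longlonglongrightarrow> (LINT p|lborel. w p * indicator (box u v) p)"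
    proof (rule w_dominated_convergence[where C=A])
      show "indicator (box u v) \<in> borel_measurable (borel \<Otimes>\<^sub>M borel)" by (simp add: borel_prod)
      show "\<bar>?B (e n) (\<tau>, x) - ?B c (\<tau>, x)\<bar> \<le> A * wt s x" for n \<tau> x
        using A(2)[of x] A(1) wt_nonneg[of s x] by (auto simp: indicator_def)
      show "(\<lambda>n. ?B (e n) (\<tau>, x) - ?B c (\<tau>, x)) \<longlonglongrightarrow> indicator (box u v) (\<tau>, x)" for \<tau> x
      proof (cases "\<tau> < d")
        case l: True
        have "eventually (\<lambda>n. e n > \<tau>) sequentially" using order_tendstoD(1)[OF el, of \<tau>] l by simp
        then have "eventually (\<lambda>n. ?B (e n) (\<tau>, x) - ?B c (\<tau>, x) = indicator (box u v) (\<tau>, x)) sequentially"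
          by eventually_elim (use l in \<open>auto simp: box indicator_def\<close>)
        then show ?thesis by (simp add: tendsto_eventually)
      next
        case False
        have "e n < d" for n by (simp add: e_def)
        then have "\<not> \<tau> \<le> e n" for n using False by (meson le_less_trans)
        moreover have "\<not> \<tau> \<le> c" using False True by linarith
        ultimately have "?B (e n) (\<tau>, x) - ?B c (\<tau>, x) = indicator (box u v) (\<tau>, x)" for n
          using False by (simp add: box indicator_def)
        then show ?thesis by (simp only: tendsto_const)
      qed
    qed measurable
    moreover have "(LINT p|lborel. w p * (?B (e n) p - ?B c p)) = 0" for n
    proof -
      have "(LINT p|lborel. w p * (?B (e n) p - ?B c p)) = (LINT p|lborel. w p * ?B (e n) p) - (LINT p|lborel. w p * ?B c p)"
        unfolding right_diff_distrib by (rule Bochner_Integration.integral_diff[OF i i])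
      then show ?thesis by (simp only: half_space_pairing_zero diff_self)
    qed
    ultimately show ?thesis by (simp add: LIMSEQ_const_iff)
  qed
qed

text \<open>The positive and negative parts of \<open>w\<close> are the densities of two measures
  that agree on open boxes, hence everywhere.\<close>

lemma w_eq_zero: "AE p in lborel. w p = 0"
proof -
  note [measurable] = w
  let ?f = "\<lambda>p. ennreal (max 0 (w p))" and ?g = "\<lambda>p. ennreal (max 0 (- w p))"
  have ibox: "integrable lborel (\<lambda>p. w p * indicator (box u v) p)" for u v
  proof -
    obtain c \<alpha> where u: "u = (c, \<alpha>)" by (cases u)
    obtain d \<beta> where v: "v = (d, \<beta>)" by (cases v)
    obtain A where A: "A \<ge> 0" "\<And>x. indicator (box \<alpha> \<beta>) (x::'a) \<le> A * wt s x" using box_bound by blast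
    have "indicator (box u v) (\<tau>, x) \<le> (indicator (box \<alpha> \<beta>) x :: real)" for \<tau> x
      unfolding u v by (auto simp: box_def Basis_prod_def indicator_def)
    then have "indicator (box u v) (\<tau>, x) \<le> A * wt s x" for \<tau> x using A(2)[of x] order_trans by blast
    then show ?thesis by (intro integrable_w_mult[where C=A]) (auto simp: borel_prod)
  qed
  have em: "(\<integral>\<^sup>+p. ?f p * indicator (box u v) p \<partial>lborel) = ennreal (LINT p|lborel. max 0 (w p * indicator (box u v) p))"
    "(\<integral>\<^sup>+p. ?g p * indicator (box u v) p \<partial>lborel) = ennreal (LINT p|lborel. max 0 (- (w p * indicator (box u v) p)))" for u v
  proof -
    have i: "integrable lborel (\<lambda>p. max 0 (w p * indicator (box u v) p))" "integrable lborel (\<lambda>p. max 0 (- (w p * indicator (box u v) p)))"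
      using ibox[of u v] by (auto intro!: integrable_max)
    show "(\<integral>\<^sup>+p. ?f p * indicator (box u v) p \<partial>lborel) = ennreal (LINT p|lborel. max 0 (w p * indicator (box u v) p))"
      by (subst nn_integral_eq_integral[OF i(1), symmetric]) (auto intro!: nn_integral_cong simp: indicator_def)
    show "(\<integral>\<^sup>+p. ?g p * indicator (box u v) p \<partial>lborel) = ennreal (LINT p|lborel. max 0 (- (w p * indicator (box u v) p)))"
      by (subst nn_integral_eq_integral[OF i(2), symmetric]) (auto intro!: nn_integral_cong simp: indicator_def)
  qed
  have eq: "(\<integral>\<^sup>+p. ?f p * indicator (box u v) p \<partial>lborel) = (\<integral>\<^sup>+p. ?g p * indicator (box u v) p \<partial>lborel)" for u v
  proof -
    have i: "integrable lborel (\<lambda>p. max 0 (w p * indicator (box u v) p))" "integrable lborel (\<lambda>p. max 0 (- (w p * indicator (box u v) p)))"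
      using ibox[of u v] by (auto intro!: integrable_max)
    have "0 = (LINT p|lborel. w p * indicator (box u v) p)" by (simp add: box_pairing_zero)
    also have "\<dots> = (LINT p|lborel. max 0 (w p * indicator (box u v) p) - max 0 (- (w p * indicator (box u v) p)))"
      by (intro Bochner_Integration.integral_cong) (auto simp: max_def)
    also have "\<dots> = (LINT p|lborel. max 0 (w p * indicator (box u v) p)) - (LINT p|lborel. max 0 (- (w p * indicator (box u v) p)))"
      by (rule Bochner_Integration.integral_diff[OF i])
    finally show ?thesis unfolding em by simp
  qed
  \<comment> \<open>Open boxes are stable under intersection, generate the Borel sets and exhaust
    the space with finite measure.\<close>
  have "density lborel ?f = density lborel ?g"
  proof (rule measure_eqI_generator_eq)
    let ?E = "range (\<lambda>(a, b). box a b :: (real \<times> 'a) set)"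
    show "Int_stable ?E" by (auto simp: Int_stable_def box_Int_box)
    show "?E \<subseteq> Pow UNIV" "sets (density lborel ?f) = sigma_sets UNIV ?E" "sets (density lborel ?g) = sigma_sets UNIV ?E"
      by (simp_all add: borel_eq_box)
    let ?A = "\<lambda>n::nat. box (- (real n *\<^sub>R One)) (real n *\<^sub>R One) :: (real \<times> 'a) set"
    show "range ?A \<subseteq> ?E" "(\<Union>i. ?A i) = UNIV" unfolding UN_box_eq_UNIV by auto
    have "emeasure (density lborel ?f) (box u v) = ennreal (LINT p|lborel. max 0 (w p * indicator (box u v) p))" for u v
      unfolding em(1)[symmetric] by (rule emeasure_density) auto
    then show "emeasure (density lborel ?f) (?A i) \<noteq> \<infinity>" for i by (simp only: ennreal_neq_top infinity_ennreal_def not_False_eq_True)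
    show "emeasure (density lborel ?f) X = emeasure (density lborel ?g) X" if "X \<in> ?E" for X
    proof -
      from that obtain u v where X: "X = box u v" by auto
      have "emeasure (density lborel ?f) (box u v) = (\<integral>\<^sup>+p. ?f p * indicator (box u v) p \<partial>lborel)" by (rule emeasure_density) auto
      also have "\<dots> = (\<integral>\<^sup>+p. ?g p * indicator (box u v) p \<partial>lborel)" by (rule eq)
      also have "\<dots> = emeasure (density lborel ?g) (box u v)" by (rule emeasure_density[symmetric]) auto
      finally show ?thesis unfolding X .
    qed
  qed
  then have "AE p in lborel. ?f p = ?g p" by (intro sigma_finite_measure.density_unique[OF sigma_finite_lborel]) auto
  then show ?thesis by eventually_elim (auto simp: max_def split: if_splits)
qed

end

section \<open>Signed initial data\<close>

lemma lebesgue_integral_borel: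
  fixes f :: "'a::euclidean_space \<Rightarrow> real"
  assumes "f \<in> borel_measurable borel"
  shows "(LINT x|lebesgue. f x) = (LINT x|lborel. f x)" "integrable lebesgue f \<longleftrightarrow> integrable lborel f"
  using assms by (simp_all add: integral_completion integrable_completion)

text \<open>Bridge between the two settings: solutions are measurable for the completed measure
  only, while products, Fubini and the potential are handled with Borel functions.\<close>

lemma lebesgue_integral_cong_AE:
  fixes f g :: "'a::euclidean_space \<Rightarrow> real"
  assumes "g \<in> borel_measurable borel" "AE x in lborel. f x = g x"
  shows "f \<in> borel_measurable lebesgue" "(LINT x|lebesgue. f x) = (LINT x|lborel. g x)"
    "integrable lebesgue f \<longleftrightarrow> integrable lborel g"
proof -
  have g: "g \<in> borel_measurable lebesgue" using assms(1) by (simp add: measurable_completion)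
  have ae: "AE x in lebesgue. f x = g x" using assms(2) by (rule AE_completion)
  show f: "f \<in> borel_measurable lebesgue"
    by (rule borel_measurable_AE[OF g]) (use ae in \<open>auto elim: eventually_mono\<close>)
  show "(LINT x|lebesgue. f x) = (LINT x|lborel. g x)"
    using integral_cong_AE[OF f g ae] lebesgue_integral_borel(1)[OF assms(1)] by simp
  show "integrable lebesgue f \<longleftrightarrow> integrable lborel g"
    using integrable_cong_AE[OF f g ae] lebesgue_integral_borel(2)[OF assms(1)] by simp
qed

locale signed_weighted_measure =
  P: weighted_measure s \<mu>p + N: weighted_measure s \<mu>m
  for s :: real and \<mu>p \<mu>m :: "'a::euclidean_space measure" +
  fixes T :: real
  assumes T: "0 < T"
begin

definition V :: "real \<Rightarrow> 'a \<Rightarrow> real" where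
  "V t x = P.U t x - N.U t x"

lemma V_measurable [measurable (raw)]:
  assumes [measurable]: "f \<in> borel_measurable M" "g \<in> borel_measurable M"
  shows "(\<lambda>z. V (f z) (g z)) \<in> borel_measurable M"
  unfolding V_def by measurable

lemma V_borel [measurable]: "(\<lambda>p. V (fst p) (snd p)) \<in> borel_measurable borel"
  by (simp add: borel_prod[symmetric])

lemma V_integrable:
  fixes F :: "real \<times> 'a \<Rightarrow> real"
  assumes F: "F \<in> borel_measurable borel" "\<And>t x. \<bar>F (t, x)\<bar> \<le> A * wt s x" "\<And>t x. t \<notin> {0<..<T} \<Longrightarrow> F (t, x) = 0"
  shows "integrable lborel (\<lambda>p. V (fst p) (snd p) * F p)"
  using P.spacetime_Fubini(1)[OF T F] N.spacetime_Fubini(1)[OF T F] by (simp add: V_def left_diff_distrib)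

lemma V_weak:
  assumes \<psi>: "test_fun T \<psi>"
  shows "(LINT p|lborel. V (fst p) (snd p) * ddir (1, 0) \<psi> p) = (LINT p|lborel. V (fst p) (snd p) * frac_lap s (\<lambda>y. \<psi> (fst p, y)) (snd p))"
  using P.U_weak_solution[OF \<psi> T] N.U_weak_solution[OF \<psi> T] by (simp add: V_def left_diff_distrib)

lemma V_trace:
  assumes \<psi>: "continuous_on UNIV \<psi>" "compact (closure {x. \<psi> x \<noteq> 0})"
  shows "((\<lambda>t. LINT x|lborel. V t x * \<psi> x) \<longlongrightarrow> integral\<^sup>L \<mu>p \<psi> - integral\<^sup>L \<mu>m \<psi>) (at 0 within {0<..<T})"
    "\<And>t. t > 0 \<Longrightarrow> integrable lborel (\<lambda>x. V t x * \<psi> x)"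
proof -
  obtain R B where B: "B \<ge> 0" "\<And>x. \<bar>\<psi> x\<bar> \<le> B" "\<And>x. norm x > R \<Longrightarrow> \<psi> x = 0" using compact_support_bounds[OF \<psi>] by metis
  obtain A where A: "A \<ge> 0" "\<And>(f :: 'a \<Rightarrow> real) x. (\<And>x. \<bar>f x\<bar> \<le> B) \<Longrightarrow> (\<And>x. norm x > R \<Longrightarrow> f x = 0) \<Longrightarrow> \<bar>f x\<bar> \<le> A * wt s x"
    using bounded_support_le_wt[OF P.s(1) B(1), where R=R and 'a='a] by metis
  have le: "\<bar>\<psi> x\<bar> \<le> A * wt s x" for x using A(2)[of \<psi> x] B by blast
  have m: "\<psi> \<in> borel_measurable borel" using \<psi>(1) by (rule borel_measurable_continuous_onI)
  have i: "integrable lborel (\<lambda>x. P.U t x * \<psi> x)" "integrable lborel (\<lambda>x. N.U t x * \<psi> x)" if "t > 0" for t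
    using P.slice_Fubini(1)[OF that m le] N.slice_Fubini(1)[OF that m le] by auto
  show "integrable lborel (\<lambda>x. V t x * \<psi> x)" if "t > 0" for t
    unfolding V_def left_diff_distrib using i[OF that] by (rule Bochner_Integration.integrable_diff)
  have "((\<lambda>t. (LINT x|lborel. P.U t x * \<psi> x) - (LINT x|lborel. N.U t x * \<psi> x)) \<longlongrightarrow> integral\<^sup>L \<mu>p \<psi> - integral\<^sup>L \<mu>m \<psi>) (at 0 within {0<..<T})"
    by (intro tendsto_diff P.U_trace N.U_trace T \<psi>)
  moreover have "eventually (\<lambda>t. (LINT x|lborel. P.U t x * \<psi> x) - (LINT x|lborel. N.U t x * \<psi> x) = (LINT x|lborel. V t x * \<psi> x)) (at 0 within {0<..<T})"
    using i by (auto simp: eventually_at_filter V_def left_diff_distrib)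
  ultimately show "((\<lambda>t. LINT x|lborel. V t x * \<psi> x) \<longlongrightarrow> integral\<^sup>L \<mu>p \<psi> - integral\<^sup>L \<mu>m \<psi>) (at 0 within {0<..<T})"
    by (rule Lim_transform_eventually)
qed

lemma strip_measurable: "{0<..<T} \<times> (UNIV :: 'a set) \<in> sets borel"
  by (intro borel_open open_Times) auto

lemma V_strip_integrable:
  "set_integrable lebesgue ({0<..<T} \<times> UNIV) (\<lambda>p. V (fst p) (snd p) * Phi_weight s (snd p))"
proof -
  have "integrable lborel (\<lambda>p. P.U (fst p) (snd p) * (indicator {0<..<T} (fst p) * Phi_weight s (snd p)) - N.U (fst p) (snd p) * (indicator {0<..<T} (fst p) * Phi_weight s (snd p)))"
    by (intro Bochner_Integration.integrable_diff P.U_Phi_integrable N.U_Phi_integrable T)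
  moreover have "P.U (fst p) (snd p) * (indicator {0<..<T} (fst p) * Phi_weight s (snd p)) - N.U (fst p) (snd p) * (indicator {0<..<T} (fst p) * Phi_weight s (snd p)) = indicator ({0<..<T} \<times> UNIV) p *\<^sub>R (V (fst p) (snd p) * Phi_weight s (snd p))" for p
    by (cases p) (auto simp: V_def indicator_def algebra_simps)
  ultimately have i: "integrable lborel (\<lambda>p. indicator ({0<..<T} \<times> UNIV) p *\<^sub>R (V (fst p) (snd p) * Phi_weight s (snd p)))" by simp
  then show ?thesis unfolding set_integrable_def
    by (subst lebesgue_integral_borel(2)) (auto simp: integrable_iff_bounded)
qed

lemma V_very_weak_sol: "very_weak_sol s T V"
  unfolding very_weak_sol_def
proof (intro conjI allI impI)
  fix a b :: real assume "0 < a" "b < T"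
  then have "{a..b} \<times> (UNIV :: 'a set) \<subseteq> {0<..<T} \<times> UNIV" by auto
  moreover have "{a..b} \<times> (UNIV :: 'a set) \<in> sets borel" by (intro borel_closed closed_Times) auto
  then have "{a..b} \<times> (UNIV :: 'a set) \<in> sets lebesgue" by (rule sets_completionI_sets[of _ lborel, simplified])
  ultimately show "set_integrable lebesgue ({a..b} \<times> UNIV) (\<lambda>p. V (fst p) (snd p) * Phi_weight s (snd p))"
    by (intro set_integrable_subset[OF V_strip_integrable])
next
  fix \<psi> :: "real \<times> 'a \<Rightarrow> real" assume \<psi>: "test_fun T \<psi>"
  note f = test_fun_facts[OF P.s \<psi>]
  have "(LINT p|lebesgue. V (fst p) (snd p) * deriv (\<lambda>t. \<psi> (t, snd p)) (fst p)) = (LINT p|lborel. V (fst p) (snd p) * ddir (1, 0) \<psi> p)"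
    using f(1) by (subst deriv_eq_ddir[OF test_fun_csmooth[OF \<psi>]]) (simp add: lebesgue_integral_borel)
  also have "\<dots> = (LINT p|lborel. V (fst p) (snd p) * frac_lap s (\<lambda>y. \<psi> (fst p, y)) (snd p))" by (rule V_weak[OF \<psi>])
  also have "\<dots> = (LINT p|lebesgue. V (fst p) (snd p) * frac_lap s (\<lambda>y. \<psi> (fst p, y)) (snd p))"
    using f(2) by (simp add: lebesgue_integral_borel)
  finally show "(LINT p|lebesgue. V (fst p) (snd p) * deriv (\<lambda>t. \<psi> (t, snd p)) (fst p)) = (LINT p|lebesgue. V (fst p) (snd p) * frac_lap s (\<lambda>y. \<psi> (fst p, y)) (snd p))" .
qed

lemma V_slice_lebesgue:
  assumes "\<psi> \<in> borel_measurable borel"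
  shows "(LINT x|lebesgue. V t x * \<psi> x) = (LINT x|lborel. V t x * \<psi> x)"
  using assms by (intro lebesgue_integral_borel) measurable

lemma V_initial_trace: "initial_trace s T V \<mu>p \<mu>m"
  unfolding initial_trace_def
proof (intro conjI allI impI exI[of _ "{}"])
  show "set_integrable lebesgue ({0<..<T} \<times> UNIV) (\<lambda>p. V (fst p) (snd p) * Phi_weight s (snd p))" by (rule V_strip_integrable)
  fix \<psi> :: "'a \<Rightarrow> real" assume \<psi>: "continuous_on UNIV \<psi>" "compact (closure {x. \<psi> x \<noteq> 0})"
  show "((\<lambda>t. LINT x|lebesgue. V t x * \<psi> x) \<longlongrightarrow> integral\<^sup>L \<mu>p \<psi> - integral\<^sup>L \<mu>m \<psi>) (at 0 within {0<..<T} - {})"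
    unfolding V_slice_lebesgue[OF borel_measurable_continuous_onI[OF \<psi>(1)]] using V_trace(1)[OF \<psi>] by simp
qed simp

text \<open>A competitor \<open>v\<close> is replaced on the strip by a Borel representative
  \<open>G\<close>. Its difference from \<open>V\<close> is then a zero-trace solution, since both
  satisfy the same weak identity and have the same initial trace.\<close>

lemma uniqueness:
  assumes v1: "very_weak_sol s T v" and v2: "initial_trace s T v \<mu>p \<mu>m"
  shows "AE p in lebesgue. p \<in> {0<..<T} \<times> UNIV \<longrightarrow> v (fst p) (snd p) = V (fst p) (snd p)"
proof -
  let ?S = "{0<..<T} \<times> (UNIV :: 'a set)"
  have S [measurable]: "?S \<in> sets borel" by (rule strip_measurable)
  define v0 where "v0 p = indicator ?S p * v (fst p) (snd p)" for p
  have vP: "integrable lebesgue (\<lambda>p. v0 p * Phi_weight s (snd p))"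
    using v2 by (simp add: initial_trace_def set_integrable_def v0_def mult.assoc)
  have Phi_pos: "Phi_weight s x > 0" for x :: 'a
    using Phi_weight_bounds(1)[OF P.s(1), of x] norm_ge_zero[of x] by (smt (verit) powr_gt_zero)
  have Phim: "(\<lambda>p::real \<times> 'a. Phi_weight s (snd p)) \<in> borel_measurable borel"
    by (simp add: borel_prod[symmetric])
  then have Phim': "(\<lambda>p::real \<times> 'a. Phi_weight s (snd p)) \<in> borel_measurable lebesgue"
    by (simp add: measurable_completion)
  \<comment> \<open>Integrability gives measurability of the weighted function only; dividing by the
    positive weight recovers that of \<open>v0\<close>.\<close>
  have "(\<lambda>p. v0 p * Phi_weight s (snd p) / Phi_weight s (snd p)) \<in> borel_measurable lebesgue"
    using borel_measurable_integrable[OF vP] Phim' by (rule borel_measurable_divide)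
  then have "v0 \<in> borel_measurable lebesgue" using Phi_pos by (simp add: less_imp_neq[symmetric])
  then obtain g where g: "g \<in> borel_measurable borel" "AE p in lborel. v0 p = g p"
    using completion_ex_borel_measurable_real[of v0 lborel] by auto
  define G where "G p = indicator ?S p * g p" for p
  have Gm [measurable]: "G \<in> borel_measurable borel" unfolding G_def using g(1) by measurable
  have vG: "AE p in lborel. v0 p = G p"
    using g(2)
  proof eventually_elim
    case (elim p)
    then show ?case by (cases "p \<in> ?S") (simp_all add: G_def v0_def)
  qed
  have Gm' [measurable]: "G \<in> borel_measurable (borel \<Otimes>\<^sub>M borel)" using Gm by (simp add: borel_prod)
  obtain C where C: "C > 0" "\<And>x::'a. Phi_weight s x \<le> C * wt s x" "\<And>x::'a. wt s x \<le> C * Phi_weight s x"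
    using P.Phi_weight_le_wt by metis
  have "integrable lborel (\<lambda>p. G p * Phi_weight s (snd p))"
  proof -
    have "AE p in lborel. v0 p * Phi_weight s (snd p) = G p * Phi_weight s (snd p)" using vG by eventually_elim simp
    then show ?thesis using lebesgue_integral_cong_AE(3)[of "\<lambda>p. G p * Phi_weight s (snd p)" "\<lambda>p. v0 p * Phi_weight s (snd p)"] vP Gm Phim
      by (simp add: borel_measurable_times)
  qed
  note GP = this
  have Gint: "integrable lborel (\<lambda>p. G p * F p)" if F: "F \<in> borel_measurable borel" "\<And>t x. \<bar>F (t, x)\<bar> \<le> A * wt s x" for F A
  proof (rule Bochner_Integration.integrable_bound[OF integrable_mult_right[OF GP, of "\<bar>A\<bar> * C"]])
    show "(\<lambda>p. G p * F p) \<in> borel_measurable lborel" using Gm F(1) by simp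
    show "AE p in lborel. norm (G p * F p) \<le> norm (\<bar>A\<bar> * C * (G p * Phi_weight s (snd p)))"
    proof (rule AE_I2)
      fix p
      have "\<bar>F p\<bar> \<le> A * wt s (snd p)" using F(2)[of "fst p" "snd p"] by simp
      also have "\<dots> \<le> \<bar>A\<bar> * (C * Phi_weight s (snd p))" using C(3)[of "snd p"] wt_nonneg[of s "snd p"] by (intro mult_mono) auto
      finally have "\<bar>G p\<bar> * \<bar>F p\<bar> \<le> \<bar>G p\<bar> * (\<bar>A\<bar> * (C * Phi_weight s (snd p)))" by (intro mult_left_mono) auto
      then show "norm (G p * F p) \<le> norm (\<bar>A\<bar> * C * (G p * Phi_weight s (snd p)))"
        using Phi_pos[of "snd p"] C(1) by (simp add: abs_mult mult_ac)
    qed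
  qed
  define w where "w p = indicator ?S p * (g p - V (fst p) (snd p))" for p
  have w_eq: "w p = G p - indicator ?S p * V (fst p) (snd p)" for p by (simp add: w_def G_def right_diff_distrib)
  have wm: "w \<in> borel_measurable borel" unfolding w_def using g(1) by measurable
  interpret W: zero_trace_solution s T w
  proof
    show "0 < s" "s < 1" by (rule P.s)+
    show "0 < T" by (rule T)
    show "w \<in> borel_measurable borel" by (rule wm)
    show "w p = 0" if "fst p \<notin> {0<..<T}" for p using that by (auto simp: w_def indicator_def mem_Times_iff)
    have wtm: "(\<lambda>p::real \<times> 'a. wt s (snd p)) \<in> borel_measurable borel" by (simp add: borel_prod[symmetric])
    have V_ind: "integrable lborel (\<lambda>p. (indicator ?S p * V (fst p) (snd p)) * F p)" if F: "F \<in> borel_measurable borel" "\<And>t x. \<bar>F (t, x)\<bar> \<le> A * wt s x" for F A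
    proof -
      have "integrable lborel (\<lambda>p. V (fst p) (snd p) * (indicator ?S p * F p))"
      proof (rule V_integrable)
        show "(\<lambda>p. indicator ?S p * F p) \<in> borel_measurable borel" using F(1) by measurable
        show "\<bar>indicator ?S (t, x) * F (t, x)\<bar> \<le> A * wt s x" for t x
          using F(2)[of t x] order_trans[OF abs_ge_zero F(2)[of t x]] by (auto simp: indicator_def)
      qed auto
      then show ?thesis by (simp add: mult_ac)
    qed
    show "integrable lborel (\<lambda>p. w p * wt s (snd p))"
      unfolding w_eq left_diff_distrib
      by (rule Bochner_Integration.integrable_diff[OF Gint[OF wtm, of 1] V_ind[OF wtm, of 1]]) (simp_all add: wt_nonneg)
    fix \<psi> :: "real \<times> 'a \<Rightarrow> real" assume \<psi>: "test_fun T \<psi>"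
    note f = test_fun_facts[OF P.s \<psi>]
    obtain A1 where A1: "\<And>t x. \<bar>ddir (1, 0) \<psi> (t, x)\<bar> \<le> A1 * wt s x" using f(5) by blast
    obtain A2 where A2: "\<And>t x. \<bar>frac_lap s (\<lambda>y. \<psi> (fst (t, x), y)) (snd (t, x))\<bar> \<le> A2 * wt s x" using f(6) by auto
    have split: "(LINT p|lborel. w p * F p) = (LINT p|lebesgue. v (fst p) (snd p) * F p) - (LINT p|lborel. V (fst p) (snd p) * F p)"
      if F: "F \<in> borel_measurable borel" "\<And>t x. \<bar>F (t, x)\<bar> \<le> A * wt s x" "\<And>t x. t \<notin> {0<..<T} \<Longrightarrow> F (t, x) = 0" for F A
    proof -
      have SF: "indicator ?S p * F p = F p" for p using F(3)[of "fst p" "snd p"] by (cases p) (auto simp: indicator_def)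
      have "(LINT p|lborel. w p * F p) = (LINT p|lborel. G p * F p) - (LINT p|lborel. (indicator ?S p * V (fst p) (snd p)) * F p)"
        unfolding w_eq left_diff_distrib by (rule Bochner_Integration.integral_diff[OF Gint[OF F(1,2)] V_ind[OF F(1,2)]])
      also have "(LINT p|lborel. (indicator ?S p * V (fst p) (snd p)) * F p) = (LINT p|lborel. V (fst p) (snd p) * F p)"
        by (rule Bochner_Integration.integral_cong[OF refl]) (metis SF mult.commute mult.left_commute)
      also have "(LINT p|lborel. G p * F p) = (LINT p|lebesgue. v (fst p) (snd p) * F p)"
      proof (rule lebesgue_integral_cong_AE(2)[symmetric])
        show "(\<lambda>p. G p * F p) \<in> borel_measurable borel" using F(1) by measurable
        show "AE p in lborel. v (fst p) (snd p) * F p = G p * F p"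
          using vG
        proof eventually_elim
          case (elim p)
          have "v (fst p) (snd p) * F p = v (fst p) (snd p) * (indicator ?S p * F p)" by (simp only: SF)
          also have "\<dots> = v0 p * F p" by (simp add: v0_def)
          finally show ?case using elim by simp
        qed
      qed
      finally show ?thesis .
    qed
    have "(LINT p|lebesgue. v (fst p) (snd p) * ddir (1, 0) \<psi> p) = (LINT p|lebesgue. v (fst p) (snd p) * frac_lap s (\<lambda>y. \<psi> (fst p, y)) (snd p))"
      using v1[unfolded very_weak_sol_def, THEN conjunct2, rule_format, OF \<psi>]
      unfolding deriv_eq_ddir[OF test_fun_csmooth[OF \<psi>]] prod.collapse .
    then show "(LINT p|lborel. w p * ddir (1, 0) \<psi> p) = (LINT p|lborel. w p * frac_lap s (\<lambda>y. \<psi> (fst p, y)) (snd p))"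
      using split[OF f(1) A1 f(3)] split[OF f(2) A2] f(4) V_weak[OF \<psi>] by simp
  next
    fix \<phi> :: "'a \<Rightarrow> real" assume \<phi>: "continuous_on UNIV \<phi>" "compact (closure {x. \<phi> x \<noteq> 0})"
    have \<phi>m [measurable]: "\<phi> \<in> borel_measurable borel" by (rule borel_measurable_continuous_onI[OF \<phi>(1)])
    obtain R B where B: "B \<ge> 0" "\<And>x. \<bar>\<phi> x\<bar> \<le> B" "\<And>x. norm x > R \<Longrightarrow> \<phi> x = 0" using compact_support_bounds[OF \<phi>] by metis
    obtain A where A: "A \<ge> 0" "\<And>(f :: 'a \<Rightarrow> real) x. (\<And>x. \<bar>f x\<bar> \<le> B) \<Longrightarrow> (\<And>x. norm x > R \<Longrightarrow> f x = 0) \<Longrightarrow> \<bar>f x\<bar> \<le> A * wt s x"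
      using bounded_support_le_wt[OF P.s(1) B(1), where R=R and 'a='a] by metis
    have le: "\<bar>\<phi> x\<bar> \<le> A * wt s x" for x using A(2)[of \<phi> x] B by blast
    obtain E1 where E1: "E1 \<in> null_sets lborel" "((\<lambda>t. LINT x|lebesgue. v t x * \<phi> x) \<longlongrightarrow> integral\<^sup>L \<mu>p \<phi> - integral\<^sup>L \<mu>m \<phi>) (at 0 within {0<..<T} - E1)"
      using v2 \<phi> unfolding initial_trace_def by blast
    have "integrable lborel (\<lambda>p. G p * \<phi> (snd p))"
      by (rule Gint[where A=A]) (use le in \<open>auto simp: borel_prod[symmetric]\<close>)
    then have "integrable (lborel \<Otimes>\<^sub>M lborel) (\<lambda>p. G p * \<phi> (snd p))" by (simp add: lborel_prod)
    from lborel_pair.AE_integrable_fst'[OF this] have ae1: "AE t in lborel. integrable lborel (\<lambda>x. G (t, x) * \<phi> x)" by simp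
    have "AE p in lborel \<Otimes>\<^sub>M lborel. v0 p = G p" unfolding lborel_prod by (rule vG)
    from lborel_pair.AE_pair[OF this] have ae2: "AE t in lborel. AE x in lborel. v0 (t, x) = G (t, x)" .
    \<comment> \<open>Changing \<open>v\<close> on a null set of space-time may spoil individual
      time slices. By Fubini the bad times form a null set, which is added to the exceptional set of
      the trace.\<close>
    define Q where "Q t \<longleftrightarrow> integrable lborel (\<lambda>x. G (t, x) * \<phi> x) \<and> (AE x in lborel. v0 (t, x) = G (t, x))" for t
    have "AE t in lborel. Q t"
      using ae1 ae2 by eventually_elim (simp add: Q_def)
    then obtain E2 where E2: "E2 \<in> null_sets lborel" "{t \<in> space lborel. \<not> Q t} \<subseteq> E2"
      unfolding eventually_ae_filter by blast
    have lim: "((\<lambda>t. (LINT x|lebesgue. v t x * \<phi> x) - (LINT x|lborel. V t x * \<phi> x)) \<longlongrightarrow> (integral\<^sup>L \<mu>p \<phi> - integral\<^sup>L \<mu>m \<phi>) - (integral\<^sup>L \<mu>p \<phi> - integral\<^sup>L \<mu>m \<phi>)) (at 0 within {0<..<T} - (E1 \<union> E2))"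
      by (intro tendsto_diff tendsto_within_subset[OF E1(2)] tendsto_within_subset[OF V_trace(1)[OF \<phi>]]) auto
    have eq: "(LINT x|lebesgue. v t x * \<phi> x) - (LINT x|lborel. V t x * \<phi> x) = (LINT x|lborel. w (t, x) * \<phi> x)" if t: "t \<in> {0<..<T} - (E1 \<union> E2)" for t
    proof -
      have e2: "integrable lborel (\<lambda>x. G (t, x) * \<phi> x)" "AE x in lborel. v0 (t, x) = G (t, x)"
      proof -
        have "Q t" using E2(2) t by auto
        then show "integrable lborel (\<lambda>x. G (t, x) * \<phi> x)" "AE x in lborel. v0 (t, x) = G (t, x)" by (simp_all add: Q_def)
      qed
      have "(LINT x|lborel. w (t, x) * \<phi> x) = (LINT x|lborel. G (t, x) * \<phi> x - V t x * \<phi> x)"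
        using t by (simp add: w_eq left_diff_distrib)
      also have "\<dots> = (LINT x|lborel. G (t, x) * \<phi> x) - (LINT x|lborel. V t x * \<phi> x)"
        by (rule Bochner_Integration.integral_diff[OF e2(1) V_trace(2)[OF \<phi>]]) (use t in auto)
      also have "(LINT x|lborel. G (t, x) * \<phi> x) = (LINT x|lebesgue. v t x * \<phi> x)"
      proof (rule lebesgue_integral_cong_AE(2)[symmetric])
        show "(\<lambda>x. G (t, x) * \<phi> x) \<in> borel_measurable borel" by measurable
        show "AE x in lborel. v t x * \<phi> x = G (t, x) * \<phi> x"
          using e2(2) by eventually_elim (use t in \<open>auto simp: v0_def\<close>)
      qed
      finally show ?thesis by simp
    qed
    have "((\<lambda>t. LINT x|lborel. w (t, x) * \<phi> x) \<longlongrightarrow> 0) (at 0 within {0<..<T} - (E1 \<union> E2))"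
    proof (rule Lim_transform_eventually)
      show "((\<lambda>t. (LINT x|lebesgue. v t x * \<phi> x) - (LINT x|lborel. V t x * \<phi> x)) \<longlongrightarrow> 0) (at 0 within {0<..<T} - (E1 \<union> E2))" using lim by simp
      show "eventually (\<lambda>t. (LINT x|lebesgue. v t x * \<phi> x) - (LINT x|lborel. V t x * \<phi> x) = (LINT x|lborel. w (t, x) * \<phi> x)) (at 0 within {0<..<T} - (E1 \<union> E2))"
        unfolding eventually_at_filter using eq by (intro always_eventually) blast
    qed
    then show "\<exists>E\<in>null_sets lborel. ((\<lambda>t. LINT x|lborel. w (t, x) * \<phi> x) \<longlongrightarrow> 0) (at 0 within {0<..<T} - E)"
      using E1(1) E2(1) by (intro bexI[of _ "E1 \<union> E2"]) auto
  qed
  have "AE p in lborel. p \<in> ?S \<longrightarrow> v (fst p) (snd p) = V (fst p) (snd p)"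
    using W.w_eq_zero vG by eventually_elim (auto simp: w_eq v0_def)
  then show ?thesis by (rule AE_completion)
qed

end

theorem theorem9p1:
  fixes s T :: real and \<mu>p \<mu>m :: "'a::euclidean_space measure"
  assumes "0 < s" "s < 1" "0 < T"
    and "jordan_pair \<mu>p \<mu>m"
    and "(\<integral>\<^sup>+ x. ennreal ((1 + norm x) powr (- (real DIM('a) + 2 * s))) \<partial>\<mu>p) < \<infinity>"
    and "(\<integral>\<^sup>+ x. ennreal ((1 + norm x) powr (- (real DIM('a) + 2 * s))) \<partial>\<mu>m) < \<infinity>"
  shows "let U = (\<lambda>t x. (\<integral>y. frac_heat_kernel s t (x - y) \<partial>\<mu>p)
                         - (\<integral>y. frac_heat_kernel s t (x - y) \<partial>\<mu>m))
         in very_weak_sol s T U \<and> initial_trace s T U \<mu>p \<mu>m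
            \<and> (\<forall>v. very_weak_sol s T v \<and> initial_trace s T v \<mu>p \<mu>m \<longrightarrow>
                 (AE p in lebesgue. p \<in> {0<..<T} \<times> UNIV \<longrightarrow> v (fst p) (snd p) = U (fst p) (snd p)))"
proof -
  interpret signed_weighted_measure s \<mu>p \<mu>m T
    by unfold_locales (use assms in \<open>auto simp: jordan_pair_def\<close>)
  have "V = (\<lambda>t x. (\<integral>y. frac_heat_kernel s t (x - y) \<partial>\<mu>p) - (\<integral>y. frac_heat_kernel s t (x - y) \<partial>\<mu>m))"
    by (simp add: fun_eq_iff V_def P.U_def N.U_def)
  then show ?thesis
    using V_very_weak_sol V_initial_trace uniqueness by (simp add: Let_def)
qed

end
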